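(* Let $M$ be a Kisin module, $r=\mathrm{rank}M$ and $d=\deg M$. The functions $\mathbf{t}_{F,n}(M):[0,r]\to\mathbb{R}$, $n\ge1$, converge uniformly, along the positive integers directed by divisibility, to a continuous concave function $\mathbf{t}_{F,\infty}(M):[0,r]\to\mathbb{R}$ which equals $\inf_{n\ge1}\mathbf{t}_{F,n}(M)$ and satisfies $\mathbf{t}_{F,\infty}(M)(0)=0$ and $\mathbf{t}_{F,\infty}(M)(r)=d$.
   Context: $p$ prime, $\mathbb{F}$ perfect of characteristic $p$, $\mathfrak{S}=W(\mathbb{F})[[u]]$, Frobenius $\varphi$ with $\varphi(u)=u^p$, $E(u)$ the Eisenstein minimal polynomial of a uniformizer of a finite totally ramified extension of $W(\mathbb{F})[1/p]$, $e=\deg E$, $\varphi^*M=\mathfrak{S}\otimes_{\varphi,\mathfrak{S}}M$. Kisin module: finite free $\mathfrak{S}$-module $M$ with $\varphi_M:\varphi^*M[1/E]\simeq M[1/E]$; $\mathrm{rank}M=\mathrm{rank}_{\mathfrak{S}}M$, $\deg M=\sum a_i$ where $M_{(E)}$ has a basis $(e_i)$ with $\varphi_M(\varphi^*M)_{(E)}=\bigoplus\mathfrak{S}_{(E)}E^{-a_i}e_i$. $p^\infty$-torsion Kisin module: finitely generated $\mathfrak{S}$-module killed by a power of $p$, $u$-torsion free, with $\varphi^*M[1/u]\simeq M[1/u]$; rank $\mathrm{length}_{W(\mathbb{F})}(M/uM)$; degree $\frac1e(i\,\mathrm{rank}M-\mathrm{length}_{\mathfrak{S}}(M/u^i\varphi_M(\varphi^*M)))$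 for any $i\ge0$ with $u^i\varphi_M(\varphi^*M)\subseteq M$; strict subobjects are $\varphi$-stable submodules with $u$-torsion-free quotient; $\mathbf{t}_{F,t}(M)$ denotes the Harder–Narasimhan polygon (concave, starting at $0$, slopes the slopes $\deg/\mathrm{rank}$ of the semistable graded pieces with multiplicity their ranks). For a Kisin module $M$, $M/p^nM$ is such a module of rank $n\,\mathrm{rank}M$ and degree $n\deg M$, and $\mathbf{t}_{F,n}(M)(x)=\frac1n\mathbf{t}_{F,t}(M/p^nM)(nx)$ for $x\in[0,\mathrm{rank}M]$. *)

theory Defs
  imports
    "HOL-Analysis.Analysis"
    "HOL-Computational_Algebra.Computational_Algebra"
    "HOL-Algebra.Algebraic_Closure_Type"
    "HOL-Algebra.Free_Abelian_Groups"
begin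

section \<open>Modules\<close>

text \<open>The fields \<open>mult\<close> and \<open>one\<close> that \<open>module\<close> inherits from \<open>ring\<close> play no role for modules; they
  are \<open>undefined\<close> in all the constructions below. A submodule \<open>H\<close> of \<open>M\<close>, regarded as a module, is
  \<open>M\<lparr>carrier := H\<rparr>\<close>.\<close>

definition quot_module :: "('a, 'b) module \<Rightarrow> 'b set \<Rightarrow> ('a, 'b set) module" where
  "quot_module M N =
     \<lparr>carrier = a_rcosets\<^bsub>M\<^esub> N, monoid.mult = undefined, one = undefined,
      ring.zero = N, add = set_add M,
      smult = (\<lambda>r Z. \<Union>x\<in>Z. N +>\<^bsub>M\<^esub> (r \<odot>\<^bsub>M\<^esub> x))\<rparr>"

definition restrict_scalars :: "('c \<Rightarrow> 'a) \<Rightarrow> ('a, 'b) module \<Rightarrow> ('c, 'b) module" where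
  "restrict_scalars h M =
     \<lparr>carrier = carrier M, monoid.mult = undefined, one = undefined,
      ring.zero = \<zero>\<^bsub>M\<^esub>, add = ring.add M, smult = (\<lambda>c. smult M (h c))\<rparr>"

definition module_iso ::
    "('a, 'c) ring_scheme \<Rightarrow> ('a, 'b) module \<Rightarrow> ('a, 'd) module \<Rightarrow> ('b \<Rightarrow> 'd) \<Rightarrow> bool" where
  "module_iso R M N f \<longleftrightarrow>
     bij_betw f (carrier M) (carrier N) \<and>
     (\<forall>x\<in>carrier M. \<forall>y\<in>carrier M. f (x \<oplus>\<^bsub>M\<^esub> y) = f x \<oplus>\<^bsub>N\<^esub> f y) \<and>
     (\<forall>a\<in>carrier R. \<forall>x\<in>carrier M. f (a \<odot>\<^bsub>M\<^esub> x) = a \<odot>\<^bsub>N\<^esub> f x)"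

definition finitely_generated :: "('a, 'c) ring_scheme \<Rightarrow> ('a, 'b) module \<Rightarrow> bool" where
  "finitely_generated R M \<longleftrightarrow>
     (\<exists>A. finite A \<and> A \<subseteq> carrier M \<and>
          (\<forall>H. submodule H R M \<and> A \<subseteq> H \<longrightarrow> H = carrier M))"

definition module_basis ::
    "('a, 'c) ring_scheme \<Rightarrow> ('a, 'b) module \<Rightarrow> nat \<Rightarrow> (nat \<Rightarrow> 'b) \<Rightarrow> bool" where
  "module_basis R M r b \<longleftrightarrow>
     b \<in> {..<r} \<rightarrow> carrier M \<and>
     (\<forall>x\<in>carrier M. \<exists>!c. c \<in> {..<r} \<rightarrow>\<^sub>E carrier R \<and>
        x = finsum M (\<lambda>i. c i \<odot>\<^bsub>M\<^esub> b i) {..<r})"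

definition module_length :: "('a, 'c) ring_scheme \<Rightarrow> ('a, 'b) module \<Rightarrow> enat" where
  "module_length R M =
     (SUP n \<in> {n. \<exists>C. (\<forall>i\<le>n. submodule (C i) R M) \<and> (\<forall>i<n. C i \<subset> C (Suc i))}. enat n)"


section \<open>Localization\<close>

text \<open>\<open>fraction T M x t\<close> is the class \<open>x/t\<close> in the localization of \<open>M\<close> at the multiplicative set
  \<open>T\<close>; classes are sets of pairs (numerator, denominator).\<close>

definition fraction :: "'a set \<Rightarrow> ('a, 'b) module \<Rightarrow> 'b \<Rightarrow> 'a \<Rightarrow> ('b \<times> 'a) set" where
  "fraction T M x t =
     {(y, s). y \<in> carrier M \<and> s \<in> T \<and>
        (\<exists>v\<in>T. v \<odot>\<^bsub>M\<^esub> (s \<odot>\<^bsub>M\<^esub> x) = v \<odot>\<^bsub>M\<^esub> (t \<odot>\<^bsub>M\<^esub> y))}"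

text \<open>The scalars of \<open>loc_module R T M\<close> are fractions with numerator in \<open>R\<close> and denominator in \<open>T\<close>,
  i.e. the elements of \<open>loc_ring R T\<close> below.\<close>

definition loc_module ::
    "'a ring \<Rightarrow> 'a set \<Rightarrow> ('a, 'b) module \<Rightarrow> (('a \<times> 'a) set, ('b \<times> 'a) set) module" where
  "loc_module R T M =
     \<lparr>carrier = {fraction T M x t | x t. x \<in> carrier M \<and> t \<in> T},
      monoid.mult = undefined, one = undefined,
      ring.zero = fraction T M \<zero>\<^bsub>M\<^esub> \<one>\<^bsub>R\<^esub>,
      add = (\<lambda>Z Y. \<Union>(x, t)\<in>Z. \<Union>(y, s)\<in>Y.
               fraction T M (s \<odot>\<^bsub>M\<^esub> x \<oplus>\<^bsub>M\<^esub> t \<odot>\<^bsub>M\<^esub> y) (t \<otimes>\<^bsub>R\<^esub> s)),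
      smult = (\<lambda>A Z. \<Union>(a, s)\<in>A. \<Union>(x, t)\<in>Z. fraction T M (a \<odot>\<^bsub>M\<^esub> x) (s \<otimes>\<^bsub>R\<^esub> t))\<rparr>"

definition self_module :: "'a ring \<Rightarrow> ('a, 'a) module" where
  "self_module R =
     \<lparr>carrier = carrier R, monoid.mult = undefined, one = undefined,
      ring.zero = \<zero>\<^bsub>R\<^esub>, add = ring.add R, smult = monoid.mult R\<rparr>"

definition loc_ring :: "'a ring \<Rightarrow> 'a set \<Rightarrow> ('a \<times> 'a) set ring" where
  "loc_ring R T =
     (let L = loc_module R T (self_module R)
      in \<lparr>carrier = carrier L, monoid.mult = smult L,
          one = fraction T (self_module R) \<one>\<^bsub>R\<^esub> \<one>\<^bsub>R\<^esub>, ring.zero = \<zero>\<^bsub>L\<^esub>, add = ring.add L\<rparr>)"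

text \<open>For \<open>f : M \<rightarrow> N\<close> and \<open>T \<subseteq> T'\<close>, the map \<open>T\<^sup>-\<^sup>1M \<rightarrow> T'\<^sup>-\<^sup>1N\<close> sending \<open>x/t\<close> to \<open>f(x)/t\<close>. The parameter
  is \<open>T'\<close>, so that \<open>loc_map T' M id\<close> is the canonical map \<open>T\<^sup>-\<^sup>1M \<rightarrow> T'\<^sup>-\<^sup>1M\<close>.\<close>

definition loc_map ::
    "'a set \<Rightarrow> ('a, 'd) module \<Rightarrow> ('b \<Rightarrow> 'd) \<Rightarrow> ('b \<times> 'a) set \<Rightarrow> ('d \<times> 'a) set" where
  "loc_map T' N f Z = (\<Union>(x, t)\<in>Z. fraction T' N (f x) t)"


section \<open>The base change \<open>R \<otimes>\<^sub>\<phi>\<^sub>,\<^sub>R M\<close>\<close>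

text \<open>The tensor product is the free abelian group on \<open>R \<times> M\<close> modulo the subgroup generated by the
  bilinearity relations and \<open>a \<phi>(r) \<otimes> m = a \<otimes> r m\<close>; scalars act on the left factor.
  (\<open>pre_pullback\<close> is only an abelian group with an action of the multiplicative monoid of \<open>R\<close>.)\<close>

type_synonym ('a, 'b) tensors = "(('a \<times> 'b) \<Rightarrow>\<^sub>0 int) set"

definition pre_pullback :: "'a ring \<Rightarrow> ('a, 'b) module \<Rightarrow> ('a, ('a \<times> 'b) \<Rightarrow>\<^sub>0 int) module" where
  "pre_pullback R M =
     \<lparr>carrier = carrier (free_Abelian_group (carrier R \<times> carrier M)),
      monoid.mult = undefined, one = undefined, ring.zero = 0, add = (+),
      smult = (\<lambda>s. frag_extend (\<lambda>(a, m). frag_of (s \<otimes>\<^bsub>R\<^esub> a, m)))\<rparr>"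

definition pullback_relations ::
    "('a \<Rightarrow> 'a) \<Rightarrow> 'a ring \<Rightarrow> ('a, 'b) module \<Rightarrow> (('a \<times> 'b) \<Rightarrow>\<^sub>0 int) set" where
  "pullback_relations \<phi> R M =
     generate (free_Abelian_group (carrier R \<times> carrier M))
      ({frag_of (a \<oplus>\<^bsub>R\<^esub> b, m) - frag_of (a, m) - frag_of (b, m) | a b m.
          a \<in> carrier R \<and> b \<in> carrier R \<and> m \<in> carrier M} \<union>
       {frag_of (a, m \<oplus>\<^bsub>M\<^esub> n) - frag_of (a, m) - frag_of (a, n) | a m n.
          a \<in> carrier R \<and> m \<in> carrier M \<and> n \<in> carrier M} \<union>
       {frag_of (a \<otimes>\<^bsub>R\<^esub> \<phi> r, m) - frag_of (a, r \<odot>\<^bsub>M\<^esub> m) | a r m.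
          a \<in> carrier R \<and> r \<in> carrier R \<and> m \<in> carrier M})"

definition pullback ::
    "('a \<Rightarrow> 'a) \<Rightarrow> 'a ring \<Rightarrow> ('a, 'b) module \<Rightarrow> ('a, ('a, 'b) tensors) module" where
  "pullback \<phi> R M = quot_module (pre_pullback R M) (pullback_relations \<phi> R M)"

text \<open>The map \<open>id \<otimes> f\<close> from the base change of the source of \<open>f\<close> to that of its target \<open>N\<close>.\<close>

definition pullback_map ::
    "('a \<Rightarrow> 'a) \<Rightarrow> 'a ring \<Rightarrow> ('a, 'd) module \<Rightarrow> ('b \<Rightarrow> 'd) \<Rightarrow> ('a, 'b) tensors \<Rightarrow> ('a, 'd) tensors"
  where
  "pullback_map \<phi> R N f Z =
     (\<Union>c\<in>Z. pullback_relations \<phi> R N +>\<^bsub>pre_pullback R N\<^esub>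
              frag_extend (\<lambda>(a, m). frag_of (a, f m)) c)"


section \<open>Modules with Frobenius\<close>

text \<open>An object is a pair \<open>(M, \<Phi>)\<close> of an \<open>R\<close>-module \<open>M\<close> and a map
  \<open>\<Phi> : T\<^sup>-\<^sup>1(R \<otimes>\<^sub>\<phi>\<^sub>,\<^sub>R M) \<rightarrow> T\<^sup>-\<^sup>1M\<close>, for some multiplicative set \<open>T\<close>. Only the values of \<open>\<Phi>\<close> on the
  carrier of its domain matter.\<close>

type_synonym ('a, 'b) phi_module =
  "('a, 'b) module \<times> ((('a, 'b) tensors \<times> 'a) set \<Rightarrow> ('b \<times> 'a) set)"

definition phi_bijective ::
    "('a \<Rightarrow> 'a) \<Rightarrow> 'a ring \<Rightarrow> 'a set \<Rightarrow> ('a, 'b) phi_module \<Rightarrow> bool" where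
  "phi_bijective \<phi> R T Z \<longleftrightarrow>
     module_iso (loc_ring R T)
       (loc_module R T (pullback \<phi> R (fst Z))) (loc_module R T (fst Z)) (snd Z)"

definition phi_stable ::
    "('a \<Rightarrow> 'a) \<Rightarrow> 'a ring \<Rightarrow> 'a set \<Rightarrow> ('a, 'b) phi_module \<Rightarrow> 'b set \<Rightarrow> bool" where
  "phi_stable \<phi> R T Z H \<longleftrightarrow>
     (let M = fst Z; N = M\<lparr>carrier := H\<rparr>
      in \<forall>Y\<in>carrier (loc_module R T (pullback \<phi> R N)).
           snd Z (loc_map T (pullback \<phi> R M) (pullback_map \<phi> R M id) Y)
             \<in> loc_map T M id ` carrier (loc_module R T N))"

text \<open>The structures induced on a stable submodule and on the quotient by a stable submodule: the
  unique maps that make the inclusion, respectively the projection, commute with the structure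
  maps.\<close>

definition sub_object ::
    "('a \<Rightarrow> 'a) \<Rightarrow> 'a ring \<Rightarrow> 'a set \<Rightarrow> ('a, 'b) phi_module \<Rightarrow> 'b set \<Rightarrow> ('a, 'b) phi_module" where
  "sub_object \<phi> R T Z H =
     (let M = fst Z; N = M\<lparr>carrier := H\<rparr>
      in (N, \<lambda>Y. inv_into (carrier (loc_module R T N)) (loc_map T M id)
                   (snd Z (loc_map T (pullback \<phi> R M) (pullback_map \<phi> R M id) Y))))"

definition quot_object ::
    "('a \<Rightarrow> 'a) \<Rightarrow> 'a ring \<Rightarrow> 'a set \<Rightarrow> ('a, 'b) phi_module \<Rightarrow> 'b set \<Rightarrow> ('a, 'b set) phi_module"
  where
  "quot_object \<phi> R T Z H =
     (let M = fst Z; Q = quot_module M H; \<pi> = (\<lambda>x. H +>\<^bsub>M\<^esub> x)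
      in (Q, \<lambda>Y. loc_map T Q \<pi>
                   (snd Z (inv_into (carrier (loc_module R T (pullback \<phi> R M)))
                            (loc_map T (pullback \<phi> R Q) (pullback_map \<phi> R Q \<pi>)) Y))))"

text \<open>Transport of the structure map from \<open>T\<^sub>1\<close> to \<open>T\<^sub>2\<close>, via a multiplicative set \<open>T\<close> containing
  both, when \<open>T\<^sub>1\<^sup>-\<^sup>1M = T\<^sup>-\<^sup>1M = T\<^sub>2\<^sup>-\<^sup>1M\<close> and likewise for the base change of \<open>M\<close>.\<close>

definition change_loc ::
    "'a ring \<Rightarrow> 'a set \<Rightarrow> 'a set \<Rightarrow> ('a, 'b) module \<Rightarrow> ('b \<times> 'a) set \<Rightarrow> ('b \<times> 'a) set" where
  "change_loc R T T\<^sub>2 M Y =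
     inv_into (carrier (loc_module R T\<^sub>2 M)) (loc_map T M id) (loc_map T M id Y)"

definition change_loc_object ::
    "('a \<Rightarrow> 'a) \<Rightarrow> 'a ring \<Rightarrow> 'a set \<Rightarrow> 'a set \<Rightarrow> 'a set \<Rightarrow> ('a, 'b) phi_module \<Rightarrow> ('a, 'b) phi_module"
  where
  "change_loc_object \<phi> R T\<^sub>1 T T\<^sub>2 Z =
     (fst Z, \<lambda>Y. change_loc R T T\<^sub>2 (fst Z)
                   (snd Z (change_loc R T T\<^sub>1 (pullback \<phi> R (fst Z)) Y)))"


section \<open>The ring \<open>W(F)[[u]]\<close>\<close>

text \<open>For \<open>F\<close> perfect of characteristic \<open>p\<close>, the ring of Witt vectors \<open>W(F)\<close> with its projection
  \<open>\<rho> : W(F) \<rightarrow> F\<close> is, up to unique isomorphism, the strict \<open>p\<close>-ring with residue field \<open>F\<close>: the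
  \<open>p\<close>-torsion free, \<open>p\<close>-adically separated and complete ring \<open>W\<close> with \<open>W/pW = F\<close>; its Frobenius \<open>\<sigma>\<close>
  is the unique ring endomorphism lifting \<open>x \<mapsto> x\<^sup>p\<close>.\<close>

definition witt_ring :: "nat \<Rightarrow> ('w::comm_ring_1 \<Rightarrow> 'f::field) \<Rightarrow> ('w \<Rightarrow> 'w) \<Rightarrow> bool" where
  "witt_ring p \<rho> \<sigma> \<longleftrightarrow>
     Factorial_Ring.prime p \<and> CHAR('f) = p \<and> (\<forall>x::'f. \<exists>y. y ^ p = x) \<and>
     \<rho> \<in> ring_hom ring_of_type_algebra ring_of_type_algebra \<and> surj \<rho> \<and>
     (\<forall>x. \<rho> x = 0 \<longleftrightarrow> of_nat p dvd x) \<and>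
     (\<forall>x::'w. of_nat p * x = 0 \<longrightarrow> x = 0) \<and>
     (\<forall>x::'w. (\<forall>n. of_nat p ^ n dvd x) \<longrightarrow> x = 0) \<and>
     (\<forall>s::nat \<Rightarrow> 'w. (\<forall>n. of_nat p ^ n dvd s (Suc n) - s n) \<longrightarrow>
        (\<exists>l. \<forall>n. of_nat p ^ n dvd l - s n)) \<and>
     \<sigma> \<in> ring_hom ring_of_type_algebra ring_of_type_algebra \<and>
     (\<forall>x. \<rho> (\<sigma> x) = \<rho> x ^ p)"

abbreviation power_series_ring :: "'w::comm_ring_1 fps ring" (\<open>\<SS>\<close>) where
  "\<SS> \<equiv> ring_of_type_algebra"

definition frob :: "nat \<Rightarrow> ('w \<Rightarrow> 'w) \<Rightarrow> 'w fps \<Rightarrow> 'w::comm_ring_1 fps" where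
  "frob p \<sigma> f = Abs_fps (\<lambda>n. \<sigma> (fps_nth f n)) oo fps_X ^ p"

text \<open>The monic Eisenstein polynomials over \<open>W(F)\<close> are exactly the minimal polynomials, over \<open>W(F)[1/p]\<close>,
  of uniformizers of finite totally ramified extensions of \<open>W(F)[1/p]\<close>.\<close>

definition eisenstein :: "nat \<Rightarrow> 'w::comm_ring_1 poly \<Rightarrow> bool" where
  "eisenstein p E \<longleftrightarrow>
     Polynomial.lead_coeff E = 1 \<and> 0 < Polynomial.degree E \<and>
     (\<forall>i<Polynomial.degree E. of_nat p dvd Polynomial.coeff E i) \<and>
     \<not> of_nat p ^ 2 dvd Polynomial.coeff E 0"

definition powers :: "'a::monoid_mult \<Rightarrow> 'a set" where
  "powers x = range (\<lambda>n::nat. x ^ n)"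


section \<open>Kisin modules\<close>

definition kisin_module ::
    "nat \<Rightarrow> ('w \<Rightarrow> 'w) \<Rightarrow> 'w::comm_ring_1 poly \<Rightarrow> ('w fps, 'm) phi_module \<Rightarrow> bool" where
  "kisin_module p \<sigma> E Z \<longleftrightarrow>
     Module.module \<SS> (fst Z) \<and> (\<exists>r b. module_basis \<SS> (fst Z) r b) \<and>
     phi_bijective (frob p \<sigma>) \<SS> (powers (fps_of_poly E)) Z"

definition kisin_rank :: "('w::comm_ring_1 fps, 'm) phi_module \<Rightarrow> nat" where
  "kisin_rank Z = (THE r. \<exists>b. module_basis \<SS> (fst Z) r b)"

text \<open>Everything takes place in \<open>V = M \<otimes> K\<close> with \<open>K = Frac(\<SS>)\<close>; as \<open>\<SS>\<close> is a domain and \<open>M\<close> is free,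
  \<open>\<SS>\<^sub>(\<^sub>E\<^sub>)\<close> embeds in \<open>K\<close>, and both \<open>M\<^sub>(\<^sub>E\<^sub>)\<close> and \<open>M[1/E]\<close> embed in \<open>V\<close>. Below, \<open>OE\<close>, \<open>ME\<close> and \<open>PE\<close>
  are the images of \<open>\<SS>\<^sub>(\<^sub>E\<^sub>)\<close>, \<open>M\<^sub>(\<^sub>E\<^sub>)\<close> and of the localization at \<open>(E)\<close> of \<open>\<Phi>(\<phi>\<^sup>*M) \<subseteq> M[1/E]\<close>.\<close>

definition kisin_degree ::
    "nat \<Rightarrow> ('w \<Rightarrow> 'w) \<Rightarrow> 'w::comm_ring_1 poly \<Rightarrow> ('w fps, 'm) phi_module \<Rightarrow> int" where
  "kisin_degree p \<sigma> E Z =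
     (let M = fst Z; E' = fps_of_poly E; T = {s::'w fps. s \<noteq> 0};
          K = loc_ring \<SS> T; V = loc_module \<SS> T M;
          P = pullback (frob p \<sigma>) \<SS> M;
          OE = {fraction T (self_module \<SS>) s t | s t. \<not> E' dvd t};
          ME = {fraction T M m t | m t. m \<in> carrier M \<and> \<not> E' dvd t};
          PE = {fraction T (self_module \<SS>) 1 t \<odot>\<^bsub>V\<^esub>
                  loc_map T M id (snd Z (fraction (powers E') P y 1)) | y t.
                  y \<in> carrier P \<and> \<not> E' dvd t}
      in THE d. \<exists>r b (a :: nat \<Rightarrow> int).
           module_basis (K\<lparr>carrier := OE\<rparr>) (V\<lparr>carrier := ME\<rparr>) r b \<and>
           PE = {finsum V
                   (\<lambda>i. (c i \<otimes>\<^bsub>K\<^esub> (fraction T (self_module \<SS>) E' 1 [^]\<^bsub>K\<^esub> (- a i))) \<odot>\<^bsub>V\<^esub> b i)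
                   {..<r} | c. c \<in> {..<r} \<rightarrow> OE} \<and>
           d = (\<Sum>i<r. a i))"


section \<open>Torsion Kisin modules and their Harder--Narasimhan polygons\<close>

abbreviation u_powers :: "'w::comm_ring_1 fps set" where
  "u_powers \<equiv> powers fps_X"

definition u_torsion_free :: "('w::comm_ring_1 fps, 'm) module \<Rightarrow> bool" where
  "u_torsion_free M \<longleftrightarrow> (\<forall>x\<in>carrier M. fps_X \<odot>\<^bsub>M\<^esub> x = \<zero>\<^bsub>M\<^esub> \<longrightarrow> x = \<zero>\<^bsub>M\<^esub>)"

definition torsion_kisin_module ::
    "nat \<Rightarrow> ('w \<Rightarrow> 'w) \<Rightarrow> ('w::comm_ring_1 fps, 'm) phi_module \<Rightarrow> bool" where
  "torsion_kisin_module p \<sigma> Z \<longleftrightarrow>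
     Module.module \<SS> (fst Z) \<and> finitely_generated \<SS> (fst Z) \<and>
     (\<exists>k. \<forall>x\<in>carrier (fst Z). of_nat p ^ k \<odot>\<^bsub>fst Z\<^esub> x = \<zero>\<^bsub>fst Z\<^esub>) \<and>
     u_torsion_free (fst Z) \<and>
     phi_bijective (frob p \<sigma>) \<SS> u_powers Z"

definition torsion_rank :: "('w::comm_ring_1 fps, 'm) phi_module \<Rightarrow> nat" where
  "torsion_rank Z =
     (let M = fst Z
      in the_enat (module_length (ring_of_type_algebra :: 'w ring)
           (restrict_scalars fps_const (quot_module M ((\<lambda>x. fps_X \<odot>\<^bsub>M\<^esub> x) ` carrier M)))))"

text \<open>\<open>U i\<close> is \<open>u\<^sup>i \<Phi>(\<phi>\<^sup>*M) \<subseteq> M[1/u]\<close>, and \<open>\<iota>\<close> is the embedding of \<open>M\<close> in \<open>M[1/u]\<close>; the degree does not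
  depend on \<open>i\<close>.\<close>

definition torsion_degree ::
    "nat \<Rightarrow> ('w \<Rightarrow> 'w) \<Rightarrow> nat \<Rightarrow> ('w::comm_ring_1 fps, 'm) phi_module \<Rightarrow> real" where
  "torsion_degree p \<sigma> e Z =
     (let M = fst Z; P = pullback (frob p \<sigma>) \<SS> M; V = loc_module \<SS> u_powers M;
          \<iota> = (\<lambda>x. fraction u_powers M x 1);
          U = (\<lambda>i. {fraction u_powers (self_module \<SS>) (fps_X ^ i) 1 \<odot>\<^bsub>V\<^esub>
                      snd Z (fraction u_powers P y 1) | y. y \<in> carrier P})
      in THE d. \<exists>i::nat. U i \<subseteq> \<iota> ` carrier M \<and>
           d = (real i * real (torsion_rank Z)
                - real (the_enat (module_length \<SS> (quot_module M {x \<in> carrier M. \<iota> x \<in> U i}))))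
               / real e)"

definition torsion_slope ::
    "nat \<Rightarrow> ('w \<Rightarrow> 'w) \<Rightarrow> nat \<Rightarrow> ('w::comm_ring_1 fps, 'm) phi_module \<Rightarrow> real" where
  "torsion_slope p \<sigma> e Z = torsion_degree p \<sigma> e Z / real (torsion_rank Z)"

definition strict_subobject ::
    "nat \<Rightarrow> ('w \<Rightarrow> 'w) \<Rightarrow> ('w::comm_ring_1 fps, 'm) phi_module \<Rightarrow> 'm set \<Rightarrow> bool" where
  "strict_subobject p \<sigma> Z H \<longleftrightarrow>
     submodule H \<SS> (fst Z) \<and> phi_stable (frob p \<sigma>) \<SS> u_powers Z H \<and>
     u_torsion_free (quot_module (fst Z) H)"

definition semistable ::
    "nat \<Rightarrow> ('w \<Rightarrow> 'w) \<Rightarrow> nat \<Rightarrow> ('w::comm_ring_1 fps, 'm) phi_module \<Rightarrow> bool" where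
  "semistable p \<sigma> e Z \<longleftrightarrow>
     torsion_kisin_module p \<sigma> Z \<and> carrier (fst Z) \<noteq> {\<zero>\<^bsub>fst Z\<^esub>} \<and>
     (\<forall>H. strict_subobject p \<sigma> Z H \<and> H \<noteq> {\<zero>\<^bsub>fst Z\<^esub>} \<longrightarrow>
        torsion_slope p \<sigma> e (sub_object (frob p \<sigma>) \<SS> u_powers Z H) \<le> torsion_slope p \<sigma> e Z)"

definition graded_piece ::
    "nat \<Rightarrow> ('w \<Rightarrow> 'w) \<Rightarrow> ('w::comm_ring_1 fps, 'm) phi_module \<Rightarrow> (nat \<Rightarrow> 'm set) \<Rightarrow> nat
      \<Rightarrow> ('w fps, 'm set) phi_module" where
  "graded_piece p \<sigma> Z F i =
     quot_object (frob p \<sigma>) \<SS> u_powers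
       (sub_object (frob p \<sigma>) \<SS> u_powers Z (F (Suc i))) (F i)"

definition hn_filtration ::
    "nat \<Rightarrow> ('w \<Rightarrow> 'w) \<Rightarrow> nat \<Rightarrow> ('w::comm_ring_1 fps, 'm) phi_module
      \<Rightarrow> nat \<Rightarrow> (nat \<Rightarrow> 'm set) \<Rightarrow> bool" where
  "hn_filtration p \<sigma> e Z k F \<longleftrightarrow>
     F 0 = {\<zero>\<^bsub>fst Z\<^esub>} \<and> F k = carrier (fst Z) \<and>
     (\<forall>i\<le>k. strict_subobject p \<sigma> Z (F i)) \<and>
     (\<forall>i<k. F i \<subset> F (Suc i) \<and> semistable p \<sigma> e (graded_piece p \<sigma> Z F i)) \<and>
     (\<forall>i. Suc i < k \<longrightarrow>
        torsion_slope p \<sigma> e (graded_piece p \<sigma> Z F i)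
          > torsion_slope p \<sigma> e (graded_piece p \<sigma> Z F (Suc i)))"

text \<open>The \<open>i\<close>-th summand is the contribution on \<open>[0,x]\<close> of the \<open>i\<close>-th segment, of width the rank and
  of slope the slope of the \<open>i\<close>-th graded piece.\<close>

definition polygon_of_filtration ::
    "nat \<Rightarrow> ('w \<Rightarrow> 'w) \<Rightarrow> nat \<Rightarrow> ('w::comm_ring_1 fps, 'm) phi_module
      \<Rightarrow> nat \<Rightarrow> (nat \<Rightarrow> 'm set) \<Rightarrow> real \<Rightarrow> real" where
  "polygon_of_filtration p \<sigma> e Z k F x =
     (\<Sum>i<k. torsion_slope p \<sigma> e (graded_piece p \<sigma> Z F i) *
        max 0 (min (x - (\<Sum>j<i. real (torsion_rank (graded_piece p \<sigma> Z F j))))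
                   (real (torsion_rank (graded_piece p \<sigma> Z F i)))))"

definition hn_polygon ::
    "nat \<Rightarrow> ('w \<Rightarrow> 'w) \<Rightarrow> nat \<Rightarrow> ('w::comm_ring_1 fps, 'm) phi_module \<Rightarrow> real \<Rightarrow> real" where
  "hn_polygon p \<sigma> e Z =
     (THE t. \<exists>k F. hn_filtration p \<sigma> e Z k F \<and> t = polygon_of_filtration p \<sigma> e Z k F)"


section \<open>Reductions of Kisin modules\<close>

text \<open>\<open>M/p\<^sup>nM\<close>, whose structure map is the reduction of \<open>\<Phi> : \<phi>\<^sup>*M[1/E] \<rightarrow> M[1/E]\<close>. On modules killed
  by a power of \<open>p\<close>, inverting \<open>E\<close> is the same as inverting \<open>u\<close>, since \<open>E\<close> is congruent to \<open>u\<^sup>e\<close> modulo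
  \<open>p\<close>; the two localizations are compared inside the one that inverts \<open>E\<close> and \<open>u\<close>.\<close>

definition kisin_reduction ::
    "nat \<Rightarrow> ('w \<Rightarrow> 'w) \<Rightarrow> 'w::comm_ring_1 poly \<Rightarrow> ('w fps, 'm) phi_module \<Rightarrow> nat
      \<Rightarrow> ('w fps, 'm set) phi_module" where
  "kisin_reduction p \<sigma> E Z n =
     (let M = fst Z; E' = fps_of_poly E
      in change_loc_object (frob p \<sigma>) \<SS> (powers E') {E' ^ i * fps_X ^ j | i j. True} u_powers
           (quot_object (frob p \<sigma>) \<SS> (powers E') Z ((\<lambda>x. of_nat p ^ n \<odot>\<^bsub>M\<^esub> x) ` carrier M)))"

definition kisin_polygon ::
    "nat \<Rightarrow> ('w \<Rightarrow> 'w) \<Rightarrow> 'w::comm_ring_1 poly \<Rightarrow> ('w fps, 'm) phi_module \<Rightarrow> nat \<Rightarrow> real \<Rightarrow> real"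
  where
  "kisin_polygon p \<sigma> E Z n x =
     hn_polygon p \<sigma> (Polynomial.degree E) (kisin_reduction p \<sigma> E Z n) (real n * x) / real n"


text \<open>The filter of the positive integers directed by divisibility.\<close>

definition divisibility_filter :: "nat filter" where
  "divisibility_filter = (INF m\<in>{1..}. principal {n. 1 \<le> n \<and> m dvd n})"

end

theory Submission imports Defs "Jordan_Normal_Form.Determinant"
begin


text \<open>
  A basis of \<open>M\<close> turns all modules in sight into submodules of a space of vectors over \<open>\<SS>\<close> and the structure map
  into a matrix \<open>A\<close> divided by a power of \<open>E\<close>. A strict subobject of \<open>M/p\<^sup>nM\<close> is then a \<open>u\<close>-saturated stable lattice
  between \<open>p\<^sup>n\<SS>\<^sup>r\<close> and \<open>\<SS>\<^sup>r\<close>; these lattices form a modular lattice on which the rank is additive and the degree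
  submodular, which gives the Harder--Narasimhan filtration and characterizes the polygon as the least concave function
  above all points (rank, degree). A subobject of \<open>M/p\<^sup>n\<^sup>mM\<close> is filtered by its intersections with the
  \<open>p\<^sup>n\<^sup>iM/p\<^sup>n\<^sup>mM\<close>, and multiplication by \<open>p\<^sup>n\<^sup>i\<close> maps the pieces injectively to subobjects of \<open>M/p\<^sup>nM\<close>; by concavity the
  normalized polygons decrease along divisibility. They have the same end points, because the \<open>E\<close>-adic valuation
  of \<open>det A\<close> computes both \<open>deg M\<close> and the length of the cokernel of \<open>A\<close> modulo \<open>p\<close>. Being concave and bounded by
  the first one, which is piecewise linear, they are equi-Lipschitz, so that the pointwise limit is uniform.
\<close>

text \<open>Two facts carry the lattice argument. The structure map is injective on every
  subquotient: if it sends \<open>z\<close> into a saturated stable \<open>H\<close>, then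
  \<open>z\<close> lies in the Frobenius pullback of \<open>H\<close>; this makes lengths of
  cokernels additive. And the sum I of two stable lattices need not be saturated: its saturation J
  adds a quotient J/I of finite length, which leaves the rank alone, while the pullback of J/I is at
  least as long as J/I. So the cokernel can only shrink, and the degree is submodular instead of
  additive. All modules are kept as quotients B/A inside one type of vectors, since iterated
  quotients would otherwise change the type. A last obstacle is that the structure map over \<SS>
  has powers of E as denominators, while the torsion theory inverts u. As E = u^e + p w, the
  factorization of u^(ek) - (-p w)^k gives \<open>g\<close> with E g = u^(ek) modulo p^k, so that
  A/E^c becomes g^c A/u^(ekc).\<close>

no_notation Polynomials.var (\<open>X\<index>\<close>)

section \<open>Submodules of spaces of vectors\<close>

text \<open>Sequences hold vectors of every rank in one type. Rank \<open>r\<close> is the set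
  \<open>VV r\<close> of sequences supported below \<open>r\<close>, so that the rank can be a
  variable inside a proof.\<close>

typedef 'a fvec = "UNIV :: (nat => 'a) set" morphisms cf fv
  by simp

setup_lifting type_definition_fvec

instantiation fvec :: (ab_group_add) ab_group_add
begin

lift_definition zero_fvec :: "'a fvec" is "%i. 0" .
lift_definition plus_fvec :: "'a fvec => 'a fvec => 'a fvec" is "%x y i. x i + y i" .
lift_definition minus_fvec :: "'a fvec => 'a fvec => 'a fvec" is "%x y i. x i - y i" .
lift_definition uminus_fvec :: "'a fvec => 'a fvec" is "%x i. - x i" .

instance
  by standard (transfer; simp add: algebra_simps fun_eq_iff)+

end

lift_definition smul :: "'a::comm_ring_1 => 'a fvec => 'a fvec" (infixr \<open>*:\<close> 75) is "%c x i. c * x i" .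

lemma fvec_eqI: "(!!i. cf x i = cf y i) ==> x = y"
  by transfer auto

lemma fvec_eq_iff: "x = y \<longleftrightarrow> (\<forall>i. cf x i = cf y i)"
  by transfer auto

lemma cf_simps [simp]:
  "cf 0 i = 0" "cf (x + y) i = cf x i + cf y i" "cf (x - y) i = cf x i - cf y i" "cf (- x) i = - cf x i"
  "cf (c *: z) i = c * cf z i" "cf (fv f) i = f i"
  by (transfer; simp)+

lemma cf_sum [simp]: "cf (\<Sum>k\<in>K. f k) i = (\<Sum>k\<in>K. cf (f k) i)"
  by (induction K rule: infinite_finite_induct) auto

lemma smul_simps:
  "c *: (x + y) = c *: x + c *: y" "c *: (x - y) = c *: x - c *: y" "(a + c) *: x = a *: x + c *: x"
  "(a - c) *: x = a *: x - c *: x" "a *: (c *: x) = (a * c) *: x" "1 *: x = x" "0 *: x = 0" "c *: 0 = 0"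
  "(- c) *: x = - (c *: x)" "c *: (- x) = - (c *: x)"
  by (auto intro!: fvec_eqI simp: algebra_simps)

lemma smul_sum: "c *: (\<Sum>k\<in>K. f k) = (\<Sum>k\<in>K. c *: f k)"
  by (auto intro!: fvec_eqI simp: sum_distrib_left)

definition submod :: "'a::comm_ring_1 fvec set => bool" where
  "submod X \<longleftrightarrow> 0 \<in> X \<and> (\<forall>x\<in>X. \<forall>y\<in>X. x + y \<in> X) \<and> (\<forall>c. \<forall>x\<in>X. c *: x \<in> X)"

definition lin :: "('a::comm_ring_1 fvec => 'a fvec) => bool" where
  "lin f \<longleftrightarrow> (\<forall>x y. f (x + y) = f x + f y) \<and> (\<forall>c x. f (c *: x) = c *: f x)"

lemma submodI: "0 \<in> X ==> (!!x y. x \<in> X ==> y \<in> X ==> x + y \<in> X) ==> (!!c x. x \<in> X ==> c *: x \<in> X) ==> submod X"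
  by (simp add: submod_def)

lemma submod_0: "submod X ==> 0 \<in> X"
  and submod_add: "submod X ==> x \<in> X ==> y \<in> X ==> x + y \<in> X"
  and submod_smul: "submod X ==> x \<in> X ==> c *: x \<in> X"
  by (simp_all add: submod_def)

lemma submod_uminus: "submod X ==> x \<in> X ==> - x \<in> X"
  using submod_smul[of X x "- 1"] by (simp add: smul_simps)

lemma submod_diff: "submod X ==> x \<in> X ==> y \<in> X ==> x - y \<in> X"
  using submod_add[of X x "- y"] submod_uminus[of X y] by simp

lemma submod_sum: "submod X ==> (!!k. k \<in> K ==> f k \<in> X) ==> (\<Sum>k\<in>K. f k) \<in> X"
  by (induction K rule: infinite_finite_induct) (auto simp: submod_0 submod_add)

lemmas submod_closed = submod_0 submod_add submod_smul submod_uminus submod_diff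

lemma submod_diff_iff: "submod X ==> x - y \<in> X ==> x \<in> X \<longleftrightarrow> y \<in> X"
  using submod_add[of X "x - y" y] submod_diff[of X x "x - y"] by auto

lemma submod_Int: "submod X ==> submod Y ==> submod (X \<inter> Y)"
  by (simp add: submod_def)

lemma submod_plus:
  assumes "submod X" "submod Y" shows "submod (X + Y)"
proof (rule submodI)
  show "0 \<in> X + Y" using set_plus_intro[of 0 X 0 Y] assms by (simp add: submod_0)
next
  fix x y assume "x \<in> X + Y" "y \<in> X + Y"
  then obtain a b c d where "a \<in> X" "b \<in> Y" "c \<in> X" "d \<in> Y" and e: "x = a + b" "y = c + d"
    by (auto simp: set_plus_def)
  then have "(a + c) + (b + d) \<in> X + Y" using assms by (intro set_plus_intro submod_add)
  then show "x + y \<in> X + Y" by (simp add: e algebra_simps)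
next
  fix c x assume "x \<in> X + Y"
  then obtain a b where "a \<in> X" "b \<in> Y" and e: "x = a + b" by (auto simp: set_plus_def)
  then have "c *: a + c *: b \<in> X + Y" using assms by (intro set_plus_intro submod_smul)
  then show "c *: x \<in> X + Y" by (simp add: e smul_simps)
qed

lemma linD: "lin f ==> f (x + y) = f x + f y" "lin f ==> f (c *: x) = c *: f x"
  by (simp_all add: lin_def)

lemma lin_0: "lin f ==> f 0 = 0"
  using linD(2)[of f 0 0] by (simp add: smul_simps)

lemma lin_uminus: "lin f ==> f (- x) = - f x"
  using linD(2)[of f "- 1" x] by (simp add: smul_simps)

lemma lin_diff: "lin f ==> f (x - y) = f x - f y"
  using linD(1)[of f x "- y"] by (simp add: lin_uminus)

lemma lin_sum: "lin f ==> f (\<Sum>k\<in>K. g k) = (\<Sum>k\<in>K. f (g k))"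
  by (induction K rule: infinite_finite_induct) (auto simp: lin_0 linD)

lemma lin_smul [simp]: "lin (smul c)"
  by (simp add: lin_def smul_simps mult.commute)

lemma lin_id [simp]: "lin (%x. x)"
  by (simp add: lin_def)

lemma lin_comp: "lin f ==> lin g ==> lin (%x. f (g x))"
  by (simp add: lin_def)

lemma submod_image: "lin f ==> submod X ==> submod (f ` X)"
proof (rule submodI)
  assume "lin f" "submod X"
  then show "0 \<in> f ` X" using image_eqI[of 0 f 0 X] by (simp add: lin_0 submod_0)
next
  fix x y assume a: "lin f" "submod X" "x \<in> f ` X" "y \<in> f ` X"
  then obtain u v where "u \<in> X" "v \<in> X" "x = f u" "y = f v" by blast
  then show "x + y \<in> f ` X" using a by (auto intro!: image_eqI[of _ f "u + v"] simp: linD submod_add)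
next
  fix c x assume a: "lin f" "submod X" "x \<in> f ` X"
  then obtain u where "u \<in> X" "x = f u" by blast
  then show "c *: x \<in> f ` X" using a by (auto intro!: image_eqI[of _ f "c *: u"] simp: linD submod_smul)
qed

lemma submod_vimage: "lin f ==> submod X ==> submod Y ==> submod {y \<in> Y. f y \<in> X}"
  by (rule submodI) (auto simp: submod_closed lin_0 linD)

lemma image_plus: "lin f ==> f ` (X + Y) = f ` X + f ` Y"
  by (force simp: set_plus_def linD)

lemma le_plus1: "submod Y ==> X <= X + Y"
  using set_plus_intro[of _ X 0 Y] by (auto simp: submod_0)

lemma le_plus2: "submod X ==> Y <= X + Y"
  using set_plus_intro[of 0 X _ Y] by (auto simp: submod_0)

lemma plus_least: "submod Z ==> X <= Z ==> Y <= Z ==> X + Y <= Z"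
  by (auto simp: set_plus_def intro: submod_add)

lemma plus_absorb: "submod Y ==> submod X ==> X <= Y ==> X + Y = Y"
  by (simp add: le_plus2 plus_least subset_antisym)

lemma plus_modular: "submod Z ==> X <= Z ==> (X + Y) \<inter> Z = X + (Y \<inter> Z)"
proof safe
  fix x assume Z: "submod Z" "X <= Z" "x \<in> X + Y" "x \<in> Z"
  then obtain a b where ab: "a \<in> X" "b \<in> Y" "x = a + b" by (auto simp: set_plus_def)
  then have "b = x - a" by simp
  then have "b \<in> Z" using submod_diff[OF Z(1,4)] ab Z(2) by blast
  then show "x \<in> X + (Y \<inter> Z)" using ab by (auto intro: set_plus_intro)
qed (auto simp: set_plus_def intro: submod_add)

section \<open>Lengths of intervals of submodules\<close>

text \<open>The predicate \<open>P\<close> is a parameter because the chains of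
  \<open>module_length\<close> run through submodules of an abstract module and those of
  \<open>len\<close> through submodules of vectors. \<open>X\<close> and \<open>Y\<close> only bound
  the chain, which may end short of them.\<close>

definition has_chain :: "('v set => bool) => 'v set => 'v set => nat => bool" where
  "has_chain P X Y n \<longleftrightarrow> (\<exists>C. (\<forall>i\<le>n. P (C i) \<and> X <= C i \<and> C i <= Y) \<and> (\<forall>i<n. C i \<subset> C (Suc i)))"

definition clen :: "('v set => bool) => 'v set => 'v set => enat" where
  "clen P X Y = (SUP n \<in> {n. has_chain P X Y n}. enat n)"

abbreviation "len \<equiv> clen submod"

lemma has_chain_le: "has_chain P X Y n ==> m \<le> n ==> has_chain P X Y m"
  unfolding has_chain_def by (meson le_trans less_le_trans)

lemma has_chain_mono: "has_chain P X Y n ==> Y <= Y' ==> has_chain P X Y' n"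
  unfolding has_chain_def by (meson order_trans)

lemma enat_le_by_nat: "(!!k. enat k \<le> a ==> enat k \<le> b) ==> a \<le> b"
proof (rule ccontr)
  assume h: "!!k. enat k \<le> a ==> enat k \<le> b" and "\<not> a \<le> b"
  then obtain m where m: "b = enat m" "enat m < a" by (cases b) auto
  then have "enat (Suc m) \<le> a" using Suc_ile_eq by simp
  then show False using h m(1) by fastforce
qed

text \<open>A chain may be cut short, so the supremum reaches \<open>k\<close> exactly when a chain
  of length \<open>k\<close> exists, even if the supremum is infinite. With
  \<open>enat_le_by_nat\<close> an inequality of lengths becomes a statement about finite
  chains.\<close>

lemma le_clen_iff:
  assumes "P X" "X <= Y"
  shows "enat k \<le> clen P X Y \<longleftrightarrow> has_chain P X Y k"
proof
  assume k: "enat k \<le> clen P X Y"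
  show "has_chain P X Y k"
  proof (rule ccontr)
    assume *: "\<not> has_chain P X Y k"
    have 0: "has_chain P X Y 0" unfolding has_chain_def using assms by auto
    have "clen P X Y \<le> enat (k - 1)"
      unfolding clen_def
    proof (rule SUP_least, simp)
      fix n assume "has_chain P X Y n"
      then have "n < k" using * has_chain_le not_le_imp_less by blast
      then show "n \<le> k - Suc 0" by simp
    qed
    then have "k \<le> k - 1" using k order_trans enat_ord_simps(1) by blast
    then show False using * 0 by (cases k) auto
  qed
qed (auto simp: clen_def intro: SUP_upper)

text \<open>A strictly monotone map between intervals carries chains to chains. Many inequalities of
  lengths below are obtained by exhibiting such a map, for instance a preimage or a Frobenius
  pullback.\<close>

lemma clen_mono_map:
  assumes "!!C. P C ==> X <= C ==> C <= Y ==> P' (f C) \<and> X' <= f C \<and> f C <= Y'"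
    and "!!C D. P C ==> P D ==> X <= C ==> C \<subset> D ==> D <= Y ==> f C \<subset> f D"
  shows "clen P X Y \<le> clen P' X' Y'"
  unfolding clen_def
proof (rule SUP_mono, simp)
  fix n assume "has_chain P X Y n"
  then obtain C where C: "\<forall>i\<le>n. P (C i) \<and> X <= C i \<and> C i <= Y" "\<forall>i<n. C i \<subset> C (Suc i)"
    unfolding has_chain_def by blast
  have "has_chain P' X' Y' n" unfolding has_chain_def
    by (rule exI[of _ "%i. f (C i)"]) (use C assms in \<open>auto simp: less_imp_le Suc_leI\<close>)
  then show "\<exists>m. has_chain P' X' Y' m \<and> n \<le> m" by blast
qed

lemma clen_mono: "X <= X' ==> Y' <= Y ==> clen P X' Y' \<le> clen P X Y"
  by (rule clen_mono_map[of _ _ _ _ "%x. x"]) auto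

lemma clen_self [simp]: "clen P X X = 0"
proof -
  have "n = 0" if "has_chain P X X n" for n
  proof (rule ccontr)
    assume "n ~= 0"
    then have "C 0 \<subset> C 1" if "\<forall>i<n. C i \<subset> C (Suc i)" for C :: "nat => 'a set" using that by auto
    with \<open>n ~= 0\<close> that show False unfolding has_chain_def by (metis One_nat_def Suc_leI bot_nat_0.extremum neq0_conv psubset_eq subset_antisym)
  qed
  then have "clen P X X \<le> 0" unfolding clen_def by (intro SUP_least) (auto simp: zero_enat_def)
  then show ?thesis by simp
qed

lemma clen_eq_0: "P X ==> P Y ==> X <= Y ==> clen P X Y = 0 ==> X = Y"
proof (rule ccontr)
  assume a: "P X" "P Y" "X <= Y" "clen P X Y = 0" "X ~= Y"
  have "has_chain P X Y 1" unfolding has_chain_def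
    by (rule exI[of _ "%i. if i = 0 then X else Y"]) (use a in auto)
  then have "enat 1 \<le> 0" using le_clen_iff[of P X Y 1] a by simp
  then show False by (simp add: zero_enat_def)
qed

lemma clen_simple:
  assumes "P X" "P Y" "X \<subset> Y" "!!C. P C ==> X <= C ==> C <= Y ==> C = X \<or> C = Y"
  shows "clen P X Y = 1"
proof (rule antisym)
  show "clen P X Y \<le> 1"
    unfolding clen_def
  proof (rule SUP_least, rule ccontr, simp)
    fix n assume "has_chain P X Y n" and n: "\<not> enat n \<le> 1"
    then obtain C where C: "\<forall>i\<le>n. P (C i) \<and> X <= C i \<and> C i <= Y" "\<forall>i<n. C i \<subset> C (Suc i)"
      unfolding has_chain_def by blast
    have "1 < n" using n by (simp add: one_enat_def)
    then have "C 0 \<subset> C 1" "C 1 \<subset> C 2" "P (C 0)" "P (C 1)" "P (C 2)" "X <= C 0" "C 2 <= Y"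
      using C by (auto simp: numeral_2_eq_2)
    then show False using assms(4)[of "C 1"] C \<open>1 < n\<close> by (metis less_imp_le psubset_subset_trans subset_not_subset_eq)
  qed
  have "clen P X Y ~= 0" using clen_eq_0 assms by blast
  then show "1 \<le> clen P X Y" by (simp add: ileI1 one_eSuc)
qed

text \<open>Repetitions are deleted from a weakly increasing chain; the cardinality counts the
  strict steps that remain.\<close>

lemma has_chain_of_mono:
  assumes "!!i. i \<le> k ==> P (D i) \<and> X <= D i" "!!i. i < k ==> D i <= D (Suc i)"
  shows "has_chain P X (D k) (card {i. i < k \<and> D i ~= D (Suc i)})"
  using assms
proof (induction k)
  case 0
  then show ?case unfolding has_chain_def by (intro exI[of _ D]) auto
next
  case (Suc k)
  have IH: "has_chain P X (D k) (card {i. i < k \<and> D i ~= D (Suc i)})" by (rule Suc.IH) (use Suc.prems in auto)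
  show ?case
  proof (cases "D k = D (Suc k)")
    case True
    then have "{i. i < Suc k \<and> D i ~= D (Suc i)} = {i. i < k \<and> D i ~= D (Suc i)}" by (auto simp: less_Suc_eq)
    then show ?thesis using IH True by simp
  next
    case False
    define n where "n = card {i. i < k \<and> D i ~= D (Suc i)}"
    have "{i. i < Suc k \<and> D i ~= D (Suc i)} = insert k {i. i < k \<and> D i ~= D (Suc i)}" using False by auto
    then have c: "card {i. i < Suc k \<and> D i ~= D (Suc i)} = Suc n" by (simp add: n_def)
    obtain C where C: "\<forall>i\<le>n. P (C i) \<and> X <= C i \<and> C i <= D k" "\<forall>i<n. C i \<subset> C (Suc i)"
      using IH unfolding has_chain_def n_def by blast
    have s: "D k \<subset> D (Suc k)" using False Suc.prems(2)[of k] by auto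
    have "has_chain P X (D (Suc k)) (Suc n)" unfolding has_chain_def
    proof (rule exI[of _ "%i. if i \<le> n then C i else D (Suc k)"], intro conjI allI impI)
      fix i assume "i \<le> Suc n"
      show "P (if i \<le> n then C i else D (Suc k))" using C(1) Suc.prems(1)[of "Suc k"] by simp
      show "X <= (if i \<le> n then C i else D (Suc k))" using C(1) Suc.prems(1)[of "Suc k"] by simp
      show "(if i \<le> n then C i else D (Suc k)) <= D (Suc k)" using C(1) s by auto
    next
      fix i assume "i < Suc n"
      then show "(if i \<le> n then C i else D (Suc k)) \<subset> (if Suc i \<le> n then C (Suc i) else D (Suc k))"
        using C(1)[rule_format, of n] C(2) s by (cases "i = n") auto
    qed
    then show ?thesis by (simp only: c)
  qed
qed

lemma enat_le_plus_split:
  assumes "enat k \<le> a + b" shows "\<exists>i j. i + j = k \<and> enat i \<le> a \<and> enat j \<le> b"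
proof (cases "enat k \<le> a")
  case True then show ?thesis by (intro exI[of _ k] exI[of _ 0]) (auto simp: zero_enat_def[symmetric])
next
  case False
  then obtain i where i: "a = enat i" "i < k" by (cases a) auto
  have "enat (k - i) \<le> b" using assms i by (cases b) auto
  then show ?thesis using i by (intro exI[of _ i] exI[of _ "k - i"]) auto
qed

text \<open>For one inequality two chains are concatenated. For the other, a chain from
  \<open>X\<close> to \<open>Z\<close> is both intersected with \<open>Y\<close> and added to
  \<open>Y\<close>. By modularity a strict step cannot become an equality in both, so the strict
  steps of the two thinned chains number at least \<open>k\<close>. Infinite lengths are
  included.\<close>

lemma len_add:
  assumes X: "submod X" and Y: "submod Y" and Z: "submod Z" and XY: "X <= Y" and YZ: "Y <= Z"
  shows "len X Z = len X Y + len Y Z"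
proof (rule antisym; rule enat_le_by_nat)
  fix k assume "enat k \<le> len X Y + len Y Z"
  then obtain n m where nm: "n + m = k" "enat n \<le> len X Y" "enat m \<le> len Y Z"
    using enat_le_plus_split by blast
  then have ch: "has_chain submod X Y n" "has_chain submod Y Z m"
    using le_clen_iff[of submod X Y n] le_clen_iff[of submod Y Z m] X Y XY YZ by simp_all
  obtain C where C: "\<forall>i\<le>n. submod (C i) \<and> X <= C i \<and> C i <= Y" "\<forall>i<n. C i \<subset> C (Suc i)"
    using ch(1) unfolding has_chain_def by blast
  obtain D where D: "\<forall>i\<le>m. submod (D i) \<and> Y <= D i \<and> D i <= Z" "\<forall>i<m. D i \<subset> D (Suc i)"
    using ch(2) unfolding has_chain_def by blast
  define B where "B i = (if i < n then C i else D (i - n))" for i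
  have "has_chain submod X Z k" unfolding has_chain_def
  proof (rule exI[of _ B], intro conjI allI impI)
    fix i assume "i \<le> k"
    then have "submod (B i) \<and> X <= B i \<and> B i <= Z"
    proof (cases "i < n")
      case True
      then have "submod (C i) \<and> X <= C i \<and> C i <= Y" using C(1) by simp
      then show ?thesis using True YZ by (simp add: B_def subset_trans[of "C i" Y Z])
    next
      case False
      then have "submod (D (i - n)) \<and> Y <= D (i - n) \<and> D (i - n) <= Z" using D(1) \<open>i \<le> k\<close> nm(1) by simp
      then show ?thesis using False XY by (simp add: B_def subset_trans[of X Y "D (i - n)"])
    qed
    then show "submod (B i)" "X <= B i" "B i <= Z" by simp_all
  next
    fix i assume i: "i < k"
    consider "Suc i < n" | "Suc i = n" | "i \<ge> n" by linarith
    then show "B i \<subset> B (Suc i)"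
    proof cases
      case 2
      then have "C i \<subset> C (Suc i)" "C (Suc i) <= Y" "Y <= D 0" using C D by auto
      then show ?thesis using 2 by (auto simp: B_def)
    qed (use C D i nm(1) in \<open>auto simp: B_def Suc_diff_le\<close>)
  qed
  then show "enat k \<le> len X Z" using le_clen_iff[of submod X Z k] X subset_trans[OF XY YZ] by simp
next
  fix k assume "enat k \<le> len X Z"
  then have "has_chain submod X Z k" using le_clen_iff[of submod X Z k] X subset_trans[OF XY YZ] by simp
  then obtain C where C: "!!i. i \<le> k ==> submod (C i) \<and> X <= C i \<and> C i <= Z" "!!i. i < k ==> C i \<subset> C (Suc i)"
    unfolding has_chain_def by blast
  let ?S1 = "{i. i < k \<and> C i \<inter> Y ~= C (Suc i) \<inter> Y}" and ?S2 = "{i. i < k \<and> C i + Y ~= C (Suc i) + Y}"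
  have c1: "has_chain submod X (C k \<inter> Y) (card ?S1)"
  proof (rule has_chain_of_mono[where D = "%i. C i \<inter> Y"])
    fix i assume "i \<le> k"
    then show "submod (C i \<inter> Y) \<and> X <= C i \<inter> Y" using C(1) XY Y by (simp add: submod_Int)
  qed (use C(2) in blast)
  have c2: "has_chain submod Y (C k + Y) (card ?S2)"
  proof (rule has_chain_of_mono[where D = "%i. C i + Y"])
    fix i assume "i \<le> k"
    then show "submod (C i + Y) \<and> Y <= C i + Y" using C(1) Y by (simp add: submod_plus le_plus2)
  next
    fix i assume "i < k"
    then show "C i + Y <= C (Suc i) + Y" using C(2) by (simp add: set_plus_mono2 psubset_imp_subset)
  qed
  have c3: "C k \<inter> Y <= Y" "C k + Y <= Z" using C(1)[of k] YZ Z by (simp_all add: plus_least)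
  have "has_chain submod X Y (card ?S1)" "has_chain submod Y Z (card ?S2)"
    by (rule has_chain_mono[OF c1 c3(1)], rule has_chain_mono[OF c2 c3(2)])
  then have *: "enat (card ?S1) \<le> len X Y" "enat (card ?S2) \<le> len Y Z"
    using le_clen_iff[of submod X Y "card ?S1"] le_clen_iff[of submod Y Z "card ?S2"] X Y XY YZ by simp_all
  have "{..<k} <= ?S1 \<union> ?S2"
  proof (rule subsetI, rule ccontr)
    fix i assume i: "i \<in> {..<k}" "i \<notin> ?S1 \<union> ?S2"
    then have e: "C i \<inter> Y = C (Suc i) \<inter> Y" "C i + Y = C (Suc i) + Y" by auto
    obtain x where x: "x \<in> C (Suc i)" "x \<notin> C i" using C(2)[of i] i by auto
    then have "x \<in> C i + Y" using e(2) le_plus1[OF Y] by blast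
    then obtain c y where cy: "c \<in> C i" "y \<in> Y" "x = c + y" by (auto simp: set_plus_def)
    have s: "submod (C i)" "submod (C (Suc i))" using C(1)[of i] C(1)[of "Suc i"] i by auto
    have "y = x - c" using cy by simp
    then have "y \<in> C (Suc i)" using submod_diff[OF s(2) x(1)] cy(1) C(2)[of i] i by auto
    then have "y \<in> C i" using e(1) cy by blast
    then show False using x cy submod_add[OF s(1)] by blast
  qed
  then have "k \<le> card (?S1 \<union> ?S2)" using card_mono[of "?S1 \<union> ?S2" "{..<k}"] by simp
  also have "\<dots> \<le> card ?S1 + card ?S2" by (rule card_Un_le)
  finally have "enat k \<le> enat (card ?S1) + enat (card ?S2)" by simp
  also have "\<dots> \<le> len X Y + len Y Z" using * by (rule add_mono)
  finally show "enat k \<le> len X Y + len Y Z" .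
qed

text \<open>The map induced by \<open>f\<close> from Y/X to (A + f Y)/(A + f X) is onto, and
  \<open>inj\<close> makes it injective. The submodule \<open>A\<close> allows \<open>f\<close> to
  be injective only modulo \<open>A\<close>. The lemma will be applied to multiplication by u and by
  powers of p, to inclusions and to the structure map.\<close>

lemma len_transport:
  assumes f: "lin f" and A: "submod A" and X: "submod X" and Y: "submod Y" and XY: "X <= Y"
    and inj: "!!y. y \<in> Y ==> f y \<in> A ==> y \<in> X"
  shows "len (A + f ` X) (A + f ` Y) = len X Y"
proof (rule antisym)
  show "len X Y \<le> len (A + f ` X) (A + f ` Y)"
  proof (rule clen_mono_map[of _ _ _ _ "%C. A + f ` C"])
    fix C D assume C: "submod C" "submod D" "X <= C" "C \<subset> D" "D <= Y"
    then obtain y where y: "y \<in> D" "y \<notin> C" by auto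
    have "f y \<notin> A + f ` C"
    proof
      assume "f y \<in> A + f ` C"
      then obtain a c where ac: "a \<in> A" "c \<in> C" "f y = a + f c" by (auto simp: set_plus_def)
      then have "f (y - c) \<in> A" using f by (simp add: lin_diff)
      then have "y - c \<in> X" using inj[of "y - c"] C y ac Y by (meson psubset_imp_subset submod_diff subsetD)
      then show False using C y ac submod_diff_iff by blast
    qed
    moreover have "f y \<in> A + f ` D" using y A le_plus2[of A "f ` D"] by auto
    moreover have "A + f ` C <= A + f ` D" using C by (intro set_plus_mono2) auto
    ultimately show "A + f ` C \<subset> A + f ` D" by blast
  qed (use A f in \<open>simp add: submod_plus submod_image set_plus_mono2 image_mono\<close>)
  show "len (A + f ` X) (A + f ` Y) \<le> len X Y"
  proof (rule clen_mono_map[of _ _ _ _ "%D. {y\<in>Y. f y \<in> D}"])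
    fix D assume D: "submod D" "A + f ` X <= D" "D <= A + f ` Y"
    have "f ` X <= D" using D A le_plus2 by blast
    then show "submod {y \<in> Y. f y \<in> D} \<and> X <= {y \<in> Y. f y \<in> D} \<and> {y \<in> Y. f y \<in> D} <= Y"
      using submod_vimage[OF f D(1) Y] XY by auto
  next
    fix D D' assume D: "submod D" "submod D'" "A + f ` X <= D" "D \<subset> D'" "D' <= A + f ` Y"
    then obtain d where d: "d \<in> D'" "d \<notin> D" by auto
    then have "d \<in> A + f ` Y" using D by blast
    then obtain a y where ay: "a \<in> A" "y \<in> Y" "d = a + f y" by (auto simp: set_plus_def)
    have aD: "a \<in> D" "a \<in> D'" using D(3,4) ay le_plus1[OF submod_image[OF f X], of A] by auto
    have "f y = d - a" using ay by simp
    then have "f y \<in> D'" using submod_diff[OF D(2) d(1)] aD by auto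
    moreover have "f y \<notin> D" using d(2) ay(3) submod_add[OF D(1)] aD by auto
    ultimately show "{y \<in> Y. f y \<in> D} \<subset> {y \<in> Y. f y \<in> D'}" using D(4) ay(2) by auto
  qed
qed

lemma len_second_iso:
  assumes "submod X" "submod Y" shows "len (X \<inter> Y) X = len Y (X + Y)"
proof -
  have "len (Y + (%x. x) ` (X \<inter> Y)) (Y + (%x. x) ` X) = len (X \<inter> Y) X"
    by (rule len_transport) (use assms in \<open>auto simp: submod_Int\<close>)
  moreover have "Y + (X \<inter> Y) = Y" using plus_absorb[of Y "X \<inter> Y"] assms by (simp add: submod_Int add.commute)
  ultimately show ?thesis by (simp add: add.commute)
qed

text \<open>Since \<open>f\<close> is injective on B/A, it carries B/Y onto (A + f B)/(A + f Y);
  what remains up to \<open>B\<close> is the cokernel of \<open>f\<close> on B/A. Iterated with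
  multiplication by u, this shows how a length changes with the exponent of u.\<close>

lemma len_shift:
  assumes f: "lin f" and A: "submod A" and Y: "submod Y" and B: "submod B" and AY: "A <= Y" and YB: "Y <= B"
    and fB: "f ` B <= B" and inj: "!!y. y \<in> B ==> f y \<in> A ==> y \<in> A"
  shows "len (A + f ` Y) B = len Y B + len (A + f ` B) B"
proof -
  have "len (A + f ` Y) (A + f ` B) = len Y B"
    by (rule len_transport) (use assms in auto)
  moreover have "len (A + f ` Y) B = len (A + f ` Y) (A + f ` B) + len (A + f ` B) B"
    by (rule len_add) (use assms plus_least[of B A "f ` B"] in \<open>simp_all add: submod_plus submod_image set_plus_mono2 image_mono\<close>)
  ultimately show ?thesis by simp
qed

lemma len_shift_funpow:
  assumes f: "lin f" and A: "submod A" and Y: "submod Y" and B: "submod B" and AY: "A <= Y" and YB: "Y <= B"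
    and fA: "f ` A <= A" and fB: "f ` B <= B" and inj: "!!y. y \<in> B ==> f y \<in> A ==> y \<in> A"
  shows "len (A + (f ^^ k) ` Y) B = len Y B + enat k * len (A + f ` B) B"
proof (induction k)
  case 0
  then show ?case using plus_absorb[OF Y A AY] by (simp add: zero_enat_def[symmetric])
next
  case (Suc k)
  have l: "lin (f ^^ k)" by (induction k) (use f in \<open>auto simp: lin_def\<close>)
  have kB: "(f ^^ k) ` B <= B" by (induction k) (use fB in auto)
  have s: "submod ((f ^^ k) ` Y)" using l Y by (rule submod_image)
  have e: "A + (f ^^ Suc k) ` Y = A + f ` (A + (f ^^ k) ` Y)"
  proof -
    have "f ` A + A = A" using plus_absorb[OF A submod_image[OF f A] fA] .
    then have "A + f ` A = A" by (simp add: add.commute)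
    then have "A + f ` (A + (f ^^ k) ` Y) = A + f ` ((f ^^ k) ` Y)"
      by (simp add: image_plus[OF f] add.assoc[symmetric])
    then show ?thesis by (simp add: image_comp comp_def)
  qed
  have "len (A + (f ^^ Suc k) ` Y) B = len (A + (f ^^ k) ` Y) B + len (A + f ` B) B"
    unfolding e
  proof (rule len_shift[OF f A _ B _ _ fB inj])
    show "A + (f ^^ k) ` Y <= B" using AY YB kB by (intro plus_least B) blast+
  qed (use A s in \<open>simp_all add: submod_plus le_plus1\<close>)
  also have "\<dots> = len Y B + enat (Suc k) * len (A + f ` B) B"
    unfolding Suc.IH by (simp add: add.assoc algebra_simps flip: one_enat_def eSuc_enat plus_1_eSuc)
  finally show ?case .
qed

text \<open>Both sides of the inequality \<open>len G' J \<le> len G I\<close> complete \<open>len I J\<close>, respectively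
  \<open>len G G'\<close>, to the length of the interval from \<open>G\<close> to \<open>J\<close>.\<close>

lemma len_compare:
  assumes "submod G" "submod G'" "submod I" "submod J" "G <= I" "I <= J" "G <= G'" "G' <= J"
    and fin: "len I J ~= \<infinity>" and le: "len I J \<le> len G G'"
  shows "len G' J \<le> len G I" and "len I J = len G G' ==> len G' J = len G I"
proof -
  have "len G I + len I J = len G G' + len G' J"
    using len_add[of G I J] len_add[of G G' J] assms by simp
  then show "len G' J \<le> len G I" "len I J = len G G' ==> len G' J = len G I"
    using fin le by (cases "len I J"; cases "len G I"; cases "len G G'"; cases "len G' J"; simp)+
qed

section \<open>Strict $p$-rings and the Frobenius of their power series rings\<close>

lemma hom_type_algebraD:
  assumes "h \<in> Ring.ring_hom ring_of_type_algebra ring_of_type_algebra"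
  shows "h (x + y) = h x + h y" "h (x * y) = h x * h y" "h 1 = 1"
  using assms by (auto simp: Ring.ring_hom_def ring_of_type_algebra_def Pi_def)

lemma dvd_fps_const_iff: "(fps_const c :: 'a::comm_ring_1 fps) dvd f \<longleftrightarrow> (\<forall>i. c dvd fps_nth f i)"
proof
  assume "\<forall>i. c dvd fps_nth f i"
  then obtain g where "!!i. fps_nth f i = c * g i" unfolding dvd_def by metis
  then have "f = fps_const c * Abs_fps g" by (simp add: fps_eq_iff)
  then show "fps_const c dvd f" by simp
qed (auto simp: dvd_def)

lemma X_power_dvd_iff: "fps_X ^ k dvd (f :: 'a::comm_ring_1 fps) \<longleftrightarrow> (\<forall>i<k. fps_nth f i = 0)"
proof
  assume f: "\<forall>i<k. fps_nth f i = 0"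
  have "f = fps_X ^ k * fps_shift k f" using f by (auto simp: fps_eq_iff fps_X_power_mult_nth)
  then show "fps_X ^ k dvd f" by (metis dvd_triv_left)
qed (auto simp: dvd_def fps_X_power_mult_nth)

locale witt =
  fixes p :: nat and \<rho> :: "'w::comm_ring_1 => 'f::field" and \<sigma> :: "'w => 'w"
  assumes witt: "witt_ring p \<rho> \<sigma>"
begin

lemma prime_p: "Factorial_Ring.prime p" using witt by (simp add: witt_ring_def)
lemma p_pos [simp]: "0 < p" using prime_p by (simp add: prime_gt_0_nat)
lemma p_neq_0 [simp]: "p ~= 0" using p_pos by simp

lemma rho_hom: "\<rho> (x + y) = \<rho> x + \<rho> y" "\<rho> (x * y) = \<rho> x * \<rho> y" "\<rho> 1 = 1"
  using witt hom_type_algebraD[of \<rho>] by (auto simp: witt_ring_def)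

lemma sigma_hom: "\<sigma> (x + y) = \<sigma> x + \<sigma> y" "\<sigma> (x * y) = \<sigma> x * \<sigma> y" "\<sigma> 1 = 1"
  using witt hom_type_algebraD[of \<sigma>] by (auto simp: witt_ring_def)

lemma rho_0 [simp]: "\<rho> 0 = 0" using rho_hom(1)[of 0 0] by (metis add.right_neutral add_left_cancel)
lemma sigma_0 [simp]: "\<sigma> 0 = 0" using sigma_hom(1)[of 0 0] by (metis add.right_neutral add_left_cancel)

lemma rho_diff: "\<rho> (x - y) = \<rho> x - \<rho> y" using rho_hom(1)[of "x - y" y] by (simp add: algebra_simps)
lemma sigma_diff: "\<sigma> (x - y) = \<sigma> x - \<sigma> y" using sigma_hom(1)[of "x - y" y] by (simp add: algebra_simps)

lemma rho_sum: "\<rho> (\<Sum>k\<in>K. f k) = (\<Sum>k\<in>K. \<rho> (f k))"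
  by (induction K rule: infinite_finite_induct) (auto simp: rho_hom)

lemma sigma_p_power [simp]: "\<sigma> (of_nat p ^ n) = of_nat p ^ n"
proof -
  have "\<sigma> (of_nat k) = of_nat k" for k by (induction k) (auto simp: sigma_hom)
  then show ?thesis by (induction n) (auto simp: sigma_hom)
qed

lemma rho_eq_0: "\<rho> x = 0 \<longleftrightarrow> of_nat p dvd x" using witt by (simp add: witt_ring_def)
lemma rho_surj: "\<exists>x. \<rho> x = y" using witt unfolding witt_ring_def surj_def by metis
lemma frobenius_surj: "\<exists>y. y ^ p = (x :: 'f)"
proof -
  have "\<forall>x::'f. \<exists>y. y ^ p = x" using witt unfolding witt_ring_def by (elim conjE)
  then show ?thesis ..
qed
lemma rho_sigma: "\<rho> (\<sigma> x) = \<rho> x ^ p" using witt by (simp add: witt_ring_def)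

lemma p_power_cancel: "of_nat p ^ n * (x::'w) = 0 ==> x = 0"
proof (induction n)
  case (Suc n)
  then have "of_nat p * (of_nat p ^ n * x) = 0" by (simp add: mult.assoc)
  moreover have "\<forall>x::'w. of_nat p * x = 0 --> x = 0" using witt by (simp add: witt_ring_def)
  ultimately show ?case using Suc.IH by blast
qed simp

lemma p_separated: "(!!n. of_nat p ^ n dvd (x::'w)) ==> x = 0"
  using witt by (simp add: witt_ring_def)

lemma p_complete:
  assumes "!!n. of_nat p ^ n dvd s (Suc n) - (s n :: 'w)"
  obtains l where "!!n. of_nat p ^ n dvd l - s n"
proof -
  have "\<forall>s::nat => 'w. (\<forall>n. of_nat p ^ n dvd s (Suc n) - s n) --> (\<exists>l. \<forall>n. of_nat p ^ n dvd l - s n)"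
    using witt unfolding witt_ring_def by (elim conjE)
  then show thesis using assms that by blast
qed

lemma p_power_decomp:
  assumes "(x::'w) ~= 0" obtains k y where "x = of_nat p ^ k * y" "\<rho> y ~= 0"
proof -
  obtain n where n: "\<not> of_nat p ^ n dvd x" using p_separated assms by blast
  define m where "m = (LEAST n. \<not> of_nat p ^ n dvd x)"
  have m: "\<not> of_nat p ^ m dvd x" unfolding m_def using n by (rule LeastI)
  then obtain k where k: "m = Suc k" by (cases m) auto
  then have "of_nat p ^ k dvd x" using not_less_Least[of k] m_def by (metis lessI)
  then obtain y where y: "x = of_nat p ^ k * y" by (auto simp: dvd_def)
  have "\<rho> y ~= 0"
  proof
    assume "\<rho> y = 0"
    then obtain z where "y = of_nat p * z" by (auto simp: rho_eq_0 dvd_def)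
    then have "x = of_nat p ^ m * z" using y k by (simp add: mult_ac)
    then show False using m by simp
  qed
  then show thesis using y that by blast
qed

text \<open>After all powers of p are split off, the residues are nonzero elements of the field
  F.\<close>

lemma witt_domain: "(x::'w) * y = 0 ==> x = 0 \<or> y = 0"
proof (rule ccontr)
  assume xy: "x * y = 0" "\<not> (x = 0 \<or> y = 0)"
  obtain k x' where x: "x = of_nat p ^ k * x'" "\<rho> x' ~= 0" using p_power_decomp[of x] xy(2) by blast
  obtain l y' where y: "y = of_nat p ^ l * y'" "\<rho> y' ~= 0" using p_power_decomp[of y] xy(2) by blast
  have "of_nat p ^ (k + l) * (x' * y') = 0" using x(1) y(1) xy(1) by (simp add: power_add mult_ac)
  then have "x' * y' = 0" using p_power_cancel by blast
  then have "\<rho> x' * \<rho> y' = 0" using rho_hom(2)[of x' y'] by simp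
  then show False using x y by simp
qed

lemma witt_unit: assumes "\<rho> x ~= 0" shows "\<exists>y. x * y = 1"
proof -
  obtain y0 where y0: "\<rho> y0 = inverse (\<rho> x)" using rho_surj by blast
  have "\<rho> (1 - x * y0) = 0" using assms y0 by (simp add: rho_diff rho_hom)
  then obtain z where z: "1 - x * y0 = of_nat p * z" by (auto simp: rho_eq_0 dvd_def)
  \<comment> \<open>\<open>x * y0\<close> equals 1 - q with q divisible by p, so the partial sums of
    the geometric series converge p-adically to its inverse.\<close>
  define q where "q = of_nat p * z"
  define s where "s n = (\<Sum>i<n. q ^ i)" for n
  have geo: "(1 - q) * s n = 1 - q ^ n" for n unfolding s_def by (rule one_diff_power_eq[symmetric])
  have "of_nat p ^ n dvd s (Suc n) - s n" for n by (simp add: s_def q_def power_mult_distrib)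
  then obtain l where l: "!!n. of_nat p ^ n dvd l - s n" using p_complete by blast
  have "of_nat p ^ n dvd (1 - q) * l - 1" for n
  proof -
    have "(1 - q) * l - 1 = (1 - q) * (l - s n) + ((1 - q) * s n - 1)" by (simp add: algebra_simps)
    also have "\<dots> = (1 - q) * (l - s n) - q ^ n" by (simp add: geo)
    finally show ?thesis using l[of n] by (simp add: q_def power_mult_distrib)
  qed
  then have "(1 - q) * l - 1 = 0" by (rule p_separated)
  moreover have "1 - q = x * y0" using z by (simp add: q_def algebra_simps)
  ultimately have "x * (y0 * l) = 1" by (simp add: mult.assoc)
  then show ?thesis by blast
qed

text \<open>An element killed by \<sigma> has residue 0, since a field has no nilpotent elements.
  Dividing by p and repeating the argument shows that it is divisible by all powers of p.\<close>

lemma sigma_inj: "\<sigma> x = \<sigma> y ==> x = y"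
proof -
  assume "\<sigma> x = \<sigma> y"
  then have z: "\<sigma> (x - y) = 0" by (simp add: sigma_diff)
  have "of_nat p ^ n dvd x - y" for n
  proof (induction n)
    case (Suc n)
    then obtain w where w: "x - y = of_nat p ^ n * w" by (auto simp: dvd_def)
    have "of_nat p ^ n * \<sigma> w = 0" using z unfolding w by (simp add: sigma_hom)
    then have "\<sigma> w = 0" by (rule p_power_cancel)
    then have "\<rho> w ^ p = 0" using rho_sigma[of w] by simp
    then obtain v where "w = of_nat p * v" by (auto simp: rho_eq_0 dvd_def)
    then show ?case using w by (simp add: mult_ac)
  qed simp
  then show "x = y" using p_separated[of "x - y"] by simp
qed

text \<open>This is where F is perfect: a p-th root of the residue of the error is lifted and
  improves the approximation by one more power of p. The limit exists by completeness.\<close>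

lemma sigma_surj: "\<exists>x. \<sigma> x = y"
proof -
  have "\<exists>s. \<forall>n. of_nat p ^ n dvd y - \<sigma> (s n) \<and> of_nat p ^ n dvd s (Suc n) - s n"
  proof (rule dependent_nat_choice)
    show "\<exists>x. of_nat p ^ 0 dvd y - \<sigma> x" by simp
  next
    fix s n assume "of_nat p ^ n dvd y - \<sigma> s"
    then obtain z where z: "y - \<sigma> s = of_nat p ^ n * z" by (auto simp: dvd_def)
    obtain a where a: "a ^ p = \<rho> z" using frobenius_surj by blast
    obtain x0 where x0: "\<rho> x0 = a" using rho_surj by blast
    have "\<rho> (z - \<sigma> x0) = 0" by (simp add: rho_diff rho_sigma x0 a)
    then obtain w where w: "z - \<sigma> x0 = of_nat p * w" by (auto simp: rho_eq_0 dvd_def)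
    have "y - \<sigma> (s + of_nat p ^ n * x0) = of_nat p ^ n * (z - \<sigma> x0)"
      using z by (simp add: sigma_hom algebra_simps)
    then have "of_nat p ^ Suc n dvd y - \<sigma> (s + of_nat p ^ n * x0)" by (simp add: w mult_ac)
    then show "\<exists>s'. of_nat p ^ Suc n dvd y - \<sigma> s' \<and> of_nat p ^ n dvd s' - s"
      by (intro exI[of _ "s + of_nat p ^ n * x0"]) simp
  qed
  then obtain s where s: "!!n. of_nat p ^ n dvd y - \<sigma> (s n)" "!!n. of_nat p ^ n dvd s (Suc n) - s n" by blast
  obtain l where l: "!!n. of_nat p ^ n dvd l - s n" using p_complete s(2) by blast
  have "of_nat p ^ n dvd y - \<sigma> l" for n
  proof -
    obtain w where w: "l - s n = of_nat p ^ n * w" using l[of n] by (auto simp: dvd_def)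
    have "\<sigma> l - \<sigma> (s n) = of_nat p ^ n * \<sigma> w" using w by (metis sigma_diff sigma_hom(2) sigma_p_power)
    then have "\<sigma> l = \<sigma> (s n) + of_nat p ^ n * \<sigma> w" by (simp add: algebra_simps)
    then have "y - \<sigma> l = (y - \<sigma> (s n)) - of_nat p ^ n * \<sigma> w" by simp
    then show ?thesis using s(1)[of n] by (metis dvd_diff dvd_triv_left)
  qed
  then have "y - \<sigma> l = 0" by (rule p_separated)
  then show ?thesis by auto
qed

definition isig :: "'w => 'w" where "isig = inv_into UNIV \<sigma>"

lemma sigma_isig [simp]: "\<sigma> (isig x) = x" unfolding isig_def using sigma_surj by (metis f_inv_into_f rangeI)
lemma isig_sigma [simp]: "isig (\<sigma> x) = x" using sigma_inj sigma_isig by metis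
lemma isig_add: "isig (x + y) = isig x + isig y" by (rule sigma_inj) (simp add: sigma_hom)
lemma isig_0 [simp]: "isig 0 = 0" by (rule sigma_inj) simp

section \<open>The Frobenius of the power series ring\<close>

abbreviation \<phi> :: "'w fps => 'w fps" where "\<phi> \<equiv> frob p \<sigma>"

lemma phi_nth: "fps_nth (\<phi> f) m = (if p dvd m then \<sigma> (fps_nth f (m div p)) else 0)"
  by (simp add: frob_def fps_nth_compose_X_power)

lemma phi_add: "\<phi> (f + g) = \<phi> f + \<phi> g" by (simp add: fps_eq_iff phi_nth sigma_hom)
lemma phi_diff: "\<phi> (f - g) = \<phi> f - \<phi> g" by (simp add: fps_eq_iff phi_nth sigma_diff)
lemma phi_0 [simp]: "\<phi> 0 = 0" by (simp add: fps_eq_iff phi_nth)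

lemma phi_mult: "\<phi> (f * g) = \<phi> f * \<phi> g"
proof (rule fps_ext)
  fix m
  have ss: "\<sigma> (\<Sum>k\<in>K. h k) = (\<Sum>k\<in>K. \<sigma> (h k))" for h and K :: "nat set"
    by (induction K rule: infinite_finite_induct) (auto simp: sigma_hom)
  let ?h = "%i. fps_nth (\<phi> f) i * fps_nth (\<phi> g) (m - i)"
  show "fps_nth (\<phi> (f * g)) m = fps_nth (\<phi> f * \<phi> g) m"
  proof (cases "p dvd m")
    case True
    then obtain n where n: "m = p * n" by (auto simp: dvd_def)
    have "(\<Sum>i\<in>{0..m}. ?h i) = (\<Sum>i\<in>(*) p ` {0..n}. ?h i)"
    proof (rule sum.mono_neutral_right)
      show "\<forall>i\<in>{0..m} - (*) p ` {0..n}. ?h i = 0"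
      proof
        fix i assume i: "i \<in> {0..m} - (*) p ` {0..n}"
        have "\<not> p dvd i"
        proof
          assume "p dvd i"
          then obtain k where "i = p * k" by (auto simp: dvd_def)
          then show False using i n by auto
        qed
        then show "?h i = 0" by (simp add: phi_nth)
      qed
    qed (auto simp: n)
    also have "\<dots> = (\<Sum>k=0..n. ?h (p * k))"
      by (subst sum.reindex) (use p_pos in \<open>auto simp: inj_on_def\<close>)
    also have "\<dots> = (\<Sum>k=0..n. \<sigma> (fps_nth f k * fps_nth g (n - k)))"
      by (rule sum.cong) (auto simp: n phi_nth sigma_hom simp flip: diff_mult_distrib2)
    also have "\<dots> = fps_nth (\<phi> (f * g)) m" using n by (simp add: phi_nth fps_mult_nth ss)
    finally show ?thesis by (simp add: fps_mult_nth)
  next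
    case False
    have "?h i = 0" if "i \<le> m" for i
      using False that dvd_diffD[of p m i] by (auto simp: phi_nth)
    then show ?thesis using False by (simp add: fps_mult_nth phi_nth)
  qed
qed

lemma phi_X: "\<phi> fps_X = fps_X ^ p"
  by (auto simp: fps_eq_iff phi_nth sigma_hom)

lemma phi_1 [simp]: "\<phi> 1 = 1"
  by (auto simp: fps_eq_iff phi_nth sigma_hom)

lemma phi_power: "\<phi> (f ^ k) = \<phi> f ^ k" by (induction k) (auto simp: phi_mult)

lemma of_nat_fps: "(of_nat p ^ n :: 'w fps) = fps_const (of_nat p ^ n)"
  by (simp add: fps_of_nat[symmetric] fps_const_power)

lemma phi_p_power [simp]: "\<phi> (of_nat p ^ n) = of_nat p ^ n"
  by (auto simp: fps_eq_iff phi_nth of_nat_fps)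

lemma p_dvd_fps: "(of_nat p ^ n :: 'w fps) dvd f \<longleftrightarrow> (\<forall>i. of_nat p ^ n dvd fps_nth f i)"
  by (simp add: of_nat_fps dvd_fps_const_iff)

lemma fps_domain: "(x :: 'w fps) * y = 0 ==> x = 0 \<or> y = 0"
proof (rule ccontr)
  assume "x * y = 0" "\<not> (x = 0 \<or> y = 0)"
  then have "fps_nth (x * y) (subdegree x + subdegree y) = 0" "fps_nth x (subdegree x) ~= 0" "fps_nth y (subdegree y) ~= 0"
    by auto
  then show False using witt_domain[of "fps_nth x (subdegree x)" "fps_nth y (subdegree y)"] by auto
qed

lemma fps_cancel: "(c :: 'w fps) ~= 0 ==> c * x = c * y \<longleftrightarrow> x = y"
  using fps_domain[of c "x - y"] by (auto simp: algebra_simps)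

lemma X_power_neq_0: "(fps_X ^ k :: 'w fps) ~= 0"
proof
  assume "(fps_X ^ k :: 'w fps) = 0"
  then have "fps_nth (fps_X ^ k :: 'w fps) k = 0" by simp
  then show False by (simp add: fps_X_power_nth)
qed

lemma p_power_neq_0: "(of_nat p ^ k :: 'w fps) ~= 0"
  using p_power_cancel[of k 1] by (auto simp: of_nat_fps fps_eq_iff dest: spec[of _ 0])

lemma fps_unit: assumes "\<rho> (fps_nth f 0) ~= 0" shows "\<exists>g. f * g = 1"
  using witt_unit[OF assms] fps_right_inverse[of f] by blast

lemma p_dvd_X_mult: assumes "of_nat p ^ n dvd (fps_X ^ k * f :: 'w fps)" shows "of_nat p ^ n dvd f"
proof -
  have "of_nat p ^ n dvd fps_nth f i" for i
    using assms[unfolded p_dvd_fps, rule_format, of "i + k"] by (simp add: fps_X_power_mult_nth)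
  then show ?thesis by (simp add: p_dvd_fps)
qed

lemma p_power_mult_dvd: "of_nat p ^ (m + n) dvd (of_nat p ^ m * f :: 'w fps) ==> of_nat p ^ n dvd f"
  using fps_cancel[OF p_power_neq_0[of m]] by (auto simp: dvd_def power_add mult.assoc)

text \<open>A series \<open>z\<close> is \<open>\<Sum>j<p. u\<^sup>j \<phi>(z\<^sub>j)\<close> for unique \<open>z\<^sub>j\<close>: this makes \<open>\<phi>\<close> flat.\<close>

definition cj :: "nat => 'w fps => 'w fps" where
  "cj j z = Abs_fps (%n. isig (fps_nth z (p * n + j)))"

lemma X_phi_nth: "fps_nth (fps_X ^ j * \<phi> w) m = (if j \<le> m \<and> p dvd m - j then \<sigma> (fps_nth w ((m - j) div p)) else 0)"
  by (auto simp: fps_X_power_mult_nth phi_nth)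

lemma X_phi_nth': "j < p ==> k < p ==> fps_nth (fps_X ^ j * \<phi> w) (p * n + k) = (if j = k then \<sigma> (fps_nth w n) else 0)"
proof -
  assume a: "j < p" "k < p"
  have "j = k" if "j \<le> p * n + k" "p dvd p * n + k - j"
  proof -
    have "(p * n + k) mod p = j mod p" using that mod_eq_dvd_iff_nat[of j "p * n + k" p] by metis
    then show ?thesis using a by simp
  qed
  then show ?thesis by (auto simp: X_phi_nth)
qed

lemma cj_decomp: "(\<Sum>j<p. fps_X ^ j * \<phi> (cj j z)) = z"
proof (rule fps_ext)
  fix m
  define n k where "n = m div p" "k = m mod p"
  have m: "m = p * n + k" and k: "k < p" by (simp_all add: n_k_def)
  have "fps_nth (\<Sum>j<p. fps_X ^ j * \<phi> (cj j z)) m = (\<Sum>j<p. if j = k then \<sigma> (fps_nth (cj j z) n) else 0)"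
    unfolding m by (auto simp: fps_sum_nth X_phi_nth' k intro!: sum.cong)
  also have "\<dots> = fps_nth z m" using k by (simp add: cj_def m)
  finally show "fps_nth (\<Sum>j<p. fps_X ^ j * \<phi> (cj j z)) m = fps_nth z m" .
qed

lemma cj_sum: assumes "k < p" shows "cj k (\<Sum>j<p. fps_X ^ j * \<phi> (w j)) = w k"
proof (rule fps_ext)
  fix n
  have "fps_nth (\<Sum>j<p. fps_X ^ j * \<phi> (w j)) (p * n + k) = (\<Sum>j<p. if j = k then \<sigma> (fps_nth (w j) n) else 0)"
    by (auto simp: fps_sum_nth X_phi_nth' assms intro!: sum.cong)
  also have "\<dots> = \<sigma> (fps_nth (w k) n)" using assms by simp
  finally show "fps_nth (cj k (\<Sum>j<p. fps_X ^ j * \<phi> (w j))) n = fps_nth (w k) n" by (simp add: cj_def)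
qed

lemma cj_add: "cj j (x + y) = cj j x + cj j y"
  by (simp add: cj_def fps_eq_iff isig_add)

lemma cj_0 [simp]: "cj j 0 = 0" by (simp add: cj_def fps_eq_iff)

lemma cj_phi_mult: assumes "k < p" shows "cj k (\<phi> c * z) = c * cj k z"
proof -
  have "\<phi> c * z = (\<Sum>j<p. fps_X ^ j * \<phi> (c * cj j z))"
    by (subst cj_decomp[symmetric]) (simp add: sum_distrib_left phi_mult mult_ac)
  then show ?thesis using cj_sum[OF assms] by simp
qed

lemma cj_phi: assumes "k < p" shows "cj k (\<phi> c) = (if k = 0 then c else 0)"
proof -
  have "\<phi> c = (\<Sum>j<p. fps_X ^ j * \<phi> (if j = 0 then c else 0))"
    by (subst sum.remove[of _ 0]) auto
  then show ?thesis using cj_sum[OF assms, of "%j. if j = 0 then c else 0"] by metis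
qed

text \<open>Multiplication by u shifts the p components cyclically; the last one comes back
  multiplied by u because u^p is the Frobenius image of u.\<close>

lemma cj_X_mult: assumes "k < p" shows "cj k (fps_X * z) = (if k = 0 then fps_X * cj (p - 1) z else cj (k - 1) z)"
proof -
  have "fps_nth (cj k (fps_X * z)) n = fps_nth (if k = 0 then fps_X * cj (p - 1) z else cj (k - 1) z) n" for n
  proof (cases "k = 0")
    case True
    have "p * Suc m - 1 = p * m + (p - 1)" for m
    proof -
      have "p * Suc m = p * m + p" by simp
      then show ?thesis using p_pos by linarith
    qed
    then show ?thesis using True by (cases n) (auto simp: cj_def)
  next
    case False
    then have "p * n + k = Suc (p * n + (k - 1))" by simp
    then have "fps_nth (fps_X * z) (p * n + k) = fps_nth z (p * n + (k - 1))" by (simp only: fps_X_mult_nth) simp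
    then show ?thesis using False by (simp add: cj_def)
  qed
  then show ?thesis by (rule fps_ext)
qed

end

text \<open>In the residue ring \<open>\<SS>/(E)\<close> every element that is not zero is a power of \<open>u\<close> times a unit; this is
  what makes \<open>E\<close> prime.\<close>

locale witt_eisenstein = witt p \<rho> \<sigma> for p :: nat and \<rho> :: "'w::comm_ring_1 => 'f::field" and \<sigma> +
  fixes E :: "'w poly"
  assumes eisenstein: "eisenstein p E"
begin

abbreviation E' :: "'w fps" where "E' \<equiv> fps_of_poly E"
abbreviation e :: nat where "e \<equiv> Polynomial.degree E"

lemma e_pos: "0 < e" using eisenstein by (simp add: eisenstein_def)

lemma E_mod_p: "\<exists>w. E' = fps_X ^ e + of_nat p * w"
proof -
  have "of_nat p ^ 1 dvd E' - fps_X ^ e"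
    unfolding p_dvd_fps
  proof
    fix i show "of_nat p ^ 1 dvd fps_nth (E' - fps_X ^ e) i"
      using eisenstein by (cases i e rule: linorder_cases) (auto simp: eisenstein_def fps_X_power_nth coeff_eq_0)
  qed
  then obtain w where "E' - fps_X ^ e = of_nat p * w" by (auto simp: dvd_def)
  then show ?thesis by (auto simp: algebra_simps)
qed

lemma E_0: "\<exists>v v'. fps_nth E' 0 = of_nat p * v \<and> v * v' = 1"
proof -
  obtain v where v: "Polynomial.coeff E 0 = of_nat p * v"
    using eisenstein unfolding eisenstein_def dvd_def by blast
  have "\<rho> v ~= 0"
  proof
    assume "\<rho> v = 0"
    then obtain z where "v = of_nat p * z" by (auto simp: rho_eq_0 dvd_def)
    then have "Polynomial.coeff E 0 = of_nat p ^ 2 * z" using v by (simp add: power2_eq_square mult.assoc)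
    then show False using eisenstein by (simp add: eisenstein_def)
  qed
  then obtain v' where "v * v' = 1" using witt_unit by blast
  then show ?thesis using v by auto
qed

lemma E_0_neq: "fps_nth E' 0 ~= 0"
proof
  assume z: "fps_nth E' 0 = 0"
  obtain v v' where "fps_nth E' 0 = of_nat p * v" "v * v' = 1" using E_0 by blast
  then have "v = 0" using p_power_cancel[of 1 v] z by simp
  then show False using \<open>v * v' = 1\<close> by simp
qed

lemma E_neq_0: "E' ~= 0" using E_0_neq by force

lemma E_power_neq_0: "E' ^ k ~= 0"
proof (induction k)
  case (Suc k)
  then show ?case using E_neq_0 fps_domain[of E' "E' ^ k"] by (metis power_Suc)
qed simp

lemma X_power_dvd_E_mult: assumes "fps_X ^ n dvd E' * b" shows "fps_X ^ n dvd b"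
proof (cases "b = 0")
  case False
  have "subdegree E' = 0" using E_0_neq by (simp add: subdegree_eq_0_iff)
  then have "fps_nth (E' * b) (subdegree b) = fps_nth E' 0 * fps_nth b (subdegree b)" by simp
  then have "fps_nth (E' * b) (subdegree b) ~= 0" using witt_domain E_0_neq False by fastforce
  then have "n \<le> subdegree b" using assms by (meson X_power_dvd_iff not_le_imp_less)
  then show ?thesis by (auto simp: X_power_dvd_iff nth_less_subdegree_zero)
qed simp

lemma E_not_unit: "\<not> E' dvd 1"
proof
  assume "E' dvd 1"
  then obtain h where h: "1 = E' * h" by (auto simp: dvd_def)
  then have "fps_nth E' 0 * fps_nth h 0 = 1" by (metis fps_mult_nth_0 fps_one_nth)
  then have "\<rho> (fps_nth E' 0) * \<rho> (fps_nth h 0) = 1" by (metis rho_hom(2,3))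
  moreover have "\<rho> (fps_nth E' 0) = 0" using E_0 by (auto simp: rho_eq_0)
  ultimately show False by simp
qed

lemma E_not_dvd_X_power: "\<not> E' dvd fps_X ^ m"
proof
  assume "E' dvd fps_X ^ m"
  then obtain h where h: "fps_X ^ m = E' * h" by (auto simp: dvd_def)
  then have "fps_X ^ m dvd h" using X_power_dvd_E_mult[of m h] by (metis dvd_refl)
  then obtain g where g: "h = fps_X ^ m * g" by (auto simp: dvd_def)
  then have "fps_X ^ m * (E' * g) = fps_X ^ m * 1" using h by (metis mult.left_commute mult.right_neutral)
  then have "E' * g = 1" using fps_cancel[OF X_power_neq_0] by blast
  then show False using E_not_unit by (metis dvd_triv_left)
qed

lemma E_residue:
  assumes "\<not> E' dvd x" shows "\<exists>k s a. x = a * E' + fps_X ^ k * s \<and> \<rho> (fps_nth s 0) ~= 0"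
proof (rule ccontr)
  assume no: "\<not> ?thesis"
  \<comment> \<open>If every remainder had residue 0, division could go on forever. The quotients
    \<open>a n\<close> would then converge u-adically, and x would be a multiple of
    \<open>E'\<close>.\<close>
  have "\<exists>a y. x = a * E' + fps_X ^ n * y" for n
  proof (induction n)
    case 0 show ?case by (rule exI[of _ 0]) simp
  next
    case (Suc n)
    then obtain a y where ay: "x = a * E' + fps_X ^ n * y" by blast
    then have "\<rho> (fps_nth y 0) = 0" using no by blast
    then obtain b where b: "fps_nth y 0 = of_nat p * b" by (auto simp: rho_eq_0 dvd_def)
    obtain v v' where v: "fps_nth E' 0 = of_nat p * v" "v * v' = 1" using E_0 by blast
    \<comment> \<open>The constant coefficient of \<open>E'\<close> is p times the unit
      \<open>v\<close>, so subtracting b v' times \<open>E'\<close> removes the constant coefficient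
      p b and leaves a multiple of u.\<close>
    have "fps_nth (y - fps_const (b * v') * E') 0 = of_nat p * b * (1 - v * v')"
      unfolding fps_sub_nth fps_mult_nth_0 b v(1) by (simp add: algebra_simps)
    also have "\<dots> = 0" using v(2) by simp
    finally have "fps_X ^ 1 dvd y - fps_const (b * v') * E'" unfolding X_power_dvd_iff by auto
    then obtain z where "y - fps_const (b * v') * E' = fps_X ^ 1 * z" unfolding dvd_def by blast
    then have "y = fps_const (b * v') * E' + fps_X * z" by (simp add: algebra_simps)
    then have "x = (a + fps_X ^ n * fps_const (b * v')) * E' + fps_X ^ Suc n * z" using ay by (simp add: algebra_simps)
    then show ?case by blast
  qed
  then obtain a y where ay: "!!n. x = a n * E' + fps_X ^ n * y n" by metis
  have agree: "fps_nth (a (Suc n)) i = fps_nth (a n) i" if "i < n" for i n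
  proof -
    have "a m * E' = x - fps_X ^ m * y m" for m using ay[of m] by (metis add_diff_cancel_right')
    then have "E' * (a (Suc n) - a n) = (x - fps_X ^ Suc n * y (Suc n)) - (x - fps_X ^ n * y n)"
      by (simp add: right_diff_distrib mult.commute[of E'])
    also have "\<dots> = fps_X ^ n * (y n - fps_X * y (Suc n))" by (simp add: algebra_simps)
    finally have "fps_X ^ n dvd E' * (a (Suc n) - a n)" by simp
    then have "fps_X ^ n dvd a (Suc n) - a n" by (rule X_power_dvd_E_mult)
    then show ?thesis using that by (simp add: X_power_dvd_iff)
  qed
  have agree': "fps_nth (a (j + k)) i = fps_nth (a j) i" if "i < j" for i j k
    using that by (induction k) (auto simp: agree)
  define c where "c = Abs_fps (%i. fps_nth (a (Suc i)) i)"
  have "fps_nth x i = fps_nth (c * E') i" for i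
  proof -
    have c: "fps_nth c j = fps_nth (a (Suc i)) j" if "j \<le> i" for j
      using agree'[of j "Suc j" "i - j"] that by (simp add: c_def)
    have "fps_nth x i = fps_nth (a (Suc i) * E' + fps_X ^ Suc i * y (Suc i)) i" using ay[of "Suc i"] by metis
    also have "\<dots> = fps_nth (a (Suc i) * E') i" by (simp only: fps_add_nth fps_X_power_mult_nth) simp
    also have "\<dots> = fps_nth (c * E') i" unfolding fps_mult_nth by (rule sum.cong) (auto simp: c)
    finally show ?thesis .
  qed
  then have "x = c * E'" by (rule fps_ext)
  then show False using assms by simp
qed

lemma E_prime: assumes "E' dvd x * y" shows "E' dvd x \<or> E' dvd y"
proof (rule ccontr)
  assume n: "\<not> (E' dvd x \<or> E' dvd y)"
  obtain k s a where x: "x = a * E' + fps_X ^ k * s" "\<rho> (fps_nth s 0) ~= 0" using E_residue n by blast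
  obtain l t b where y: "y = b * E' + fps_X ^ l * t" "\<rho> (fps_nth t 0) ~= 0" using E_residue n by blast
  have "\<rho> (fps_nth (s * t) 0) ~= 0" using x y by (simp add: rho_hom)
  then obtain g where g: "s * t * g = 1" using fps_unit by blast
  have "x * y = (a * y + fps_X ^ k * s * b) * E' + fps_X ^ (k + l) * (s * t)"
    using x(1) y(1) by (simp add: algebra_simps power_add)
  then have "E' dvd fps_X ^ (k + l) * (s * t)" using assms by (metis dvd_add_right_iff dvd_triv_right)
  then have "E' dvd fps_X ^ (k + l) * (s * t) * g" by (rule dvd_mult2)
  then have "E' dvd fps_X ^ (k + l)" using g by (simp add: mult.assoc)
  then show False using E_not_dvd_X_power by blast
qed

text \<open>\<open>E'\<close> lies in the ideal (p, u), so its k-th power is a combination of the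
  products p^(k-i) u^i, and only those with i \<le> n reach coefficient n. The subtraction is
  truncated. With \<open>p_separated\<close> it follows that no nonzero series is divisible by all
  powers of \<open>E'\<close>.\<close>

lemma E_power_nth: "of_nat p ^ (k - n) dvd fps_nth (E' ^ k * y) n"
proof (induction k arbitrary: n y)
  case (Suc k)
  obtain w where w: "E' = fps_X ^ e + of_nat p * w" using E_mod_p by blast
  obtain d where d: "e = Suc d" using e_pos by (cases e) auto
  have "E' ^ Suc k * y = fps_X * (E' ^ k * (fps_X ^ d * y)) + fps_const (of_nat p) * (E' ^ k * (w * y))"
    by (subst power_Suc, subst (1) w) (simp add: d algebra_simps fps_of_nat)
  moreover have "of_nat p ^ (Suc k - n) dvd fps_nth (fps_X * (E' ^ k * (fps_X ^ d * y))) n"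
  proof (cases n)
    case (Suc m)
    then show ?thesis using Suc.IH[of m "fps_X ^ d * y"] by simp
  qed simp
  moreover have "of_nat p ^ (Suc k - n) dvd fps_nth (fps_const (of_nat p) * (E' ^ k * (w * y))) n"
  proof (cases "n \<le> k")
    case True
    then show ?thesis using Suc.IH[of n "w * y"] by (simp add: Suc_diff_le mult_dvd_mono)
  qed simp
  ultimately show ?case by simp
qed simp

lemma E_power_decomp: assumes "x ~= 0" shows "\<exists>k s. x = E' ^ k * s \<and> \<not> E' dvd s"
proof -
  have "\<exists>k. \<not> E' ^ k dvd x"
  proof (rule ccontr)
    assume "\<not> ?thesis"
    then have all: "E' ^ k dvd x" for k by blast
    have "fps_nth x n = 0" for n
    proof (rule p_separated)
      fix m
      obtain y where "x = E' ^ (m + n) * y" using all[of "m + n"] by (auto simp: dvd_def)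
      then show "of_nat p ^ m dvd fps_nth x n" using E_power_nth[of "m + n" n y] by simp
    qed
    then show False using assms by (simp add: fps_eq_iff)
  qed
  then obtain n where n: "\<not> E' ^ n dvd x" by blast
  define m where "m = (LEAST n. \<not> E' ^ n dvd x)"
  have m: "\<not> E' ^ m dvd x" unfolding m_def using n by (rule LeastI)
  then obtain k where k: "m = Suc k" by (cases m) auto
  then have "E' ^ k dvd x" using not_less_Least[of k] m_def by (metis lessI)
  then obtain y where y: "x = E' ^ k * y" by (auto simp: dvd_def)
  have "\<not> E' dvd y"
  proof
    assume "E' dvd y"
    then obtain z where "y = E' * z" by (auto simp: dvd_def)
    then have "x = E' ^ m * z" using y k by (simp add: mult_ac)
    then show False using m by simp
  qed
  then show ?thesis using y by blast
qed

end

section \<open>The Frobenius pullback of a submodule\<close>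

definition VV :: "nat => 'a::comm_ring_1 fvec set" where
  "VV r = {x. \<forall>i\<ge>r. cf x i = 0}"

lemma submod_VV [simp]: "submod (VV r)"
  by (auto simp: submod_def VV_def)

lemma smul_image_subset: "submod X ==> smul c ` X <= X"
  by (auto simp: submod_smul)

lemma submod_smul_image [simp]: "submod X ==> submod (smul c ` X)"
  by (simp add: submod_image)

lemma lin_image_smul: "lin f ==> f ` (smul c ` X) = smul c ` (f ` X)"
  by (simp add: image_image linD)

lemma smul_funpow: "(smul c ^^ k) = smul (c ^ k)"
  by (induction k) (auto simp: fun_eq_iff smul_simps)

text \<open>Additivity of cokernel lengths for an operator G along A \<le> B \<le> C. The hypothesis
  \<open>GC \<inter> B = GB\<close> says that an image lying in \<open>B\<close> comes from
  \<open>B\<close>. The images are given as sets so that the lemma covers both multiplication by u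
  and the structure map composed with the Frobenius pullback.\<close>

lemma len_op_add:
  assumes "submod A" "submod B" "submod C" "submod GB" "submod GC" "A <= B" "B <= C" "GC <= C" "GC \<inter> B = GB"
  shows "len (A + GC) C = len (A + GB) B + len (B + GC) C"
proof -
  have "B \<inter> (A + GC) = A + (GC \<inter> B)" using plus_modular[of B A GC] assms by (simp add: Int_commute)
  then have e1: "B \<inter> (A + GC) = A + GB" using assms by simp
  have "B + (A + GC) = (A + B) + GC" by (simp add: add_ac)
  then have e2: "B + (A + GC) = B + GC" using plus_absorb[of B A] assms by simp
  have "len (A + GB) B = len (A + GC) (B + GC)"
    using len_second_iso[of B "A + GC"] assms by (simp add: submod_plus e1 e2)
  moreover have "len (A + GC) C = len (A + GC) (B + GC) + len (B + GC) C"
    by (rule len_add) (use assms in \<open>simp_all add: submod_plus set_plus_mono2 plus_least\<close>)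
  ultimately show ?thesis by simp
qed

text \<open>By the second isomorphism theorem the cokernel of an operator on A/(A \<inter> B) is
  that on (A + B)/B. As above, the images are given as sets.\<close>

lemma len_op_iso:
  assumes "submod A" "submod B" "submod GA" "submod GB" "GA <= A" "GB <= B"
  shows "len ((A \<inter> B) + GA) A = len (B + (GA + GB)) (A + B)"
proof -
  have "B + (GA + GB) = (GB + B) + GA" by (simp add: add_ac)
  then have e: "B + (GA + GB) = B + GA" using plus_absorb[of B GB] assms by (simp add: add.commute)
  have "A \<inter> (B + GA) = GA + (B \<inter> A)" using plus_modular[of A GA B] assms by (simp add: Int_commute add.commute)
  then have e2: "A \<inter> (B + GA) = (A \<inter> B) + GA" by (simp add: Int_commute add.commute)
  have "A + (B + GA) = (GA + A) + B" by (simp add: add_ac)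
  then have e3: "A + (B + GA) = A + B" using plus_absorb[of A GA] assms by simp
  show ?thesis using len_second_iso[of A "B + GA"] assms by (simp add: submod_plus e e2 e3)
qed

context witt
begin

abbreviation (input) u :: "'w fps" where "u \<equiv> fps_X"

definition co :: "nat => 'w fps fvec => 'w fps fvec" where "co j x = fv (%i. cj j (cf x i))"
definition Fr :: "'w fps fvec => 'w fps fvec" where "Fr x = fv (%i. \<phi> (cf x i))"

lemma cf_co [simp]: "cf (co j x) i = cj j (cf x i)" by (simp add: co_def)
lemma cf_Fr [simp]: "cf (Fr x) i = \<phi> (cf x i)" by (simp add: Fr_def)

lemma Fr_add: "Fr (x + y) = Fr x + Fr y" and Fr_0 [simp]: "Fr 0 = 0" and Fr_smul: "Fr (c *: x) = \<phi> c *: Fr x"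
  by (auto intro!: fvec_eqI simp: phi_add phi_mult)

lemma co_add: "co j (x + y) = co j x + co j y" and co_0 [simp]: "co j 0 = 0"
  by (auto intro!: fvec_eqI simp: cj_add)

lemma co_phi_smul: "k < p ==> co k (\<phi> c *: x) = c *: co k x"
  by (auto intro!: fvec_eqI simp: cj_phi_mult)

lemma co_X_smul: "k < p ==> co k (u *: x) = (if k = 0 then u *: co (p - 1) x else co (k - 1) x)"
  by (auto intro!: fvec_eqI simp: cj_X_mult)

lemma co_p_smul: "k < p ==> co k (of_nat p ^ n *: x) = of_nat p ^ n *: co k x"
  using co_phi_smul[of k "of_nat p ^ n"] by simp

lemma co_decomp: "(\<Sum>j<p. u ^ j *: Fr (co j z)) = z"
  by (auto intro!: fvec_eqI simp: cj_decomp)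

lemma co_sum: "k < p ==> co k (\<Sum>j<p. u ^ j *: Fr (w j)) = w k"
  by (auto intro!: fvec_eqI simp: cj_sum)

lemma co_Fr: "k < p ==> co k (Fr x) = (if k = 0 then x else 0)"
  by (auto intro!: fvec_eqI simp: cj_phi)

text \<open>The submodule \<open>\<phi>\<^sup>*X\<close> of \<open>\<phi>\<^sup>*V = V\<close>.\<close>

definition Ph :: "'w fps fvec set => 'w fps fvec set" where "Ph X = {z. \<forall>j<p. co j z \<in> X}"

text \<open>By \<open>cj_decomp\<close> a scalar is a sum of u^j times Frobenius images, so closure
  under u and under the scalars \<open>\<phi> c\<close> suffices; the former holds because u shifts
  the components cyclically.\<close>

lemma submod_Ph [simp]: assumes X: "submod X" shows "submod (Ph X)"
proof -
  have 1: "\<phi> c *: z \<in> Ph X" if "z \<in> Ph X" for c z using that X by (auto simp: Ph_def co_phi_smul submod_smul)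
  have 2: "u *: z \<in> Ph X" if "z \<in> Ph X" for z using that X by (auto simp: Ph_def co_X_smul submod_smul)
  have 3: "u ^ j *: z \<in> Ph X" if "z \<in> Ph X" for j z
    using that by (induction j) (auto simp: smul_simps(6) smul_simps(5)[symmetric] 2)
  have 4: "z + w \<in> Ph X" if "z \<in> Ph X" "w \<in> Ph X" for z w using that X by (auto simp: Ph_def co_add submod_add)
  have 0: "0 \<in> Ph X" using X by (simp add: Ph_def submod_0)
  have 5: "(\<Sum>j\<in>J. f j) \<in> Ph X" if "!!j. f j \<in> Ph X" for f and J :: "nat set"
    by (induction J rule: infinite_finite_induct) (auto simp: 0 4 that)
  have "c *: z \<in> Ph X" if z: "z \<in> Ph X" for c z
  proof -
    have "c *: z = (\<Sum>j<p. u ^ j * \<phi> (cj j c)) *: z" by (simp add: cj_decomp)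
    also have "\<dots> = (\<Sum>j<p. u ^ j *: (\<phi> (cj j c) *: z))"
      by (rule fvec_eqI) (simp add: sum_distrib_right mult.assoc)
    also have "\<dots> \<in> Ph X" by (intro 5 3 1 z)
    finally show ?thesis .
  qed
  then show ?thesis using 0 4 by (auto intro: submodI)
qed

lemma Ph_mono: "X <= Y ==> Ph X <= Ph Y"
  by (auto simp: Ph_def)

lemma Fr_in_Ph: "submod X ==> Fr x \<in> Ph X \<longleftrightarrow> x \<in> X"
  using p_pos by (auto simp: Ph_def co_Fr submod_0)

lemma Ph_sum_mem: "(!!j. j < p ==> w j \<in> X) ==> (\<Sum>j<p. u ^ j *: Fr (w j)) \<in> Ph X"
  by (simp add: Ph_def co_sum)

lemma Ph_plus: assumes X: "submod X" and Y: "submod Y" shows "Ph (X + Y) = Ph X + Ph Y"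
proof
  show "Ph X + Ph Y <= Ph (X + Y)"
    using X Y by (intro plus_least Ph_mono submod_Ph submod_plus le_plus1 le_plus2)
  show "Ph (X + Y) <= Ph X + Ph Y"
  proof
    fix z assume "z \<in> Ph (X + Y)"
    then have "\<forall>j. \<exists>x y. j < p --> x \<in> X \<and> y \<in> Y \<and> co j z = x + y" by (simp add: Ph_def set_plus_def) blast
    then obtain x y where xy: "!!j. j < p ==> x j \<in> X \<and> y j \<in> Y \<and> co j z = x j + y j" by metis
    have "z = (\<Sum>j<p. u ^ j *: Fr (x j)) + (\<Sum>j<p. u ^ j *: Fr (y j))"
      by (subst co_decomp[symmetric]) (simp add: xy Fr_add smul_simps sum.distrib)
    then show "z \<in> Ph X + Ph Y" using xy by (auto intro!: set_plus_intro Ph_sum_mem)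
  qed
qed

text \<open>Faithful flatness in coordinates: \<open>Fr x\<close> lies in the pullback of
  \<open>X\<close> only if x lies in \<open>X\<close>. Consequently the pullback never shortens an
  interval, which is what makes the degree submodular.\<close>

lemma Ph_strict: assumes "submod X" "submod Y" "X \<subset> Y" shows "Ph X \<subset> Ph Y"
  using assms Ph_mono[of X Y] Fr_in_Ph by blast

lemma Ph_VV [simp]: "Ph (VV r) = VV r"
proof
  show "VV r <= Ph (VV r)" by (auto simp: Ph_def VV_def)
  show "Ph (VV r) <= VV r"
  proof
    fix z assume z: "z \<in> Ph (VV r)"
    have "Fr x \<in> VV r" if "x \<in> VV r" for x using that by (simp add: VV_def)
    then have "(\<Sum>j<p. u ^ j *: Fr (co j z)) \<in> VV r"
      using z by (intro submod_sum submod_VV submod_smul) (auto simp: Ph_def)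
    then show "z \<in> VV r" by (simp add: co_decomp)
  qed
qed

lemma Ph_p_smul: "Ph (smul (of_nat p ^ n) ` X) = smul (of_nat p ^ n) ` Ph X"
proof
  show "smul (of_nat p ^ n) ` Ph X <= Ph (smul (of_nat p ^ n) ` X)" by (auto simp: Ph_def co_p_smul)
  show "Ph (smul (of_nat p ^ n) ` X) <= smul (of_nat p ^ n) ` Ph X"
  proof
    fix z assume "z \<in> Ph (smul (of_nat p ^ n) ` X)"
    then have "\<forall>j. \<exists>x. j < p --> x \<in> X \<and> co j z = of_nat p ^ n *: x" by (auto simp: Ph_def)
    then obtain x where x: "!!j. j < p ==> x j \<in> X \<and> co j z = of_nat p ^ n *: x j" by metis
    have "z = of_nat p ^ n *: (\<Sum>j<p. u ^ j *: Fr (x j))"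
      by (subst co_decomp[symmetric]) (simp add: x Fr_smul smul_sum smul_simps mult.commute)
    then show "z \<in> smul (of_nat p ^ n) ` Ph X" using x by (auto intro!: Ph_sum_mem)
  qed
qed

section \<open>Ranks\<close>

definition pV :: "nat => nat => 'w fps fvec set" where "pV n r = smul (of_nat p ^ n) ` VV r"

lemma submod_pV [simp]: "submod (pV n r)" by (simp add: pV_def)

lemma pV_iff: "x \<in> pV n r \<longleftrightarrow> x \<in> VV r \<and> (\<forall>i. of_nat p ^ n dvd cf x i)"
proof
  assume x: "x \<in> VV r \<and> (\<forall>i. of_nat p ^ n dvd cf x i)"
  then obtain g where g: "!!i. cf x i = of_nat p ^ n * g i" unfolding dvd_def by metis
  have "x = of_nat p ^ n *: fv g" by (rule fvec_eqI) (simp add: g)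
  moreover have "fv g \<in> VV r"
    using x g fps_cancel[OF p_power_neq_0, of n _ 0] by (auto simp: VV_def)
  ultimately show "x \<in> pV n r" by (auto simp: pV_def)
qed (auto simp: pV_def VV_def)

lemma pV_subset: "pV n r <= VV r" by (auto simp: pV_iff)

lemma pV_mono: "k \<le> l ==> pV l r <= pV k r"
  using dvd_trans[OF le_imp_power_dvd[of k l "of_nat p :: 'w fps"]] by (auto simp: pV_iff)

lemma Ph_pV [simp]: "Ph (pV n r) = pV n r" by (simp add: pV_def Ph_p_smul)

definition usat :: "nat => 'w fps fvec set => bool" where
  "usat r X \<longleftrightarrow> (\<forall>x\<in>VV r. u *: x \<in> X --> x \<in> X)"

lemma usat_pow: "usat r X ==> x \<in> VV r ==> u ^ k *: x \<in> X ==> x \<in> X"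
proof (induction k)
  case (Suc k)
  then have "u *: (u ^ k *: x) \<in> X" by (simp add: smul_simps)
  moreover have "u ^ k *: x \<in> VV r" using Suc.prems by (simp add: submod_smul)
  ultimately show ?case using Suc by (simp add: usat_def)
qed (simp add: smul_simps)

lemma usat_pV [simp]: "usat r (pV n r)"
  unfolding usat_def
proof (intro ballI impI)
  fix x :: "'w fps fvec" assume x: "x \<in> VV r" "u *: x \<in> pV n r"
  have "of_nat p ^ n dvd cf x i" for i
    using x(2) p_dvd_X_mult[of n 1 "cf x i"] by (simp add: pV_iff)
  then show "x \<in> pV n r" using x(1) by (simp add: pV_iff)
qed

lemma usat_Ph: assumes "usat r X" "X <= VV r" shows "usat r (Ph X)"
  unfolding usat_def
proof (intro ballI impI)
  fix z assume z: "z \<in> VV r" "u *: z \<in> Ph X"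
  have zV: "co j z \<in> VV r" for j using z(1) by (auto simp: VV_def)
  have *: "co k (u *: z) \<in> X" if "k < p" for k using z(2) that by (simp add: Ph_def)
  have "co j z \<in> X" if j: "j < p" for j
  proof (cases "j = p - 1")
    case True
    have "u *: co (p - 1) z \<in> X" using *[of 0] by (simp add: co_X_smul)
    then show ?thesis using assms(1) zV True by (auto simp: usat_def)
  next
    case False
    then show ?thesis using *[of "Suc j"] j by (simp add: co_X_smul)
  qed
  then show "z \<in> Ph X" by (simp add: Ph_def)
qed

text \<open>For M = B/A this is the length of M/uM. It is taken over \<SS>;
  \<open>residue_length\<close> identifies it with the length over W(F) that defines the
  rank.\<close>

definition rkl :: "'w fps fvec set => 'w fps fvec set => enat" where
  "rkl A B = len (A + smul u ` B) B"

lemma rkl_add: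
  assumes "submod A" "submod B" "submod C" "A <= B" "B <= C" "usat r B" "C <= VV r"
  shows "rkl A C = rkl A B + rkl B C"
  unfolding rkl_def
proof (rule len_op_add)
  show "smul u ` C \<inter> B = smul u ` B"
  proof
    show "smul u ` C \<inter> B <= smul u ` B" using assms(6,7) unfolding usat_def by blast
    show "smul u ` B <= smul u ` C \<inter> B" using assms(2,5) smul_image_subset[of B u] by blast
  qed
qed (use assms in \<open>simp_all add: smul_image_subset\<close>)

lemma len_smul_u:
  assumes "submod A" "submod B" "submod Y" "A <= Y" "Y <= B" "B <= VV r" "usat r A"
  shows "len (A + smul (u ^ k) ` Y) B = len Y B + enat k * rkl A B"
proof -
  have "len (A + (smul u ^^ k) ` Y) B = len Y B + enat k * len (A + smul u ` B) B"
  proof (rule len_shift_funpow)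
    show "y \<in> A" if "y \<in> B" "u *: y \<in> A" for y using that assms(6,7) by (auto simp: usat_def)
  qed (use assms in \<open>simp_all add: smul_image_subset\<close>)
  then show ?thesis unfolding smul_funpow rkl_def .
qed

text \<open>Multiplication by u is injective modulo \<open>A\<close>, so going from \<open>I\<close>
  to \<open>J\<close> enlarges the module and its multiple by u by the same finite length, and the
  cokernel keeps its length.\<close>

lemma rkl_saturate:
  assumes A: "submod A" and I: "submod I" and J: "submod J" and AI: "A <= I" and IJ: "I <= J" and JV: "J <= VV r"
    and sat: "usat r A" and fin: "len I J ~= \<infinity>"
  shows "rkl A I = rkl A J"
proof -
  have e: "len (A + smul u ` I) (A + smul u ` J) = len I J"
    by (rule len_transport) (use assms in \<open>auto simp: usat_def\<close>)
  have "A + smul u ` I <= I" "A + smul u ` J <= J"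
    using assms by (simp_all add: plus_least smul_image_subset)
  then have "len (A + smul u ` J) J = len (A + smul u ` I) I"
    by (intro len_compare(2)[OF _ _ I J _ IJ _ _ fin _ e[symmetric]])
      (use A I J IJ e in \<open>simp_all add: submod_plus set_plus_mono2 image_mono\<close>)
  then show ?thesis by (simp add: rkl_def)
qed

text \<open>A flag from the submodule (p, u)V at k = 0 up to V = \<SS>^r at k = r, whose steps are
  lines over the residue field F.\<close>

definition Wk :: "nat => nat => 'w fps fvec set" where
  "Wk r k = {x \<in> VV r. \<forall>i\<ge>k. \<rho> (fps_nth (cf x i) 0) = 0}"

lemma submod_Wk: "submod (Wk r k)"
  by (auto simp: submod_def Wk_def VV_def rho_hom)

lemma Wk_0: "Wk r 0 = smul u ` VV r + pV 1 r"
proof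
  show "smul u ` VV r + pV 1 r <= Wk r 0"
    by (rule plus_least[OF submod_Wk]) (auto simp: Wk_def VV_def pV_def rho_hom rho_eq_0[of "of_nat p"] fps_of_nat[symmetric])
  show "Wk r 0 <= smul u ` VV r + pV 1 r"
  proof
    fix x assume x: "x \<in> Wk r 0"
    then have "\<forall>i. \<exists>c. fps_nth (cf x i) 0 = of_nat p * c" by (auto simp: Wk_def rho_eq_0 dvd_def)
    then obtain c where c: "!!i. fps_nth (cf x i) 0 = of_nat p * c i" by metis
    have c0: "c i = 0" if "i \<ge> r" for i using c[of i] x that p_power_cancel[of 1 "c i"] by (auto simp: Wk_def VV_def)
    define y where "y = fv (%i. fps_shift 1 (cf x i))"
    define z where "z = fv (%i. fps_const (c i))"
    have "x = u *: y + of_nat p *: z"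
    proof (rule fvec_eqI, rule fps_ext)
      fix i m show "fps_nth (cf x i) m = fps_nth (cf (u *: y + of_nat p *: z) i) m"
        by (cases m) (auto simp: y_def z_def c fps_of_nat[symmetric])
    qed
    moreover have "y \<in> VV r" "z \<in> VV r" using x c0 by (auto simp: y_def z_def VV_def Wk_def)
    ultimately show "x \<in> smul u ` VV r + pV 1 r" by (auto simp: pV_def intro!: set_plus_intro)
  qed
qed

lemma len_Wk_Suc: assumes "k < r" shows "len (Wk r k) (Wk r (Suc k)) = 1"
proof (rule clen_simple)
  show "submod (Wk r k)" "submod (Wk r (Suc k))" by (rule submod_Wk)+
next
  let ?e = "fv (%i. if i = k then 1 else 0) :: 'w fps fvec"
  have "?e \<in> Wk r (Suc k)" "?e \<notin> Wk r k" using assms by (auto simp: Wk_def VV_def rho_hom)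
  moreover have "Wk r k <= Wk r (Suc k)" by (auto simp: Wk_def)
  ultimately show "Wk r k \<subset> Wk r (Suc k)" by blast
next
  fix C assume C: "submod C" "Wk r k <= C" "C <= Wk r (Suc k)"
  show "C = Wk r k \<or> C = Wk r (Suc k)"
  proof (rule disjCI)
    assume "C ~= Wk r (Suc k)"
    then obtain d where d: "d \<in> Wk r (Suc k)" "d \<notin> C" using C by blast
    have "c \<in> Wk r k" if c: "c \<in> C" for c
    proof (rule ccontr)
      assume nc: "c \<notin> Wk r k"
      have cW: "c \<in> Wk r (Suc k)" using c C by blast
      have "\<rho> (fps_nth (cf c k) 0) ~= 0"
      proof
        assume "\<rho> (fps_nth (cf c k) 0) = 0"
        then have "c \<in> Wk r k" using cW by (auto simp: Wk_def le_Suc_eq not_less_eq_eq) (metis le_antisym not_less_eq_eq)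
        then show False using nc by simp
      qed
      \<comment> \<open>A coordinate with nonzero residue is a unit of \<SS>, so a multiple of
        \<open>c\<close> clears coordinate \<open>k\<close> of \<open>d\<close>.\<close>
      then obtain g where g: "cf c k * g = 1" using fps_unit by blast
      define w where "w = d - (cf d k * g) *: c"
      have "cf d k * g * cf c k = cf d k * (cf c k * g)" by (simp add: mult_ac)
      then have wk: "cf w k = 0" by (simp add: w_def g)
      have "w \<in> Wk r (Suc k)" unfolding w_def using d cW submod_Wk by (intro submod_diff submod_smul)
      then have "w \<in> Wk r k" using wk by (auto simp: Wk_def) (metis fps_zero_nth le_antisym not_less_eq_eq rho_0)
      then have "w \<in> C" using C by blast
      then have "w + (cf d k * g) *: c \<in> C" using C(1) c by (intro submod_add submod_smul)
      then show False using d by (simp add: w_def)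
    qed
    then show "C = Wk r k" using C by blast
  qed
qed

lemma len_Wk: "k \<le> r ==> len (Wk r 0) (Wk r k) = enat k"
proof (induction k)
  case (Suc k)
  have "len (Wk r 0) (Wk r (Suc k)) = len (Wk r 0) (Wk r k) + len (Wk r k) (Wk r (Suc k))"
    by (rule len_add[OF submod_Wk submod_Wk submod_Wk]) (auto simp: Wk_def)
  then show ?case using Suc by (simp add: len_Wk_Suc one_enat_def)
qed (simp add: zero_enat_def)

lemma Wk_r: "Wk r r = VV r"
  by (auto simp: Wk_def VV_def)

lemma rkl_top: "rkl (pV n r) (VV r) = enat (n * r)"
proof -
  have *: "len (smul u ` VV r + pV n r) (VV r) = enat (n * r)"
  proof (induction n)
    case 0
    have "pV 0 r = VV r" by (auto simp: pV_def smul_simps)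
    then show ?case using plus_absorb[of "VV r" "smul u ` VV r"] by (simp add: smul_image_subset zero_enat_def)
  next
    case (Suc n)
    let ?A = "smul u ` VV r :: 'w fps fvec set"
    \<comment> \<open>Multiplication by p^n identifies V/(uV + pV) with the layer between uV +
      p^(n+1) V and uV + p^n V; it is injective because p^n divides a vector as soon as it divides u
      times that vector.\<close>
    have "len (?A + smul (of_nat p ^ n) ` (?A + pV 1 r)) (?A + smul (of_nat p ^ n) ` VV r) = len (?A + pV 1 r) (VV r)"
    proof (rule len_transport)
      fix y :: "'w fps fvec" assume y: "y \<in> VV r" "of_nat p ^ n *: y \<in> ?A"
      then obtain x where x: "x \<in> VV r" "of_nat p ^ n *: y = u *: x" by blast
      have "of_nat p ^ n dvd cf x i" for i
      proof (rule p_dvd_X_mult[of n 1])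
        have "u ^ 1 * cf x i = of_nat p ^ n * cf y i" using x(2) by (simp add: fvec_eq_iff)
        then show "of_nat p ^ n dvd u ^ 1 * cf x i" by simp
      qed
      then have "x \<in> pV n r" using x(1) by (simp add: pV_iff)
      then obtain x' where x': "x' \<in> VV r" "x = of_nat p ^ n *: x'" by (auto simp: pV_def)
      have "cf y i = u * cf x' i" for i
      proof -
        have "of_nat p ^ n * cf y i = of_nat p ^ n * (u * cf x' i)"
          using x(2) x'(2) by (simp add: fvec_eq_iff mult_ac)
        then show ?thesis using fps_cancel[OF p_power_neq_0] by blast
      qed
      then have "y = u *: x'" by (intro fvec_eqI) simp
      then show "y \<in> ?A + pV 1 r" using x' le_plus1[of "pV 1 r" ?A] by auto
    qed (simp_all add: submod_plus plus_least smul_image_subset pV_subset)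
    moreover have "?A + smul (of_nat p ^ n) ` (?A + pV 1 r) = ?A + pV (Suc n) r"
    proof -
      have "smul (of_nat p ^ n) ` (?A + pV 1 r) = smul (of_nat p ^ n) ` ?A + pV (Suc n) r"
        by (simp add: image_plus pV_def image_image smul_simps mult.commute)
      then have "?A + smul (of_nat p ^ n) ` (?A + pV 1 r) = (smul (of_nat p ^ n) ` ?A + ?A) + pV (Suc n) r"
        by (simp add: add_ac)
      then show ?thesis by (simp add: plus_absorb smul_image_subset)
    qed
    moreover have "len (?A + pV 1 r) (VV r) = enat r"
      using len_Wk[of r r] by (simp add: Wk_0 Wk_r)
    moreover have "len (?A + pV (Suc n) r) (VV r) = len (?A + pV (Suc n) r) (?A + pV n r) + len (?A + pV n r) (VV r)"
    proof (rule len_add)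
      have "pV (Suc n) r <= pV n r" by (rule pV_mono) simp
      then show "?A + pV (Suc n) r <= ?A + pV n r" by (simp add: set_plus_mono2)
      show "?A + pV n r <= VV r" by (simp add: plus_least smul_image_subset pV_subset)
    qed (simp_all add: submod_plus)
    ultimately show ?case using Suc.IH by (simp add: pV_def)
  qed
  then show ?thesis by (simp add: rkl_def add.commute)
qed

lemma rkl_finite:
  assumes "submod H" "pV n r <= H" "H <= VV r" "usat r H"
  shows "rkl (pV n r) H ~= \<infinity>"
proof
  assume i: "rkl (pV n r) H = \<infinity>"
  have "rkl (pV n r) (VV r) = rkl (pV n r) H + rkl H (VV r)"
    by (rule rkl_add[where r = r]) (use assms in auto)
  then show False by (simp add: rkl_top i)
qed

section \<open>Finite generation and Nakayama's lemma\<close>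

definition lspan :: "nat => (nat => 'w fps fvec) => 'w fps fvec set" where
  "lspan m g = range (%c. \<Sum>i<m. c i *: g i)"

lemma submod_lspan: "submod (lspan m g)"
proof (rule submodI)
  have "(\<Sum>i<m. 0 *: g i) = 0" by (simp add: smul_simps)
  then show "0 \<in> lspan m g" 
    unfolding lspan_def by (intro image_eqI[of _ _ "%_. 0"]) simp_all
next
  fix x y assume "x \<in> lspan m g" "y \<in> lspan m g"
  then obtain c d where "x = (\<Sum>i<m. c i *: g i)" "y = (\<Sum>i<m. d i *: g i)" by (auto simp: lspan_def)
  then have "x + y = (\<Sum>i<m. (c i + d i) *: g i)" by (simp add: smul_simps sum.distrib)
  then show "x + y \<in> lspan m g" by (auto simp: lspan_def)
next
  fix a x assume "x \<in> lspan m g"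
  then obtain c where "x = (\<Sum>i<m. c i *: g i)" by (auto simp: lspan_def)
  then have "a *: x = (\<Sum>i<m. (a * c i) *: g i)" by (simp add: smul_sum smul_simps)
  then show "a *: x \<in> lspan m g" by (auto simp: lspan_def)
qed

lemma lspan_least: "submod X ==> (!!i. i < m ==> g i \<in> X) ==> lspan m g <= X"
  by (auto simp: lspan_def intro!: submod_sum submod_smul)

lemma lspan_Suc: "lspan m g + range (%c. c *: x) <= lspan (Suc m) (g(m := x))"
proof
  fix y assume "y \<in> lspan m g + range (%c. c *: x)"
  then obtain c d where y: "y = (\<Sum>i<m. c i *: g i) + d *: x" by (auto simp: lspan_def set_plus_def)
  have "y = (\<Sum>i<Suc m. (c(m := d)) i *: (g(m := x)) i)" by (simp add: y)
  then show "y \<in> lspan (Suc m) (g(m := x))" unfolding lspan_def by blast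
qed

text \<open>Finite length does the work of a Noetherian hypothesis: adding an element of
  \<open>X\<close> outside \<open>Y\<close> strictly shortens the interval up to
  \<open>X\<close>.\<close>

lemma generators_of_finite_length:
  assumes X: "submod X"
  shows "submod Y ==> Y <= X ==> len Y X = enat k ==> \<exists>m g. (\<forall>i<m. g i \<in> X) \<and> X <= lspan m g + Y"
proof (induction k arbitrary: Y rule: less_induct)
  case (less k)
  show ?case
  proof (cases "Y = X")
    case True
    then show ?thesis using le_plus2[OF submod_lspan] by (intro exI[of _ 0]) auto
  next
    case False
    then obtain x where x: "x \<in> X" "x \<notin> Y" using less.prems by auto
    let ?R = "range (%c. c *: x)"
    have R: "submod ?R"
    proof (rule submodI)
      show "0 \<in> ?R" by (rule image_eqI[of _ _ 0]) (simp_all add: smul_simps)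
    next
      fix y z assume "y \<in> ?R" "z \<in> ?R"
      then obtain b c where "y = b *: x" "z = c *: x" by blast
      then have "y + z = (b + c) *: x" by (simp add: smul_simps)
      then show "y + z \<in> ?R" by blast
    next
      fix c y assume "y \<in> ?R"
      then obtain b where "y = b *: x" by blast
      then have "c *: y = (c * b) *: x" by (simp add: smul_simps)
      then show "c *: y \<in> ?R" by blast
    qed
    have RX: "?R <= X" using x X by (auto simp: submod_smul)
    have s: "submod (Y + ?R)" using less.prems R by (simp add: submod_plus)
    have YX: "Y + ?R <= X" using less.prems X RX by (simp add: plus_least)
    have YY: "Y <= Y + ?R" using R by (rule le_plus1)
    have "x \<in> ?R" by (rule image_eqI[of _ _ 1]) (simp_all add: smul_simps)
    then have "x \<in> Y + ?R" using le_plus2[of Y ?R] less.prems by blast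
    then have ne: "len Y (Y + ?R) ~= 0" using clen_eq_0[of submod Y "Y + ?R"] s YY less.prems x by auto
    have "len Y X = len Y (Y + ?R) + len (Y + ?R) X" by (rule len_add) (use less.prems X s YX YY in auto)
    then obtain j where j: "len (Y + ?R) X = enat j" "j < k"
      using ne less.prems by (cases "len Y (Y + ?R)"; cases "len (Y + ?R) X") (auto simp: zero_enat_def)
    obtain m g where g: "\<forall>i<m. g i \<in> X" "X <= lspan m g + (Y + ?R)" using less.IH[OF j(2) s YX j(1)] by blast
    have "lspan m g + (Y + ?R) = (lspan m g + ?R) + Y" by (simp add: add_ac)
    also have "\<dots> <= lspan (Suc m) (g(m := x)) + Y" by (intro set_plus_mono2 lspan_Suc) simp
    finally have "X <= lspan (Suc m) (g(m := x)) + Y" using g by blast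
    moreover have "\<forall>i<Suc m. (g(m := x)) i \<in> X" using g x by (auto simp: less_Suc_eq)
    ultimately show ?thesis by blast
  qed
qed

text \<open>Nakayama's lemma for the ideal \<open>(u)\<close>; the coefficients are limits of \<open>u\<close>-adic approximations.\<close>

lemma nakayama:
  assumes Y: "submod Y" and YV: "Y <= VV r" and gen: "Y <= lspan m g + (pV n r + smul u ` Y)"
  shows "Y <= lspan m g + pV n r"
proof
  fix x assume x: "x \<in> Y"
  have step: "\<exists>c a x'. y = (\<Sum>i<m. c i *: g i) + (a + u *: x') \<and> a \<in> pV n r \<and> x' \<in> Y" if "y \<in> Y" for y
  proof -
    have "y \<in> lspan m g + (pV n r + smul u ` Y)" using that gen by blast
    then show ?thesis by (auto simp: lspan_def set_plus_def)
  qed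
  then obtain c a x' where st: "!!y. y \<in> Y ==> y = (\<Sum>i<m. c y i *: g i) + (a y + u *: x' y) \<and> a y \<in> pV n r \<and> x' y \<in> Y"
    by metis
  \<comment> \<open>Each step writes a vector of \<open>Y\<close> as a combination of the
    generators, plus a vector divisible by p^n, plus u times the next vector. \<open>X k\<close> is
    the k-th of these vectors, and \<open>D K\<close> collects the coefficients of the first
    \<open>K\<close> steps.\<close>
  define X where "X k = (x' ^^ k) x" for k
  have XY: "X k \<in> Y" for k by (induction k) (use x st in \<open>auto simp: X_def\<close>)
  define D where "D K i = (\<Sum>k<K. u ^ k * c (X k) i)" for K i
  have expand: "\<exists>b\<in>pV n r. x = (\<Sum>i<m. D K i *: g i) + (b + u ^ K *: X K)" for K
  proof (induction K)
    case 0
    show ?case by (rule bexI[of _ 0]) (auto simp: D_def X_def smul_simps submod_0)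
  next
    case (Suc K)
    then obtain b where b: "b \<in> pV n r" "x = (\<Sum>i<m. D K i *: g i) + (b + u ^ K *: X K)" by blast
    have XS: "X (Suc K) = x' (X K)" by (simp add: X_def)
    have "u ^ K *: X K = u ^ K *: ((\<Sum>i<m. c (X K) i *: g i) + (a (X K) + u *: X (Suc K)))"
      using st[OF XY[of K]] XS by metis
    also have "\<dots> = (\<Sum>i<m. (u ^ K * c (X K) i) *: g i) + (u ^ K *: a (X K) + u ^ Suc K *: X (Suc K))"
      by (simp add: smul_simps smul_sum mult.commute)
    finally have "x = ((\<Sum>i<m. D K i *: g i) + (\<Sum>i<m. (u ^ K * c (X K) i) *: g i)) + ((b + u ^ K *: a (X K)) + u ^ Suc K *: X (Suc K))"
      using b(2) by (simp add: add_ac)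
    also have "(\<Sum>i<m. D K i *: g i) + (\<Sum>i<m. (u ^ K * c (X K) i) *: g i) = (\<Sum>i<m. D (Suc K) i *: g i)"
      by (simp add: sum.distrib[symmetric] smul_simps(3)[symmetric] D_def)
    finally show ?case using b(1) st[OF XY[of K]] by (blast intro: submod_add submod_smul submod_pV)
  qed
  define C where "C i = Abs_fps (%j. \<Sum>k\<le>j. fps_nth (c (X k) i) (j - k))" for i
  have CD: "u ^ K dvd C i - D K i" for i K
    unfolding X_power_dvd_iff
  proof (intro allI impI)
    fix j assume j: "j < K"
    have "fps_nth (D K i) j = (\<Sum>k<K. if k \<le> j then fps_nth (c (X k) i) (j - k) else 0)"
      by (auto simp: D_def fps_sum_nth fps_X_power_mult_nth intro!: sum.cong)
    also have "\<dots> = (\<Sum>k\<le>j. fps_nth (c (X k) i) (j - k))"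
      by (rule sum.mono_neutral_cong_right) (use j in auto)
    finally show "fps_nth (C i - D K i) j = 0" by (simp add: C_def)
  qed
  define y where "y = x - (\<Sum>i<m. C i *: g i)"
  have gy: "\<exists>b\<in>pV n r. \<exists>w. y = b + u ^ K *: w" for K
  proof -
    obtain b where b: "b \<in> pV n r" "x = (\<Sum>i<m. D K i *: g i) + (b + u ^ K *: X K)" using expand by blast
    have "\<forall>i. \<exists>q. C i - D K i = u ^ K * q" using CD[of K] unfolding dvd_def by blast
    then obtain q where q: "!!i. C i - D K i = u ^ K * q i" by metis
    have "(\<Sum>i<m. C i *: g i) - (\<Sum>i<m. D K i *: g i) = (\<Sum>i<m. (C i - D K i) *: g i)"
      by (simp add: sum_subtractf smul_simps)
    also have "\<dots> = u ^ K *: (\<Sum>i<m. q i *: g i)" by (simp add: q smul_sum smul_simps)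
    finally have "y = b + u ^ K *: (X K - (\<Sum>i<m. q i *: g i))"
      using b(2) by (simp add: y_def smul_simps algebra_simps)
    then show ?thesis using b(1) by blast
  qed
  \<comment> \<open>Divisibility by p^n is tested coefficient by coefficient, and coefficient j only
    sees y modulo u^(j+1): p^n V is closed in the u-adic topology.\<close>
  have "of_nat p ^ n dvd cf y i" for i
    unfolding p_dvd_fps
  proof
    fix j
    obtain b w where b: "b \<in> pV n r" "y = b + u ^ Suc j *: w" using gy by blast
    have "fps_nth (u ^ Suc j * cf w i) j = 0" by (simp only: fps_X_power_mult_nth) simp
    then have "fps_nth (cf y i) j = fps_nth (cf b i) j" using b(2) by (simp only: cf_simps fps_add_nth) simp
    then show "of_nat p ^ n dvd fps_nth (cf y i) j" using b(1) by (simp add: pV_iff p_dvd_fps)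
  qed
  moreover have "y \<in> VV r"
  proof -
    have "cf y i = 0" if i: "i \<ge> r" for i
    proof (rule fps_ext)
      fix j
      obtain b w where b: "b \<in> pV n r" "y = b + u ^ Suc j *: w" using gy by blast
      have "fps_nth (u ^ Suc j * cf w i) j = 0" by (simp only: fps_X_power_mult_nth) simp
      moreover have "cf b i = 0" using b(1) i by (simp add: pV_iff VV_def)
      ultimately show "fps_nth (cf y i) j = fps_nth 0 j" using b(2) by simp
    qed
    then show ?thesis by (simp add: VV_def)
  qed
  ultimately have "y \<in> pV n r" by (simp add: pV_iff)
  moreover have "x = (\<Sum>i<m. C i *: g i) + y" by (simp add: y_def)
  moreover have "(\<Sum>i<m. C i *: g i) \<in> lspan m g" by (auto simp: lspan_def)
  ultimately show "x \<in> lspan m g + pV n r" by (simp add: set_plus_intro)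
qed

lemma generators_usat:
  assumes "submod X" "pV n r <= X" "X <= VV r" "usat r X"
  obtains m g where "!!i. i < m ==> g i \<in> X" "X = lspan m g + pV n r"
proof -
  obtain k where "rkl (pV n r) X = enat k" using rkl_finite[OF assms] by auto
  then have k: "len (pV n r + smul u ` X) X = enat k" by (simp add: rkl_def)
  have "\<exists>m g. (\<forall>i<m. g i \<in> X) \<and> X <= lspan m g + (pV n r + smul u ` X)"
    by (rule generators_of_finite_length[OF assms(1) _ _ k])
      (use assms in \<open>simp_all add: submod_plus plus_least smul_image_subset\<close>)
  then obtain m g where g: "!!i. i < m ==> g i \<in> X" "X <= lspan m g + (pV n r + smul u ` X)" by blast
  have "X <= lspan m g + pV n r" by (rule nakayama[OF assms(1,3) g(2)])
  moreover have "lspan m g + pV n r <= X" using assms g by (simp add: plus_least lspan_least)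
  ultimately show thesis using that g by blast
qed

text \<open>Equal ranks leave no room for Y/(X + uY), so Y = X + uY. As \<open>X\<close> is finitely
  generated modulo p^n, Nakayama's lemma gives equality. This makes the rank strictly increasing on
  saturated submodules.\<close>

lemma rkl_eq_imp_eq:
  assumes X: "submod X" "pV n r <= X" "usat r X" and Y: "submod Y" "X <= Y" "Y <= VV r"
    and le: "rkl (pV n r) Y \<le> rkl (pV n r) X"
  shows "X = Y"
proof -
  have XV: "X <= VV r" using Y by blast
  have "rkl (pV n r) Y = rkl (pV n r) X + rkl X Y" by (rule rkl_add[where r = r]) (use X Y in auto)
  then have "rkl X Y = 0" using le rkl_finite[OF X(1,2) XV X(3)]
    by (cases "rkl (pV n r) X"; cases "rkl X Y") (auto simp: zero_enat_def)
  then have e: "X + smul u ` Y = Y"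
    unfolding rkl_def using clen_eq_0[of submod "X + smul u ` Y" Y] X Y
    by (simp add: submod_plus plus_least smul_image_subset)
  obtain m g where g: "!!i. i < m ==> g i \<in> X" "X = lspan m g + pV n r" using generators_usat X XV by metis
  have "Y <= lspan m g + (pV n r + smul u ` Y)" using e g(2) by (simp add: add.assoc)
  then have "Y <= lspan m g + pV n r" by (rule nakayama[OF Y(1,3)])
  then show ?thesis using g(2) Y by blast
qed

end

section \<open>Piecewise linear concave functions\<close>

text \<open>For increasing \<open>s\<close>, the polygon with breakpoints \<open>s\<close> and
  slopes \<open>\<mu>\<close>. It is defined on the whole line and constant beyond its first and
  last breakpoint, in agreement with \<open>polygon_of_filtration\<close>.\<close>

definition pl :: "nat => (nat => real) => (nat => real) => real => real" where
  "pl k \<mu> s x = (\<Sum>i<k. \<mu> i * max 0 (min (x - s i) (s (Suc i) - s i)))"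

locale piecewise =
  fixes k :: nat and \<mu> s :: "nat => real"
  assumes s0: "s 0 = 0" and s_less: "!!i. i < k ==> s i < s (Suc i)"
    and mu_dec: "!!i. Suc i < k ==> \<mu> (Suc i) \<le> \<mu> i"
begin

abbreviation P :: "real => real" where "P \<equiv> pl k \<mu> s"
abbreviation cl :: "nat => real => real" where "cl i x \<equiv> max 0 (min (x - s i) (s (Suc i) - s i))"

lemma s_mono: "i \<le> j ==> j \<le> k ==> s i \<le> s j"
proof (induction j)
  case (Suc j)
  then show ?case using s_less[of j] by (cases "i = Suc j") auto
qed simp

lemma s_nonneg: "i \<le> k ==> 0 \<le> s i" using s_mono[of 0 i] s0 by simp

lemma cl_sum: "m \<le> k ==> 0 \<le> x ==> (\<Sum>i<m. cl i x) = min x (s m)"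
proof (induction m)
  case (Suc m)
  then show ?case using s_less[of m] s_nonneg[of m] by (auto simp: min_def max_def)
qed (simp add: s0)

text \<open>Summation by parts. In \<open>upper\<close> it is applied to differences whose total is
  0, and then says that the weighted sum is nonnegative.\<close>

lemma abel: "Suc m \<le> k ==> (!!j. j \<le> k ==> 0 \<le> (\<Sum>i<j. d i)) ==> \<mu> m * (\<Sum>i<Suc m. d i) \<le> (\<Sum>i<Suc m. \<mu> i * d i)"
proof (induction m)
  case (Suc m)
  have "\<mu> (Suc m) * (\<Sum>i<Suc m. d i) \<le> \<mu> m * (\<Sum>i<Suc m. d i)"
    using mu_dec[of m] Suc.prems(1) Suc.prems(2)[of "Suc m"] by (intro mult_right_mono) auto
  also have "\<dots> \<le> (\<Sum>i<Suc m. \<mu> i * d i)" using Suc by simp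
  finally show ?case by (simp add: algebra_simps)
qed simp

text \<open>\<open>P\<close> fills the segments in order, and their slopes decrease. Any other
  distribution \<open>\<rho>\<close> of the length \<open>x\<close> over the segments is behind in
  every partial sum, so its weighted sum is at most that of the greedy filling.\<close>

lemma upper:
  assumes \<rho>: "!!i. i < k ==> 0 \<le> \<rho> i \<and> \<rho> i \<le> s (Suc i) - s i" and x: "x = (\<Sum>i<k. \<rho> i)"
  shows "(\<Sum>i<k. \<mu> i * \<rho> i) \<le> P x"
proof (cases k)
  case 0 then show ?thesis by (simp add: pl_def)
next
  case (Suc m)
  have tel: "j \<le> k ==> (\<Sum>i<j. s (Suc i) - s i) = s j" for j using sum_lessThan_telescope[of s j] by (simp add: s0)
  have x0: "0 \<le> x" unfolding x by (rule sum_nonneg) (use \<rho> in auto)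
  have part: "(\<Sum>i<j. \<rho> i) \<le> (\<Sum>i<j. cl i x)" if j: "j \<le> k" for j
  proof -
    have "(\<Sum>i<j. \<rho> i) \<le> x" unfolding x by (rule sum_mono2) (use \<rho> j in auto)
    moreover have "(\<Sum>i<j. \<rho> i) \<le> (\<Sum>i<j. s (Suc i) - s i)" by (rule sum_mono) (use \<rho> j in auto)
    ultimately show ?thesis using cl_sum[OF j x0] tel[OF j] by simp
  qed
  have xk: "x \<le> s k" unfolding x using sum_mono[of "{..<k}" \<rho> "%i. s (Suc i) - s i"] \<rho> tel[of k] by simp
  have "\<mu> m * (\<Sum>i<Suc m. cl i x - \<rho> i) \<le> (\<Sum>i<Suc m. \<mu> i * (cl i x - \<rho> i))"
    by (rule abel) (use Suc part in \<open>auto simp: sum_subtractf\<close>)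
  moreover have "(\<Sum>i<k. cl i x - \<rho> i) = 0" using cl_sum[of k x] x0 xk x by (simp add: sum_subtractf)
  ultimately have "0 \<le> (\<Sum>i<k. \<mu> i * (cl i x - \<rho> i))" using Suc by simp
  then show ?thesis by (simp add: pl_def right_diff_distrib sum_subtractf)
qed

text \<open>A convex combination of two greedy fillings is an admissible filling of the combined
  length, to which \<open>upper\<close> applies.\<close>

lemma concave: "concave_on {0..s k} P"
  unfolding concave_on_iff
proof (intro conjI ballI allI impI)
  fix x y a b :: real
  assume x: "x \<in> {0..s k}" and y: "y \<in> {0..s k}" and ab: "0 \<le> a" "0 \<le> b" "a + b = 1"
  define \<rho> where "\<rho> i = a * cl i x + b * cl i y" for i
  have "a * x + b * y = (\<Sum>i<k. \<rho> i)"
    using cl_sum[of k x] cl_sum[of k y] x y by (simp add: \<rho>_def sum.distrib flip: sum_distrib_left)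
  moreover have "0 \<le> \<rho> i \<and> \<rho> i \<le> s (Suc i) - s i" if i: "i < k" for i
  proof -
    have "cl i x \<le> s (Suc i) - s i" "cl i y \<le> s (Suc i) - s i" using s_less[OF i] by auto
    then have "\<rho> i \<le> a * (s (Suc i) - s i) + b * (s (Suc i) - s i)"
      unfolding \<rho>_def using ab by (intro add_mono mult_left_mono) auto
    also have "\<dots> = s (Suc i) - s i" using ab by (metis distrib_right mult_1)
    finally show ?thesis using ab by (simp add: \<rho>_def)
  qed
  ultimately have "(\<Sum>i<k. \<mu> i * \<rho> i) \<le> P (a * x + b * y)" by (intro upper)
  moreover have "(\<Sum>i<k. \<mu> i * \<rho> i) = a * P x + b * P y"
    by (simp add: \<rho>_def pl_def sum_distrib_left distrib_left sum.distrib mult_ac)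
  ultimately show "a * P x + b * P y \<le> P (a *\<^sub>R x + b *\<^sub>R y)" by simp
qed simp

lemma affine:
  assumes i: "i < k" and x: "s i \<le> x" "x \<le> s (Suc i)"
  shows "P x = (\<Sum>j<i. \<mu> j * (s (Suc j) - s j)) + \<mu> i * (x - s i)"
proof -
  have "P x = (\<Sum>j<k. if j < i then \<mu> j * (s (Suc j) - s j) else if j = i then \<mu> i * (x - s i) else 0)"
    unfolding pl_def
  proof (rule sum.cong[OF refl])
    fix j assume j: "j \<in> {..<k}"
    consider "j < i" | "j = i" | "i < j" by linarith
    then show "\<mu> j * cl j x = (if j < i then \<mu> j * (s (Suc j) - s j) else if j = i then \<mu> i * (x - s i) else 0)"
    proof cases
      case 1
      then have "s (Suc j) \<le> x" using s_mono[of "Suc j" i] i x by simp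
      then show ?thesis using 1 s_less[of j] j by simp
    next
      case 3
      then have "x \<le> s j" using s_mono[of "Suc i" j] j x by simp
      then show ?thesis using 3 by simp
    qed (use x in simp)
  qed
  also have "\<dots> = (\<Sum>j<Suc i. if j < i then \<mu> j * (s (Suc j) - s j) else if j = i then \<mu> i * (x - s i) else 0)"
    by (rule sum.mono_neutral_right) (use i in auto)
  finally show ?thesis by simp
qed

lemma at_vertex: assumes "m \<le> k" shows "P (s m) = (\<Sum>j<m. \<mu> j * (s (Suc j) - s j))"
proof (cases "m < k")
  case True then show ?thesis using affine[of m "s m"] s_less[of m] by simp
next
  case False
  then have m: "m = k" using assms by simp
  show ?thesis
  proof (cases k)
    case 0 then show ?thesis by (simp add: m pl_def)
  next
    case (Suc j) then show ?thesis using affine[of j "s k"] s_less[of j] by (simp add: m)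
  qed
qed

text \<open>Between two breakpoints \<open>P\<close> is affine, so the chords of \<open>Q\<close>
  already lie above it.\<close>

lemma least:
  assumes Q: "concave_on {0..s k} Q" and v: "!!i. i \<le> k ==> P (s i) \<le> Q (s i)" and x: "x \<in> {0..s k}"
  shows "P x \<le> Q x"
proof (cases "x = s k")
  case False
  then have xk: "x < s k" using x by simp
  define i where "i = (LEAST j. x < s (Suc j))"
  have "k ~= 0" using xk x s0 by (cases k) auto
  then have ex: "x < s (Suc (k - 1))" using xk by simp
  have i1: "x < s (Suc i)" unfolding i_def using ex by (rule LeastI)
  have ik: "i < k" using Least_le[of "%j. x < s (Suc j)", OF ex] \<open>k ~= 0\<close> unfolding i_def by linarith
  have i0: "s i \<le> x"
  proof (cases i)
    case 0 then show ?thesis using s0 x by simp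
  next
    case (Suc j) then show ?thesis using not_less_Least[of j "%j. x < s (Suc j)"] i_def by simp
  qed
  define t where "t = (x - s i) / (s (Suc i) - s i)"
  have d: "0 < s (Suc i) - s i" using s_less ik by simp
  have t: "0 \<le> t" "t \<le> 1" using i0 i1 d by (auto simp: t_def divide_simps)
  have td: "t * (s (Suc i) - s i) = x - s i" using d by (simp add: t_def)
  have xe: "x = (1 - t) * s i + t * s (Suc i)" using td by (simp add: algebra_simps)
  have "P x = (1 - t) * P (s i) + t * P (s (Suc i))"
  proof -
    define C where "C = (\<Sum>j<i. \<mu> j * (s (Suc j) - s j))"
    have a: "P x = C + \<mu> i * (x - s i)" "P (s i) = C" "P (s (Suc i)) = C + \<mu> i * (s (Suc i) - s i)"
      using affine[of i x] affine[of i "s i"] affine[of i "s (Suc i)"] ik i0 i1 d by (simp_all add: C_def)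
    have "(1 - t) * P (s i) + t * P (s (Suc i)) = C + \<mu> i * (t * (s (Suc i) - s i))"
      unfolding a by (simp add: algebra_simps)
    then show ?thesis unfolding td a(1) by simp
  qed
  also have "\<dots> \<le> (1 - t) * Q (s i) + t * Q (s (Suc i))"
    using v[of i] v[of "Suc i"] ik t by (intro add_mono mult_left_mono) auto
  also have "\<dots> \<le> Q ((1 - t) *\<^sub>R s i + t *\<^sub>R s (Suc i))"
    using Q t ik s_mono[of 0 i] s_mono[of i k] s_mono[of "Suc i" k] s_mono[of 0 "Suc i"] s0
    unfolding concave_on_iff by auto
  also have "\<dots> = Q x" by (simp add: xe)
  finally show ?thesis .
qed (use v in simp)

lemma outside: "x \<le> 0 ==> P x = 0" "s k \<le> x ==> P x = P (s k)"
proof -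
  assume "x \<le> 0"
  then have "cl i x = 0" if "i < k" for i using s_nonneg[of i] that by simp
  then show "P x = 0" unfolding pl_def by simp
next
  assume "s k \<le> x"
  then have "cl i x = cl i (s k)" if "i < k" for i using s_mono[of "Suc i" k] that by simp
  then show "P x = P (s k)" unfolding pl_def by simp
qed

end

section \<open>Harder--Narasimhan polygons in a lattice with rank and degree\<close>

text \<open>An abstract lattice of strict subobjects. The join is the saturation of the sum and not
  the sum itself, hence only its universal property and its numerical laws are assumed. Degrees are
  integers bounded above, so that a maximal slope is attained.\<close>

locale hn_lattice =
  fixes L :: "'a set set" and bt tp :: "'a set" and rk :: "'a set => nat" and dg :: "'a set => int"
  assumes bt_L: "bt \<in> L" and tp_L: "tp \<in> L" and between: "!!H. H \<in> L ==> bt <= H \<and> H <= tp"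
    and rk_less: "!!H K. H \<in> L ==> K \<in> L ==> H \<subset> K ==> rk H < rk K"
    and rk_bt: "rk bt = 0" and dg_bt: "dg bt = 0"
    and meet: "!!H K. H \<in> L ==> K \<in> L ==> H \<inter> K \<in> L"
    and join: "!!H K. H \<in> L ==> K \<in> L ==> \<exists>J\<in>L. H <= J \<and> K <= J \<and> (\<forall>U\<in>L. H <= U --> K <= U --> J <= U) \<and>
        rk (H \<inter> K) + rk J = rk H + rk K \<and> dg H + dg K \<le> dg (H \<inter> K) + dg J"
    and dg_bounded: "\<exists>B. \<forall>H\<in>L. dg H \<le> B"
begin

definition slope :: "'a set => 'a set => real" where
  "slope A B = real_of_int (dg B - dg A) / (real (rk B) - real (rk A))"

text \<open>The bottom term \<open>F 0\<close> is left free: existence is proved by induction for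
  filtrations starting at any \<open>A\<close>, and \<open>F 0 = bt\<close> is added where the
  polygon is meant.\<close>

definition filt :: "nat => (nat => 'a set) => bool" where
  "filt k F \<longleftrightarrow> F k = tp \<and> (\<forall>i\<le>k. F i \<in> L) \<and>
     (\<forall>i<k. F i \<subset> F (Suc i) \<and> (\<forall>H\<in>L. F i \<subset> H --> H <= F (Suc i) --> slope (F i) H \<le> slope (F i) (F (Suc i)))) \<and>
     (\<forall>i. Suc i < k --> slope (F (Suc i)) (F (Suc (Suc i))) < slope (F i) (F (Suc i)))"

definition polygon :: "nat => (nat => 'a set) => real => real" where
  "polygon k F = pl k (%i. slope (F i) (F (Suc i))) (%i. real (rk (F i)))"

lemma rk_mono: "H \<in> L ==> K \<in> L ==> H <= K ==> rk H \<le> rk K"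
  using rk_less[of H K] by (cases "H = K") (simp_all add: psubset_eq less_imp_le)

lemma slope_mult: "A \<in> L ==> B \<in> L ==> A \<subset> B ==> slope A B * (real (rk B) - real (rk A)) = real_of_int (dg B - dg A)"
  using rk_less[of A B] by (simp add: slope_def)

lemma piecewise_filt: "filt k F ==> F 0 = bt ==> piecewise k (%i. slope (F i) (F (Suc i))) (%i. real (rk (F i)))"
  by standard (simp_all add: filt_def rk_bt rk_less less_imp_le)

lemma polygon_vertex:
  assumes F: "filt k F" "F 0 = bt" and m: "m \<le> k"
  shows "polygon k F (real (rk (F m))) = real_of_int (dg (F m))"
proof -
  interpret piecewise k "%i. slope (F i) (F (Suc i))" "%i. real (rk (F i))" by (rule piecewise_filt) (rule F)+
  have "polygon k F (real (rk (F m))) = (\<Sum>j<m. real_of_int (dg (F (Suc j))) - real_of_int (dg (F j)))"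
    unfolding polygon_def at_vertex[OF m]
  proof (rule sum.cong[OF refl])
    fix j assume "j \<in> {..<m}"
    then show "slope (F j) (F (Suc j)) * (real (rk (F (Suc j))) - real (rk (F j))) = real_of_int (dg (F (Suc j))) - real_of_int (dg (F j))"
      using slope_mult[of "F j" "F (Suc j)"] F(1) m by (simp add: filt_def)
  qed
  also have "\<dots> = real_of_int (dg (F m))" using sum_lessThan_telescope[of "%j. real_of_int (dg (F j))" m] by (simp add: F dg_bt)
  finally show ?thesis .
qed

text \<open>\<open>H\<close> is cut into the pieces between \<open>H \<inter> F i\<close> and
  \<open>H \<inter> F (Suc i)\<close>. With \<open>J\<close> the join of
  \<open>H \<inter> F (Suc i)\<close> and \<open>F i\<close>, such a piece has the rank of J over
  \<open>F i\<close> and at most its degree, so semistability bounds its degree by slope times rank;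
  \<open>upper\<close> adds up the pieces.\<close>

lemma polygon_bound:
  assumes F: "filt k F" "F 0 = bt" and H: "H \<in> L"
  shows "real_of_int (dg H) \<le> polygon k F (real (rk H))"
proof -
  interpret piecewise k "%i. slope (F i) (F (Suc i))" "%i. real (rk (F i))" by (rule piecewise_filt) (rule F)+
  have FL: "F i \<in> L" if "i \<le> k" for i using F that by (simp add: filt_def)
  have HF: "H \<inter> F i \<in> L" if "i \<le> k" for i using meet H FL that by blast
  define \<rho> where "\<rho> i = real (rk (H \<inter> F (Suc i))) - real (rk (H \<inter> F i))" for i
  have step: "0 \<le> \<rho> i \<and> \<rho> i \<le> real (rk (F (Suc i))) - real (rk (F i)) \<and>
      real_of_int (dg (H \<inter> F (Suc i)) - dg (H \<inter> F i)) \<le> slope (F i) (F (Suc i)) * \<rho> i" if i: "i < k" for i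
  proof -
    let ?K = "H \<inter> F (Suc i)"
    have sub: "F i \<subset> F (Suc i)" using F i by (simp add: filt_def)
    have e: "?K \<inter> F i = H \<inter> F i" using sub by auto
    obtain J where J: "J \<in> L" "?K <= J" "F i <= J" "\<forall>U\<in>L. ?K <= U --> F i <= U --> J <= U"
      "rk (H \<inter> F i) + rk J = rk ?K + rk (F i)" "dg ?K + dg (F i) \<le> dg (H \<inter> F i) + dg J"
      using join[of ?K "F i"] HF[of "Suc i"] FL[of i] i unfolding e by auto
    have JF: "J <= F (Suc i)" using J(4) FL[of "Suc i"] i sub by auto
    have rho: "\<rho> i = real (rk J) - real (rk (F i))" using J(5) by (simp add: \<rho>_def)
    have "rk (F i) \<le> rk J" "rk J \<le> rk (F (Suc i))" using rk_mono FL[of i] FL[of "Suc i"] J JF i by auto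
    moreover have "real_of_int (dg J - dg (F i)) \<le> slope (F i) (F (Suc i)) * \<rho> i"
    proof (cases "J = F i")
      case False
      then have FJ: "F i \<subset> J" using J by auto
      have "real_of_int (dg J - dg (F i)) = slope (F i) J * \<rho> i" using slope_mult[of "F i" J] FJ FL[of i] J i rho by simp
      also have "\<dots> \<le> slope (F i) (F (Suc i)) * \<rho> i"
        using F FJ J JF i \<open>rk (F i) \<le> rk J\<close> unfolding filt_def rho by (intro mult_right_mono) auto
      finally show ?thesis .
    qed (simp add: rho)
    ultimately show ?thesis using J(6) rho by linarith
  qed
  have "real_of_int (dg H) = (\<Sum>i<k. real_of_int (dg (H \<inter> F (Suc i)) - dg (H \<inter> F i)))"
    using sum_lessThan_telescope[of "%j. real_of_int (dg (H \<inter> F j))" k] between[OF H] F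
    by (simp add: filt_def Int_absorb2 Int_absorb1 dg_bt)
  also have "\<dots> \<le> (\<Sum>i<k. slope (F i) (F (Suc i)) * \<rho> i)" by (rule sum_mono) (use step in auto)
  also have "\<dots> \<le> P (real (rk H))"
  proof (rule upper)
    show "real (rk H) = (\<Sum>i<k. \<rho> i)"
      using sum_lessThan_telescope[of "%j. real (rk (H \<inter> F j))" k] between[OF H] F
      by (simp add: filt_def Int_absorb2 Int_absorb1 rk_bt \<rho>_def)
  qed (use step in auto)
  finally show ?thesis by (simp add: polygon_def)
qed

lemma polygon_least:
  assumes F: "filt k F" "F 0 = bt" and Q: "concave_on {0..real (rk tp)} Q" "!!H. H \<in> L ==> real_of_int (dg H) \<le> Q (real (rk H))"
    and x: "x \<in> {0..real (rk tp)}"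
  shows "polygon k F x \<le> Q x"
proof -
  interpret piecewise k "%i. slope (F i) (F (Suc i))" "%i. real (rk (F i))" by (rule piecewise_filt) (rule F)+
  have Fk: "F k = tp" using F by (simp add: filt_def)
  have "P x \<le> Q x"
  proof (rule least)
    fix i assume i: "i \<le> k"
    then have "F i \<in> L" using F by (simp add: filt_def)
    then show "P (real (rk (F i))) \<le> Q (real (rk (F i)))"
      using polygon_vertex[OF F i] Q(2) by (simp add: polygon_def)
  qed (use Q x Fk in auto)
  then show ?thesis by (simp add: polygon_def)
qed

lemma polygon_concave: "filt k F ==> F 0 = bt ==> concave_on {0..real (rk tp)} (polygon k F)"
proof -
  assume F: "filt k F" "F 0 = bt"
  interpret piecewise k "%i. slope (F i) (F (Suc i))" "%i. real (rk (F i))" by (rule piecewise_filt) (rule F)+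
  show ?thesis using concave F by (simp add: polygon_def filt_def)
qed

text \<open>Each polygon is the least concave function above all points (rank, degree), so each is
  below the other. The cases beyond the end points give equality on the whole line, as the definite
  description of \<open>hn\<close> requires.\<close>

lemma polygon_unique:
  assumes F: "filt k F" "F 0 = bt" and G: "filt l G" "G 0 = bt"
  shows "polygon k F = polygon l G"
proof
  fix x
  interpret F: piecewise k "%i. slope (F i) (F (Suc i))" "%i. real (rk (F i))" by (rule piecewise_filt) (rule F)+
  interpret G: piecewise l "%i. slope (G i) (G (Suc i))" "%i. real (rk (G i))" by (rule piecewise_filt) (rule G)+
  have e: "F k = tp" "G l = tp" using F G by (simp_all add: filt_def)
  have in_eq: "polygon k F y = polygon l G y" if "y \<in> {0..real (rk tp)}" for y
    by (rule antisym; rule polygon_least; use F G that polygon_concave polygon_bound in simp)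
  consider "x \<le> 0" | "x \<in> {0..real (rk tp)}" | "real (rk tp) \<le> x" by force
  then show "polygon k F x = polygon l G x"
  proof cases
    case 1 then show ?thesis using F.outside(1) G.outside(1) by (simp add: polygon_def)
  next
    case 3 then show ?thesis using F.outside(2)[of x] G.outside(2)[of x] in_eq[of "real (rk tp)"] by (simp add: polygon_def e)
  qed (rule in_eq)
qed

text \<open>The integer \<open>g H\<close> below orders submodules first by slope, then by rank.\<close>

lemma destabilizing:
  assumes A: "A \<in> L" "A ~= tp"
  obtains K where "K \<in> L" "A \<subset> K" "!!H. H \<in> L ==> A \<subset> H ==> slope A H \<le> slope A K"
    "!!H. H \<in> L ==> A \<subset> H ==> slope A H = slope A K ==> rk H \<le> rk K"
proof -
  obtain B where B: "!!H. H \<in> L ==> dg H \<le> B" using dg_bounded by blast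
  let ?R = "rk tp"
  let ?C = "%H. H \<in> L \<and> A \<subset> H"
  \<comment> \<open>Every difference of ranks divides \<open>fact ?R\<close>, so \<open>f H\<close>
    is the slope times \<open>fact ?R\<close> and still an integer. In \<open>g\<close> the weight
    ?R + 1 exceeds every rank, so ranks only break ties.\<close>
  define f where "f H = (dg H - dg A) * int (fact ?R div (rk H - rk A))" for H
  define g where "g H = f H * (int ?R + 1) + int (rk H)" for H
  have rH: "rk A < rk H \<and> rk H \<le> ?R" if "?C H" for H using rk_less[of A H] rk_mono[of H tp] tp_L between A that by blast
  have fs: "real_of_int (f H) = slope A H * fact ?R" if "?C H" for H
  proof -
    have "rk H - rk A dvd fact ?R" using rH[OF that] by (intro dvd_fact) auto
    then have "real (fact ?R div (rk H - rk A)) = fact ?R / real (rk H - rk A)" by (simp add: real_of_nat_div)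
    then show ?thesis using rH[OF that] by (simp add: f_def slope_def of_nat_diff)
  qed
  have fb: "f H \<le> \<bar>B - dg A\<bar> * fact ?R" if "?C H" for H
  proof -
    have "f H \<le> \<bar>B - dg A\<bar> * int (fact ?R div (rk H - rk A))" unfolding f_def
      using B[of H] that by (intro mult_right_mono) auto
    also have "\<dots> \<le> \<bar>B - dg A\<bar> * int (fact ?R)"
      by (intro mult_left_mono) (simp_all only: of_nat_le_iff div_le_dividend abs_ge_zero)
    also have "int (fact ?R) = fact ?R" by simp
    finally show ?thesis .
  qed
  define U where "U = (\<bar>B - dg A\<bar> * fact ?R) * (int ?R + 1) + int ?R"
  have gU: "g H \<le> U" if "?C H" for H
    unfolding g_def U_def using fb[OF that] rH[OF that] by (intro add_mono mult_right_mono) auto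
  have "?C tp" using A tp_L between by blast
  then obtain K where K: "?C K" "!!H. ?C H ==> nat (U - g K) \<le> nat (U - g H)"
    using ex_has_least_nat[of ?C tp "%H. nat (U - g H)"] by blast
  have gm: "g H \<le> g K" if "?C H" for H using K(2)[OF that] gU[OF that] gU[OF K(1)] by simp
  have fm: "f H \<le> f K" if "?C H" for H
  proof (rule ccontr)
    assume "\<not> f H \<le> f K"
    then have "(f K + 1) * (int ?R + 1) \<le> f H * (int ?R + 1)" by (intro mult_right_mono) auto
    then have "g K + 1 \<le> f H * (int ?R + 1)" using rH[OF K(1)] by (simp add: g_def algebra_simps)
    then show False using gm[OF that] by (simp add: g_def)
  qed
  show thesis
  proof (rule that[of K])
    fix H assume H: "H \<in> L" "A \<subset> H"
    have "real_of_int (f H) \<le> real_of_int (f K)" using fm H by simp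
    then show "slope A H \<le> slope A K" using fs[of H] fs[of K] H K by simp
    assume "slope A H = slope A K"
    then have "real_of_int (f H) = real_of_int (f K)" using fs[of H] fs[of K] H K by simp
    then show "rk H \<le> rk K" using gm[of H] H by (simp add: g_def)
  qed (use K in auto)
qed

lemma filt_exists: "A \<in> L ==> \<exists>k F. filt k F \<and> F 0 = A"
proof (induction "rk tp - rk A" arbitrary: A rule: less_induct)
  case less
  show ?case
  proof (cases "A = tp")
    case True
    then show ?thesis by (intro exI[of _ 0] exI[of _ "%_. tp"]) (auto simp: filt_def tp_L)
  next
    case False
    obtain K where K: "K \<in> L" "A \<subset> K" "!!H. H \<in> L ==> A \<subset> H ==> slope A H \<le> slope A K"
      "!!H. H \<in> L ==> A \<subset> H ==> slope A H = slope A K ==> rk H \<le> rk K"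
      using destabilizing[OF less.prems False] by blast
    have r: "rk A < rk K" "rk K \<le> rk tp" using rk_less[OF less.prems K(1,2)] rk_mono[OF K(1) tp_L] between[OF K(1)] by auto
    then have "rk tp - rk K < rk tp - rk A" by linarith
    then obtain k F where F: "filt k F" "F 0 = K" using less.hyps[OF _ K(1)] by blast
    define G where "G i = (case i of 0 => A | Suc j => F j)" for i
    have G: "G 0 = A" "!!i. G (Suc i) = F i" by (simp_all add: G_def)
    \<comment> \<open>If the slope did not drop, the slope of \<open>F 1\<close> over
      \<open>A\<close>, a mean of two slopes that are at least that of \<open>K\<close>, would be
      maximal too, and \<open>F 1\<close> has larger rank than \<open>K\<close>.\<close>
    have drop: "slope (F 0) (F 1) < slope A K" if k: "0 < k"
    proof (rule ccontr)
      assume c: "\<not> ?thesis"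
      have F1: "F 1 \<in> L" "K \<subset> F 1" using F k by (auto simp: filt_def Suc_le_eq)
      have rr: "rk K < rk (F 1)" using rk_less[OF K(1) F1] .
      have A1: "A \<subset> F 1" using K(2) F1 by blast
      have "slope A K * (real (rk (F 1)) - real (rk A)) = slope A K * (real (rk K) - real (rk A)) + slope A K * (real (rk (F 1)) - real (rk K))"
        by (simp add: algebra_simps)
      also have "\<dots> \<le> slope A K * (real (rk K) - real (rk A)) + slope K (F 1) * (real (rk (F 1)) - real (rk K))"
        using c rr F by (intro add_left_mono mult_right_mono) auto
      also have "\<dots> = real_of_int (dg (F 1) - dg A)" using slope_mult[OF less.prems K(1,2)] slope_mult[OF K(1) F1] by simp
      also have "\<dots> = slope A (F 1) * (real (rk (F 1)) - real (rk A))" using slope_mult[OF less.prems F1(1) A1] by simp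
      finally have "slope A K \<le> slope A (F 1)" using rr r by simp
      then have "rk (F 1) \<le> rk K" using K(3)[OF F1(1) A1] K(4)[OF F1(1) A1] by simp
      then show False using rr by simp
    qed
    have "filt (Suc k) G" unfolding filt_def
    proof (intro conjI allI impI)
      show "G (Suc k) = tp" using F by (simp add: G filt_def)
    next
      fix i assume "i \<le> Suc k" then show "G i \<in> L" using F less.prems by (cases i) (auto simp: G filt_def)
    next
      fix i assume "i < Suc k" then show "G i \<subset> G (Suc i)" using F K by (cases i) (auto simp: G filt_def)
    next
      fix i assume i: "i < Suc k"
      show "\<forall>H\<in>L. G i \<subset> H --> H <= G (Suc i) --> slope (G i) H \<le> slope (G i) (G (Suc i))"
      proof (cases i)
        case 0 then show ?thesis using K(3) F by (simp add: G)
      next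
        case (Suc j) then show ?thesis using F i by (simp add: G filt_def)
      qed
    next
      fix i assume i: "Suc i < Suc k"
      show "slope (G (Suc i)) (G (Suc (Suc i))) < slope (G i) (G (Suc i))"
      proof (cases i)
        case 0 then show ?thesis using drop i F by (simp add: G)
      next
        case (Suc j) then show ?thesis using F i by (simp add: G filt_def)
      qed
    qed
    then show ?thesis using G(1) by blast
  qed
qed

definition hn :: "real => real" where
  "hn = (THE t. \<exists>k F. filt k F \<and> F 0 = bt \<and> t = polygon k F)"

lemma hn_eq: "filt k F ==> F 0 = bt ==> hn = polygon k F"
  unfolding hn_def using polygon_unique by (intro the_equality) blast+

lemma hn_filt: obtains k F where "filt k F" "F 0 = bt" "hn = polygon k F"
  using filt_exists[OF bt_L] hn_eq by blast

lemma hn_concave: "concave_on {0..real (rk tp)} hn"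
  by (metis hn_filt polygon_concave)

lemma hn_bound: "H \<in> L ==> real_of_int (dg H) \<le> hn (real (rk H))"
  by (metis hn_filt polygon_bound)

lemma hn_least: "concave_on {0..real (rk tp)} Q ==> (!!H. H \<in> L ==> real_of_int (dg H) \<le> Q (real (rk H))) ==>
    x \<in> {0..real (rk tp)} ==> hn x \<le> Q x"
  using hn_filt polygon_least by metis

lemma hn_ends: "hn 0 = 0" "hn (real (rk tp)) = real_of_int (dg tp)"
proof -
  obtain k F where F: "filt k F" "F 0 = bt" "hn = polygon k F" by (rule hn_filt)
  show "hn 0 = 0" using polygon_vertex[OF F(1,2), of 0] F by (simp add: rk_bt dg_bt)
  show "hn (real (rk tp)) = real_of_int (dg tp)" using polygon_vertex[OF F(1,2), of k] F by (simp add: filt_def)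
qed

end

section \<open>Strict subobjects of the reduction modulo $p^n$\<close>

text \<open>\<open>VV r\<close> is \<open>M\<close>, and \<open>a\<close> is the linearized structure map \<open>\<phi>\<^sup>*M \<rightarrow> M\<close> multiplied by \<open>u\<^sup>N\<close>, for \<open>N\<close> large;
  submodules of \<open>M/p\<^sup>nM\<close> are represented by their preimages in \<open>M\<close>.\<close>

locale reduction = witt p \<rho> \<sigma> for p :: nat and \<rho> :: "'w::comm_ring_1 => 'f::field" and \<sigma> +
  fixes n r N :: nat and a :: "'w fps fvec => 'w fps fvec"
  assumes lin_a: "lin a" and aV: "a ` VV r <= VV r"
    and a_inj: "!!x. x \<in> VV r ==> a x \<in> pV n r ==> x \<in> pV n r"
    and a_surj: "\<exists>c. \<forall>x\<in>VV r. \<exists>z\<in>VV r. u ^ c *: x - a z \<in> pV n r"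
begin

definition L :: "'w fps fvec set set" where
  "L = {H. submod H \<and> pV n r <= H \<and> H <= VV r \<and> usat r H \<and> a ` Ph H <= H}"

text \<open>The length of the cokernel of the map that \<open>a\<close> induces from the Frobenius
  pullback of B/A to B/A.\<close>

definition dl :: "'w fps fvec set => 'w fps fvec set => enat" where
  "dl A B = len (A + a ` Ph B) B"

lemma LD: assumes "H \<in> L"
  shows "submod H" "pV n r <= H" "H <= VV r" "usat r H" "a ` Ph H <= H"
  using assms by (simp_all add: L_def)

lemma a_pV: "a ` pV k r <= pV k r"
proof -
  have "a ` pV k r = smul (of_nat p ^ k) ` (a ` VV r)" by (simp add: pV_def lin_image_smul lin_a)
  then show ?thesis using aV by (simp add: pV_def image_mono)
qed

lemma pV_L: "k \<le> n ==> pV k r \<in> L"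
  using a_pV[of k] pV_mono[of k n] pV_subset[of k r] by (simp add: L_def)

lemma top_L: "VV r \<in> L"
  using aV pV_subset[of n r] by (simp add: L_def usat_def)

lemma submod_aPh: "submod H ==> submod (a ` Ph H)"
  by (simp add: submod_image lin_a)

text \<open>J/I is a quotient of J/(p^n V + u^c J), whose length is c times a finite rank.\<close>

lemma len_finite:
  assumes "submod I" "submod J" "pV n r <= I" "J <= VV r" "usat r J" and c: "smul (u ^ c) ` J <= I" and IJ: "I <= J"
  shows "len I J ~= \<infinity>"
proof -
  have J: "pV n r <= J" using assms by blast
  have "pV n r + smul (u ^ c) ` J <= I" using assms by (simp add: plus_least)
  then have "len I J \<le> len (pV n r + smul (u ^ c) ` J) J" by (rule clen_mono) simp
  also have "\<dots> = enat c * rkl (pV n r) J" using len_smul_u[of "pV n r" J J r c] assms J by simp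
  finally show ?thesis using rkl_finite[of J n r] assms J by (cases "rkl (pV n r) J"; cases "len I J") auto
qed

text \<open>The preimage of \<open>H\<close> under \<open>a\<close> and \<open>\<phi>\<^sup>*H\<close> are saturated of the same rank, hence equal.\<close>

lemma preimage_in_Ph:
  assumes H: "H \<in> L" and z: "z \<in> VV r" "a z \<in> H"
  shows "z \<in> Ph H"
proof -
  note h = LD[OF H]
  let ?A = "pV n r"
  define K where "K = {z \<in> VV r. a z \<in> H}"
  have K: "submod K" "K <= VV r" using submod_vimage[OF lin_a h(1), of "VV r"] by (auto simp: K_def)
  have AK: "?A <= K" using a_pV[of n] h(2) pV_subset[of n r] by (auto simp: K_def)
  have uK: "usat r K" using h(4) aV by (auto simp: usat_def K_def linD(2)[OF lin_a] submod_smul)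
  define I where "I = ?A + a ` K"
  have I: "submod I" "?A <= I" unfolding I_def using K(1) lin_a by (simp_all add: submod_plus submod_image le_plus1)
  have aKH: "a ` K <= H" by (auto simp: K_def)
  have IH: "I <= H" unfolding I_def using h(1,2) aKH by (rule plus_least)
  \<comment> \<open>\<open>a\<close> is injective modulo p^n, so it carries K/p^n V isomorphically
    to its image, which \<open>I\<close> represents.\<close>
  have 1: "rkl ?A K = rkl ?A I"
  proof -
    have "len (?A + a ` (?A + smul u ` K)) (?A + a ` K) = len (?A + smul u ` K) K"
    proof (rule len_transport[OF lin_a])
      fix y assume "y \<in> K" "a y \<in> ?A"
      then have "y \<in> ?A" using a_inj K(2) by blast
      then show "y \<in> ?A + smul u ` K" using le_plus1[of "smul u ` K" ?A] K(1) by auto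
    qed (use K AK in \<open>simp_all add: submod_plus plus_least smul_image_subset\<close>)
    moreover have "?A + a ` (?A + smul u ` K) = ?A + smul u ` I"
    proof -
      have "a ` ?A + ?A = ?A" using a_pV[of n] by (intro plus_absorb) (simp_all add: submod_image lin_a)
      moreover have "smul u ` ?A + ?A = ?A" by (intro plus_absorb) (simp_all add: smul_image_subset)
      moreover have "?A + a ` (?A + smul u ` K) = (a ` ?A + ?A) + smul u ` (a ` K)"
        by (simp add: image_plus lin_a lin_image_smul add_ac)
      moreover have "?A + smul u ` I = (smul u ` ?A + ?A) + smul u ` (a ` K)"
        by (simp add: I_def image_plus add_ac)
      ultimately show ?thesis by simp
    qed
    ultimately show ?thesis by (simp add: rkl_def I_def)
  qed
  \<comment> \<open>The cokernel of \<open>a\<close> is killed by u^c, so \<open>I\<close> contains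
    u^c H. Hence H/I has finite length and the two ranks agree.\<close>
  obtain c where c: "!!x. x \<in> VV r ==> \<exists>z\<in>VV r. u ^ c *: x - a z \<in> ?A" using a_surj by blast
  have 2: "smul (u ^ c) ` H <= I"
  proof
    fix y assume "y \<in> smul (u ^ c) ` H"
    then obtain x where x: "x \<in> H" "y = u ^ c *: x" by blast
    obtain z where z: "z \<in> VV r" "u ^ c *: x - a z \<in> ?A" using c[of x] x h(3) by blast
    have "y \<in> H" using x h(1) by (simp add: submod_smul)
    moreover have "y - a z \<in> H" using z x h(2) by blast
    ultimately have "a z \<in> H" using submod_diff_iff[OF h(1)] by blast
    then have "z \<in> K" using z by (simp add: K_def)
    moreover have "y = (y - a z) + a z" by simp
    ultimately show "y \<in> I" unfolding I_def using z x set_plus_intro[of "y - a z" ?A "a z" "a ` K"] by simp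
  qed
  have 3: "rkl ?A I = rkl ?A H"
    by (rule rkl_saturate[where r = r]) (use I IH h 2 len_finite[of I H c] in simp_all)
  \<comment> \<open>A chain between p^n V + uH and H is pulled back by Frobenius. It stays strict
    modulo u times \<open>Ph H\<close>, because component 0 of u w is u times a component of w and
    so lies in uH.\<close>
  have 4: "rkl ?A H \<le> rkl ?A (Ph H)"
    unfolding rkl_def
  proof (rule clen_mono_map[of _ _ _ _ "%C. Ph C + smul u ` Ph H"])
    fix C assume C: "submod C" "?A + smul u ` H <= C" "C <= H"
    have "?A <= C" using C(2) le_plus1[of "smul u ` H" ?A] h(1) by simp
    then have "?A <= Ph C" using Ph_mono[of ?A C] by simp
    then show "submod (Ph C + smul u ` Ph H) \<and> ?A + smul u ` Ph H <= Ph C + smul u ` Ph H \<and> Ph C + smul u ` Ph H <= Ph H"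
      using C h(1) by (simp add: submod_plus set_plus_mono2 plus_least smul_image_subset Ph_mono)
  next
    fix C D assume C: "submod C" "submod D" "?A + smul u ` H <= C" "C \<subset> D" "D <= H"
    obtain x where x: "x \<in> D" "x \<notin> C" using C by blast
    have "Fr x \<notin> Ph C + smul u ` Ph H"
    proof
      assume "Fr x \<in> Ph C + smul u ` Ph H"
      then obtain z w where zw: "z \<in> Ph C" "w \<in> Ph H" "Fr x = z + u *: w" by (auto simp: set_plus_def)
      have "x = co 0 (Fr x)" by (simp add: co_Fr)
      also have "\<dots> = co 0 z + u *: co (p - 1) w" by (simp add: zw(3) co_add co_X_smul)
      finally have xe: "x = co 0 z + u *: co (p - 1) w" .
      have "co 0 z \<in> C" using zw(1) by (simp add: Ph_def)
      moreover have "u *: co (p - 1) w \<in> smul u ` H" using zw(2) by (simp add: Ph_def)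
      moreover have "smul u ` H <= C" using C(3) le_plus2[of ?A "smul u ` H"] by simp
      ultimately have "x \<in> C" unfolding xe using submod_add[OF C(1)] by blast
      then show False using x by simp
    qed
    moreover have "Fr x \<in> Ph D + smul u ` Ph H"
      using x Fr_in_Ph[OF C(2)] le_plus1[of "smul u ` Ph H" "Ph D"] h(1) by auto
    moreover have "Ph C + smul u ` Ph H <= Ph D + smul u ` Ph H" using C(4) by (simp add: set_plus_mono2 Ph_mono psubset_imp_subset)
    ultimately show "Ph C + smul u ` Ph H \<subset> Ph D + smul u ` Ph H" by blast
  qed
  have PV: "Ph H <= VV r" using Ph_mono[OF h(3)] by simp
  have APh: "?A <= Ph H" using Ph_mono[OF h(2)] by simp
  have "Ph H <= K" using h(5) PV by (auto simp: K_def)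
  then have "Ph H = K"
    by (rule rkl_eq_imp_eq[where n = n and r = r, rotated 4])
      (use h K APh usat_Ph[OF h(4,3)] 1 3 4 in simp_all)
  then show ?thesis using z by (auto simp: K_def)
qed

text \<open>By \<open>preimage_in_Ph\<close> an image of \<open>Ph C\<close> that lies in
  \<open>B\<close> comes from \<open>Ph B\<close>, which is the hypothesis of
  \<open>len_op_add\<close>.\<close>

lemma dl_add:
  assumes A: "A \<in> L" and B: "B \<in> L" and C: "C \<in> L" and AB: "A <= B" and BC: "B <= C"
  shows "dl A C = dl A B + dl B C"
  unfolding dl_def
proof (rule len_op_add)
  have "Ph C <= VV r" using Ph_mono[OF LD(3)[OF C]] by simp
  then have "a ` Ph C \<inter> B <= a ` Ph B" using preimage_in_Ph[OF B] by auto
  moreover have "a ` Ph B <= a ` Ph C \<inter> B" using LD(5)[OF B] Ph_mono[OF BC] by auto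
  ultimately show "a ` Ph C \<inter> B = a ` Ph B" by blast
qed (use LD[OF A] LD[OF B] LD[OF C] AB BC in \<open>simp_all add: submod_aPh\<close>)

lemma dl_finite:
  assumes A: "A \<in> L" and B: "B \<in> L" and AB: "A <= B"
  shows "dl A B ~= \<infinity>"
proof -
  obtain c where c: "!!x. x \<in> VV r ==> \<exists>z\<in>VV r. u ^ c *: x - a z \<in> pV n r" using a_surj by blast
  note b = LD[OF B] and h = LD[OF A]
  have "smul (u ^ c) ` B <= A + a ` Ph B"
  proof
    fix y assume "y \<in> smul (u ^ c) ` B"
    then obtain x where x: "x \<in> B" "y = u ^ c *: x" by blast
    obtain z where z: "z \<in> VV r" "u ^ c *: x - a z \<in> pV n r" using c[of x] x b(3) by blast
    have "y \<in> B" using x b(1) by (simp add: submod_smul)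
    moreover have "y - a z \<in> B" using z x b(2) by blast
    ultimately have "a z \<in> B" using submod_diff_iff[OF b(1)] by blast
    then have "z \<in> Ph B" using preimage_in_Ph[OF B] z by blast
    moreover have "y - a z \<in> A" using z x h(2) by blast
    ultimately show "y \<in> A + a ` Ph B" using set_plus_intro[of "y - a z" A "a z" "a ` Ph B"] by simp
  qed
  then show ?thesis unfolding dl_def
    by (intro len_finite) (use h b AB le_plus1[of "a ` Ph B" A] in \<open>simp_all add: submod_plus submod_aPh plus_least\<close>)
qed

text \<open>J/I has finite length, so the rank does not change. The image of the pullback grows by
  the length of Ph J/Ph I, which is at least that of J/I; hence the cokernel can only become
  shorter.\<close>

lemma saturate:
  assumes A: "A \<in> L" and I: "submod I" "A <= I" and J: "J \<in> L" "I <= J"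
    and c: "smul (u ^ c) ` J <= I" and stable: "a ` Ph I <= I"
  shows "rkl A I = rkl A J" and "dl A J \<le> len (A + a ` Ph I) I"
proof -
  note h = LD[OF A] and j = LD[OF J(1)]
  have fin: "len I J ~= \<infinity>" by (rule len_finite[where c = c]) (use I J h j c in auto)
  show "rkl A I = rkl A J" by (rule rkl_saturate[where r = r]) (use I J h j fin in auto)
  have e: "len (A + a ` Ph I) (A + a ` Ph J) = len (Ph I) (Ph J)"
  proof (rule len_transport[OF lin_a h(1)])
    fix y assume y: "y \<in> Ph J" "a y \<in> A"
    have "y \<in> VV r" using y(1) Ph_mono[OF j(3)] by auto
    then have "y \<in> Ph A" using preimage_in_Ph[OF A] y by blast
    then show "y \<in> Ph I" using Ph_mono[OF I(2)] by blast
  qed (use I J j in \<open>simp_all add: Ph_mono\<close>)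
  have "len I J \<le> len (Ph I) (Ph J)"
    by (rule clen_mono_map[of _ _ _ _ Ph]) (simp_all add: Ph_mono Ph_strict)
  then show "dl A J \<le> len (A + a ` Ph I) I" unfolding dl_def
    by (intro len_compare(1)[OF _ _ I(1) j(1) _ J(2) _ _ fin])
      (use I J h j stable e in \<open>simp_all add: submod_plus submod_aPh plus_least set_plus_mono2 image_mono Ph_mono\<close>)
qed

lemma saturation:
  assumes I: "submod I" "pV n r <= I" "I <= VV r" and stable: "a ` Ph I <= I"
  obtains J c where "J \<in> L" "I <= J" "smul (u ^ c) ` J <= I" "!!U. U \<in> L ==> I <= U ==> J <= U"
proof -
  define J where "J = {x \<in> VV r. \<exists>c. u ^ c *: x \<in> I}"
  have mono: "u ^ (c + d) *: x \<in> I" if "u ^ c *: x \<in> I" for c d x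
    using submod_smul[OF I(1) that, of "u ^ d"] by (simp add: smul_simps power_add mult.commute)
  have sJ: "submod J"
  proof (rule submodI)
    show "0 \<in> J" using I(1) by (auto simp: J_def submod_0 smul_simps)
  next
    fix x y assume "x \<in> J" "y \<in> J"
    then obtain c d where cd: "x \<in> VV r" "y \<in> VV r" "u ^ c *: x \<in> I" "u ^ d *: y \<in> I" by (auto simp: J_def)
    have "u ^ (c + d) *: x + u ^ (c + d) *: y \<in> I"
      using mono[OF cd(3), of d] mono[OF cd(4), of c] I(1) by (simp add: submod_add add.commute)
    then show "x + y \<in> J" using cd by (auto simp: J_def submod_add smul_simps intro!: exI[of _ "c + d"])
  next
    fix b x assume "x \<in> J"
    then obtain c where c: "x \<in> VV r" "u ^ c *: x \<in> I" by (auto simp: J_def)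
    have "u ^ c *: (b *: x) \<in> I" using submod_smul[OF I(1) c(2), of b] by (simp add: smul_simps mult.commute)
    then show "b *: x \<in> J" using c by (auto simp: J_def submod_smul)
  qed
  have IJ: "I <= J" using I by (auto simp: J_def smul_simps intro!: exI[of _ 0])
  have uJ: "usat r J"
    unfolding usat_def
  proof (intro ballI impI)
    fix x assume x: "x \<in> VV r" "u *: x \<in> J"
    then obtain c where "u ^ c *: (u *: x) \<in> I" by (auto simp: J_def)
    then have "u ^ Suc c *: x \<in> I" by (simp add: smul_simps mult.commute)
    then show "x \<in> J" using x(1) unfolding J_def by blast
  qed
  have JV: "J <= VV r" by (auto simp: J_def)
  have AJ: "pV n r <= J" using I IJ by blast
  \<comment> \<open>\<open>J\<close> is generated by finitely many vectors modulo p^n, so one power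
    of u brings all of \<open>J\<close> into \<open>I\<close>.\<close>
  obtain m g where g: "!!i. i < m ==> g i \<in> J" "J = lspan m g + pV n r" using generators_usat[OF sJ AJ JV uJ] by blast
  then have "\<forall>i. \<exists>c. i < m --> u ^ c *: g i \<in> I" by (auto simp: J_def)
  then obtain c where c: "!!i. i < m ==> u ^ c i *: g i \<in> I" by metis
  define d where "d = (\<Sum>i<m. c i)"
  have d: "u ^ d *: g i \<in> I" if "i < m" for i
  proof -
    have "c i \<le> d" unfolding d_def by (rule member_le_sum) (use that in auto)
    then show ?thesis using mono[OF c[OF that], of "d - c i"] by simp
  qed
  have dJ: "smul (u ^ d) ` J <= I"
  proof -
    have "u ^ d *: (\<Sum>i<m. b i *: g i) \<in> I" for b
    proof -
      have "u ^ d *: (\<Sum>i<m. b i *: g i) = (\<Sum>i<m. b i *: (u ^ d *: g i))"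
        by (simp add: smul_sum smul_simps mult.commute)
      also have "\<dots> \<in> I" by (rule submod_sum[OF I(1)], rule submod_smul[OF I(1)]) (use d in simp)
      finally show ?thesis .
    qed
    then have "smul (u ^ d) ` lspan m g <= I" by (auto simp: lspan_def)
    moreover have "smul (u ^ d) ` pV n r <= I" using smul_image_subset[of "pV n r"] I(2) by fastforce
    ultimately show ?thesis unfolding g(2) using I(1) by (simp add: image_plus plus_least)
  qed
  have "a ` Ph J <= J"
  proof
    fix y assume "y \<in> a ` Ph J"
    then obtain z where z: "z \<in> Ph J" "y = a z" by blast
    have "z \<in> VV r" using z Ph_mono[OF JV] by auto
    \<comment> \<open>The exponent is p d because the Frobenius turns u^d into u^(p d), and it is
      u^d that acts on the components of \<open>z\<close>.\<close>
    moreover have "u ^ (p * d) *: z \<in> Ph I"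
    proof -
      have "co j (u ^ (p * d) *: z) = u ^ d *: co j z" if "j < p" for j
        using co_phi_smul[OF that, of "u ^ d" z] by (simp add: phi_power phi_X power_mult)
      then show ?thesis using z(1) dJ by (auto simp: Ph_def)
    qed
    then have "u ^ (p * d) *: y \<in> I" using stable z(2) by (auto simp: linD(2)[OF lin_a, symmetric])
    moreover have "y \<in> VV r" using aV z(2) \<open>z \<in> VV r\<close> by blast
    ultimately show "y \<in> J" by (auto simp: J_def)
  qed
  then have "J \<in> L" using sJ AJ JV uJ by (simp add: L_def)
  moreover have "J <= U" if "U \<in> L" "I <= U" for U
    using that usat_pow[OF LD(4)[OF that(1)]] by (auto simp: J_def)
  ultimately show thesis using that IJ dJ by blast
qed

section \<open>Meets and joins of strict subobjects\<close>

lemma meet_L: "H \<in> L ==> K \<in> L ==> H \<inter> K \<in> L"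
proof -
  assume H: "H \<in> L" and K: "K \<in> L"
  have "a ` Ph (H \<inter> K) <= a ` Ph H" "a ` Ph (H \<inter> K) <= a ` Ph K" by (simp_all add: image_mono Ph_mono)
  then have "a ` Ph (H \<inter> K) <= H \<inter> K" using LD(5)[OF H] LD(5)[OF K] by blast
  moreover have "usat r (H \<inter> K)" using LD(4)[OF H] LD(4)[OF K] by (simp add: usat_def)
  moreover have "pV n r <= H \<inter> K" "H \<inter> K <= VV r" using LD[OF H] LD[OF K] by blast+
  ultimately show ?thesis using LD(1)[OF H] LD(1)[OF K] by (simp add: L_def submod_Int)
qed

text \<open>Both numerical statements first compare H + K over \<open>K\<close> with
  \<open>H\<close> over \<open>H \<inter> K\<close> by \<open>len_op_iso\<close>, and then pass to
  the saturation of H + K, where the cokernel may shrink.\<close>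

lemma join_L:
  assumes H: "H \<in> L" and K: "K \<in> L"
  obtains J where "J \<in> L" "H <= J" "K <= J" "!!U. U \<in> L ==> H <= U ==> K <= U ==> J <= U"
    "rkl K J = rkl (H \<inter> K) H" "dl K J \<le> dl (H \<inter> K) H"
proof -
  note h = LD[OF H] and k = LD[OF K]
  have PhI: "a ` Ph (H + K) = a ` Ph H + a ` Ph K" using h k by (simp add: Ph_plus image_plus lin_a)
  have I: "submod (H + K)" "H <= H + K" "K <= H + K" using h k by (simp_all add: submod_plus le_plus1 le_plus2)
  obtain J c where J: "J \<in> L" "H + K <= J" "smul (u ^ c) ` J <= H + K" "!!U. U \<in> L ==> H + K <= U ==> J <= U"
  proof (rule saturation[of "H + K"])
    show "pV n r <= H + K" using I(2) h(2) by blast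
    show "H + K <= VV r" using h k by (simp add: plus_least)
    show "a ` Ph (H + K) <= H + K" unfolding PhI using h k by (simp add: set_plus_mono2)
  qed (use I in auto)
  have st: "a ` Ph (H + K) <= H + K" unfolding PhI using h k by (simp add: set_plus_mono2)
  note s = saturate[OF K I(1,3) J(1,2,3) st]
  show thesis
  proof (rule that[OF J(1)])
    show "rkl K J = rkl (H \<inter> K) H"
      using s(1) len_op_iso[of H K "smul u ` H" "smul u ` K"] h k by (simp add: rkl_def image_plus smul_image_subset)
    show "dl K J \<le> dl (H \<inter> K) H"
      using s(2) len_op_iso[of H K "a ` Ph H" "a ` Ph K"] h k by (simp add: dl_def PhI submod_aPh)
    show "J <= U" if "U \<in> L" "H <= U" "K <= U" for U using J(4) that LD(1)[OF that(1)] by (simp add: plus_least)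
  qed (use J(2) I in blast)+
qed

definition rk :: "'w fps fvec set => nat" where "rk H = the_enat (rkl (pV n r) H)"
definition dd :: "'w fps fvec set => nat" where "dd H = the_enat (dl (pV n r) H)"
text \<open>This is the degree multiplied by its denominator e, which keeps it an integer. Since
  \<open>a\<close> is u^N times the structure map, the exponent i in the definition of the degree is
  taken to be \<open>N\<close>.\<close>

definition dg :: "'w fps fvec set => int" where "dg H = int (N * rk H) - int (dd H)"

lemma rk_enat: "H \<in> L ==> rkl (pV n r) H = enat (rk H)"
  unfolding rk_def using rkl_finite[of H n r] LD[of H] by (cases "rkl (pV n r) H") auto

lemma dd_enat: "H \<in> L ==> dl (pV n r) H = enat (dd H)"
  unfolding dd_def using dl_finite[OF pV_L[of n], of H] LD[of H] by (cases "dl (pV n r) H") auto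

lemma rkl_diff: assumes "A \<in> L" "B \<in> L" "A <= B" shows "rk A \<le> rk B" "rkl A B = enat (rk B - rk A)"
proof -
  have "rkl (pV n r) B = rkl (pV n r) A + rkl A B"
    by (rule rkl_add[where r = r]) (use assms LD[of A] LD[of B] in auto)
  then show "rk A \<le> rk B" "rkl A B = enat (rk B - rk A)"
    using rk_enat assms by (cases "rkl A B"; simp)+
qed

lemma dl_diff: assumes "A \<in> L" "B \<in> L" "A <= B" shows "dd A \<le> dd B" "dl A B = enat (dd B - dd A)"
proof -
  have "dl (pV n r) B = dl (pV n r) A + dl A B"
    using dl_add[of "pV n r" A B] pV_L[of n] assms LD[of A] by simp
  then show "dd A \<le> dd B" "dl A B = enat (dd B - dd A)"
    using dd_enat assms by (cases "dl A B"; simp)+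
qed

lemma rk_top: "rk (VV r) = n * r"
  by (simp add: rk_def rkl_top)

sublocale hn: hn_lattice L "pV n r" "VV r" rk dg
proof
  show b: "pV n r \<in> L" using pV_L by simp
  show "VV r \<in> L" by (rule top_L)
  show "pV n r <= H \<and> H <= VV r" if "H \<in> L" for H using LD[OF that] by simp
  show "rk (pV n r) = 0" using rkl_diff(2)[OF b b] rk_enat[OF b] by (simp add: zero_enat_def)
  then show "dg (pV n r) = 0" using dl_diff(2)[OF b b] dd_enat[OF b] by (simp add: dg_def zero_enat_def)
  show "H \<inter> K \<in> L" if "H \<in> L" "K \<in> L" for H K using meet_L that .
  show "rk H < rk K" if "H \<in> L" "K \<in> L" "H \<subset> K" for H K
  proof (rule ccontr)
    assume "\<not> rk H < rk K"
    then have "rkl (pV n r) K \<le> rkl (pV n r) H" using rk_enat that by simp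
    then have "H = K" by (rule rkl_eq_imp_eq[where n = n and r = r, rotated 6]) (use that LD[of H] LD[of K] in auto)
    then show False using that by simp
  qed
  show "\<exists>J\<in>L. H <= J \<and> K <= J \<and> (\<forall>U\<in>L. H <= U --> K <= U --> J <= U) \<and>
        rk (H \<inter> K) + rk J = rk H + rk K \<and> dg H + dg K \<le> dg (H \<inter> K) + dg J" if H: "H \<in> L" and K: "K \<in> L" for H K
  proof -
    obtain J where J: "J \<in> L" "H <= J" "K <= J" "!!U. U \<in> L ==> H <= U ==> K <= U ==> J <= U"
      "rkl K J = rkl (H \<inter> K) H" "dl K J \<le> dl (H \<inter> K) H" using join_L[OF H K] by blast
    have m: "H \<inter> K \<in> L" using meet_L H K .
    have 1: "rk (H \<inter> K) + rk J = rk H + rk K"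
      using J(5) rkl_diff[OF m H] rkl_diff[OF K J(1,3)] by simp
    have 2: "dd (H \<inter> K) + dd J \<le> dd H + dd K"
      using J(6) dl_diff[OF m H] dl_diff[OF K J(1,3)] by simp
    have "int (N * rk (H \<inter> K)) + int (N * rk J) = int (N * rk H) + int (N * rk K)"
      using arg_cong[OF 1, of "%k. int (N * k)"] by (simp add: distrib_left)
    then have "dg H + dg K \<le> dg (H \<inter> K) + dg J" using 2 unfolding dg_def by linarith
    then show ?thesis using 1 J by (intro bexI[of _ J]) simp_all
  qed
  show "\<exists>B. \<forall>H\<in>L. dg H \<le> B"
  proof (intro exI ballI)
    fix H assume H: "H \<in> L"
    have "rk H \<le> rk (VV r)" using rkl_diff(1)[OF H top_L] LD[OF H] by blast
    then have "int (N * rk H) \<le> int (N * rk (VV r))" by (simp only: of_nat_le_iff mult_le_mono2)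
    then show "dg H \<le> int (N * rk (VV r))" unfolding dg_def by linarith
  qed
qed

end

lemma len_image_inj:
  assumes f: "lin f" and XY: "submod X" "submod Y" "X <= Y" and inj: "!!y. y \<in> Y ==> f y = 0 ==> y = 0"
  shows "len (f ` X) (f ` Y) = len X Y"
proof -
  have z: "{0} + Z = Z" for Z :: "'a fvec set" by (auto simp: set_plus_def)
  have "submod ({0} :: 'a fvec set)" by (rule submodI) (simp_all add: smul_simps)
  then have "len ({0} + f ` X) ({0} + f ` Y) = len X Y"
  proof (rule len_transport[OF f _ XY])
    show "y \<in> X" if "y \<in> Y" "f y \<in> {0}" for y using inj[OF that(1)] that(2) XY(1) by (simp add: submod_0)
  qed
  then show ?thesis by (simp add: z)
qed

context reduction
begin

lemma p_smul_eq_0: "of_nat p ^ k *: y = 0 ==> y = (0 :: 'w fps fvec)"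
  using fps_cancel[OF p_power_neq_0, of k _ 0] by (simp add: fvec_eq_iff)

text \<open>Multiplication by p^k identifies V/pV with p^k V/p^(k+1) V compatibly with
  \<open>a\<close>, so all n layers contribute the same length.\<close>

lemma dd_top: "enat (dd (VV r)) = enat n * len (pV 1 r + a ` VV r) (VV r)"
proof -
  have one: "dl (pV (Suc k) r) (pV k r) = len (pV 1 r + a ` VV r) (VV r)" for k
  proof -
    let ?f = "smul (of_nat p ^ k) :: 'w fps fvec => _"
    have "?f ` (pV 1 r + a ` VV r) = pV (Suc k) r + a ` Ph (pV k r)"
      unfolding Ph_pV by (simp add: image_plus pV_def image_image smul_simps mult.commute linD(2)[OF lin_a])
    then have "dl (pV (Suc k) r) (pV k r) = len (?f ` (pV 1 r + a ` VV r)) (?f ` VV r)" by (simp add: dl_def pV_def)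
    also have "\<dots> = len (pV 1 r + a ` VV r) (VV r)"
      by (rule len_image_inj) (use aV pV_subset[of 1 r] p_smul_eq_0 in \<open>simp_all add: submod_plus submod_image lin_a plus_least\<close>)
    finally show ?thesis .
  qed
  have "dl (pV n r) (pV (n - j) r) = enat j * len (pV 1 r + a ` VV r) (VV r)" if "j \<le> n" for j
    using that
  proof (induction j)
    case 0
    then show ?case using dl_diff(2)[OF pV_L[of n] pV_L[of n]] by (simp add: zero_enat_def[symmetric])
  next
    case (Suc j)
    have e: "Suc (n - Suc j) = n - j" using Suc.prems by simp
    have "dl (pV n r) (pV (n - Suc j) r) = dl (pV n r) (pV (n - j) r) + dl (pV (n - j) r) (pV (n - Suc j) r)"
      by (rule dl_add) (simp_all add: pV_L pV_mono)
    also have "dl (pV (n - j) r) (pV (n - Suc j) r) = len (pV 1 r + a ` VV r) (VV r)" using one[of "n - Suc j"] e by simp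
    finally show ?case using Suc by (simp add: algebra_simps flip: one_enat_def eSuc_enat plus_1_eSuc)
  qed
  from this[of n] have "dl (pV n r) (pV 0 r) = enat n * len (pV 1 r + a ` VV r) (VV r)" by simp
  moreover have "pV 0 r = VV r" by (auto simp: pV_def smul_simps)
  ultimately show ?thesis using dd_enat[OF top_L] by simp
qed

end

section \<open>Comparison of the polygons of $M/p^{nm}$ and $M/p^n$\<close>

text \<open>Both levels share \<open>a\<close> and \<open>N\<close>, so that ranks and degrees of a
  lattice and of its layers are computed by the same formulas.\<close>

locale reduction_pair =
  A: reduction p \<rho> \<sigma> n r N a + B: reduction p \<rho> \<sigma> "n * m" r N a
  for p :: nat and \<rho> :: "'w::comm_ring_1 => 'f::field" and \<sigma> n m r N a +
  assumes m_pos: "0 < m"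
begin

lemma layer:
  assumes H: "H \<in> B.L" and k: "k < m"
  shows "\<exists>J\<in>A.L. B.rk (H \<inter> A.pV (k * n) r) = B.rk (H \<inter> A.pV (Suc k * n) r) + A.rk J \<and>
    B.dg (H \<inter> A.pV (k * n) r) \<le> B.dg (H \<inter> A.pV (Suc k * n) r) + A.dg J"
proof -
  note h = B.LD[OF H]
  let ?f = "smul (of_nat p ^ (k * n)) :: 'w fps fvec => _"
  let ?A = "A.pV n r" let ?X = "H \<inter> A.pV (k * n) r" let ?Y = "H \<inter> A.pV (Suc k * n) r"
  \<comment> \<open>Division by p^(kn) turns the layer of \<open>H\<close> into G/(G \<inter> p^n
    V), a submodule of V/p^n V.\<close>
  define G where "G = {x \<in> VV r. ?f x \<in> H}"
  have G: "submod G" "G <= VV r" using submod_vimage[of ?f H "VV r"] h(1) by (auto simp: G_def)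
  have X: "?X = ?f ` G" by (auto simp: G_def A.pV_def)
  have Y: "?Y = ?f ` (G \<inter> ?A)"
  proof
    show "?Y <= ?f ` (G \<inter> ?A)"
    proof
      fix y assume y: "y \<in> ?Y"
      then obtain w where w: "w \<in> VV r" "y = of_nat p ^ (Suc k * n) *: w" by (auto simp: A.pV_def)
      have "y = ?f (of_nat p ^ n *: w)" using w by (simp add: smul_simps power_add mult.commute)
      moreover have "of_nat p ^ n *: w \<in> ?A" using w by (simp add: A.pV_def)
      ultimately show "y \<in> ?f ` (G \<inter> ?A)" using y w by (auto simp: G_def submod_smul intro!: image_eqI[of _ _ "of_nat p ^ n *: w"])
    qed
    show "?f ` (G \<inter> ?A) <= ?Y"
      by (auto simp: G_def A.pV_def smul_simps power_add mult.commute)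
  qed
  have le: "k * n \<le> n * m" "Suc k * n \<le> n * m"
    using k mult_le_mono1[of k m n] mult_le_mono1[of "Suc k" m n] by (simp_all add: mult.commute)
  have XL: "?X \<in> B.L" "?Y \<in> B.L" using B.meet_L[OF H B.pV_L] le by blast+
  have YX: "?Y <= ?X" using A.pV_mono[of "k * n" "Suc k * n" r] by auto
  have inj: "?f y = 0 ==> y = 0" for y using A.p_smul_eq_0 .
  have PhX: "A.Ph ?X = ?f ` A.Ph G" unfolding X by (rule A.Ph_p_smul)
  have aG: "a ` A.Ph G <= G"
  proof
    fix y assume "y \<in> a ` A.Ph G"
    then obtain z where z: "z \<in> A.Ph G" "y = a z" by blast
    have zV: "z \<in> VV r" using z(1) A.Ph_mono[OF G(2)] by auto
    have "?f z \<in> A.Ph ?X" unfolding PhX using z by blast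
    then have "?f z \<in> A.Ph H" using A.Ph_mono[of ?X H] by auto
    then have "?f y \<in> H" using h(5) z(2) by (auto simp: linD(2)[OF A.lin_a, symmetric])
    then show "y \<in> G" using A.aV zV z(2) by (auto simp: G_def)
  qed
  \<comment> \<open>The image of \<open>G\<close> in V/p^n V is stable but perhaps not saturated.
    Its saturation \<open>J\<close> has the same rank and at least the same degree, which is the
    right direction for an upper bound.\<close>
  define I where "I = G + ?A"
  have I: "submod I" "?A <= I" "G <= I" using G by (simp_all add: I_def submod_plus le_plus1 le_plus2)
  have IV: "I <= VV r" unfolding I_def using G A.pV_subset[of n r] by (simp add: plus_least)
  have aPhI: "a ` A.Ph I = a ` A.Ph G + a ` A.Ph ?A" unfolding I_def using G by (simp add: A.Ph_plus image_plus A.lin_a)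
  have aI: "a ` A.Ph I <= I" unfolding aPhI unfolding I_def using aG A.a_pV[of n] by (simp add: set_plus_mono2)
  obtain J c where J: "J \<in> A.L" "I <= J" "smul (A.u ^ c) ` J <= I" 
    by (rule A.saturation[OF I(1,2) IV aI], rule that)
  note s = A.saturate[OF A.pV_L[OF order_refl] I(1,2) J aI]
  have "A.rkl ?Y ?X = len (?f ` ((G \<inter> ?A) + smul A.u ` G)) (?f ` G)"
    unfolding A.rkl_def X Y by (simp add: image_plus lin_image_smul[of ?f A.u G])
  also have "\<dots> = len ((G \<inter> ?A) + smul A.u ` G) G"
    by (rule len_image_inj) (use G inj in \<open>simp_all add: submod_plus submod_Int plus_least smul_image_subset\<close>)
  also have "\<dots> = A.rkl ?A I"
    unfolding A.rkl_def I_def using len_op_iso[of G ?A "smul A.u ` G" "smul A.u ` ?A"] G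
    by (simp add: image_plus smul_image_subset)
  also have "\<dots> = A.rkl ?A J" by (rule s(1))
  finally have 1: "A.rkl ?Y ?X = enat (A.rk J)" using A.rk_enat[OF J(1)] by simp
  have "B.dl ?Y ?X = len (?f ` ((G \<inter> ?A) + a ` A.Ph G)) (?f ` G)"
    unfolding B.dl_def PhX unfolding X Y by (simp add: image_plus image_image linD(2)[OF A.lin_a])
  also have "\<dots> = len ((G \<inter> ?A) + a ` A.Ph G) G"
    by (rule len_image_inj) (use G inj aG in \<open>simp_all add: submod_plus submod_Int plus_least A.submod_aPh\<close>)
  also have "\<dots> = len (?A + a ` A.Ph I) I"
    unfolding aPhI unfolding I_def using len_op_iso[of G ?A "a ` A.Ph G" "a ` A.Ph ?A"] G aG A.a_pV[of n]
    by (simp add: A.submod_aPh submod_image A.lin_a)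
  also have "\<dots> \<ge> A.dl ?A J" by (rule s(2))
  finally have 2: "enat (A.dd J) \<le> B.dl ?Y ?X" using A.dd_enat[OF J(1)] by simp
  note r = B.rkl_diff[OF XL(2,1) YX] and d = B.dl_diff[OF XL(2,1) YX]
  have rr: "B.rk ?X = B.rk ?Y + A.rk J" using r 1 by simp
  have dd: "B.dd ?Y + A.dd J \<le> B.dd ?X" using d 2 by simp
  have "int (N * B.rk ?X) = int (N * B.rk ?Y) + int (N * A.rk J)"
    unfolding rr by (simp add: distrib_left)
  then have "B.dg ?X \<le> B.dg ?Y + A.dg J" using dd unfolding B.dg_def A.dg_def by linarith
  then show ?thesis using rr J(1) by blast
qed

lemma concave_scaled: "concave_on {0..real (n * m * r)} (%x. real m * A.hn.hn (x / real m))"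
  unfolding concave_on_iff
proof (intro conjI ballI allI impI)
  fix x y s t :: real
  assume x: "x \<in> {0..real (n * m * r)}" and y: "y \<in> {0..real (n * m * r)}" and st: "0 \<le> s" "0 \<le> t" "s + t = 1"
  have "x / real m \<in> {0..real (A.rk (VV r))}" "y / real m \<in> {0..real (A.rk (VV r))}"
    using x y m_pos by (auto simp: A.rk_top divide_simps mult_ac)
  then have "s * A.hn.hn (x / real m) + t * A.hn.hn (y / real m) \<le> A.hn.hn (s *\<^sub>R (x / real m) + t *\<^sub>R (y / real m))"
    using A.hn.hn_concave st unfolding concave_on_iff by blast
  then have "real m * (s * A.hn.hn (x / real m) + t * A.hn.hn (y / real m)) \<le> real m * A.hn.hn (s *\<^sub>R (x / real m) + t *\<^sub>R (y / real m))"
    by (intro mult_left_mono) auto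
  then show "s * (real m * A.hn.hn (x / real m)) + t * (real m * A.hn.hn (y / real m)) \<le> real m * A.hn.hn ((s *\<^sub>R x + t *\<^sub>R y) / real m)"
    by (simp add: algebra_simps add_divide_distrib)
qed simp

text \<open>By minimality of the polygon modulo p^(nm) it suffices to bound the degree of each
  \<open>H\<close>. Its \<open>m\<close> layers give \<open>m\<close> points on or below the polygon
  modulo p^n, and Jensen's inequality with weights 1/m moves them to their mean rank.\<close>

lemma hn_le: assumes x: "x \<in> {0..real (n * m * r)}" shows "B.hn.hn x \<le> real m * A.hn.hn (x / real m)"
proof (rule B.hn.hn_least)
  show "x \<in> {0..real (B.rk (VV r))}" using x by (simp add: B.rk_top)
  show "concave_on {0..real (B.rk (VV r))} (%x. real m * A.hn.hn (x / real m))"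
    using concave_scaled by (simp add: B.rk_top)
next
  fix H assume H: "H \<in> B.L"
  let ?X = "%k. H \<inter> A.pV (k * n) r"
  have "\<forall>k. \<exists>J. k < m --> J \<in> A.L \<and> B.rk (?X k) = B.rk (?X (Suc k)) + A.rk J \<and> B.dg (?X k) \<le> B.dg (?X (Suc k)) + A.dg J"
    using layer[OF H] by blast
  then obtain J where J: "!!k. k < m ==> J k \<in> A.L \<and> B.rk (?X k) = B.rk (?X (Suc k)) + A.rk (J k) \<and> B.dg (?X k) \<le> B.dg (?X (Suc k)) + A.dg (J k)"
    by metis
  have "A.pV 0 r = VV r" by (auto simp: A.pV_def smul_simps)
  then have X0: "?X 0 = H" using B.LD[OF H] by auto
  have Xm: "?X m = A.pV (n * m) r" using B.LD[OF H] by (auto simp: mult.commute)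
  have r: "B.rk H = B.rk (?X k) + (\<Sum>j<k. A.rk (J j))" if "k \<le> m" for k
    using that by (induction k) (use X0 J in auto)
  have d: "B.dg H \<le> B.dg (?X k) + (\<Sum>j<k. A.dg (J j))" if "k \<le> m" for k
    using that
  proof (induction k)
    case (Suc k)
    then show ?case using J[of k] by simp
  qed (use X0 in simp)
  have rH: "real (B.rk H) = (\<Sum>j<m. real (A.rk (J j)))" using r[of m] Xm B.hn.rk_bt by simp
  have "B.dg H \<le> (\<Sum>j<m. A.dg (J j))" using d[of m] Xm B.hn.dg_bt by simp
  then have "real_of_int (B.dg H) \<le> real_of_int (\<Sum>j<m. A.dg (J j))" by (simp only: of_int_le_iff)
  also have "\<dots> \<le> (\<Sum>j<m. A.hn.hn (real (A.rk (J j))))"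
    unfolding of_int_sum by (rule sum_mono, rule A.hn.hn_bound) (use J in simp)
  also have "\<dots> = real m * (\<Sum>j<m. (1 / real m) * A.hn.hn (real (A.rk (J j))))"
    using m_pos by (simp add: sum_distrib_left)
  also have "\<dots> \<le> real m * A.hn.hn (\<Sum>j<m. (1 / real m) *\<^sub>R real (A.rk (J j)))"
  proof (intro mult_left_mono concave_on_sum[OF _ _ A.hn.hn_concave])
    fix j assume "j \<in> {..<m}"
    then have "A.rk (J j) \<le> A.rk (VV r)" using J[of j] A.hn.rk_mono[of "J j" "VV r"] A.LD[of "J j"] A.top_L by auto
    then show "real (A.rk (J j)) \<in> {0..real (A.rk (VV r))}" by simp
  qed (use m_pos in auto)
  also have "(\<Sum>j<m. (1 / real m) *\<^sub>R real (A.rk (J j))) = real (B.rk H) / real m"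
    unfolding rH by (simp add: sum_divide_distrib)
  finally show "real_of_int (B.dg H) \<le> real m * A.hn.hn (real (B.rk H) / real m)" .
qed

end

section \<open>Presentations of modules by vectors\<close>

lemma SS_simps [simp]:
  "carrier (ring_of_type_algebra :: 'a::comm_ring_1 ring) = UNIV"
  "x \<otimes>\<^bsub>ring_of_type_algebra\<^esub> y = x * (y :: 'a)" "x \<oplus>\<^bsub>ring_of_type_algebra\<^esub> y = x + (y :: 'a)"
  "\<one>\<^bsub>ring_of_type_algebra\<^esub> = (1 :: 'a)" "\<zero>\<^bsub>ring_of_type_algebra\<^esub> = (0 :: 'a)"
  by (simp_all add: ring_of_type_algebra_def)

abbreviation RT :: "'a::comm_ring_1 ring" where "RT \<equiv> ring_of_type_algebra"

lemma cring_RT: "cring (RT :: 'a::comm_ring_1 ring)"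
  by (rule cring_from_type_algebra)

text \<open>\<open>q\<close> induces an isomorphism from B/A onto \<open>M\<close>. Quotients change
  the element type of a module, whereas their presentations remain in one type of vectors.\<close>

definition presents :: "('a::comm_ring_1, 'b) module => 'a fvec set => 'a fvec set => ('a fvec => 'b) => bool" where
  "presents M A B q \<longleftrightarrow> submod A \<and> submod B \<and> A <= B \<and> carrier M = q ` B \<and> \<zero>\<^bsub>M\<^esub> = q 0 \<and>
     (\<forall>x\<in>B. \<forall>y\<in>B. q x \<oplus>\<^bsub>M\<^esub> q y = q (x + y)) \<and> (\<forall>c. \<forall>x\<in>B. c \<odot>\<^bsub>M\<^esub> q x = q (c *: x)) \<and>
     (\<forall>x\<in>B. \<forall>y\<in>B. q x = q y \<longleftrightarrow> x - y \<in> A)"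

lemma presentsD:
  assumes "presents M A B q"
  shows "submod A" "submod B" "A <= B" "carrier M = q ` B" "\<zero>\<^bsub>M\<^esub> = q 0"
    "!!x y. x \<in> B ==> y \<in> B ==> q x \<oplus>\<^bsub>M\<^esub> q y = q (x + y)" "!!c x. x \<in> B ==> c \<odot>\<^bsub>M\<^esub> q x = q (c *: x)"
    "!!x y. x \<in> B ==> y \<in> B ==> q x = q y \<longleftrightarrow> x - y \<in> A"
  using assms unfolding presents_def by simp_all

lemma presents_zero_iff: "presents M A B q ==> x \<in> B ==> q x = \<zero>\<^bsub>M\<^esub> \<longleftrightarrow> x \<in> A"
  using presentsD(8)[of M A B q x 0] by (simp add: presentsD(2,5) submod_0)

lemma presents_image_mem: "presents M A B q ==> submod X ==> A <= X ==> X <= B ==> x \<in> B ==> q x \<in> q ` X \<longleftrightarrow> x \<in> X"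
proof
  assume P: "presents M A B q" "submod X" "A <= X" "X <= B" "x \<in> B" and "q x \<in> q ` X"
  then obtain y where y: "y \<in> X" "q x = q y" by blast
  then have "x - y \<in> A" using presentsD(8)[OF P(1), of x y] P by blast
  then show "x \<in> X" using submod_diff_iff[OF P(2), of x y] y P(3) by blast
qed simp

lemma presents_module:
  assumes P: "presents M A B q" shows "Module.module RT M"
proof (rule moduleI)
  note d = presentsD[OF P]
  show "cring RT" by (rule cring_RT)
  show "abelian_group M"
  proof (rule abelian_groupI)
    fix x assume "x \<in> carrier M"
    then obtain a where a: "a \<in> B" "x = q a" using d(4) by auto
    have "q (- a) \<oplus>\<^bsub>M\<^esub> x = \<zero>\<^bsub>M\<^esub>" using a d by (simp add: submod_uminus)
    then show "\<exists>y\<in>carrier M. y \<oplus>\<^bsub>M\<^esub> x = \<zero>\<^bsub>M\<^esub>" using a d(2,4)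
      by (intro bexI[of _ "q (- a)"]) (simp_all add: submod_uminus)
  qed (use d in \<open>auto simp: submod_closed add_ac\<close>)
qed (use presentsD[OF P] in \<open>auto simp: submod_closed smul_simps mult.commute\<close>)

lemma presents_sub:
  assumes P: "presents M A B q" and X: "submod X" "A <= X" "X <= B"
  shows "presents (M\<lparr>carrier := q ` X\<rparr>) A X q"
  using presentsD[OF P] X unfolding presents_def by (auto simp: subset_iff)

lemma presents_coset:
  assumes P: "presents M A B q" and X: "submod X" "A <= X" "X <= B" and x: "x \<in> B"
  shows "q ` X +>\<^bsub>M\<^esub> q x = q ` {z \<in> B. z - x \<in> X}"
proof -
  note d = presentsD[OF P]
  have "q ` X +>\<^bsub>M\<^esub> q x = (\<Union>w\<in>X. {q w \<oplus>\<^bsub>M\<^esub> q x})" by (simp add: a_r_coset_def r_coset_def)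
  also have "\<dots> = (%w. q (w + x)) ` X"
  proof -
    have "q w \<oplus>\<^bsub>M\<^esub> q x = q (w + x)" if "w \<in> X" for w using d(6)[of w x] that X x by blast
    then show ?thesis by (simp add: UNION_singleton_eq_range cong: image_cong)
  qed
  also have "\<dots> = q ` {z \<in> B. z - x \<in> X}"
  proof
    show "(%w. q (w + x)) ` X <= q ` {z \<in> B. z - x \<in> X}" using X x d(2) by (auto intro!: imageI submod_add)
    show "q ` {z \<in> B. z - x \<in> X} <= (%w. q (w + x)) ` X"
    proof
      fix y assume "y \<in> q ` {z \<in> B. z - x \<in> X}"
      then obtain z where "z - x \<in> X" "y = q z" by blast
      then show "y \<in> (%w. q (w + x)) ` X" by (intro image_eqI[of _ _ "z - x"]) simp_all
    qed
  qed
  finally show ?thesis .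
qed

lemma coset_class_eq:
  assumes P: "presents M A B q" and X: "submod X" "A <= X" "X <= B" and xy: "x \<in> B" "y \<in> B"
  shows "q ` X +>\<^bsub>M\<^esub> q x = q ` X +>\<^bsub>M\<^esub> q y \<longleftrightarrow> x - y \<in> X"
  unfolding presents_coset[OF P X xy(1)] presents_coset[OF P X xy(2)]
proof
  note d = presentsD[OF P]
  assume e: "q ` {z \<in> B. z - x \<in> X} = q ` {z \<in> B. z - y \<in> X}"
  have "q x \<in> q ` {z \<in> B. z - x \<in> X}" using xy X by (simp add: submod_0)
  then obtain z where z: "z \<in> B" "z - y \<in> X" "q x = q z" using e by auto
  then have "x - z \<in> X" using d(8) xy X by blast
  then have "(x - z) + (z - y) \<in> X" using z X by (intro submod_add)
  then show "x - y \<in> X" by simp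
next
  assume a: "x - y \<in> X"
  have "z - x \<in> X \<longleftrightarrow> z - y \<in> X" for z
    using submod_diff_iff[OF X(1), of "z - y" "z - x"] a by simp
  then show "q ` {z \<in> B. z - x \<in> X} = q ` {z \<in> B. z - y \<in> X}" by simp
qed

lemma presents_quot:
  assumes P: "presents M A B q" and X: "submod X" "A <= X" "X <= B"
  shows "presents (quot_module M (q ` X)) X B (%x. q ` X +>\<^bsub>M\<^esub> q x)"
proof -
  note d = presentsD[OF P]
  let ?c = "%x. q ` X +>\<^bsub>M\<^esub> q x"
  note c = presents_coset[OF P X]
  have add: "set_add M (?c x) (?c y) = ?c (x + y)" if xy: "x \<in> B" "y \<in> B" for x y
  proof
    show "set_add M (?c x) (?c y) <= ?c (x + y)"
    proof
      fix w assume "w \<in> set_add M (?c x) (?c y)"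
      then obtain z z' where z: "z \<in> B" "z - x \<in> X" "z' \<in> B" "z' - y \<in> X" "w = q z \<oplus>\<^bsub>M\<^esub> q z'"
        using c xy by (auto simp: set_add_def set_mult_def)
      have "(z - x) + (z' - y) \<in> X" using z X by (intro submod_add)
      then have "(z + z') - (x + y) \<in> X" by (simp add: algebra_simps)
      then show "w \<in> ?c (x + y)" using z d c[of "x + y"] xy by (auto simp: submod_add)
    qed
    show "?c (x + y) <= set_add M (?c x) (?c y)"
    proof
      fix w assume "w \<in> ?c (x + y)"
      then obtain z where z: "z \<in> B" "z - (x + y) \<in> X" "w = q z" using c[of "x + y"] xy d by (auto simp: submod_add)
      have "w = q (z - y) \<oplus>\<^bsub>M\<^esub> q y" using z d xy by (simp add: submod_diff)
      moreover have "q (z - y) \<in> ?c x" using z xy d c[of x] by (auto simp: submod_diff algebra_simps)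
      moreover have "q y \<in> ?c y" using xy X c[of y] by (auto simp: submod_0)
      ultimately show "w \<in> set_add M (?c x) (?c y)" by (auto simp: set_add_def set_mult_def)
    qed
  qed
  have smult: "(\<Union>y\<in>?c x. q ` X +>\<^bsub>M\<^esub> (r \<odot>\<^bsub>M\<^esub> y)) = ?c (r *: x)" if x: "x \<in> B" for r x
  proof -
    have "q ` X +>\<^bsub>M\<^esub> (r \<odot>\<^bsub>M\<^esub> y) = ?c (r *: x)" if y: "y \<in> ?c x" for y
    proof -
      obtain z where z: "z \<in> B" "z - x \<in> X" "y = q z" using y c[OF x] by auto
      have "r *: z - r *: x \<in> X" using submod_smul[OF X(1) z(2), of r] by (simp add: smul_simps)
      then show ?thesis using coset_class_eq[OF P X, of "r *: z" "r *: x"] z x d by (simp add: submod_smul)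
    qed
    moreover have "?c x ~= {}" using x X c[OF x] by (auto simp: submod_0)
    ultimately show ?thesis by auto
  qed
  have "?c 0 = q ` X" using c[of 0] d X by (auto simp: submod_0)
  moreover have "a_rcosets\<^bsub>M\<^esub> (q ` X) = ?c ` B" by (auto simp: A_RCOSETS_def RCOSETS_def a_r_coset_def d(4))
  ultimately show ?thesis
    unfolding presents_def quot_module_def using X d add smult coset_class_eq[OF P X] by simp
qed

lemma submodule_iff:
  assumes P: "presents M A B q"
  shows "submodule H RT M \<longleftrightarrow> (\<exists>X. submod X \<and> A <= X \<and> X <= B \<and> H = q ` X)"
proof
  note d = presentsD[OF P]
  assume H: "submodule H RT M"
  note h = module.submoduleE[OF presents_module[OF P] H]
  define X where "X = {x \<in> B. q x \<in> H}"
  have "submod X"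
  proof (rule submodI)
    have "\<zero>\<^bsub>M\<^esub> \<in> H" using subgroup.one_closed[OF submodule.axioms(1)[OF H]] by simp
    then show "0 \<in> X" using d by (simp add: X_def submod_0)
  next
    fix x y assume "x \<in> X" "y \<in> X"
    then show "x + y \<in> X" using h(5) d(6) d(2) by (auto simp: X_def submod_add simp flip: d(6))
  next
    fix c x assume "x \<in> X"
    then show "c *: x \<in> X" using h(4) d(2) by (auto simp: X_def submod_smul simp flip: d(7))
  qed
  moreover have "A <= X"
  proof
    fix x assume "x \<in> A"
    then have "x \<in> B" "q x = \<zero>\<^bsub>M\<^esub>" using presents_zero_iff[OF P] d(3) by auto
    then show "x \<in> X" using subgroup.one_closed[OF submodule.axioms(1)[OF H]] by (simp add: X_def)
  qed
  moreover have "H = q ` X" using h(1) d(4) by (auto simp: X_def)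
  moreover have "X <= B" by (auto simp: X_def)
  ultimately show "\<exists>X. submod X \<and> A <= X \<and> X <= B \<and> H = q ` X" by (intro exI[of _ X] conjI)
next
  note d = presentsD[OF P]
  assume "\<exists>X. submod X \<and> A <= X \<and> X <= B \<and> H = q ` X"
  then obtain X where X: "submod X" "A <= X" "X <= B" "H = q ` X" by blast
  interpret Module.module RT M by (rule presents_module[OF P])
  show "submodule H RT M"
  proof (rule submoduleI)
    fix a assume "a \<in> H"
    then obtain x where x: "x \<in> X" "a = q x" using X by blast
    have xB: "x \<in> B" "- x \<in> B" "- x \<in> X" using x X d(2) by (auto simp: submod_uminus)
    have "q (- x) \<oplus>\<^bsub>M\<^esub> a = \<zero>\<^bsub>M\<^esub>" using xB x(2) d by simp
    then have "\<ominus>\<^bsub>M\<^esub> a = q (- x)" using xB x(2) d(4) by (intro minus_equality) auto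
    then show "\<ominus>\<^bsub>M\<^esub> a \<in> H" using X(4) xB by simp
  next
    fix a b assume "a \<in> H" "b \<in> H"
    then obtain x y where "x \<in> X" "y \<in> X" "a = q x" "b = q y" using X(4) by blast
    moreover have "x \<in> B" "y \<in> B" using calculation X by auto
    ultimately have "a \<oplus>\<^bsub>M\<^esub> b = q (x + y)" "x + y \<in> X" using X d(6) by (simp_all add: submod_add)
    then show "a \<oplus>\<^bsub>M\<^esub> b \<in> H" using X by simp
  next
    fix c x assume "x \<in> H"
    then obtain y where "y \<in> X" "x = q y" using X(4) by blast
    then show "c \<odot>\<^bsub>M\<^esub> x \<in> H" using X d(7)[of y c] by (auto simp: submod_smul)
  qed (use X d in \<open>auto simp: submod_0\<close>)
qed

lemma module_length_clen: "module_length R M = clen (%H. submodule H R M) {} UNIV"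
  by (simp add: module_length_def clen_def has_chain_def)

lemma module_length_eq:
  assumes P: "presents M A B q" shows "module_length RT M = len A B"
proof (rule antisym)
  note d = presentsD[OF P]
  have vim: "{x \<in> B. q x \<in> q ` X} = X" if "submod X" "A <= X" "X <= B" for X
    using presents_image_mem[OF P that] that(3) by blast
  show "module_length RT M \<le> len A B"
    unfolding module_length_clen
  proof (rule clen_mono_map[of _ _ _ _ "%H. {x \<in> B. q x \<in> H}"])
    fix C assume "submodule C RT M"
    then obtain X where "submod X" "A <= X" "X <= B" "C = q ` X" using submodule_iff[OF P] by blast
    then show "submod {x \<in> B. q x \<in> C} \<and> A <= {x \<in> B. q x \<in> C} \<and> {x \<in> B. q x \<in> C} <= B" using vim by simp
  next
    fix C D assume "submodule C RT M" "submodule D RT M" and CD: "C \<subset> D"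
    then obtain X Y where X: "submod X" "A <= X" "X <= B" "C = q ` X" and Y: "submod Y" "A <= Y" "Y <= B" "D = q ` Y"
      using submodule_iff[OF P] by metis
    have "X <= Y" using CD vim[OF X(1-3)] vim[OF Y(1-3)] X(4) Y(4) by blast
    moreover have "X ~= Y" using CD X(4) Y(4) by blast
    ultimately show "{x \<in> B. q x \<in> C} \<subset> {x \<in> B. q x \<in> D}" using vim X Y by blast
  qed
  show "len A B \<le> module_length RT M"
    unfolding module_length_clen
  proof (rule clen_mono_map[of _ _ _ _ "%X. q ` X"])
    fix X Y assume X: "submod X" "submod Y" "A <= X" "X \<subset> Y" "Y <= B"
    then have "A <= Y" "X <= B" by blast+
    then have "X = {x \<in> B. q x \<in> q ` X}" "Y = {x \<in> B. q x \<in> q ` Y}" using vim[of X] vim[of Y] X by simp_all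
    then have "q ` X ~= q ` Y" using X(4) by fastforce
    then show "q ` X \<subset> q ` Y" using X(4) by blast
  qed (use submodule_iff[OF P] in auto)
qed

lemma image_plus_ker:
  assumes P: "presents M A B q" and X: "submod X" "X <= B" shows "q ` (A + X) = q ` X"
proof
  note d = presentsD[OF P]
  show "q ` (A + X) <= q ` X"
  proof
    fix y assume "y \<in> q ` (A + X)"
    then obtain a x where ax: "a \<in> A" "x \<in> X" "y = q (a + x)" by (auto simp: set_plus_def)
    have "a + x \<in> B" "x \<in> B" using ax X d(2,3) by (auto intro: submod_add)
    then have "q (a + x) = q x" using ax d(8)[of "a + x" x] by simp
    then show "y \<in> q ` X" using ax by simp
  qed
  show "q ` X <= q ` (A + X)" using le_plus2[OF d(1)] by (intro image_mono)
qed

lemma smult_image: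
  assumes P: "presents M A B q" shows "(%x. c \<odot>\<^bsub>M\<^esub> x) ` carrier M = q ` (A + smul c ` B)"
proof -
  note d = presentsD[OF P]
  have "(%x. c \<odot>\<^bsub>M\<^esub> x) ` carrier M = q ` (smul c ` B)" unfolding d(4) image_image using d(7) by (intro image_cong) auto
  also have "\<dots> = q ` (A + smul c ` B)"
    using image_plus_ker[OF P, of "smul c ` B"] d(2) by (simp add: smul_image_subset)
  finally show ?thesis .
qed

text \<open>On M/uM a power series acts through its constant coefficient, so the submodules over
  W(F) and over \<SS> are the same.\<close>

lemma residue_length:
  fixes M :: "('w::comm_ring_1 fps, 'b) module"
  assumes P: "presents M A B q"
  shows "module_length (RT :: 'w ring) (restrict_scalars fps_const (quot_module M ((%x. fps_X \<odot>\<^bsub>M\<^esub> x) ` carrier M)))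
     = len (A + smul fps_X ` B) B"
proof -
  note d = presentsD[OF P]
  let ?X = "A + smul fps_X ` B"
  have X: "submod ?X" "A <= ?X" "?X <= B"
    using d by (simp_all add: submod_plus submod_image le_plus1 plus_least smul_image_subset)
  let ?Q = "quot_module M ((%x. fps_X \<odot>\<^bsub>M\<^esub> x) ` carrier M)"
  let ?q = "%x. q ` ?X +>\<^bsub>M\<^esub> q x"
  have Q: "presents ?Q ?X B ?q" unfolding smult_image[OF P] by (rule presents_quot[OF P X])
  note e = presentsD[OF Q]
  have am: "subgroup H (add_monoid (restrict_scalars fps_const ?Q)) \<longleftrightarrow> subgroup H (add_monoid ?Q)" for H
    by (simp add: subgroup_def m_inv_def restrict_scalars_def)
  have "submodule H (RT :: 'w ring) (restrict_scalars fps_const ?Q) \<longleftrightarrow> submodule H RT ?Q" for H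
  proof
    assume H: "submodule H (RT :: 'w ring) (restrict_scalars fps_const ?Q)"
    show "submodule H RT ?Q"
      unfolding submodule_def submodule_axioms_def
    proof (intro conjI allI impI)
      show sg: "subgroup H (add_monoid ?Q)" using H by (simp add: submodule_def am)
      fix c :: "'w fps" and x assume x: "x \<in> H"
      then have "x \<in> carrier ?Q" using subgroup.subset[OF sg] by auto
      then obtain y where y: "y \<in> B" "x = ?q y" using e(4) by auto
      let ?c = "fps_const (fps_nth c 0)"
      have "c = ?c + fps_X * fps_shift 1 c" by (rule fps_ext) (auto simp: fps_X_mult_nth split: nat.splits)
      then have "c *: y - ?c *: y = fps_X *: (fps_shift 1 c *: y)"
        by (metis add_diff_cancel_left' smul_simps(4,5))
      moreover have "fps_X *: (fps_shift 1 c *: y) \<in> ?X"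
        using y d le_plus2[OF d(1), of "smul fps_X ` B"] by (auto simp: submod_smul)
      ultimately have "?q (c *: y) = ?q (?c *: y)" using e(8)[of "c *: y" "?c *: y"] y d by (simp add: submod_smul)
      then have "c \<odot>\<^bsub>?Q\<^esub> x = ?c \<odot>\<^bsub>?Q\<^esub> x" using e(7)[OF y(1)] y by simp
      moreover have "?c \<odot>\<^bsub>?Q\<^esub> x \<in> H"
        using submodule.smult_closed[OF H _ x, of "fps_nth c 0"] by (simp add: restrict_scalars_def)
      ultimately show "c \<odot>\<^bsub>?Q\<^esub> x \<in> H" by simp
    qed
  next
    assume H: "submodule H RT ?Q"
    show "submodule H (RT :: 'w ring) (restrict_scalars fps_const ?Q)"
      unfolding submodule_def submodule_axioms_def
      using H submodule.smult_closed[OF H] by (simp add: submodule_def am) (simp add: restrict_scalars_def)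
  qed
  then have "module_length (RT :: 'w ring) (restrict_scalars fps_const ?Q) = module_length RT ?Q"
    by (simp add: module_length_def)
  then show ?thesis using module_length_eq[OF Q] by simp
qed

section \<open>Localizations of presented modules\<close>

definition mulset :: "'a::comm_ring_1 set => bool" where
  "mulset T \<longleftrightarrow> 1 \<in> T \<and> (\<forall>s\<in>T. \<forall>t\<in>T. s * t \<in> T)"

lemma mulsetD: "mulset T ==> 1 \<in> T" "mulset T ==> s \<in> T ==> t \<in> T ==> s * t \<in> T"
  by (simp_all add: mulset_def)

lemma fraction_alt:
  assumes P: "presents M A B q" and x: "x \<in> B"
  shows "fraction T M (q x) t = {(q y, s) | y s. y \<in> B \<and> s \<in> T \<and> (\<exists>v\<in>T. v *: (s *: x - t *: y) \<in> A)}"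
proof -
  note d = presentsD[OF P]
  have e: "v \<odot>\<^bsub>M\<^esub> (s \<odot>\<^bsub>M\<^esub> q x) = v \<odot>\<^bsub>M\<^esub> (t \<odot>\<^bsub>M\<^esub> q y) \<longleftrightarrow> v *: (s *: x - t *: y) \<in> A" if "y \<in> B" for v s y
    using d(8)[of "v *: s *: x" "v *: t *: y"] that x d(2) by (simp add: d(7) submod_smul smul_simps)
  show ?thesis unfolding fraction_def d(4) using e by auto blast+
qed

lemma frac_eq:
  assumes P: "presents M A B q" and T: "mulset T" and x: "x \<in> B" "t \<in> T" and y: "y \<in> B" "s \<in> T"
  shows "fraction T M (q x) t = fraction T M (q y) s \<longleftrightarrow> (\<exists>v\<in>T. v *: (s *: x - t *: y) \<in> A)"
proof
  note d = presentsD[OF P]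
  assume e: "fraction T M (q x) t = fraction T M (q y) s"
  have "(q y, s) \<in> fraction T M (q y) s"
    unfolding fraction_alt[OF P y(1)] using y mulsetD(1)[OF T] d(1) by (force simp: submod_0 smul_simps)
  then have "(q y, s) \<in> fraction T M (q x) t" using e by simp
  then obtain y' v where y': "y' \<in> B" "q y = q y'" "v \<in> T" "v *: (s *: x - t *: y') \<in> A"
    unfolding fraction_alt[OF P x(1)] by auto
  have "y' - y \<in> A" using d(8)[of y' y] y' y by simp
  then have "(v * t) *: (y' - y) \<in> A" using d(1) by (rule_tac submod_smul)
  then have "v *: (s *: x - t *: y') + (v * t) *: (y' - y) \<in> A" using y' d(1) by (intro submod_add)
  moreover have "v *: (s *: x - t *: y') + (v * t) *: (y' - y) = v *: (s *: x - t *: y)"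
    by (simp add: smul_simps)
  ultimately show "\<exists>v\<in>T. v *: (s *: x - t *: y) \<in> A" using y'(3) by auto
next
  note d = presentsD[OF P]
  have sub: "fraction T M (q x) t <= fraction T M (q y) s"
    if x: "x \<in> B" "t \<in> T" and y: "y \<in> B" "s \<in> T" and v: "v \<in> T" "v *: (s *: x - t *: y) \<in> A" for x y s t v
  proof
    fix e assume "e \<in> fraction T M (q x) t"
    then obtain z w v' where z: "e = (q z, w)" "z \<in> B" "w \<in> T" "v' \<in> T" "v' *: (w *: x - t *: z) \<in> A"
      unfolding fraction_alt[OF P x(1)] by auto
    have "(v * s) *: (v' *: (w *: x - t *: z)) - (v' * w) *: (v *: (s *: x - t *: y)) \<in> A"
      by (rule submod_diff[OF d(1) submod_smul[OF d(1) z(5)] submod_smul[OF d(1) v(2)]])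
    also have "(v * s) *: (v' *: (w *: x - t *: z)) - (v' * w) *: (v *: (s *: x - t *: y)) = (v * v' * t) *: (w *: y - s *: z)"
      by (rule fvec_eqI) (simp add: algebra_simps)
    finally have "(v * v' * t) *: (w *: y - s *: z) \<in> A" .
    moreover have "v * v' * t \<in> T" using v z x T by (simp add: mulsetD)
    ultimately show "e \<in> fraction T M (q y) s" unfolding fraction_alt[OF P y(1)] using z by blast
  qed
  assume "\<exists>v\<in>T. v *: (s *: x - t *: y) \<in> A"
  then obtain v where v: "v \<in> T" "v *: (s *: x - t *: y) \<in> A" by blast
  have "- (v *: (s *: x - t *: y)) \<in> A" using v d(1) by (intro submod_uminus)
  then have "v *: (t *: y - s *: x) \<in> A" by (simp add: smul_simps)
  then show "fraction T M (q x) t = fraction T M (q y) s" using sub[OF x y v] sub[OF y x v(1)] by blast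
qed

lemma frac_mem:
  assumes P: "presents M A B q" and T: "mulset T" and x: "x \<in> B" "t \<in> T" and e: "(m, s) \<in> fraction T M (q x) t"
  obtains y where "m = q y" "y \<in> B" "s \<in> T" "fraction T M (q y) s = fraction T M (q x) t"
proof -
  obtain y v where y: "m = q y" "y \<in> B" "s \<in> T" "v \<in> T" "v *: (s *: x - t *: y) \<in> A"
    using e unfolding fraction_alt[OF P x(1)] by auto
  then have "fraction T M (q y) s = fraction T M (q x) t" using frac_eq[OF P T x, of y s] by blast
  then show thesis using that y by blast
qed

lemma frac_self: "presents M A B q ==> mulset T ==> x \<in> B ==> t \<in> T ==> (q x, t) \<in> fraction T M (q x) t"
  using mulsetD(1)[of T] presentsD(1)[of M A B q] by (force simp: fraction_alt submod_0 smul_simps)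

lemma carrier_loc: "presents M A B q ==> carrier (loc_module RT T M) = {fraction T M (q x) t | x t. x \<in> B \<and> t \<in> T}"
  by (auto simp: loc_module_def presentsD(4))

text \<open>The operations of \<open>loc_module\<close> are unions over all representatives. They
  are evaluated by showing that every pair of representatives contributes the same class.\<close>

lemma UN_pairs_const:
  assumes "(m0, t0) \<in> Z" "(n0, s0) \<in> Y" "!!m t n s. (m, t) \<in> Z ==> (n, s) \<in> Y ==> F m t n s = C"
  shows "(\<Union>(m, t)\<in>Z. \<Union>(n, s)\<in>Y. F m t n s) = C"
proof -
  have "(\<Union>(m, t)\<in>Z. \<Union>(n, s)\<in>Y. F m t n s) = (\<Union>z\<in>Z. \<Union>y\<in>Y. C)"
    using assms(3) by (intro SUP_cong refl) (auto intro!: SUP_cong)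
  then show ?thesis using assms(1,2) by auto
qed

lemma loc_add:
  assumes P: "presents M A B q" and T: "mulset T" and x: "x \<in> B" "t \<in> T" and y: "y \<in> B" "s \<in> T"
  shows "fraction T M (q x) t \<oplus>\<^bsub>loc_module RT T M\<^esub> fraction T M (q y) s = fraction T M (q (s *: x + t *: y)) (t * s)"
proof -
  note d = presentsD[OF P]
  have "fraction T M (s' \<odot>\<^bsub>M\<^esub> m \<oplus>\<^bsub>M\<^esub> t' \<odot>\<^bsub>M\<^esub> n) (t' * s') = fraction T M (q (s *: x + t *: y)) (t * s)"
    if m: "(m, t') \<in> fraction T M (q x) t" and n: "(n, s') \<in> fraction T M (q y) s" for m n s' t'
  proof -
    obtain x' where x': "m = q x'" "x' \<in> B" "t' \<in> T" "fraction T M (q x') t' = fraction T M (q x) t"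
      using frac_mem[OF P T x m] by blast
    obtain y' where y': "n = q y'" "y' \<in> B" "s' \<in> T" "fraction T M (q y') s' = fraction T M (q y) s"
      using frac_mem[OF P T y n] by blast
    obtain v where v: "v \<in> T" "v *: (t *: x' - t' *: x) \<in> A" using frac_eq[OF P T x'(2,3) x] x'(4) by blast
    obtain w where w: "w \<in> T" "w *: (s *: y' - s' *: y) \<in> A" using frac_eq[OF P T y'(2,3) y] y'(4) by blast
    have "(w * s * s') *: (v *: (t *: x' - t' *: x)) + (v * t * t') *: (w *: (s *: y' - s' *: y)) \<in> A"
      by (rule submod_add[OF d(1) submod_smul[OF d(1) v(2)] submod_smul[OF d(1) w(2)]])
    also have "(w * s * s') *: (v *: (t *: x' - t' *: x)) + (v * t * t') *: (w *: (s *: y' - s' *: y))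
        = (v * w) *: ((t * s) *: (s' *: x' + t' *: y') - (t' * s') *: (s *: x + t *: y))"
      by (rule fvec_eqI) (simp add: algebra_simps)
    finally have "fraction T M (q (s' *: x' + t' *: y')) (t' * s') = fraction T M (q (s *: x + t *: y)) (t * s)"
      using frac_eq[OF P T, of "s' *: x' + t' *: y'" "t' * s'" "s *: x + t *: y" "t * s"] x x' y y' v w d(2) T
      by (auto simp: submod_closed mulsetD)
    then show ?thesis using x' y' d by (simp add: submod_smul)
  qed
  moreover have "(q x, t) \<in> fraction T M (q x) t" "(q y, s) \<in> fraction T M (q y) s"
    using frac_self[OF P T] x y by auto
  ultimately show ?thesis by (simp add: loc_module_def) (rule UN_pairs_const)
qed

text \<open>The ring itself is presented by vectors of length one, so that facts about fractions in
  modules also describe the fractions in \<open>loc_ring\<close>.\<close>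

lemma presents_self: "presents (self_module (RT :: 'a::comm_ring_1 ring)) {0} (VV 1) (%x. cf x 0)"
proof -
  have "submod {0 :: 'a fvec}" by (auto simp: submod_def smul_simps)
  moreover have "UNIV = (%x. cf x 0) ` (VV 1 :: 'a fvec set)"
  proof -
    have "c \<in> (%x. cf x 0) ` (VV 1 :: 'a fvec set)" for c
      by (rule image_eqI[of _ _ "fv (%i. if i = 0 then c else 0)"]) (auto simp: VV_def)
    then show ?thesis by blast
  qed
  moreover have "cf x 0 = cf y 0 \<longleftrightarrow> x - y \<in> {0}" if "x \<in> VV 1" "y \<in> VV 1" for x y :: "'a fvec"
    using that by (auto simp: VV_def fvec_eq_iff) (metis One_nat_def Suc_leI gr0I)
  ultimately show ?thesis unfolding presents_def by (auto simp: self_module_def submod_0)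
qed

abbreviation sfrac :: "'a::comm_ring_1 set => 'a => 'a => ('a \<times> 'a) set" where
  "sfrac T \<equiv> fraction T (self_module RT)"

lemma sfrac_mem: "(b, s') \<in> sfrac T a s \<longleftrightarrow> s' \<in> T \<and> (\<exists>v\<in>T. v * (s' * a) = v * (s * b))"
  by (auto simp: fraction_def self_module_def)

lemma sfrac_eq:
  assumes T: "mulset T" "t \<in> T" "s \<in> T"
  shows "sfrac T a t = sfrac T b s \<longleftrightarrow> (\<exists>v\<in>T. v * (s * a) = v * (t * b))"
proof -
  let ?e = "%c. fv (%i. if i = 0 then c else 0) :: 'a fvec"
  have e: "?e c \<in> VV 1" "cf (?e c) 0 = c" for c by (auto simp: VV_def)
  have "v *: (s *: ?e a - t *: ?e b) \<in> {0} \<longleftrightarrow> v * (s * a) = v * (t * b)" for v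
    by (auto simp: fvec_eq_iff algebra_simps)
  then show ?thesis using frac_eq[OF presents_self T(1) e(1)[of a] T(2) e(1)[of b] T(3)] e(2) by simp
qed

lemma carrier_loc_ring: "carrier (loc_ring RT T) = {sfrac T a s | a s. s \<in> T}"
  by (auto simp: loc_ring_def Let_def loc_module_def self_module_def)

lemma loc_smult:
  assumes P: "presents M A B q" and T: "mulset T" and x: "x \<in> B" "t \<in> T" and s: "s \<in> T"
  shows "sfrac T a s \<odot>\<^bsub>loc_module RT T M\<^esub> fraction T M (q x) t = fraction T M (q (a *: x)) (s * t)"
proof -
  note d = presentsD[OF P]
  have "fraction T M (a' \<odot>\<^bsub>M\<^esub> m) (s' * t') = fraction T M (q (a *: x)) (s * t)"
    if a: "(a', s') \<in> sfrac T a s" and m: "(m, t') \<in> fraction T M (q x) t" for a' s' m t'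
  proof -
    obtain x' where x': "m = q x'" "x' \<in> B" "t' \<in> T" "fraction T M (q x') t' = fraction T M (q x) t"
      using frac_mem[OF P T x m] by blast
    obtain v where v: "v \<in> T" "v *: (t *: x' - t' *: x) \<in> A" using frac_eq[OF P T x'(2,3) x] x'(4) by blast
    obtain w where w: "w \<in> T" "s' \<in> T" "w * (s' * a) = w * (s * a')" using a by (auto simp: sfrac_mem)
    have "(w * s * a') *: (v *: (t *: x' - t' *: x)) \<in> A" by (rule submod_smul[OF d(1) v(2)])
    also have "(w * s * a') *: (v *: (t *: x' - t' *: x)) = (v * w) *: ((s * t) *: (a' *: x') - (s' * t') *: (a *: x))"
    proof (rule fvec_eqI)
      fix i
      have "v * w * (s' * t' * (a * cf x i)) = v * (w * (s' * a)) * t' * cf x i" by (simp add: mult_ac)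
      also have "\<dots> = v * (w * (s * a')) * t' * cf x i" by (simp only: w(3))
      finally show "cf ((w * s * a') *: v *: (t *: x' - t' *: x)) i = cf ((v * w) *: ((s * t) *: a' *: x' - (s' * t') *: a *: x)) i"
        by (simp add: algebra_simps)
    qed
    finally have "fraction T M (q (a' *: x')) (s' * t') = fraction T M (q (a *: x)) (s * t)"
      using frac_eq[OF P T, of "a' *: x'" "s' * t'" "a *: x" "s * t"] x x' v w s d(2) T
      by (auto simp: submod_smul mulsetD)
    then show ?thesis using x' d by simp
  qed
  moreover have "(q x, t) \<in> fraction T M (q x) t" using frac_self[OF P T] x by auto
  moreover have "(a, s) \<in> sfrac T a s" using s mulsetD(1)[OF T] by (auto simp: sfrac_mem)
  ultimately show ?thesis by (simp add: loc_module_def) (rule UN_pairs_const)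
qed

lemma loc_map_frac:
  assumes P: "presents M A B q" and N: "presents N A' B' q'" and A: "A <= A'" "B <= B'" and T: "mulset T" "mulset T'" "T <= T'"
    and f: "!!x. x \<in> B ==> f (q x) = q' x" and x: "x \<in> B" "t \<in> T"
  shows "loc_map T' N f (fraction T M (q x) t) = fraction T' N (q' x) t"
proof -
  have "fraction T' N (f m) s = fraction T' N (q' x) t" if m: "(m, s) \<in> fraction T M (q x) t" for m s
  proof -
    obtain y where y: "m = q y" "y \<in> B" "s \<in> T" "fraction T M (q y) s = fraction T M (q x) t" using frac_mem[OF P T(1) x m] .
    obtain v where "v \<in> T" "v *: (t *: y - s *: x) \<in> A" using frac_eq[OF P T(1) y(2,3) x] y(4) by blast
    then have "fraction T' N (q' y) s = fraction T' N (q' x) t"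
      using frac_eq[OF N T(2), of y s x t] y x A T(3) by blast
    then show ?thesis using y f by simp
  qed
  moreover have "(q x, t) \<in> fraction T M (q x) t" using frac_self[OF P T(1)] x by auto
  ultimately show ?thesis unfolding loc_map_def by blast
qed

section \<open>Presentation of the Frobenius pullback\<close>

context witt
begin

text \<open>A vector z is the sum of the u^j times \<open>Fr (co j z)\<close>; this is the
  corresponding sum of tensors, represented in the free abelian group. It is additive only modulo
  the relations.\<close>

definition tens :: "('w fps fvec => 'm) => 'w fps fvec => ('w fps \<times> 'm) \<Rightarrow>\<^sub>0 int" where
  "tens q z = (\<Sum>j<p. frag_of (u ^ j, q (co j z)))"

definition theta :: "('w fps, 'm) module => ('w fps fvec => 'm) => 'w fps fvec => ('w fps, 'm) tensors" where
  "theta M q z = pullback_relations \<phi> RT M +>\<^bsub>pre_pullback RT M\<^esub> tens q z"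

abbreviation pb :: "('w fps, 'm) module => ('w fps, ('w fps, 'm) tensors) module" where
  "pb \<equiv> pullback \<phi> RT"

lemma pre_coset: "Rl +>\<^bsub>pre_pullback RT M\<^esub> c = {d. d - c \<in> Rl}"
  unfolding a_r_coset_def r_coset_def pre_pullback_def by (auto intro!: bexI[of _ "_ - c"])

lemma co_smul_Fr: "k < p ==> co k (a *: Fr x) = cj k a *: x"
  using cj_phi_mult[of k] by (auto intro!: fvec_eqI simp: mult.commute)

text \<open>The additive extension of \<open>a \<otimes> m \<mapsto> a \<phi>(s m)\<close>, where \<open>s\<close> is a section of the presentation.\<close>

definition lam :: "('m => 'w fps fvec) => (('w fps \<times> 'm) \<Rightarrow>\<^sub>0 int) => 'w fps fvec" where
  "lam s c = (\<Sum>k\<in>Poly_Mapping.keys c. of_int (Poly_Mapping.lookup c k) *: (fst k *: Fr (s (snd k))))"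

lemma lam_superset:
  assumes "finite K" "Poly_Mapping.keys c <= K"
  shows "lam s c = (\<Sum>k\<in>K. of_int (Poly_Mapping.lookup c k) *: (fst k *: Fr (s (snd k))))"
  unfolding lam_def using assms
  by (intro sum.mono_neutral_left) (auto simp: in_keys_iff smul_simps)

lemma lam_add: "lam s (c + d) = lam s c + lam s d"
proof -
  let ?K = "Poly_Mapping.keys c \<union> Poly_Mapping.keys d"
  have "finite ?K" "Poly_Mapping.keys (c + d) <= ?K" by (simp_all add: Poly_Mapping.keys_add)
  then show ?thesis
    using lam_superset[of ?K c] lam_superset[of ?K d] lam_superset[of ?K "c + d"]
    by (simp add: Poly_Mapping.lookup_add smul_simps(3) sum.distrib)
qed

lemma lam_0 [simp]: "lam s 0 = 0" by (simp add: lam_def)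

lemma lam_minus: "lam s (- c) = - lam s c"
  using lam_add[of s c "- c"] by (simp add: eq_neg_iff_add_eq_0 add.commute)

lemma lam_diff: "lam s (c - d) = lam s c - lam s d"
  using lam_add[of s c "- d"] by (simp add: lam_minus)

lemma lam_of [simp]: "lam s (frag_of k) = fst k *: Fr (s (snd k))"
  by (simp add: lam_def smul_simps)

lemma lam_sum: "lam s (\<Sum>j\<in>J. f j) = (\<Sum>j\<in>J. lam s (f j))"
  by (induction J rule: infinite_finite_induct) (auto simp: lam_add)

definition pgens :: "('w fps, 'm) module => (('w fps \<times> 'm) \<Rightarrow>\<^sub>0 int) set" where
  "pgens M = {frag_of (a + b, m) - frag_of (a, m) - frag_of (b, m) | a b m. m \<in> carrier M} \<union>
     {frag_of (a, m \<oplus>\<^bsub>M\<^esub> n) - frag_of (a, m) - frag_of (a, n) | a m n. m \<in> carrier M \<and> n \<in> carrier M} \<union>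
     {frag_of (a * \<phi> r, m) - frag_of (a, r \<odot>\<^bsub>M\<^esub> m) | a r m. m \<in> carrier M}"

lemma pgens_subset:
  assumes "!!a b m. m \<in> carrier M ==> frag_of (a + b, m) - frag_of (a, m) - frag_of (b, m) \<in> H"
    and "!!a m n. m \<in> carrier M ==> n \<in> carrier M ==> frag_of (a, m \<oplus>\<^bsub>M\<^esub> n) - frag_of (a, m) - frag_of (a, n) \<in> H"
    and "!!a r m. m \<in> carrier M ==> frag_of (a * \<phi> r, m) - frag_of (a, r \<odot>\<^bsub>M\<^esub> m) \<in> H"
  shows "pgens M <= H"
  using assms unfolding pgens_def by blast

context
  fixes M :: "('w fps, 'm) module" and A B :: "'w fps fvec set" and q
  assumes P: "presents M A B q"
begin

abbreviation (input) "gens \<equiv> pgens M"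
abbreviation (input) "Rl \<equiv> pullback_relations \<phi> RT M"
abbreviation (input) "Fab \<equiv> free_Abelian_group (carrier (RT :: 'w fps ring) \<times> carrier M)"
lemma keys_diff3: "Poly_Mapping.keys (frag_of x - frag_of y) <= {x, y}"
  "Poly_Mapping.keys (frag_of x - frag_of y - frag_of z) <= {x, y, z}"
  using keys_diff[of "frag_of x" "frag_of y"] keys_diff[of "frag_of x - frag_of y" "frag_of z"] by auto

lemma gens_carrier: "gens <= carrier Fab"
proof -
  note d = presentsD[OF P]
  have 1: "Poly_Mapping.keys (frag_of (a + b, m) - frag_of (a, m) - frag_of (b, m)) <= UNIV \<times> carrier M" if "m \<in> carrier M" for a b m
    using keys_diff3(2)[of "(a + b, m)" "(a, m)" "(b, m)"] that by auto
  have 2: "Poly_Mapping.keys (frag_of (a, m \<oplus>\<^bsub>M\<^esub> n) - frag_of (a, m) - frag_of (a, n)) <= UNIV \<times> carrier M"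
    if "m \<in> carrier M" "n \<in> carrier M" for a :: "'w fps" and m n
    using keys_diff3(2)[of "(a, m \<oplus>\<^bsub>M\<^esub> n)" "(a, m)" "(a, n)"] that d by (auto simp: submod_add)
  have 3: "Poly_Mapping.keys (frag_of (a * \<phi> r, m) - frag_of (a, r \<odot>\<^bsub>M\<^esub> m)) <= UNIV \<times> carrier M" if "m \<in> carrier M" for a r m
    using keys_diff3(1)[of "(a * \<phi> r, m)" "(a, r \<odot>\<^bsub>M\<^esub> m)"] that d by (auto simp: submod_smul)
  show ?thesis by (rule pgens_subset) (simp_all add: 1 2 3)
qed

lemma gens_keys: "c \<in> gens ==> Poly_Mapping.keys c <= UNIV \<times> carrier M"
  using subsetD[OF gens_carrier, of c] by simp

lemma N_def: "Rl = generate Fab gens" by (simp add: pullback_relations_def pgens_def)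

lemma subgroup_N: "subgroup Rl Fab"
  unfolding N_def by (rule group.generate_is_subgroup[OF group_free_Abelian_group gens_carrier])

lemma N_keys: "c \<in> Rl ==> Poly_Mapping.keys c <= UNIV \<times> carrier M"
  using subgroup.mem_carrier[OF subgroup_N, of c] by simp

lemma N_0: "0 \<in> Rl" using subgroup.one_closed[OF subgroup_N] by simp
lemma N_add: "c \<in> Rl ==> d \<in> Rl ==> c + d \<in> Rl" using subgroup.m_closed[OF subgroup_N, of c d] by simp
lemma N_minus: "c \<in> Rl ==> - c \<in> Rl"
  using subgroup.m_inv_closed[OF subgroup_N, of c] N_keys[of c] by simp
lemma N_diff: "c \<in> Rl ==> d \<in> Rl ==> c - d \<in> Rl" using N_add[of c "- d"] N_minus[of d] by simp
lemma N_sum: "(!!j. j \<in> J ==> f j \<in> Rl) ==> (\<Sum>j\<in>J. f j) \<in> Rl"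
  by (induction J rule: infinite_finite_induct) (auto simp: N_0 N_add)
lemma N_gens: "gens <= Rl"
  unfolding N_def by (auto intro: generate.incl)

lemma N_least: "gens <= H ==> (!!c. c \<in> H ==> Poly_Mapping.keys c <= UNIV \<times> carrier M) ==> 0 \<in> H ==>
    (!!c d. c \<in> H ==> d \<in> H ==> c + d \<in> H) ==> (!!c. c \<in> H ==> - c \<in> H) ==> Rl <= H"
  unfolding N_def
  by (intro group.generate_subgroup_incl[OF group_free_Abelian_group] subgroup.intro) auto

lemma N_gen:
  assumes "x \<in> B" "y \<in> B"
  shows "frag_of (a + b, q x) - frag_of (a, q x) - frag_of (b, q x) \<in> Rl"
    "frag_of (a, q (x + y)) - frag_of (a, q x) - frag_of (a, q y) \<in> Rl"
    "frag_of (a * \<phi> r, q x) - frag_of (a, q (r *: x)) \<in> Rl"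
proof -
  note d = presentsD[OF P]
  have c: "q x \<in> carrier M" "q y \<in> carrier M" using assms d(4) by auto
  have "frag_of (a + b, q x) - frag_of (a, q x) - frag_of (b, q x) \<in> gens" using c(1) unfolding pgens_def by blast
  then show "frag_of (a + b, q x) - frag_of (a, q x) - frag_of (b, q x) \<in> Rl" using N_gens by blast
  have "frag_of (a, q x \<oplus>\<^bsub>M\<^esub> q y) - frag_of (a, q x) - frag_of (a, q y) \<in> gens" using c unfolding pgens_def by blast
  then show "frag_of (a, q (x + y)) - frag_of (a, q x) - frag_of (a, q y) \<in> Rl" using N_gens d(6)[OF assms] by auto
  have "frag_of (a * \<phi> r, q x) - frag_of (a, r \<odot>\<^bsub>M\<^esub> q x) \<in> gens" using c(1) unfolding pgens_def by blast
  then show "frag_of (a * \<phi> r, q x) - frag_of (a, q (r *: x)) \<in> Rl" using N_gens d(7)[OF assms(1)] by auto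
qed

lemma frag_zero: "x \<in> B ==> frag_of (0, q x) \<in> Rl" "frag_of (a, q 0) \<in> Rl"
proof -
  assume x: "x \<in> B"
  have "frag_of (0 + 0, q x) - frag_of (0, q x) - frag_of (0, q x) \<in> Rl" by (rule N_gen(1)[OF x x])
  then show "frag_of (0, q x) \<in> Rl" using N_minus by fastforce
next
  have z: "0 \<in> B" using presentsD(2)[OF P] by (rule submod_0)
  have "frag_of (a, q (0 + 0)) - frag_of (a, q 0) - frag_of (a, q 0) \<in> Rl" by (rule N_gen(2)[OF z z])
  then show "frag_of (a, q 0) \<in> Rl" using N_minus by fastforce
qed

lemma frag_sum_left:
  assumes x: "x \<in> B" and J: "finite J"
  shows "frag_of (\<Sum>j\<in>J. f j, q x) - (\<Sum>j\<in>J. frag_of (f j, q x)) \<in> Rl"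
  using J
proof (induction J rule: finite_induct)
  case (insert i J)
  have "(frag_of (f i + (\<Sum>j\<in>J. f j), q x) - frag_of (f i, q x) - frag_of (\<Sum>j\<in>J. f j, q x))
      + (frag_of (\<Sum>j\<in>J. f j, q x) - (\<Sum>j\<in>J. frag_of (f j, q x))) \<in> Rl"
    using insert x by (intro N_add N_gen(1)) auto
  then show ?case using insert by (simp add: algebra_simps)
qed (simp add: frag_zero x)

text \<open>Write a as the sum of the u^j \<phi>(a_j) and move each a_j across the tensor product.
  So pure tensors are in the image of \<open>tens\<close> modulo the relations.\<close>

lemma frag_tens:
  assumes x: "x \<in> B" shows "frag_of (a, q x) - tens q (a *: Fr x) \<in> Rl"
proof -
  have "frag_of (\<Sum>j<p. u ^ j * \<phi> (cj j a), q x) - (\<Sum>j<p. frag_of (u ^ j * \<phi> (cj j a), q x)) \<in> Rl"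
    using x by (intro frag_sum_left) auto
  moreover have "(\<Sum>j<p. frag_of (u ^ j * \<phi> (cj j a), q x)) - (\<Sum>j<p. frag_of (u ^ j, q (cj j a *: x))) \<in> Rl"
    unfolding sum_subtractf[symmetric] by (intro N_sum N_gen(3)[OF x x])
  ultimately have "frag_of (\<Sum>j<p. u ^ j * \<phi> (cj j a), q x) - (\<Sum>j<p. frag_of (u ^ j, q (cj j a *: x))) \<in> Rl"
    using N_add by fastforce
  then show ?thesis unfolding cj_decomp by (simp add: tens_def co_smul_Fr)
qed

lemma tens_add:
  assumes "z \<in> Ph B" "w \<in> Ph B" shows "tens q (z + w) - tens q z - tens q w \<in> Rl"
  unfolding tens_def sum_subtractf[symmetric] co_add
  by (rule N_sum, rule N_gen(2)) (use assms in \<open>auto simp: Ph_def\<close>)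

lemma tens_0: "tens q 0 \<in> Rl"
  unfolding tens_def co_0 by (intro N_sum frag_zero(2))

lemma tens_surj:
  assumes "Poly_Mapping.keys c <= UNIV \<times> carrier M" shows "\<exists>z\<in>Ph B. c - tens q z \<in> Rl"
  using assms
proof (induction c rule: frag_induction)
  case zero
  show ?case using tens_0 N_minus presentsD(2)[OF P] by (intro bexI[of _ 0]) (auto simp: submod_0)
next
  case (one k)
  then obtain a x where k: "k = (a, q x)" "x \<in> B" using presentsD(4)[OF P] by auto
  have "a *: Fr x \<in> Ph B" using k presentsD(2)[OF P] by (intro submod_smul) (auto simp: Fr_in_Ph)
  then show ?case using frag_tens k by blast
next
  case (diff c d)
  then obtain z w where zw: "z \<in> Ph B" "c - tens q z \<in> Rl" "w \<in> Ph B" "d - tens q w \<in> Rl" by blast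
  have zw': "z - w \<in> Ph B" using zw presentsD(2)[OF P] by (simp add: submod_diff)
  have "((c - tens q z) - (d - tens q w)) + (tens q ((z - w) + w) - tens q (z - w) - tens q w) \<in> Rl"
    by (rule N_add[OF N_diff[OF zw(2,4)] tens_add[OF zw' zw(3)]])
  then have "(c - d) - tens q (z - w) \<in> Rl" by (simp add: algebra_simps)
  then show ?case using zw' by blast
qed

text \<open>The section \<open>s\<close> need not be linear, but its defects lie in \<open>A\<close>
  since \<open>q\<close> is linear on \<open>B\<close>; so \<open>lam\<close> maps every relation
  into \<open>Ph A\<close>.\<close>

lemma lam_N:
  assumes s: "!!m. m \<in> carrier M ==> s m \<in> B \<and> q (s m) = m" and c: "c \<in> Rl"
  shows "lam s c \<in> Ph A"
proof -
  note d = presentsD[OF P]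
  have PA: "submod (Ph A)" using d(1) by simp
  let ?H = "{c. Poly_Mapping.keys c <= UNIV \<times> carrier M \<and> lam s c \<in> Ph A}"
  have "Rl <= ?H"
  proof (rule N_least)
    have lam1: "lam s (frag_of (a + b, m) - frag_of (a, m) - frag_of (b, m)) \<in> Ph A" for a b m
      using PA by (simp add: lam_diff smul_simps submod_0)
    have lam2: "lam s (frag_of (a, m \<oplus>\<^bsub>M\<^esub> n) - frag_of (a, m) - frag_of (a, n)) \<in> Ph A"
      if "m \<in> carrier M" "n \<in> carrier M" for a m n
    proof -
      have mn: "m \<oplus>\<^bsub>M\<^esub> n = q (s m + s n)" using d(6)[of "s m" "s n"] s that by simp
      then have "m \<oplus>\<^bsub>M\<^esub> n \<in> carrier M" using d s that by (simp add: submod_add)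
      then have "q (s (m \<oplus>\<^bsub>M\<^esub> n)) = q (s m + s n)" "s (m \<oplus>\<^bsub>M\<^esub> n) \<in> B" using mn s by auto
      then have "s (m \<oplus>\<^bsub>M\<^esub> n) - (s m + s n) \<in> A" using d s that by (simp add: submod_add)
      then have "a *: Fr (s (m \<oplus>\<^bsub>M\<^esub> n) - (s m + s n)) \<in> Ph A" using Fr_in_Ph[OF d(1)] PA by (intro submod_smul) auto
      moreover have "Fr (s (m \<oplus>\<^bsub>M\<^esub> n) - (s m + s n)) = Fr (s (m \<oplus>\<^bsub>M\<^esub> n)) - Fr (s m) - Fr (s n)"
        by (rule fvec_eqI) (simp add: phi_diff phi_add)
      ultimately show ?thesis by (simp add: lam_diff smul_simps)
    qed
    have lam3: "lam s (frag_of (a * \<phi> r, m) - frag_of (a, r \<odot>\<^bsub>M\<^esub> m)) \<in> Ph A" if "m \<in> carrier M" for a r m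
    proof -
      have rm: "r \<odot>\<^bsub>M\<^esub> m = q (r *: s m)" using d(7)[of "s m" r] s that by simp
      then have "r \<odot>\<^bsub>M\<^esub> m \<in> carrier M" using d s that by (simp add: submod_smul)
      then have "q (s (r \<odot>\<^bsub>M\<^esub> m)) = q (r *: s m)" "s (r \<odot>\<^bsub>M\<^esub> m) \<in> B" using rm s by auto
      then have "r *: s m - s (r \<odot>\<^bsub>M\<^esub> m) \<in> A" using d(8)[of "r *: s m" "s (r \<odot>\<^bsub>M\<^esub> m)"] d(2) s that by (simp add: submod_smul)
      then have "a *: Fr (r *: s m - s (r \<odot>\<^bsub>M\<^esub> m)) \<in> Ph A" using Fr_in_Ph[OF d(1)] PA by (intro submod_smul) auto
      moreover have "Fr (r *: s m - s (r \<odot>\<^bsub>M\<^esub> m)) = \<phi> r *: Fr (s m) - Fr (s (r \<odot>\<^bsub>M\<^esub> m))"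
        by (rule fvec_eqI) (simp add: phi_diff phi_mult)
      ultimately show ?thesis by (simp add: lam_diff smul_simps)
    qed
    have "gens <= {c. lam s c \<in> Ph A}" by (rule pgens_subset) (simp_all add: lam1 lam2 lam3)
    then show "gens <= ?H" using gens_keys by blast
  next
    fix c d assume "c \<in> ?H" "d \<in> ?H"
    then show "c + d \<in> ?H" using PA Poly_Mapping.keys_add[of c d] by (auto simp: lam_add submod_add)
  qed (use PA in \<open>auto simp: lam_minus submod_uminus submod_0\<close>)
  then show ?thesis using c by blast
qed

lemma lam_tens:
  assumes s: "!!m. m \<in> carrier M ==> s m \<in> B \<and> q (s m) = m" and z: "z \<in> Ph B"
  shows "lam s (tens q z) - z \<in> Ph A"
proof -
  note d = presentsD[OF P]
  have "lam s (tens q z) - z = (\<Sum>j<p. u ^ j *: Fr (s (q (co j z)))) - (\<Sum>j<p. u ^ j *: Fr (co j z))"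
    by (simp add: tens_def lam_sum co_decomp)
  also have "\<dots> = (\<Sum>j<p. u ^ j *: Fr (s (q (co j z)) - co j z))"
    unfolding sum_subtractf[symmetric] by (rule sum.cong) (auto intro!: fvec_eqI simp: phi_diff algebra_simps)
  also have "\<dots> \<in> Ph A"
  proof (rule Ph_sum_mem)
    fix j assume "j < p"
    then have "co j z \<in> B" using z by (simp add: Ph_def)
    then show "s (q (co j z)) - co j z \<in> A" using s[of "q (co j z)"] d(4) d(8)[of "s (q (co j z))" "co j z"] by auto
  qed
  finally show ?thesis .
qed

text \<open>\<open>lam\<close> sends relations into \<open>Ph A\<close> and undoes
  \<open>tens\<close> up to \<open>Ph A\<close>, whence one direction. Conversely, vectors congruent
  modulo \<open>Ph A\<close> have components with equal images under \<open>q\<close>, so their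
  tensors are literally the same.\<close>

lemma theta_eq:
  assumes z: "z \<in> Ph B" and w: "w \<in> Ph B"
  shows "tens q z - tens q w \<in> Rl \<longleftrightarrow> z - w \<in> Ph A"
proof
  note d = presentsD[OF P]
  have "\<forall>m\<in>carrier M. \<exists>x. x \<in> B \<and> q x = m" using d(4) by auto
  then obtain s where s: "!!m. m \<in> carrier M ==> s m \<in> B \<and> q (s m) = m" by metis
  assume "tens q z - tens q w \<in> Rl"
  then have "lam s (tens q z) - lam s (tens q w) \<in> Ph A" using lam_N[OF s, of "tens q z - tens q w"] by (simp add: lam_diff)
  then have "(lam s (tens q z) - lam s (tens q w)) - (lam s (tens q z) - z) + (lam s (tens q w) - w) \<in> Ph A"
    by (rule submod_add[OF submod_Ph[OF d(1)] submod_diff[OF submod_Ph[OF d(1)] _ lam_tens[OF s z]] lam_tens[OF s w]])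
  then show "z - w \<in> Ph A" by simp
next
  note d = presentsD[OF P]
  assume zw: "z - w \<in> Ph A"
  have "q (co j z) = q (co j w)" if j: "j < p" for j
  proof -
    have "co j z = co j (z - w) + co j w" using co_add[of j "z - w" w] by simp
    moreover have "co j (z - w) \<in> A" using zw j by (simp add: Ph_def)
    ultimately have "co j z - co j w \<in> A" by simp
    then show ?thesis using d(8)[of "co j z" "co j w"] z w j by (simp add: Ph_def)
  qed
  then have "tens q z = tens q w" unfolding tens_def by (intro sum.cong) auto
  then show "tens q z - tens q w \<in> Rl" using N_0 by simp
qed

lemma coset_pre_eq: "{d. d - c \<in> Rl} = {d. d - c' \<in> Rl} \<longleftrightarrow> c - c' \<in> Rl"
proof
  assume "{d. d - c \<in> Rl} = {d. d - c' \<in> Rl}"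
  moreover have "c \<in> {d. d - c \<in> Rl}" using N_0 by simp
  ultimately show "c - c' \<in> Rl" by blast
next
  assume cc: "c - c' \<in> Rl"
  have "d - c \<in> Rl \<longleftrightarrow> d - c' \<in> Rl" for d
  proof
    assume "d - c \<in> Rl"
    from N_add[OF this cc] show "d - c' \<in> Rl" by simp
  next
    assume "d - c' \<in> Rl"
    from N_diff[OF this cc] show "d - c \<in> Rl" by simp
  qed
  then show "{d. d - c \<in> Rl} = {d. d - c' \<in> Rl}" by simp
qed

lemma scale_N:
  assumes c: "c \<in> Rl" shows "frag_extend (%(a, m). frag_of (s * a, m)) c \<in> Rl"
proof -
  let ?f = "frag_extend (%(a, m). frag_of (s * a, m)) :: (('w fps \<times> 'm) \<Rightarrow>\<^sub>0 int) => _"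
  have "Rl <= {c. Poly_Mapping.keys c <= UNIV \<times> carrier M \<and> ?f c \<in> Rl}"
  proof (rule N_least)
    note d = presentsD[OF P]
    have 1: "?f (frag_of (a + b, m) - frag_of (a, m) - frag_of (b, m)) \<in> Rl" if "m \<in> carrier M" for a b m
      using that d(4) N_gen(1)[of _ _ "s * a" "s * b"] by (auto simp: frag_extend_diff distrib_left)
    have 2: "?f (frag_of (a, m \<oplus>\<^bsub>M\<^esub> n) - frag_of (a, m) - frag_of (a, n)) \<in> Rl" if "m \<in> carrier M" "n \<in> carrier M" for a m n
      using that d(4,6) N_gen(2)[of _ _ "s * a"] by (auto simp: frag_extend_diff)
    have 3: "?f (frag_of (a * \<phi> r, m) - frag_of (a, r \<odot>\<^bsub>M\<^esub> m)) \<in> Rl" if "m \<in> carrier M" for a r m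
      using that d(4,7) N_gen(3)[of _ _ "s * a" r] by (auto simp: frag_extend_diff mult.assoc)
    have "gens <= {c. ?f c \<in> Rl}" by (rule pgens_subset) (simp_all add: 1 2 3)
    then show "gens <= {c. Poly_Mapping.keys c <= UNIV \<times> carrier M \<and> ?f c \<in> Rl}" using gens_keys by blast
  next
    fix c d assume "c \<in> {c. Poly_Mapping.keys c <= UNIV \<times> carrier M \<and> ?f c \<in> Rl}" "d \<in> {c. Poly_Mapping.keys c <= UNIV \<times> carrier M \<and> ?f c \<in> Rl}"
    then show "c + d \<in> {c. Poly_Mapping.keys c <= UNIV \<times> carrier M \<and> ?f c \<in> Rl}"
      using Poly_Mapping.keys_add[of c d] by (auto simp: frag_extend_add N_add)
  qed (auto simp: frag_extend_minus N_minus N_0)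
  then show ?thesis using c by blast
qed

text \<open>Multiplication by s turns u^j into s u^j, which is in general not one of the powers
  occurring in \<open>tens\<close>. \<open>frag_tens\<close> rewrites each summand, and an induction
  collects them, since \<open>tens\<close> is additive only modulo the relations.\<close>

lemma scale_tens:
  assumes z: "z \<in> Ph B" shows "frag_extend (%(a, m). frag_of (s * a, m)) (tens q z) - tens q (s *: z) \<in> Rl"
proof -
  note d = presentsD[OF P]
  have zj: "co j z \<in> B" if "j < p" for j using z that by (simp add: Ph_def)
  have "tens q (\<Sum>j\<in>J. (s * u ^ j) *: Fr (co j z)) - (\<Sum>j\<in>J. frag_of (s * u ^ j, q (co j z))) \<in> Rl"
    if "finite J" "J <= {..<p}" for J
    using that
  proof (induction J rule: finite_induct)
    case empty
    show ?case using tens_0 by simp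
  next
    case (insert i J)
    let ?v = "%j. (s * u ^ j) *: Fr (co j z)"
    have v: "?v j \<in> Ph B" if "j < p" for j using zj[OF that] d(2) by (intro submod_smul) (auto simp: Fr_in_Ph)
    have sv: "(\<Sum>j\<in>J. ?v j) \<in> Ph B" using insert.prems v d(2) by (intro submod_sum) auto
    have i: "i < p" and IH: "tens q (\<Sum>j\<in>J. ?v j) - (\<Sum>j\<in>J. frag_of (s * u ^ j, q (co j z))) \<in> Rl"
      using insert by auto
    have "(tens q (?v i + (\<Sum>j\<in>J. ?v j)) - tens q (?v i) - tens q (\<Sum>j\<in>J. ?v j))
        + (tens q (\<Sum>j\<in>J. ?v j) - (\<Sum>j\<in>J. frag_of (s * u ^ j, q (co j z)))) - (frag_of (s * u ^ i, q (co i z)) - tens q (?v i)) \<in> Rl"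
      by (rule N_diff[OF N_add[OF tens_add[OF v[OF i] sv] IH] frag_tens[OF zj[OF i]]])
    then show ?case using insert by (simp add: algebra_simps)
  qed
  from this[of "{..<p}"] have "tens q (\<Sum>j<p. (s * u ^ j) *: Fr (co j z)) - (\<Sum>j<p. frag_of (s * u ^ j, q (co j z))) \<in> Rl" by simp
  moreover have "(\<Sum>j<p. (s * u ^ j) *: Fr (co j z)) = s *: z"
    by (subst (2) co_decomp[symmetric]) (simp add: smul_sum smul_simps)
  moreover have "frag_extend (%(a, m). frag_of (s * a, m)) (tens q z) = (\<Sum>j<p. frag_of (s * u ^ j, q (co j z)))"
    by (simp add: tens_def frag_extend_sum comp_def)
  ultimately show ?thesis using N_minus by fastforce
qed

text \<open>The abstract tensor product becomes a quotient of explicit submodules of the same space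
  of vectors. With \<open>pullback_map_theta\<close>, later arguments can work with
  \<open>Ph\<close> instead of tensors.\<close>

lemma presents_pullback: "presents (pb M) (Ph A) (Ph B) (theta M q)"
proof -
  note d = presentsD[OF P]
  have th: "theta M q z = {c. c - tens q z \<in> Rl}" for z by (simp add: theta_def pre_coset)
  have eq: "theta M q z = theta M q w \<longleftrightarrow> z - w \<in> Ph A" if "z \<in> Ph B" "w \<in> Ph B" for z w
    unfolding th coset_pre_eq by (rule theta_eq[OF that])
  have carr: "carrier (pb M) = theta M q ` Ph B"
  proof -
    have "carrier (pb M) = {Rl +>\<^bsub>pre_pullback RT M\<^esub> c | c. Poly_Mapping.keys c <= UNIV \<times> carrier M}"
      by (auto simp: pullback_def quot_module_def A_RCOSETS_def RCOSETS_def a_r_coset_def pre_pullback_def)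
    also have "\<dots> = theta M q ` Ph B"
    proof
      show "{Rl +>\<^bsub>pre_pullback RT M\<^esub> c | c. Poly_Mapping.keys c <= UNIV \<times> carrier M} <= theta M q ` Ph B"
      proof
        fix e assume "e \<in> {Rl +>\<^bsub>pre_pullback RT M\<^esub> c | c. Poly_Mapping.keys c <= UNIV \<times> carrier M}"
        then obtain c where c: "e = {d. d - c \<in> Rl}" "Poly_Mapping.keys c <= UNIV \<times> carrier M" by (auto simp: pre_coset)
        obtain z where z: "z \<in> Ph B" "c - tens q z \<in> Rl" using tens_surj[OF c(2)] by blast
        have "e = theta M q z" unfolding c(1) th coset_pre_eq by (rule z(2))
        then show "e \<in> theta M q ` Ph B" using z(1) by blast
      qed
      have "Poly_Mapping.keys (tens q z) <= UNIV \<times> carrier M" if "z \<in> Ph B" for z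
      proof -
        have "Poly_Mapping.keys (tens q z) <= (\<Union>j<p. Poly_Mapping.keys (frag_of (u ^ j, q (co j z))))"
          unfolding tens_def by (rule Poly_Mapping.keys_sum)
        then show ?thesis using that d(4) by (auto simp: Ph_def)
      qed
      then show "theta M q ` Ph B <= {Rl +>\<^bsub>pre_pullback RT M\<^esub> c | c. Poly_Mapping.keys c <= UNIV \<times> carrier M}"
        by (auto simp: theta_def)
    qed
    finally show ?thesis .
  qed
  have zero: "\<zero>\<^bsub>pb M\<^esub> = theta M q 0"
  proof -
    have "{c. c - 0 \<in> Rl} = {c. c - tens q 0 \<in> Rl}" unfolding coset_pre_eq using tens_0 N_minus by force
    then show ?thesis by (simp add: pullback_def quot_module_def th)
  qed
  have add: "theta M q z \<oplus>\<^bsub>pb M\<^esub> theta M q w = theta M q (z + w)" if "z \<in> Ph B" "w \<in> Ph B" for z w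
  proof -
    have "theta M q z \<oplus>\<^bsub>pb M\<^esub> theta M q w = {c + c' | c c'. c - tens q z \<in> Rl \<and> c' - tens q w \<in> Rl}"
      by (auto simp: pullback_def quot_module_def set_add_def set_mult_def pre_pullback_def th)
    also have "\<dots> = theta M q (z + w)"
    proof (intro equalityI subsetI)
      fix e assume "e \<in> {c + c' | c c'. c - tens q z \<in> Rl \<and> c' - tens q w \<in> Rl}"
      then obtain c c' where c: "e = c + c'" "c - tens q z \<in> Rl" "c' - tens q w \<in> Rl" by blast
      have "(c - tens q z) + (c' - tens q w) - (tens q (z + w) - tens q z - tens q w) \<in> Rl"
        by (rule N_diff[OF N_add[OF c(2,3)] tens_add[OF that]])
      then show "e \<in> theta M q (z + w)" by (simp add: th c(1) algebra_simps)
    next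
      fix e assume "e \<in> theta M q (z + w)"
      then have "e - tens q (z + w) \<in> Rl" by (simp add: th)
      from N_add[OF this tens_add[OF that]]
      have "(e - tens q (z + w)) + (tens q (z + w) - tens q z - tens q w) \<in> Rl" .
      then have "(e - tens q w) - tens q z \<in> Rl" by (simp add: algebra_simps)
      moreover have "tens q w - tens q w \<in> Rl" using N_0 by simp
      moreover have "e = (e - tens q w) + tens q w" by simp
      ultimately show "e \<in> {c + c' | c c'. c - tens q z \<in> Rl \<and> c' - tens q w \<in> Rl}" by blast
    qed
    finally show ?thesis .
  qed
  have smult: "s \<odot>\<^bsub>pb M\<^esub> theta M q z = theta M q (s *: z)" if z: "z \<in> Ph B" for s z
  proof -
    let ?f = "frag_extend (%(a, m). frag_of (s * a, m)) :: (('w fps \<times> 'm) \<Rightarrow>\<^sub>0 int) => _"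
    have "{d. d - ?f c \<in> Rl} = theta M q (s *: z)" if c: "c \<in> theta M q z" for c
    proof -
      have "?f (c - tens q z) + (?f (tens q z) - tens q (s *: z)) \<in> Rl"
        by (rule N_add[OF scale_N scale_tens[OF z]]) (use c in \<open>simp add: th\<close>)
      then have "?f c - tens q (s *: z) \<in> Rl" by (simp add: frag_extend_diff)
      then show ?thesis unfolding th coset_pre_eq .
    qed
    moreover have "tens q z \<in> theta M q z" using N_0 by (simp add: th)
    moreover have "s \<odot>\<^bsub>pb M\<^esub> theta M q z = (\<Union>c\<in>theta M q z. {d. d - ?f c \<in> Rl})"
      by (simp add: pullback_def quot_module_def pre_coset) (simp add: pre_pullback_def)
    ultimately show ?thesis by auto
  qed
  show ?thesis unfolding presents_def using d carr zero add smult eq by (simp add: Ph_mono)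
qed

end

lemma pullback_map_theta:
  fixes M :: "('w fps, 'm) module" and M' :: "('w fps, 'n) module"
  assumes P: "presents M A B q" and P': "presents M' A' B' q'" and AA: "A <= A'" "B <= B'"
    and f: "!!x. x \<in> B ==> f (q x) = q' x" and z: "z \<in> Ph B"
  shows "pullback_map \<phi> RT M' f (theta M q z) = theta M' q' z"
proof -
  note d = presentsD[OF P] and d' = presentsD[OF P']
  let ?g = "frag_extend (%(a, m). frag_of (a, f m)) :: (('w fps \<times> 'm) \<Rightarrow>\<^sub>0 int) => _"
  let ?N = "pullback_relations \<phi> RT M" and ?N' = "pullback_relations \<phi> RT M'"
  have NN: "?N <= {c. Poly_Mapping.keys c <= UNIV \<times> carrier M \<and> ?g c \<in> ?N'}"
  proof (rule N_least[OF P])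
    have 1: "?g (frag_of (a + b, m) - frag_of (a, m) - frag_of (b, m)) \<in> ?N'" if mc: "m \<in> carrier M" for a b m
    proof -
      obtain x where x: "m = q x" "x \<in> B" using mc d(4) by auto
      then show ?thesis using N_gen(1)[OF P', of x x a b] f AA by (auto simp: frag_extend_diff)
    qed
    have 2: "?g (frag_of (a, m \<oplus>\<^bsub>M\<^esub> n) - frag_of (a, m) - frag_of (a, n)) \<in> ?N'" if mc: "m \<in> carrier M" "n \<in> carrier M" for a m n
    proof -
      obtain x y where x: "m = q x" "x \<in> B" "n = q y" "y \<in> B" using mc d(4) by auto
      then have "f (m \<oplus>\<^bsub>M\<^esub> n) = q' (x + y)" using d(2,6) f by (simp add: submod_add)
      then show ?thesis using N_gen(2)[OF P', of x y a] f AA x by (auto simp: frag_extend_diff)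
    qed
    have 3: "?g (frag_of (a * \<phi> r, m) - frag_of (a, r \<odot>\<^bsub>M\<^esub> m)) \<in> ?N'" if mc: "m \<in> carrier M" for a r m
    proof -
      obtain x where x: "m = q x" "x \<in> B" using mc d(4) by auto
      then have "f (r \<odot>\<^bsub>M\<^esub> m) = q' (r *: x)" using d(2,7) f by (simp add: submod_smul)
      then show ?thesis using N_gen(3)[OF P', of x x a r] f AA x by (auto simp: frag_extend_diff)
    qed
    have "pgens M <= {c. ?g c \<in> ?N'}" by (rule pgens_subset) (simp_all add: 1 2 3)
    then show "pgens M <= {c. Poly_Mapping.keys c <= UNIV \<times> carrier M \<and> ?g c \<in> ?N'}" using gens_keys[OF P] by blast
  next
    fix c d assume "c \<in> {c. Poly_Mapping.keys c <= UNIV \<times> carrier M \<and> ?g c \<in> ?N'}" "d \<in> {c. Poly_Mapping.keys c <= UNIV \<times> carrier M \<and> ?g c \<in> ?N'}"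
    then show "c + d \<in> {c. Poly_Mapping.keys c <= UNIV \<times> carrier M \<and> ?g c \<in> ?N'}"
      using Poly_Mapping.keys_add[of c d] by (auto simp: frag_extend_add N_add[OF P'])
  qed (auto simp: frag_extend_minus N_minus[OF P'] N_0[OF P'])
  have gt: "?g (tens q z) = tens q' z"
    using z f by (simp add: tens_def frag_extend_sum comp_def Ph_def)
  have "{e. e - ?g c \<in> ?N'} = theta M' q' z" if "c \<in> theta M q z" for c
  proof -
    have "c - tens q z \<in> ?N" using that by (simp add: theta_def pre_coset)
    then have "?g (c - tens q z) \<in> ?N'" using NN by blast
    then have "?g c - tens q' z \<in> ?N'" by (simp add: frag_extend_diff gt)
    then show ?thesis unfolding theta_def pre_coset coset_pre_eq[OF P'] .
  qed
  moreover have "tens q z \<in> theta M q z" using N_0[OF P] by (simp add: theta_def pre_coset)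
  ultimately show ?thesis unfolding pullback_map_def pre_coset by blast
qed

end

section \<open>Presentations of modules with Frobenius\<close>

lemma mulset_powers [simp]: "mulset (powers x)"
  unfolding mulset_def powers_def by (auto simp: power_add[symmetric] intro: range_eqI[of _ _ 0])

lemma power_in_powers [simp]: "x ^ k \<in> powers x" "1 \<in> powers x"
  unfolding powers_def by (auto intro: range_eqI[of _ _ 0])

context witt
begin

text \<open>The structure map of \<open>Z\<close> is \<open>z/t \<mapsto> a(z)/(t\<^sub>0 t)\<close>.\<close>

definition rep :: "'w fps set => 'w fps => ('w fps, 'm) phi_module => 'w fps fvec set => 'w fps fvec set
    => ('w fps fvec => 'm) => ('w fps fvec => 'w fps fvec) => bool" where
  "rep T t\<^sub>0 Z A B q a \<longleftrightarrow> mulset T \<and> t\<^sub>0 \<in> T \<and> presents (fst Z) A B q \<and> lin a \<and> a ` Ph B <= B \<and> a ` Ph A <= A \<and>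
     (\<forall>z\<in>Ph B. \<forall>t\<in>T. snd Z (fraction T (pb (fst Z)) (theta (fst Z) q z) t) = fraction T (fst Z) (q (a z)) (t\<^sub>0 * t))"

lemma repD:
  assumes "rep T t\<^sub>0 Z A B q a"
  shows "mulset T" "t\<^sub>0 \<in> T" "presents (fst Z) A B q" "lin a" "a ` Ph B <= B" "a ` Ph A <= A"
    "!!z t. z \<in> Ph B ==> t \<in> T ==> snd Z (fraction T (pb (fst Z)) (theta (fst Z) q z) t) = fraction T (fst Z) (q (a z)) (t\<^sub>0 * t)"
    "presents (pb (fst Z)) (Ph A) (Ph B) (theta (fst Z) q)"
  using assms unfolding rep_def by (simp_all add: presents_pullback[of "fst Z" A B q])

lemma rep_sub:
  assumes R: "rep T t\<^sub>0 Z A B q a" and X: "submod X" "A <= X" "X <= B" "a ` Ph X <= X"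
  shows "rep T t\<^sub>0 (sub_object \<phi> RT T Z (q ` X)) A X q a"
proof -
  note r = repD[OF R]
  let ?M = "fst Z" let ?N = "?M\<lparr>carrier := q ` X\<rparr>"
  have PN: "presents ?N A X q" by (rule presents_sub[OF r(3) X(1-3)])
  note PPN = presents_pullback[OF PN]
  \<comment> \<open>Both fractions are compared modulo the same \<open>A\<close>, so localization
    keeps the inclusion injective and \<open>inv_into\<close> in \<open>sub_object\<close> is
    determined.\<close>
  have inj: "inj_on (loc_map T ?M id) (carrier (loc_module RT T ?N))"
  proof (rule inj_onI)
    fix Y Y' assume "Y \<in> carrier (loc_module RT T ?N)" "Y' \<in> carrier (loc_module RT T ?N)"
      and e: "loc_map T ?M id Y = loc_map T ?M id Y'"
    then obtain x t y s where xy: "x \<in> X" "t \<in> T" "Y = fraction T ?N (q x) t" "y \<in> X" "s \<in> T" "Y' = fraction T ?N (q y) s"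
      unfolding carrier_loc[OF PN] by blast
    have m: "loc_map T ?M id (fraction T ?N (q x) t) = fraction T ?M (q x) t" if "x \<in> X" "t \<in> T" for x t
      by (rule loc_map_frac[OF PN r(3) subset_refl X(3) r(1) r(1)]) (use that in auto)
    have "fraction T ?M (q x) t = fraction T ?M (q y) s" using e xy m by simp
    then show "Y = Y'" using frac_eq[OF r(3) r(1), of x t y s] frac_eq[OF PN r(1), of x t y s] xy X(3) by blast
  qed
  have main: "snd (sub_object \<phi> RT T Z (q ` X)) (fraction T (pb ?N) (theta ?N q z) t) = fraction T ?N (q (a z)) (t\<^sub>0 * t)"
    if z: "z \<in> Ph X" and t: "t \<in> T" for z t
  proof -
    have zB: "z \<in> Ph B" using z Ph_mono[OF X(3)] by blast
    have az: "a z \<in> X" using z X(4) by blast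
    have tt: "t\<^sub>0 * t \<in> T" using r(1,2) t by (simp add: mulsetD)
    have 1: "loc_map T (pb ?M) (pullback_map \<phi> RT ?M id) (fraction T (pb ?N) (theta ?N q z) t) = fraction T (pb ?M) (theta ?M q z) t"
      by (rule loc_map_frac[OF PPN r(8) subset_refl Ph_mono[OF X(3)] r(1) r(1) subset_refl _ z t],
          rule pullback_map_theta[OF PN r(3) subset_refl X(3)]) auto
    have 2: "loc_map T ?M id (fraction T ?N (q (a z)) (t\<^sub>0 * t)) = fraction T ?M (q (a z)) (t\<^sub>0 * t)"
      by (rule loc_map_frac[OF PN r(3) subset_refl X(3) r(1) r(1) subset_refl _ az tt]) simp
    have "snd (sub_object \<phi> RT T Z (q ` X)) (fraction T (pb ?N) (theta ?N q z) t)
        = inv_into (carrier (loc_module RT T ?N)) (loc_map T ?M id) (loc_map T ?M id (fraction T ?N (q (a z)) (t\<^sub>0 * t)))"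
      unfolding 2 r(7)[OF zB t, symmetric] 1[symmetric] by (simp add: sub_object_def Let_def)
    also have "\<dots> = fraction T ?N (q (a z)) (t\<^sub>0 * t)"
      using inj az tt by (intro inv_into_f_f) (auto simp: carrier_loc[OF PN])
    finally show ?thesis .
  qed
  have "fst (sub_object \<phi> RT T Z (q ` X)) = ?N" by (simp add: sub_object_def Let_def)
  then show ?thesis unfolding rep_def using r PN X main by simp
qed

lemma rep_quot:
  assumes R: "rep T t\<^sub>0 Z A B q a" and X: "submod X" "A <= X" "X <= B" "a ` Ph X <= X"
  shows "rep T t\<^sub>0 (quot_object \<phi> RT T Z (q ` X)) X B (%x. q ` X +>\<^bsub>fst Z\<^esub> q x) a"
proof -
  note r = repD[OF R]
  let ?M = "fst Z" let ?Q = "quot_module ?M (q ` X)" let ?\<pi> = "%x. q ` X +>\<^bsub>?M\<^esub> x" let ?q = "%x. ?\<pi> (q x)"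
  have PQ: "presents ?Q X B ?q" by (rule presents_quot[OF r(3) X(1-3)])
  note PPQ = presents_pullback[OF PQ]
  let ?m = "loc_map T (pb ?Q) (pullback_map \<phi> RT ?Q ?\<pi>)"
  have lm: "?m (fraction T (pb ?M) (theta ?M q z) t) = fraction T (pb ?Q) (theta ?Q ?q z) t"
    if z: "z \<in> Ph B" and t: "t \<in> T" for z t
    by (rule loc_map_frac[OF r(8) PPQ Ph_mono[OF X(2)] subset_refl r(1) r(1) subset_refl _ z t],
        rule pullback_map_theta[OF r(3) PQ X(2) subset_refl]) auto
  have main: "snd (quot_object \<phi> RT T Z (q ` X)) (fraction T (pb ?Q) (theta ?Q ?q z) t) = fraction T ?Q (?q (a z)) (t\<^sub>0 * t)"
    if z: "z \<in> Ph B" and t: "t \<in> T" for z t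
  proof -
    let ?Y = "fraction T (pb ?Q) (theta ?Q ?q z) t"
    let ?C = "carrier (loc_module RT T (pb ?M))"
    have "fraction T (pb ?M) (theta ?M q z) t \<in> ?C" unfolding carrier_loc[OF r(8)] using z t by blast
    then have "?m (fraction T (pb ?M) (theta ?M q z) t) \<in> ?m ` ?C" by (rule imageI)
    then have im: "?Y \<in> ?m ` ?C" unfolding lm[OF z t] .
    \<comment> \<open>\<open>inv_into\<close> picks an unknown preimage w/s of the class. Up to a
      factor from \<open>T\<close>, its difference from z/t has numerator in \<open>Ph X\<close>,
      which \<open>a\<close> maps into \<open>X\<close>, so the result does not depend on the
      choice.\<close>
    then have "inv_into ?C ?m ?Y \<in> ?C" by (rule inv_into_into)
    then obtain w s where w: "w \<in> Ph B" "s \<in> T" "inv_into ?C ?m ?Y = fraction T (pb ?M) (theta ?M q w) s"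
      unfolding carrier_loc[OF r(8)] by blast
    have "fraction T (pb ?Q) (theta ?Q ?q w) s = ?Y" using f_inv_into_f[OF im] lm[OF w(1,2)] w(3) by simp
    then obtain v where v: "v \<in> T" "v *: (t *: w - s *: z) \<in> Ph X" using frac_eq[OF PPQ r(1) w(1,2) z t] by blast
    have tt: "t\<^sub>0 * t \<in> T" "t\<^sub>0 * s \<in> T" using r(1,2) t w by (simp_all add: mulsetD)
    have aB: "a w \<in> B" "a z \<in> B" using w z r(5) by auto
    have "a (v *: (t *: w - s *: z)) \<in> X" using v X(4) by blast
    then have "t\<^sub>0 *: a (v *: (t *: w - s *: z)) \<in> X" using X(1) by (intro submod_smul)
    also have "t\<^sub>0 *: a (v *: (t *: w - s *: z)) = v *: ((t\<^sub>0 * t) *: a w - (t\<^sub>0 * s) *: a z)"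
      by (simp add: linD(2)[OF r(4)] lin_diff[OF r(4)] smul_simps mult_ac)
    finally have "fraction T ?Q (?q (a w)) (t\<^sub>0 * s) = fraction T ?Q (?q (a z)) (t\<^sub>0 * t)"
      using frac_eq[OF PQ r(1) aB(1) tt(2) aB(2) tt(1)] v(1) by blast
    moreover have "loc_map T ?Q ?\<pi> (fraction T ?M (q (a w)) (t\<^sub>0 * s)) = fraction T ?Q (?q (a w)) (t\<^sub>0 * s)"
      by (rule loc_map_frac[OF r(3) PQ X(2) subset_refl r(1) r(1) subset_refl _ aB(1) tt(2)]) simp
    ultimately show ?thesis using r(7)[OF w(1,2)] w(3) by (simp add: quot_object_def Let_def)
  qed
  have "fst (quot_object \<phi> RT T Z (q ` X)) = ?Q" by (simp add: quot_object_def Let_def)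
  then show ?thesis unfolding rep_def using r PQ X main by simp
qed

lemma rep_module_iso:
  assumes R: "rep T t\<^sub>0 Z A B q a" and bij: "bij_betw (snd Z) (carrier (loc_module RT T (pb (fst Z)))) (carrier (loc_module RT T (fst Z)))"
  shows "phi_bijective \<phi> RT T Z"
  unfolding phi_bijective_def module_iso_def
proof (intro conjI ballI)
  note r = repD[OF R]
  show "bij_betw (snd Z) (carrier (loc_module RT T (pb (fst Z)))) (carrier (loc_module RT T (fst Z)))" by (rule bij)
next
  note r = repD[OF R]
  fix X Y assume "X \<in> carrier (loc_module RT T (pb (fst Z)))" "Y \<in> carrier (loc_module RT T (pb (fst Z)))"
  then obtain z t w s where z: "z \<in> Ph B" "t \<in> T" "X = fraction T (pb (fst Z)) (theta (fst Z) q z) t"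
    and w: "w \<in> Ph B" "s \<in> T" "Y = fraction T (pb (fst Z)) (theta (fst Z) q w) s"
    unfolding carrier_loc[OF r(8)] by blast
  have B: "submod B" "submod (Ph B)" using presentsD(2)[OF r(3)] by simp_all
  have ab: "a z \<in> B" "a w \<in> B" using z w r(5) by auto
  have tt: "t\<^sub>0 * t \<in> T" "t\<^sub>0 * s \<in> T" "t * s \<in> T" using r(1,2) z w by (simp_all add: mulsetD)
  have zw: "s *: z + t *: w \<in> Ph B" using z w B by (intro submod_add submod_smul)
  have "fraction T (fst Z) (q (a (s *: z + t *: w))) (t\<^sub>0 * (t * s))
      = fraction T (fst Z) (q ((t\<^sub>0 * s) *: a z + (t\<^sub>0 * t) *: a w)) (t\<^sub>0 * t * (t\<^sub>0 * s))"
  proof -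
    have "a (s *: z + t *: w) \<in> B" "(t\<^sub>0 * s) *: a z + (t\<^sub>0 * t) *: a w \<in> B" using zw r(5) ab B by (auto intro!: submod_add submod_smul)
    moreover have "t\<^sub>0 * (t * s) \<in> T" "t\<^sub>0 * t * (t\<^sub>0 * s) \<in> T" using tt r(1,2) by (simp_all add: mulsetD)
    moreover have "1 *: ((t\<^sub>0 * t * (t\<^sub>0 * s)) *: a (s *: z + t *: w) - (t\<^sub>0 * (t * s)) *: ((t\<^sub>0 * s) *: a z + (t\<^sub>0 * t) *: a w)) = 0"
      by (simp add: linD[OF r(4)] smul_simps mult_ac)
    ultimately show ?thesis
      using frac_eq[OF r(3,1)] mulsetD(1)[OF r(1)] submod_0[OF presentsD(1)[OF r(3)]] by metis
  qed
  then show "snd Z (X \<oplus>\<^bsub>loc_module RT T (pb (fst Z))\<^esub> Y) = snd Z X \<oplus>\<^bsub>loc_module RT T (fst Z)\<^esub> snd Z Y"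
    unfolding z(3) w(3) loc_add[OF r(8,1) z(1,2) w(1,2)] r(7)[OF z(1,2)] r(7)[OF w(1,2)] r(7)[OF zw tt(3)]
      loc_add[OF r(3,1) ab(1) tt(1) ab(2) tt(2)] .
next
  note r = repD[OF R]
  fix b X assume "b \<in> carrier (loc_ring RT T)" "X \<in> carrier (loc_module RT T (pb (fst Z)))"
  then obtain c s z t where b: "s \<in> T" "b = sfrac T c s" and z: "z \<in> Ph B" "t \<in> T" "X = fraction T (pb (fst Z)) (theta (fst Z) q z) t"
    unfolding carrier_loc[OF r(8)] carrier_loc_ring by blast
  have ab: "a z \<in> B" using z r(5) by auto
  have tt: "t\<^sub>0 * t \<in> T" "s * t \<in> T" using r(1,2) z b by (simp_all add: mulsetD)
  have cz: "c *: z \<in> Ph B" using z presentsD(2)[OF r(3)] by (intro submod_smul) auto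
  show "snd Z (b \<odot>\<^bsub>loc_module RT T (pb (fst Z))\<^esub> X) = b \<odot>\<^bsub>loc_module RT T (fst Z)\<^esub> snd Z X"
    unfolding z(3) b(2) loc_smult[OF r(8,1) z(1,2) b(1)] r(7)[OF z(1,2)] r(7)[OF cz tt(2)]
      loc_smult[OF r(3,1) ab tt(1) b(1)] by (simp add: linD(2)[OF r(4)] mult_ac)
qed

lemma strict_iff:
  assumes R: "rep u_powers t\<^sub>0 Z A B q a"
  shows "strict_subobject p \<sigma> Z H \<longleftrightarrow>
    (\<exists>X. H = q ` X \<and> submod X \<and> A <= X \<and> X <= B \<and> (\<forall>x\<in>B. u *: x \<in> X --> x \<in> X) \<and> a ` Ph X <= X)"
proof -
  note r = repD[OF R]
  note d = presentsD[OF r(3)]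
  have tf: "u_torsion_free (quot_module (fst Z) (q ` X)) \<longleftrightarrow> (\<forall>x\<in>B. u *: x \<in> X --> x \<in> X)"
    if X: "submod X" "A <= X" "X <= B" for X
  proof -
    note PQ = presents_quot[OF r(3) X]
    note e = presentsD[OF PQ]
    show ?thesis unfolding u_torsion_free_def e(4)
      using presents_zero_iff[OF PQ] e(7) d(2) by (simp add: submod_smul)
  qed
  \<comment> \<open>Stability is defined after u is inverted; saturation of \<open>X\<close> brings
    it back to \<open>X\<close> itself.\<close>
  have st: "phi_stable \<phi> RT u_powers Z (q ` X) \<longleftrightarrow> a ` Ph X <= X"
    if X: "submod X" "A <= X" "X <= B" and sat: "\<forall>x\<in>B. u *: x \<in> X --> x \<in> X" for X
  proof -
    let ?M = "fst Z" let ?N = "?M\<lparr>carrier := q ` X\<rparr>"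
    have PN: "presents ?N A X q" by (rule presents_sub[OF r(3) X])
    note PPN = presents_pullback[OF PN]
    have val: "snd Z (loc_map u_powers (pb ?M) (pullback_map \<phi> RT ?M id) (fraction u_powers (pb ?N) (theta ?N q z) t))
        = fraction u_powers ?M (q (a z)) (t\<^sub>0 * t)" if z: "z \<in> Ph X" and t: "t \<in> u_powers" for z t
    proof -
      have zB: "z \<in> Ph B" using z Ph_mono[OF X(3)] by blast
      have "loc_map u_powers (pb ?M) (pullback_map \<phi> RT ?M id) (fraction u_powers (pb ?N) (theta ?N q z) t) = fraction u_powers (pb ?M) (theta ?M q z) t"
        by (rule loc_map_frac[OF PPN r(8) subset_refl Ph_mono[OF X(3)] r(1) r(1) subset_refl _ z t],
            rule pullback_map_theta[OF PN r(3) subset_refl X(3)]) auto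
      then show ?thesis using r(7)[OF zB t] by simp
    qed
    have m: "loc_map u_powers ?M id (fraction u_powers ?N (q x) t) = fraction u_powers ?M (q x) t" if "x \<in> X" "t \<in> u_powers" for x t
      by (rule loc_map_frac[OF PN r(3) subset_refl X(3) r(1) r(1)]) (use that in auto)
    have satk: "x \<in> X" if "x \<in> B" "u ^ k *: x \<in> X" for x k
      using that
    proof (induction k)
      case (Suc k)
      have "u *: (u ^ k *: x) \<in> X" using Suc.prems by (simp add: smul_simps)
      moreover have "u ^ k *: x \<in> B" using Suc.prems d(2) by (simp add: submod_smul)
      ultimately show ?case using sat Suc by blast
    qed (simp add: smul_simps)
    show ?thesis
    proof
      assume st: "phi_stable \<phi> RT u_powers Z (q ` X)"
      show "a ` Ph X <= X"
      proof
        fix y assume "y \<in> a ` Ph X"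
        then obtain z where z: "z \<in> Ph X" "y = a z" by blast
        have aB: "a z \<in> B" using z Ph_mono[OF X(3)] r(5) by blast
        have "fraction u_powers (pb ?N) (theta ?N q z) 1 \<in> carrier (loc_module RT u_powers (pb ?N))"
          unfolding carrier_loc[OF PPN] using z(1) power_in_powers(2) by blast
        then have "fraction u_powers ?M (q (a z)) (t\<^sub>0 * 1) \<in> loc_map u_powers ?M id ` carrier (loc_module RT u_powers ?N)"
          using st val[OF z(1) power_in_powers(2)] unfolding phi_stable_def Let_def by metis
        then obtain x t where x: "x \<in> X" "t \<in> u_powers" "fraction u_powers ?M (q (a z)) t\<^sub>0 = fraction u_powers ?M (q x) t"
          unfolding carrier_loc[OF PN] using m by auto
        obtain v where v: "v \<in> u_powers" "v *: (t *: a z - t\<^sub>0 *: x) \<in> A"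
          using frac_eq[OF r(3,1) aB r(2), of x t] x X(3) by blast
        have "v *: (t\<^sub>0 *: x) \<in> X" using x X(1) by (intro submod_smul)
        moreover have "(v * t) *: a z - v *: (t\<^sub>0 *: x) \<in> X" using v(2) X(2) by (auto simp: smul_simps)
        ultimately have "(v * t) *: a z \<in> X" using submod_diff_iff[OF X(1)] by blast
        moreover obtain k where "v * t = u ^ k" using v(1) x(2) by (auto simp: powers_def power_add[symmetric])
        ultimately show "y \<in> X" using satk[OF aB] z(2) by simp
      qed
    next
      assume aX: "a ` Ph X <= X"
      show "phi_stable \<phi> RT u_powers Z (q ` X)"
        unfolding phi_stable_def Let_def
      proof
        fix Y assume "Y \<in> carrier (loc_module RT u_powers (pb ?N))"
        then obtain z t where z: "z \<in> Ph X" "t \<in> u_powers" "Y = fraction u_powers (pb ?N) (theta ?N q z) t"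
          unfolding carrier_loc[OF PPN] by blast
        have "a z \<in> X" "t\<^sub>0 * t \<in> u_powers" using aX z r(1,2) by (auto intro: mulsetD)
        then have "fraction u_powers ?M (q (a z)) (t\<^sub>0 * t) \<in> loc_map u_powers ?M id ` carrier (loc_module RT u_powers ?N)"
          unfolding carrier_loc[OF PN] using m by (intro image_eqI[of _ _ "fraction u_powers ?N (q (a z)) (t\<^sub>0 * t)"]) auto
        then show "snd Z (loc_map u_powers (pb ?M) (pullback_map \<phi> RT ?M id) Y) \<in> loc_map u_powers ?M id ` carrier (loc_module RT u_powers ?N)"
          unfolding z(3) val[OF z(1,2)] .
      qed
    qed
  qed
  show ?thesis
  proof
    assume s: "strict_subobject p \<sigma> Z H"
    then obtain X where X: "submod X" "A <= X" "X <= B" "H = q ` X"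
      unfolding strict_subobject_def submodule_iff[OF r(3)] by blast
    have sat: "\<forall>x\<in>B. u *: x \<in> X --> x \<in> X" using tf[OF X(1-3)] s unfolding strict_subobject_def X(4) by simp
    have "a ` Ph X <= X" using st[OF X(1-3) sat] s unfolding strict_subobject_def X(4) by simp
    then show "\<exists>X. H = q ` X \<and> submod X \<and> A <= X \<and> X <= B \<and> (\<forall>x\<in>B. u *: x \<in> X --> x \<in> X) \<and> a ` Ph X <= X"
      using X sat by (intro exI[of _ X] conjI)
  next
    assume "\<exists>X. H = q ` X \<and> submod X \<and> A <= X \<and> X <= B \<and> (\<forall>x\<in>B. u *: x \<in> X --> x \<in> X) \<and> a ` Ph X <= X"
    then obtain X where X: "H = q ` X" "submod X" "A <= X" "X <= B" "\<forall>x\<in>B. u *: x \<in> X --> x \<in> X" "a ` Ph X <= X" by blast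
    have "submodule H RT (fst Z)" unfolding submodule_iff[OF r(3)] using X(1-4) by blast
    then show "strict_subobject p \<sigma> Z H"
      unfolding strict_subobject_def using tf[OF X(2-4)] st[OF X(2-5)] X(1,5,6) by simp
  qed
qed

lemma torsion_rank_rep:
  assumes "presents (fst Z) A B q" shows "torsion_rank Z = the_enat (rkl A B)"
  unfolding torsion_rank_def Let_def residue_length[OF assms] rkl_def ..

lemma torsion_degree_rep:
  assumes R: "rep u_powers (u ^ N) Z A B q a" and B: "B <= VV r" and A: "usat r A"
    and k: "rkl A B = enat k" and l: "len (A + a ` Ph B) B = enat l"
  shows "torsion_degree p \<sigma> ee Z = (real N * real k - real l) / real ee"
proof -
  note r = repD[OF R]
  note d = presentsD[OF r(3)]
  let ?M = "fst Z" let ?V = "loc_module RT u_powers ?M"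
  let ?\<iota> = "%x. fraction u_powers ?M x 1"
  let ?U = "%i. {sfrac u_powers (u ^ i) 1 \<odot>\<^bsub>?V\<^esub> snd Z (fraction u_powers (pb ?M) y 1) | y. y \<in> carrier (pb ?M)}"
  \<comment> \<open>The part of \<open>B\<close> that represents u^i times the image of the
    structure map: since the latter is a/u^N, the condition is u^N y = u^i a(z) modulo
    \<open>A\<close>.\<close>
  define Y where "Y i = {y \<in> B. \<exists>z\<in>Ph B. u ^ N *: y - u ^ i *: a z \<in> A}" for i
  have aB: "a z \<in> B" if "z \<in> Ph B" for z using that r(5) by blast
  have U: "?U i = {fraction u_powers ?M (q (u ^ i *: a z)) (u ^ N) | z. z \<in> Ph B}" for i
  proof -
    have "sfrac u_powers (u ^ i) 1 \<odot>\<^bsub>?V\<^esub> snd Z (fraction u_powers (pb ?M) (theta ?M q z) 1) = fraction u_powers ?M (q (u ^ i *: a z)) (u ^ N)"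
      if "z \<in> Ph B" for z
      using r(7)[OF that power_in_powers(2)] loc_smult[OF r(3,1) aB[OF that] r(2) power_in_powers(2), of "u ^ i"] by simp
    then show ?thesis unfolding presentsD(4)[OF r(8)] by auto
  qed
  have iota: "?\<iota> (q y) = fraction u_powers ?M (q (u ^ i *: a z)) (u ^ N) \<longleftrightarrow> u ^ N *: y - u ^ i *: a z \<in> A"
    if y: "y \<in> B" and z: "z \<in> Ph B" for y z i
  proof -
    have "?\<iota> (q y) = fraction u_powers ?M (q (u ^ i *: a z)) (u ^ N) \<longleftrightarrow> (\<exists>v\<in>u_powers. v *: (u ^ N *: y - 1 *: (u ^ i *: a z)) \<in> A)"
      by (rule frac_eq[OF r(3,1) y power_in_powers(2) _ r(2)]) (use aB[OF z] d(2) in \<open>simp add: submod_smul\<close>)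
    also have "\<dots> \<longleftrightarrow> u ^ N *: y - u ^ i *: a z \<in> A"
    proof
      assume "\<exists>v\<in>u_powers. v *: (u ^ N *: y - 1 *: (u ^ i *: a z)) \<in> A"
      then obtain j where "u ^ j *: (u ^ N *: y - u ^ i *: a z) \<in> A" by (auto simp: powers_def smul_simps(6))
      moreover have "u ^ N *: y - u ^ i *: a z \<in> VV r" using y aB[OF z] B by (intro submod_diff submod_smul submod_VV) auto
      ultimately show "u ^ N *: y - u ^ i *: a z \<in> A" using usat_pow[OF A] by blast
    qed (auto intro!: bexI[of _ 1] simp: smul_simps(6))
    finally show ?thesis .
  qed
  have Yset: "{x \<in> carrier ?M. ?\<iota> x \<in> ?U i} = q ` Y i" for i
    unfolding U d(4) Y_def using iota by auto blast+
  have aa: "submod (a ` Ph B)" using d(2) r(4) by (simp add: submod_image)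
  have sY: "submod (Y i)" for i
  proof (rule submodI)
    show "0 \<in> Y i" using d(1,2) lin_0[OF r(4)] unfolding Y_def
      by (auto intro!: bexI[of _ 0] simp: submod_0 smul_simps)
  next
    fix x y assume "x \<in> Y i" "y \<in> Y i"
    then obtain z w where zw: "x \<in> B" "y \<in> B" "z \<in> Ph B" "w \<in> Ph B" "u ^ N *: x - u ^ i *: a z \<in> A" "u ^ N *: y - u ^ i *: a w \<in> A"
      unfolding Y_def by blast
    have "(u ^ N *: x - u ^ i *: a z) + (u ^ N *: y - u ^ i *: a w) \<in> A" by (rule submod_add[OF d(1) zw(5,6)])
    also have "(u ^ N *: x - u ^ i *: a z) + (u ^ N *: y - u ^ i *: a w) = u ^ N *: (x + y) - u ^ i *: a (z + w)"
      by (simp add: smul_simps linD[OF r(4)])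
    finally show "x + y \<in> Y i" unfolding Y_def using zw d(2) by (auto simp: submod_add intro!: bexI[of _ "z + w"])
  next
    fix c x assume "x \<in> Y i"
    then obtain z where z: "x \<in> B" "z \<in> Ph B" "u ^ N *: x - u ^ i *: a z \<in> A" unfolding Y_def by blast
    have "c *: (u ^ N *: x - u ^ i *: a z) \<in> A" by (rule submod_smul[OF d(1) z(3)])
    also have "c *: (u ^ N *: x - u ^ i *: a z) = u ^ N *: (c *: x) - u ^ i *: a (c *: z)"
      by (simp add: smul_simps linD[OF r(4)] mult.commute)
    finally show "c *: x \<in> Y i" unfolding Y_def using z d(2) by (auto simp: submod_smul intro!: bexI[of _ "c *: z"])
  qed
  have AY: "A <= Y i" for i
  proof
    fix x assume x: "x \<in> A"
    then have "u ^ N *: x - u ^ i *: a 0 \<in> A" using d(1) lin_0[OF r(4)] by (simp add: smul_simps submod_smul)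
    then show "x \<in> Y i" unfolding Y_def using x d(2,3) by (auto intro!: bexI[of _ 0] simp: submod_0)
  qed
  have YB: "Y i <= B" for i by (auto simp: Y_def)
  have len_quot: "module_length RT (quot_module ?M {x \<in> carrier ?M. ?\<iota> x \<in> ?U i}) = len (Y i) B" for i
    unfolding Yset by (rule module_length_eq[OF presents_quot[OF r(3) sY AY YB]])
  have val: "(real i * real k - real (the_enat (len (Y i) B))) / real ee = (real N * real k - real l) / real ee"
    if i: "?U i <= ?\<iota> ` carrier ?M" for i
  proof -
    have ex: "\<exists>y\<in>B. u ^ N *: y - u ^ i *: a z \<in> A" if z: "z \<in> Ph B" for z
    proof -
      have "fraction u_powers ?M (q (u ^ i *: a z)) (u ^ N) \<in> ?\<iota> ` carrier ?M" using i z unfolding U by blast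
      then obtain y where "y \<in> B" "fraction u_powers ?M (q (u ^ i *: a z)) (u ^ N) = ?\<iota> (q y)" unfolding d(4) by blast
      then show ?thesis using iota[of y z i] z by metis
    qed
    \<comment> \<open>Modulo \<open>A\<close>, u^N Y_i is u^i times the image of \<open>a\<close>.
      Counting the colength of this submodule in two ways by \<open>len_smul_u\<close> makes the
      value independent of i.\<close>
    have e: "A + smul (u ^ N) ` Y i = A + smul (u ^ i) ` (A + a ` Ph B)"
    proof (rule antisym; rule plus_least)
      show "submod (A + smul (u ^ i) ` (A + a ` Ph B))" "submod (A + smul (u ^ N) ` Y i)"
        using d(1) aa sY by (simp_all add: submod_plus)
      show "A <= A + smul (u ^ i) ` (A + a ` Ph B)" "A <= A + smul (u ^ N) ` Y i"
        using d(1) aa sY by (simp_all add: le_plus1 submod_plus)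
      show "smul (u ^ N) ` Y i <= A + smul (u ^ i) ` (A + a ` Ph B)"
      proof
        fix x assume "x \<in> smul (u ^ N) ` Y i"
        then obtain y z where y: "x = u ^ N *: y" "z \<in> Ph B" "u ^ N *: y - u ^ i *: a z \<in> A" unfolding Y_def by blast
        have "a z \<in> A + a ` Ph B" using y(2) le_plus2[OF d(1), of "a ` Ph B"] by blast
        then have "(u ^ N *: y - u ^ i *: a z) + u ^ i *: a z \<in> A + smul (u ^ i) ` (A + a ` Ph B)"
          using y(3) by (intro set_plus_intro) auto
        then show "x \<in> A + smul (u ^ i) ` (A + a ` Ph B)" using y(1) by simp
      qed
      show "smul (u ^ i) ` (A + a ` Ph B) <= A + smul (u ^ N) ` Y i"
      proof
        fix x assume "x \<in> smul (u ^ i) ` (A + a ` Ph B)"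
        then obtain b z where bz: "b \<in> A" "z \<in> Ph B" "x = u ^ i *: (b + a z)" by (auto simp: set_plus_def)
        obtain y where y: "y \<in> B" "u ^ N *: y - u ^ i *: a z \<in> A" using ex[OF bz(2)] by blast
        have "y \<in> Y i" using y bz(2) by (auto simp: Y_def)
        moreover have "u ^ i *: b - (u ^ N *: y - u ^ i *: a z) \<in> A" by (rule submod_diff[OF d(1) submod_smul[OF d(1) bz(1)] y(2)])
        ultimately have "(u ^ i *: b - (u ^ N *: y - u ^ i *: a z)) + u ^ N *: y \<in> A + smul (u ^ N) ` Y i" by (intro set_plus_intro) auto
        then show "x \<in> A + smul (u ^ N) ` Y i" by (simp add: bz(3) smul_simps)
      qed
    qed
    have aPB: "A + a ` Ph B <= B" "A <= A + a ` Ph B" using d r(5) aa by (simp_all add: plus_least le_plus1)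
    have "len (A + smul (u ^ N) ` Y i) B = len (Y i) B + enat N * rkl A B"
      by (rule len_smul_u) (use d sY AY YB B A in auto)
    moreover have "len (A + smul (u ^ i) ` (A + a ` Ph B)) B = len (A + a ` Ph B) B + enat i * rkl A B"
      by (rule len_smul_u) (use d aa aPB B A in \<open>auto simp: submod_plus\<close>)
    ultimately have "len (Y i) B + enat (N * k) = enat (l + i * k)" using e k l by simp
    then obtain m where m: "len (Y i) B = enat m" "m + N * k = l + i * k" by (cases "len (Y i) B") auto
    have "real m + real N * real k = real l + real i * real k" using arg_cong[OF m(2), of real] by simp
    then show ?thesis using m(1) by simp
  qed
  \<comment> \<open>For i = N the denominators cancel, so the definite description has a
    witness.\<close>
  have exN: "?U N <= ?\<iota> ` carrier ?M"
  proof
    fix x assume "x \<in> ?U N"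
    then obtain z where z: "z \<in> Ph B" "x = fraction u_powers ?M (q (u ^ N *: a z)) (u ^ N)" unfolding U by blast
    then have "x = ?\<iota> (q (a z))" using iota[OF aB[OF z(1)] z(1), of N] d(1) by (simp add: submod_0)
    then show "x \<in> ?\<iota> ` carrier ?M" using aB[OF z(1)] d(4) by blast
  qed
  have "torsion_degree p \<sigma> ee Z = (THE d. \<exists>i. ?U i <= ?\<iota> ` carrier ?M \<and> d = (real i * real k - real (the_enat (len (Y i) B))) / real ee)"
    unfolding torsion_degree_def Let_def torsion_rank_rep[OF r(3)] k len_quot by simp
  also have "\<dots> = (real N * real k - real l) / real ee"
  proof (rule the_equality)
    show "\<exists>i. ?U i <= ?\<iota> ` carrier ?M \<and> (real N * real k - real l) / real ee = (real i * real k - real (the_enat (len (Y i) B))) / real ee"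
      by (intro exI[of _ N] conjI exN val[OF exN, symmetric])
  next
    fix d assume "\<exists>i. ?U i <= ?\<iota> ` carrier ?M \<and> d = (real i * real k - real (the_enat (len (Y i) B))) / real ee"
    then obtain i where i: "?U i <= ?\<iota> ` carrier ?M" "d = (real i * real k - real (the_enat (len (Y i) B))) / real ee" by (elim exE conjE)
    show "d = (real N * real k - real l) / real ee" unfolding i(2) by (rule val[OF i(1)])
  qed
  finally show ?thesis .
qed

end

section \<open>Diagonalization of matrices\<close>

lemma index_mult_sum:
  assumes "A \<in> carrier_mat n m" "B \<in> carrier_mat m l" "i < n" "j < l"
  shows "(A * B) $$ (i, j) = (\<Sum>k<m. A $$ (i, k) * B $$ (k, j))"
  using assms by (auto simp: scalar_prod_def lessThan_atLeast0 intro!: sum.cong)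

text \<open>\<open>\<pi>\<close> is a prime element of the quotient by the ideal \<open>J\<close>, and \<open>Us\<close> consists of elements prime to it. This
  covers both the localization of \<open>\<SS>\<close> at \<open>(E)\<close> and \<open>\<SS>/p\<close>.\<close>

locale valuation_mod =
  fixes J Us :: "'a::comm_ring_1 set" and \<pi> :: 'a
  assumes J0: "0 \<in> J" and J_add: "!!x y. x \<in> J ==> y \<in> J ==> x + y \<in> J" and J_mult: "!!c x. x \<in> J ==> c * x \<in> J"
    and U1: "1 \<in> Us" and U_neg: "- 1 \<in> Us" and U_mult: "!!s t. s \<in> Us ==> t \<in> Us ==> s * t \<in> Us"
    and decomp: "!!x. x \<notin> J ==> \<exists>k s. s \<in> Us \<and> x - \<pi> ^ k * s \<in> J"
begin

lemma J_neg: "x \<in> J ==> - x \<in> J" using J_mult[of x "- 1"] by simp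
lemma J_diff: "x \<in> J ==> y \<in> J ==> x - y \<in> J" using J_add[of x "- y"] J_neg[of y] by simp
lemma J_mult': "x \<in> J ==> x * c \<in> J" using J_mult[of x c] by (simp add: mult.commute)
lemma J_sum: "(!!k. k \<in> K ==> f k \<in> J) ==> (\<Sum>k\<in>K. f k) \<in> J"
  by (induction K rule: infinite_finite_induct) (auto simp: J0 J_add)
lemma U_power: "s \<in> Us ==> s ^ n \<in> Us" by (induction n) (auto simp: U1 U_mult)

text \<open>\<open>Us\<close> stands for the elements that become units in the valuation ring. Only
  \<open>det P\<close> and \<open>det Q\<close> are controlled, so rows and columns may be
  multiplied by elements of \<open>Us\<close> and nothing is ever divided.\<close>

definition diagonalizable :: "nat => 'a mat => bool" where
  "diagonalizable n A \<longleftrightarrow> (\<exists>P Q. P \<in> carrier_mat n n \<and> Q \<in> carrier_mat n n \<and> det P \<in> Us \<and> det Q \<in> Us \<and>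
     (\<forall>i<n. \<forall>j<n. i ~= j --> (P * A * Q) $$ (i, j) \<in> J))"

lemma diagonalizable_transform:
  assumes "A \<in> carrier_mat n n" "P \<in> carrier_mat n n" "Q \<in> carrier_mat n n" "det P \<in> Us" "det Q \<in> Us"
    and d: "diagonalizable n (P * A * Q)"
  shows "diagonalizable n A"
proof -
  obtain P' Q' where PQ: "P' \<in> carrier_mat n n" "Q' \<in> carrier_mat n n" "det P' \<in> Us" "det Q' \<in> Us"
    "\<forall>i<n. \<forall>j<n. i ~= j --> (P' * (P * A * Q) * Q') $$ (i, j) \<in> J" using d unfolding diagonalizable_def by blast
  have e: "(P' * P) * A * (Q * Q') = P' * (P * A * Q) * Q'"
    using assms PQ by (simp add: assoc_mult_mat[of _ n n _ n _ n] mult_carrier_mat[of _ n n _ n])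
  have off: "\<forall>i<n. \<forall>j<n. i ~= j --> ((P' * P) * A * (Q * Q')) $$ (i, j) \<in> J" unfolding e by (rule PQ(5))
  show ?thesis unfolding diagonalizable_def
    by (rule exI[of _ "P' * P"], rule exI[of _ "Q * Q'"], intro conjI off)
      (use assms PQ in \<open>simp_all add: mult_carrier_mat[of _ n n _ n] det_mult[of _ n] U_mult\<close>)
qed

lemma swap_transform:
  assumes A: "A \<in> carrier_mat n n" and i: "i < n" and j: "j < n" and l: "l < n"
  obtains P Q where "P \<in> carrier_mat n n" "Q \<in> carrier_mat n n" "det P \<in> Us" "det Q \<in> Us"
    "(P * A * Q) $$ (l, l) = A $$ (i, j)" "!!a b. a < n ==> b < n ==> \<exists>a'<n. \<exists>b'<n. (P * A * Q) $$ (a, b) = A $$ (a', b')"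
proof -
  define S :: "nat => 'a mat" where "S k = (if k = l then 1\<^sub>m n else swaprows_mat n l k)" for k
  have S: "S k \<in> carrier_mat n n" "det (S k) \<in> Us" if "k < n" for k
    using that l U1 U_neg by (auto simp: S_def det_swaprows_mat)
  define sw where "sw k a = (if a = l then k else if a = k then l else a)" for k a :: nat
  have row: "(S k * B) $$ (a, b) = B $$ (sw k a, b)" if "k < n" "a < n" "b < n" "B \<in> carrier_mat n n" for k a b B
  proof (cases "k = l")
    case False
    then have "S k * B = swaprows l k B" using swaprows_mat[of B n n l k] that l by (simp add: S_def del: index_mult_mat)
    then show ?thesis using that l False by (simp add: sw_def del: index_mult_mat)
  qed (use that l in \<open>simp add: S_def sw_def del: index_mult_mat\<close>)
  have col: "(B * S k) $$ (a, b) = B $$ (a, sw k b)" if "k < n" "a < n" "b < n" "B \<in> carrier_mat n n" for k a b B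
  proof (cases "k = l")
    case False
    then have "B * S k = swapcols l k B" using swapcols_mat[of B n n l k] that l by (simp add: S_def del: index_mult_mat)
    then show ?thesis using that l False by (simp add: sw_def del: index_mult_mat)
  qed (use that l in \<open>simp add: S_def sw_def del: index_mult_mat\<close>)
  have SA: "S i * A \<in> carrier_mat n n" using S(1)[OF i] A by simp
  have sw: "sw k a < n" if "k < n" "a < n" for k a using that l by (simp add: sw_def)
  have e: "(S i * A * S j) $$ (a, b) = A $$ (sw i a, sw j b)" if "a < n" "b < n" for a b
    using col[OF j that SA] row[OF i that(1) sw[OF j that(2)] A] by simp
  show thesis
  proof (rule that[of "S i" "S j"])
    show "(S i * A * S j) $$ (l, l) = A $$ (i, j)" using e[OF l l] by (simp add: sw_def)
    show "\<exists>a'<n. \<exists>b'<n. (S i * A * S j) $$ (a, b) = A $$ (a', b')" if "a < n" "b < n" for a b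
      using e[OF that] sw[OF i that(1)] sw[OF j that(2)] by blast
  qed (use S i j in auto)
qed

lemma diagonalizable_all: "A \<in> carrier_mat n n ==> diagonalizable n A"
proof (induction n arbitrary: A)
  case 0
  show ?case unfolding diagonalizable_def
    by (rule exI[of _ "1\<^sub>m 0"], rule exI[of _ "1\<^sub>m 0"]) (auto simp: U1)
next
  case (Suc n)
  note A = Suc.prems
  show ?case
  proof (cases "\<forall>i<Suc n. \<forall>j<Suc n. A $$ (i, j) \<in> J")
    case True
    then show ?thesis unfolding diagonalizable_def
      by (intro exI[of _ "1\<^sub>m (Suc n)"]) (use A in \<open>auto simp: U1\<close>)
  next
    case False
    \<comment> \<open>An entry of least order k is moved to the corner (n, n); up to
      \<open>J\<close>, every entry is then a multiple of \<pi>^k.\<close>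
    let ?P = "%k. \<exists>i<Suc n. \<exists>j<Suc n. \<exists>s\<in>Us. A $$ (i, j) \<notin> J \<and> A $$ (i, j) - \<pi> ^ k * s \<in> J"
    have ex: "\<exists>k. ?P k" using False decomp by blast
    define k where "k = (LEAST k. ?P k)"
    have "?P k" unfolding k_def using ex by (rule LeastI_ex)
    then obtain i j s where ij: "i < Suc n" "j < Suc n" "s \<in> Us" "A $$ (i, j) - \<pi> ^ k * s \<in> J" by blast
    have div: "\<exists>y. A $$ (a, b) - \<pi> ^ k * y \<in> J" if "a < Suc n" "b < Suc n" for a b
    proof (cases "A $$ (a, b) \<in> J")
      case True then show ?thesis by (intro exI[of _ 0]) simp
    next
      case F: False
      then obtain m t where mt: "t \<in> Us" "A $$ (a, b) - \<pi> ^ m * t \<in> J" using decomp by blast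
      then have "k \<le> m" unfolding k_def using that F by (intro Least_le) blast
      then have "\<pi> ^ m * t = \<pi> ^ k * (\<pi> ^ (m - k) * t)" by (simp add: mult.assoc[symmetric] power_add[symmetric])
      then show ?thesis using mt by metis
    qed
    obtain P1 Q1 where 1: "P1 \<in> carrier_mat (Suc n) (Suc n)" "Q1 \<in> carrier_mat (Suc n) (Suc n)" "det P1 \<in> Us" "det Q1 \<in> Us"
      "(P1 * A * Q1) $$ (n, n) = A $$ (i, j)"
      "!!a b. a < Suc n ==> b < Suc n ==> \<exists>a'<Suc n. \<exists>b'<Suc n. (P1 * A * Q1) $$ (a, b) = A $$ (a', b')"
      using swap_transform[OF A ij(1,2), of n] by blast
    define B where "B = P1 * A * Q1"
    have B: "B \<in> carrier_mat (Suc n) (Suc n)" using 1 A by (simp add: B_def)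
    have "\<exists>y. B $$ (a, b) - \<pi> ^ k * y \<in> J" if "a < Suc n" "b < Suc n" for a b
      using 1(6)[OF that] div unfolding B_def by metis
    then have "\<forall>a. \<exists>y. a < n --> B $$ (a, n) - \<pi> ^ k * y \<in> J" "\<forall>b. \<exists>y. b < n --> B $$ (n, b) - \<pi> ^ k * y \<in> J"
      by (meson less_SucI lessI)+
    then obtain y x where y: "!!a. a < n ==> B $$ (a, n) - \<pi> ^ k * y a \<in> J" and x: "!!b. b < n ==> B $$ (n, b) - \<pi> ^ k * x b \<in> J"
      by metis
    have Bn: "B $$ (n, n) - \<pi> ^ k * s \<in> J" using 1(5) ij(4) by (simp add: B_def)
    \<comment> \<open>Every other row is multiplied by s before y a times the last row is
      subtracted, since s need not be invertible in the ring; the determinant is s^n.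
      \<open>Q2\<close> treats the columns in the same way.\<close>
    define P2 where "P2 = mat (Suc n) (Suc n) (%(a, b). if a < n then (if b = a then s else if b = n then - y a else 0) else (if b = n then 1 else 0))"
    define Q2 where "Q2 = mat (Suc n) (Suc n) (%(a, b). if b < n then (if a = b then s else if a = n then - x b else 0) else (if a = n then 1 else 0))"
    have P2: "P2 \<in> carrier_mat (Suc n) (Suc n)" and Q2: "Q2 \<in> carrier_mat (Suc n) (Suc n)" by (simp_all add: P2_def Q2_def)
    have dP2: "det P2 \<in> Us"
    proof -
      have "det P2 = prod_list (diag_mat P2)" by (rule det_upper_triangular[OF _ P2]) (auto simp: P2_def)
      also have "\<dots> = (\<Prod>a<Suc n. P2 $$ (a, a))" using P2 by (simp add: prod_list_diag_prod lessThan_atLeast0)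
      also have "\<dots> = s ^ n" by (simp add: P2_def)
      finally show ?thesis using U_power ij(3) by simp
    qed
    have dQ2: "det Q2 \<in> Us"
    proof -
      have "det Q2 = prod_list (diag_mat Q2)" by (rule det_lower_triangular[OF _ Q2]) (auto simp: Q2_def)
      also have "\<dots> = (\<Prod>a<Suc n. Q2 $$ (a, a))" using Q2 by (simp add: prod_list_diag_prod lessThan_atLeast0)
      also have "\<dots> = s ^ n" by (simp add: Q2_def)
      finally show ?thesis using U_power ij(3) by simp
    qed
    define C where "C = P2 * B"
    have C: "C \<in> carrier_mat (Suc n) (Suc n)" using P2 B by (simp add: C_def)
    have Ca: "C $$ (a, b) = s * B $$ (a, b) - y a * B $$ (n, b)" if "a < n" "b < Suc n" for a b
    proof -
      have "C $$ (a, b) = (\<Sum>l<Suc n. P2 $$ (a, l) * B $$ (l, b))" unfolding C_def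
        by (rule index_mult_sum[OF P2 B]) (use that in auto)
      also have "\<dots> = (\<Sum>l<n. P2 $$ (a, l) * B $$ (l, b)) + - y a * B $$ (n, b)" using that by (simp add: P2_def)
      also have "(\<Sum>l<n. P2 $$ (a, l) * B $$ (l, b)) = (\<Sum>l<n. if l = a then s * B $$ (a, b) else 0)"
        by (rule sum.cong) (use that in \<open>simp_all add: P2_def\<close>)
      finally show ?thesis using that by simp
    qed
    have Cn: "C $$ (n, b) = B $$ (n, b)" if "b < Suc n" for b
      using index_mult_sum[OF P2 B, of n b] that by (simp add: C_def P2_def)
    define D where "D = C * Q2"
    have D: "D \<in> carrier_mat (Suc n) (Suc n)" using C Q2 by (simp add: D_def)
    have Db: "D $$ (a, b) = s * C $$ (a, b) - x b * C $$ (a, n)" if "b < n" "a < Suc n" for a b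
    proof -
      have "D $$ (a, b) = (\<Sum>l<Suc n. C $$ (a, l) * Q2 $$ (l, b))" unfolding D_def
        by (rule index_mult_sum[OF C Q2]) (use that in auto)
      also have "\<dots> = (\<Sum>l<n. C $$ (a, l) * Q2 $$ (l, b)) + C $$ (a, n) * - x b" using that by (simp add: Q2_def)
      also have "(\<Sum>l<n. C $$ (a, l) * Q2 $$ (l, b)) = (\<Sum>l<n. if l = b then s * C $$ (a, b) else 0)"
        by (rule sum.cong) (use that in \<open>simp_all add: Q2_def mult.commute\<close>)
      finally show ?thesis using that by (simp add: mult.commute)
    qed
    have Dn: "D $$ (a, n) = C $$ (a, n)" if "a < Suc n" for a
      using index_mult_sum[OF C Q2, of a n] that by (simp add: D_def Q2_def)
    have DJ1: "D $$ (a, n) \<in> J" if "a < n" for a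
    proof -
      have "D $$ (a, n) = s * B $$ (a, n) - y a * B $$ (n, n)" using Dn Ca that by simp
      also have "\<dots> = s * (B $$ (a, n) - \<pi> ^ k * y a) - y a * (B $$ (n, n) - \<pi> ^ k * s)" by (simp add: algebra_simps)
      finally show ?thesis using y[OF that] Bn by (simp add: J_diff J_mult)
    qed
    have DJ2: "D $$ (n, b) \<in> J" if "b < n" for b
    proof -
      have "D $$ (n, b) = s * B $$ (n, b) - x b * B $$ (n, n)" using Db[OF that, of n] Cn that by simp
      also have "\<dots> = s * (B $$ (n, b) - \<pi> ^ k * x b) - x b * (B $$ (n, n) - \<pi> ^ k * s)" by (simp add: algebra_simps)
      finally show ?thesis using x[OF that] Bn by (simp add: J_diff J_mult)
    qed
    define D' where "D' = mat n n (%(a, b). D $$ (a, b))"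
    have D': "D' \<in> carrier_mat n n" by (simp add: D'_def)
    obtain P' Q' where PQ: "P' \<in> carrier_mat n n" "Q' \<in> carrier_mat n n" "det P' \<in> Us" "det Q' \<in> Us"
      "\<forall>i<n. \<forall>j<n. i ~= j --> (P' * D' * Q') $$ (i, j) \<in> J"
      using Suc.IH[OF D'] unfolding diagonalizable_def by blast
    define ext where "ext R = four_block_mat R (0\<^sub>m n 1) (0\<^sub>m 1 n) (1\<^sub>m 1)" for R :: "'a mat"
    have ext: "ext R \<in> carrier_mat (Suc n) (Suc n)" "det (ext R) = det R"
      "!!a b. a < Suc n ==> b < Suc n ==> ext R $$ (a, b) = (if a < n \<and> b < n then R $$ (a, b) else if a = n \<and> b = n then 1 else 0)"
      if R: "R \<in> carrier_mat n n" for R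
    proof -
      show "ext R \<in> carrier_mat (Suc n) (Suc n)" using R four_block_carrier_mat[of R n n "1\<^sub>m 1" 1 1] by (simp add: ext_def)
      show "det (ext R) = det R" unfolding ext_def
        using det_four_block_mat_upper_right_zero_col[OF R refl, of "0\<^sub>m 1 n" "1\<^sub>m 1"] by simp
      show "ext R $$ (a, b) = (if a < n \<and> b < n then R $$ (a, b) else if a = n \<and> b = n then 1 else 0)"
        if "a < Suc n" "b < Suc n" for a b
        using that R by (auto simp: ext_def less_Suc_eq)
    qed
    note eP = ext[OF PQ(1)] and eQ = ext[OF PQ(2)]
    have PD: "ext P' * D \<in> carrier_mat (Suc n) (Suc n)" using eP(1) D by simp
    have PDa: "(ext P' * D) $$ (a, b) = (\<Sum>l<n. P' $$ (a, l) * D $$ (l, b))" if "a < n" "b < Suc n" for a b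
      using that by (subst index_mult_sum[OF eP(1) D]) (auto simp: eP(3))
    have PDn: "(ext P' * D) $$ (n, b) = D $$ (n, b)" if "b < Suc n" for b
      using that by (subst index_mult_sum[OF eP(1) D]) (auto simp: eP(3))
    have G: "(ext P' * D * ext Q') $$ (a, b) = (\<Sum>l<n. (ext P' * D) $$ (a, l) * Q' $$ (l, b))" if "a < Suc n" "b < n" for a b
      using that by (subst index_mult_sum[OF PD eQ(1)]) (auto simp: eQ(3))
    have Gn: "(ext P' * D * ext Q') $$ (a, n) = (ext P' * D) $$ (a, n)" if "a < Suc n" for a
      using that by (subst index_mult_sum[OF PD eQ(1)]) (auto simp: eQ(3))
    have "diagonalizable (Suc n) D"
      unfolding diagonalizable_def
    proof (rule exI[of _ "ext P'"], rule exI[of _ "ext Q'"], intro conjI allI impI)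
      fix a b assume ab: "a < Suc n" "b < Suc n" "a ~= b"
      consider "a < n" "b < n" | "a < n" "b = n" | "a = n" "b < n" using ab by linarith
      then show "(ext P' * D * ext Q') $$ (a, b) \<in> J"
      proof cases
        case 1
        have PD': "P' * D' \<in> carrier_mat n n" using PQ(1) D' by simp
        have "(P' * D') $$ (a, l) = (\<Sum>k<n. P' $$ (a, k) * D $$ (k, l))" if "l < n" for l
          using that 1 by (subst index_mult_sum[OF PQ(1) D']) (auto simp: D'_def)
        then have "(P' * D' * Q') $$ (a, b) = (ext P' * D * ext Q') $$ (a, b)"
          using 1 ab by (subst index_mult_sum[OF PD' PQ(2)]) (auto simp: G PDa)
        then show ?thesis using PQ(5) 1 ab by metis
      next
        case 2
        then show ?thesis using Gn[OF ab(1)] PDa[of a n] DJ1 by (auto intro!: J_sum J_mult)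
      next
        case 3
        then show ?thesis using G[OF ab(1), of b] PDn DJ2 by (auto intro!: J_sum J_mult')
      qed
    qed (use eP eQ PQ in simp_all)
    moreover have "D = P2 * B * Q2" by (simp add: D_def C_def)
    ultimately have "diagonalizable (Suc n) B" using diagonalizable_transform[OF B P2 Q2 dP2 dQ2] by simp
    then show ?thesis unfolding B_def by (rule diagonalizable_transform[OF A 1(1-4)])
  qed
qed

text \<open>Every permutation other than the identity picks an entry off the diagonal.\<close>

lemma det_mod:
  assumes A: "A \<in> carrier_mat n n" and off: "!!i j. i < n ==> j < n ==> i ~= j ==> A $$ (i, j) \<in> J"
  shows "det A - (\<Prod>i<n. A $$ (i, i)) \<in> J"
proof -
  let ?t = "%f. signof f * (\<Prod>i = 0..<n. A $$ (i, f i))"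
  let ?S = "{f. f permutes {0..<n}}"
  have fin: "finite ?S" by (simp add: finite_permutations)
  have "det A = ?t id + (\<Sum>f\<in>?S - {id}. ?t f)"
    unfolding det_def'[OF A] by (rule sum.remove[OF fin]) (simp add: permutes_id)
  moreover have "?t f \<in> J" if f: "f \<in> ?S - {id}" for f
  proof -
    obtain i where i: "f i ~= i" using f by (auto simp: fun_eq_iff)
    have fp: "f permutes {0..<n}" using f by simp
    have "i < n" using permutes_not_in[OF fp, of i] i by force
    then have "f i < n" using permutes_in_image[OF fp, of i] by simp
    have "(\<Prod>i = 0..<n. A $$ (i, f i)) = A $$ (i, f i) * (\<Prod>i\<in>{0..<n} - {i}. A $$ (i, f i))"
      using \<open>i < n\<close> by (intro prod.remove) auto
    moreover have "A $$ (i, f i) \<in> J" using off[OF \<open>i < n\<close> \<open>f i < n\<close>] i by simp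
    ultimately show ?thesis by (simp only: J_mult J_mult')
  qed
  ultimately show ?thesis using J_sum[of "?S - {id}" ?t] by (simp add: lessThan_atLeast0)
qed

end

section \<open>Linear maps given by matrices\<close>

definition lm :: "nat => 'a::comm_ring_1 mat => 'a fvec => 'a fvec" where
  "lm r A x = fv (%i. if i < r then (\<Sum>j<r. A $$ (i, j) * cf x j) else 0)"

lemma lin_lm: "lin (lm r A)"
  by (auto simp: lin_def lm_def distrib_left sum.distrib sum_distrib_left mult_ac intro!: fvec_eqI)

lemma lm_VV [simp]: "lm r A x \<in> VV r"
  by (simp add: lm_def VV_def)

lemma lm_mult:
  assumes "A \<in> carrier_mat r r" "B \<in> carrier_mat r r" shows "lm r (A * B) x = lm r A (lm r B x)"
proof (rule fvec_eqI)
  fix i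
  show "cf (lm r (A * B) x) i = cf (lm r A (lm r B x)) i"
  proof (cases "i < r")
    case True
    have "(\<Sum>j<r. (A * B) $$ (i, j) * cf x j) = (\<Sum>j<r. \<Sum>k<r. A $$ (i, k) * B $$ (k, j) * cf x j)"
      using True by (intro sum.cong refl) (simp add: index_mult_sum[OF assms] sum_distrib_right)
    also have "\<dots> = (\<Sum>k<r. \<Sum>j<r. A $$ (i, k) * B $$ (k, j) * cf x j)" by (rule sum.swap)
    also have "\<dots> = (\<Sum>k<r. A $$ (i, k) * (\<Sum>j<r. B $$ (k, j) * cf x j))"
      by (simp add: sum_distrib_left mult.assoc)
    finally show ?thesis using True by (simp add: lm_def)
  qed (simp add: lm_def)
qed

lemma lm_scalar: "x \<in> VV r ==> lm r (c \<cdot>\<^sub>m 1\<^sub>m r) x = c *: x"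
proof (rule fvec_eqI)
  fix i assume x: "x \<in> VV r"
  show "cf (lm r (c \<cdot>\<^sub>m 1\<^sub>m r) x) i = cf (c *: x) i"
  proof (cases "i < r")
    case True
    have "(\<Sum>j<r. (c \<cdot>\<^sub>m 1\<^sub>m r) $$ (i, j) * cf x j) = (\<Sum>j<r. if j = i then c * cf x i else 0)"
      using True by (intro sum.cong) auto
    then show ?thesis using True by (simp add: lm_def)
  qed (use x in \<open>simp add: lm_def VV_def\<close>)
qed

lemma lm_adj:
  assumes A: "A \<in> carrier_mat r r" and x: "x \<in> VV r"
  shows "lm r A (lm r (adj_mat A) x) = det A *: x" "lm r (adj_mat A) (lm r A x) = det A *: x"
  using adj_mat[OF A] lm_mult[OF A, of "adj_mat A" x] lm_mult[OF _ A, of "adj_mat A" x] lm_scalar[OF x, of "det A"]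
  by simp_all

lemma lin_eq_lm:
  assumes f: "lin f" "!!x. x \<in> VV r ==> f x \<in> VV r" and x: "x \<in> VV r"
  shows "f x = lm r (mat r r (%(i, j). cf (f (fv (%k. if k = j then 1 else 0))) i)) x"
proof -
  let ?e = "%j. fv (%k. if k = j then 1 else 0)"
  have xe: "x = (\<Sum>j<r. cf x j *: ?e j)"
  proof (rule fvec_eqI)
    fix i
    have "(\<Sum>j<r. cf x j * (if i = j then 1 else 0)) = (\<Sum>j<r. if j = i then cf x i else 0)" by (intro sum.cong) auto
    then show "cf x i = cf (\<Sum>j<r. cf x j *: ?e j) i" using x by (auto simp: VV_def)
  qed
  have "f x = (\<Sum>j<r. cf x j *: f (?e j))" by (subst xe) (simp add: lin_sum f(1) linD(2))
  moreover have "f x \<in> VV r" by (rule f(2)[OF x])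
  ultimately show ?thesis by (intro fvec_eqI) (auto simp: lm_def VV_def mult.commute)
qed

section \<open>Colengths of matrices modulo \<open>p\<close>\<close>

text \<open>If m < n, both matrices are padded with zeros to size n. Then C' has a zero row and
  determinant 0, while the product is s times the identity. This will compare the sizes of two
  bases.\<close>

lemma mat_right_inverse_le:
  fixes B C :: "nat => nat => 'a::comm_ring_1"
  assumes BC: "!!i j. i < n ==> j < n ==> (\<Sum>l<m. B i l * C l j) = (if i = j then s else 0)" and s: "s ^ n ~= 0"
  shows "n \<le> m"
proof (rule ccontr)
  assume "\<not> n \<le> m"
  then have mn: "m < n" by simp
  define B' where "B' = mat n n (%(i, l). if l < m then B i l else 0)"
  define C' where "C' = mat n n (%(l, j). if l < m then C l j else 0)"
  have c: "B' \<in> carrier_mat n n" "C' \<in> carrier_mat n n" by (simp_all add: B'_def C'_def)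
  have "B' * C' = s \<cdot>\<^sub>m 1\<^sub>m n"
  proof (rule eq_matI)
    fix i j assume "i < dim_row (s \<cdot>\<^sub>m 1\<^sub>m n :: 'a mat)" "j < dim_col (s \<cdot>\<^sub>m 1\<^sub>m n :: 'a mat)"
    then have ij: "i < n" "j < n" by auto
    have "(B' * C') $$ (i, j) = (\<Sum>l<n. B' $$ (i, l) * C' $$ (l, j))" by (rule index_mult_sum[OF c ij])
    also have "\<dots> = (\<Sum>l<m. B i l * C l j)" using mn ij by (intro sum.mono_neutral_cong_right) (auto simp: B'_def C'_def)
    finally show "(B' * C') $$ (i, j) = (s \<cdot>\<^sub>m 1\<^sub>m n) $$ (i, j)" using BC ij by simp
  qed (use c in auto)
  then have "det B' * det C' = s ^ n" using det_mult[OF c] by simp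
  moreover have "det C' = 0"
    unfolding det_def'[OF c(2)]
  proof (rule sum.neutral, rule ballI)
    fix f assume "f \<in> {f. f permutes {0..<n}}"
    then have f: "f permutes {0..<n}" by simp
    have "f m < n" using permutes_in_image[OF f, of m] mn by simp
    then have "C' $$ (m, f m) = 0" using mn by (simp add: C'_def)
    then have "(\<Prod>i = 0..<n. C' $$ (i, f i)) = 0" using mn by (intro prod_zero) auto
    then show "signof f * (\<Prod>i = 0..<n. C' $$ (i, f i)) = 0" by simp
  qed
  ultimately show False using s by simp
qed

context witt
begin

lemma p_dvd_iff: "of_nat p dvd (x :: 'w fps) \<longleftrightarrow> (\<forall>i. \<rho> (fps_nth x i) = 0)"
  using p_dvd_fps[of 1 x] by (simp add: rho_eq_0)

lemma valuation_u: "valuation_mod {x :: 'w fps. of_nat p dvd x} {s. \<rho> (fps_nth s 0) ~= 0} u"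
proof
  have "\<rho> (- 1) = - 1" using rho_diff[of 0 1] by (simp add: rho_hom)
  then show "- 1 \<in> {s :: 'w fps. \<rho> (fps_nth s 0) ~= 0}" by simp
  show "1 \<in> {s :: 'w fps. \<rho> (fps_nth s 0) ~= 0}" by (simp add: rho_hom)
  fix x :: "'w fps"
  assume "x \<notin> {x. of_nat p dvd x}"
  then have ex: "\<exists>i. \<rho> (fps_nth x i) ~= 0" by (simp add: p_dvd_iff)
  define k where "k = (LEAST i. \<rho> (fps_nth x i) ~= 0)"
  have k: "\<rho> (fps_nth x k) ~= 0" unfolding k_def using ex by (rule LeastI_ex)
  have k': "\<rho> (fps_nth x i) = 0" if "i < k" for i using not_less_Least[of i] that unfolding k_def by blast
  have "of_nat p dvd x - u ^ k * fps_shift k x" using k' by (auto simp: p_dvd_iff fps_X_power_mult_nth)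
  then show "\<exists>k s. s \<in> {s. \<rho> (fps_nth s 0) ~= 0} \<and> x - u ^ k * s \<in> {x. of_nat p dvd x}"
    using k by (intro exI[of _ k] exI[of _ "fps_shift k x"]) simp
qed (auto simp: rho_hom)

lemma u_order_unique:
  assumes "of_nat p dvd (u ^ k * s - u ^ l * t :: 'w fps)" "\<rho> (fps_nth s 0) ~= 0" "\<rho> (fps_nth t 0) ~= 0"
  shows "k = l"
proof -
  have e: "\<rho> (fps_nth (u ^ k * s) i) = \<rho> (fps_nth (u ^ l * t) i)" for i
    using assms(1)[unfolded p_dvd_iff, rule_format, of i] by (simp add: rho_diff)
  have "\<not> k < l" using e[of k] assms(2) by (auto simp: fps_X_power_mult_nth)
  moreover have "\<not> l < k" using e[of l] assms(3) by (auto simp: fps_X_power_mult_nth)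
  ultimately show ?thesis by simp
qed

text \<open>The preimage in V of the direct sum of the u^(m i) F[[u]], which is the image of a
  diagonal matrix modulo p.\<close>

definition Wm :: "nat => (nat => nat) => 'w fps fvec set" where
  "Wm r m = {x \<in> VV r. \<forall>i<r. \<forall>j<m i. \<rho> (fps_nth (cf x i) j) = 0}"

lemma submod_Wm [simp]: "submod (Wm r m)"
proof (rule submodI)
  fix c and x :: "'w fps fvec" assume x: "x \<in> Wm r m"
  have "\<rho> (fps_nth (c * cf x i) j) = 0" if "i < r" "j < m i" for i j
    using x that by (auto simp: fps_mult_nth rho_sum rho_hom Wm_def intro!: sum.neutral)
  then show "c *: x \<in> Wm r m" using x by (simp add: Wm_def submod_smul)
qed (auto simp: Wm_def rho_hom VV_def)

lemma len_Wm: "len (Wm r m) (VV r) = enat (\<Sum>i<r. m i)"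
proof (induction "\<Sum>i<r. m i" arbitrary: m)
  case 0
  then have "Wm r m = VV r" by (auto simp: Wm_def)
  then show ?case using 0 by (simp add: clen_eq_0 zero_enat_def)
next
  case (Suc n)
  then obtain k where k: "k < r" "m k ~= 0" by (metis (no_types, lifting) Zero_not_Suc lessThan_iff sum.neutral)
  \<comment> \<open>Lowering one positive exponent by one enlarges the submodule by a single copy of
    F.\<close>
  define m' where "m' = m(k := m k - 1)"
  have sm: "(\<Sum>i<r. m i) = Suc (\<Sum>i<r. m' i)"
  proof -
    have "(\<Sum>i<r. m i) = m k + (\<Sum>i\<in>{..<r} - {k}. m i)" using k by (intro sum.remove) auto
    moreover have "(\<Sum>i<r. m' i) = m' k + (\<Sum>i\<in>{..<r} - {k}. m' i)" using k by (intro sum.remove) auto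
    moreover have "(\<Sum>i\<in>{..<r} - {k}. m' i) = (\<Sum>i\<in>{..<r} - {k}. m i)" by (rule sum.cong) (auto simp: m'_def)
    ultimately show ?thesis using k by (simp add: m'_def)
  qed
  have mem: "x \<in> Wm r m \<longleftrightarrow> x \<in> Wm r m' \<and> \<rho> (fps_nth (cf x k) (m k - 1)) = 0" for x
  proof -
    have "(\<forall>i<r. \<forall>j<m i. \<rho> (fps_nth (cf x i) j) = 0) \<longleftrightarrow>
      (\<forall>i<r. \<forall>j<m' i. \<rho> (fps_nth (cf x i) j) = 0) \<and> \<rho> (fps_nth (cf x k) (m k - 1)) = 0" (is "?L \<longleftrightarrow> ?R")
    proof
      assume ?L then show ?R using k by (auto simp: m'_def)
    next
      assume R: ?R
      show ?L
      proof (intro allI impI)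
        fix i j assume ij: "i < r" "j < m i"
        show "\<rho> (fps_nth (cf x i) j) = 0"
        proof (cases "i = k \<and> j = m k - 1")
          case False
          then have "j < m' i" using ij by (auto simp: m'_def)
          then show ?thesis using R ij by blast
        qed (use R in simp)
      qed
    qed
    then show ?thesis by (simp add: Wm_def)
  qed
  have sub: "Wm r m <= Wm r m'" using mem by blast
  have "len (Wm r m) (Wm r m') = 1"
  proof (rule clen_simple)
    let ?e = "fv (%i. if i = k then u ^ (m k - 1) else 0) :: 'w fps fvec"
    have "?e \<in> Wm r m'" using k by (auto simp: Wm_def VV_def m'_def)
    moreover have "?e \<notin> Wm r m" using k by (auto simp: mem rho_hom)
    ultimately show "Wm r m \<subset> Wm r m'" using sub by blast
  next
    fix C assume C: "submod C" "Wm r m <= C" "C <= Wm r m'"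
    have "Wm r m' <= C" if ne: "C ~= Wm r m"
    proof
      fix x assume x: "x \<in> Wm r m'"
      obtain c where c: "c \<in> C" "c \<notin> Wm r m" using C(2) ne by blast
      then have cn: "\<rho> (fps_nth (cf c k) (m k - 1)) ~= 0" using mem C(3) by blast
      obtain l where l: "\<rho> l = \<rho> (fps_nth (cf x k) (m k - 1)) / \<rho> (fps_nth (cf c k) (m k - 1))" using rho_surj by blast
      have lc: "fps_const l *: c \<in> C" using C(1) c(1) by (rule submod_smul)
      have "x - fps_const l *: c \<in> Wm r m'" by (rule submod_diff[OF submod_Wm x]) (use lc C(3) in blast)
      then have "x - fps_const l *: c \<in> Wm r m" using cn l by (simp add: mem rho_diff rho_hom)
      then have "(x - fps_const l *: c) + fps_const l *: c \<in> C" using C(2) by (intro submod_add[OF C(1) _ lc]) blast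
      then show "x \<in> C" by simp
    qed
    then show "C = Wm r m \<or> C = Wm r m'" using C(3) by blast
  qed simp_all
  moreover have "len (Wm r m) (VV r) = len (Wm r m) (Wm r m') + len (Wm r m') (VV r)"
    by (rule len_add[OF submod_Wm submod_Wm submod_VV sub]) (auto simp: Wm_def)
  moreover have "len (Wm r m') (VV r) = enat (\<Sum>i<r. m' i)" using Suc sm by (intro Suc.hyps(1)) simp
  ultimately show ?case using sm by (simp add: one_enat_def)
qed

lemma lm_bij:
  assumes P: "P \<in> carrier_mat r r" and d: "\<rho> (fps_nth (det P :: 'w fps) 0) ~= 0"
  shows "lm r P ` VV r = VV r" "!!x. x \<in> VV r ==> lm r P x = 0 ==> x = 0" "lm r P ` pV n r = pV n r"
proof -
  obtain d' where d': "det P * d' = 1" using fps_unit[OF d] by blast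
  have s: "lm r P (lm r (adj_mat P) (d' *: x)) = x" if "x \<in> VV r" for x
    using lm_adj(1)[OF P, of "d' *: x"] that d' by (simp add: submod_smul smul_simps)
  show im: "lm r P ` VV r = VV r"
  proof
    show "VV r <= lm r P ` VV r" using s by (metis image_eqI lm_VV subsetI)
  qed auto
  show "x = 0" if x: "x \<in> VV r" "lm r P x = 0" for x
  proof -
    have "d' *: (det P *: x) = 0" using lm_adj(2)[OF P x(1)] x(2) lin_0[OF lin_lm, of r "adj_mat P"] by (simp add: smul_simps)
    then show ?thesis using d' by (simp add: smul_simps mult.commute)
  qed
  show "lm r P ` pV n r = pV n r" unfolding pV_def lin_image_smul[OF lin_lm] im ..
qed

text \<open>Modulo p the base ring is the discrete valuation ring F[[u]]. There P and Q are
  invertible, so \<open>A\<close> may be replaced by a diagonal matrix; the orders of its entries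
  add up to the order s of the determinant.\<close>

theorem len_lm:
  assumes A: "A \<in> carrier_mat r r" and d: "of_nat p dvd (det A - u ^ s * w :: 'w fps)" and w: "\<rho> (fps_nth w 0) ~= 0"
  shows "len (pV 1 r + lm r A ` VV r) (VV r) = enat s"
proof -
  interpret v: valuation_mod "{x :: 'w fps. of_nat p dvd x}" "{s. \<rho> (fps_nth s 0) ~= 0}" u by (rule valuation_u)
  obtain P Q where PQ: "P \<in> carrier_mat r r" "Q \<in> carrier_mat r r" "\<rho> (fps_nth (det P) 0) ~= 0" "\<rho> (fps_nth (det Q) 0) ~= 0"
    "!!i j. i < r ==> j < r ==> i ~= j ==> of_nat p dvd (P * A * Q) $$ (i, j)"
    using v.diagonalizable_all[OF A] unfolding v.diagonalizable_def by auto
  define D where "D = P * A * Q"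
  have PA: "P * A \<in> carrier_mat r r" using PQ A by simp
  have D: "D \<in> carrier_mat r r" using PA PQ by (simp add: D_def)
  have dD: "det D = det P * det A * det Q" using PQ A PA by (simp add: D_def det_mult[of _ r])
  have pd: "of_nat p dvd det D - (\<Prod>i<r. D $$ (i, i))" using v.det_mod[OF D] PQ(5) by (simp add: D_def)
  define w' where "w' = det P * w * det Q"
  have w': "\<rho> (fps_nth w' 0) ~= 0" using PQ w by (simp add: w'_def rho_hom)
  have "det D - u ^ s * w' = (det A - u ^ s * w) * (det P * det Q)" by (simp add: dD w'_def algebra_simps)
  then have dw: "of_nat p dvd det D - u ^ s * w'" using d by simp
  have "of_nat p dvd (det D - u ^ s * w') - (det D - (\<Prod>i<r. D $$ (i, i)))" using dw pd by (rule dvd_diff)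
  then have pw: "of_nat p dvd (\<Prod>i<r. D $$ (i, i)) - u ^ s * w'" by simp
  have nz: "\<not> of_nat p dvd D $$ (i, i)" if "i < r" for i
  proof
    assume "of_nat p dvd D $$ (i, i)"
    then have "of_nat p dvd (\<Prod>i<r. D $$ (i, i))" using that
      by (intro dvd_trans[OF _ dvd_prodI[of "{..<r}" i "%i. D $$ (i, i)"]]) auto
    then have "of_nat p dvd (\<Prod>i<r. D $$ (i, i)) - ((\<Prod>i<r. D $$ (i, i)) - u ^ s * w')" using pw by (rule dvd_diff)
    then have "of_nat p dvd u ^ s * w'" by simp
    then show False using w' p_dvd_iff[of "u ^ s * w'"] by (auto simp: fps_X_power_mult_nth dest: spec[of _ s])
  qed
  have "\<exists>m t. \<rho> (fps_nth t 0) ~= 0 \<and> of_nat p dvd D $$ (i, i) - u ^ m * t" if "i < r" for i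
    using v.decomp[of "D $$ (i, i)"] nz[OF that] by simp
  then have "\<forall>i. \<exists>m t. i < r --> \<rho> (fps_nth t 0) ~= 0 \<and> of_nat p dvd D $$ (i, i) - u ^ m * t" by blast
  then obtain m t where mt: "!!i. i < r ==> \<rho> (fps_nth (t i) 0) ~= 0" "!!i. i < r ==> of_nat p dvd D $$ (i, i) - u ^ m i * t i"
    by metis
  have prod: "of_nat p dvd (\<Prod>i<n. D $$ (i, i)) - u ^ (\<Sum>i<n. m i) * (\<Prod>i<n. t i)" if "n \<le> r" for n
    using that
  proof (induction n)
    case (Suc n)
    let ?a = "\<Prod>i<n. D $$ (i, i)" and ?b = "u ^ (\<Sum>i<n. m i) * (\<Prod>i<n. t i)"
    have e: "(\<Prod>i<Suc n. D $$ (i, i)) - u ^ (\<Sum>i<Suc n. m i) * (\<Prod>i<Suc n. t i)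
      = (?a - ?b) * D $$ (n, n) + ?b * (D $$ (n, n) - u ^ m n * t n)" by (simp add: algebra_simps power_add)
    show ?case unfolding e using Suc mt(2)[of n] by (intro dvd_add dvd_mult2 dvd_mult) auto
  qed simp
  have "\<rho> (fps_nth (\<Prod>i<n. t i) 0) ~= 0" if "n \<le> r" for n
    using that mt(1) by (induction n) (auto simp: rho_hom)
  then have tu: "\<rho> (fps_nth (\<Prod>i<r. t i) 0) ~= 0" by simp
  have "of_nat p dvd ((\<Prod>i<r. D $$ (i, i)) - u ^ s * w') - ((\<Prod>i<r. D $$ (i, i)) - u ^ (\<Sum>i<r. m i) * (\<Prod>i<r. t i))"
    using pw prod[OF order_refl] by (rule dvd_diff)
  then have "of_nat p dvd u ^ (\<Sum>i<r. m i) * (\<Prod>i<r. t i) - u ^ s * w'" by simp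
  then have ms: "(\<Sum>i<r. m i) = s" using tu w' by (rule u_order_unique)
  have lmD: "\<exists>c. cf (lm r D x) i = u ^ m i * (t i * cf x i) + of_nat p * c" if i: "i < r" for x i
  proof -
    have "cf (lm r D x) i - u ^ m i * (t i * cf x i) = (\<Sum>j<r. D $$ (i, j) * cf x j) - u ^ m i * (t i * cf x i)" using i by (simp add: lm_def)
    also have "(\<Sum>j<r. D $$ (i, j) * cf x j) = D $$ (i, i) * cf x i + (\<Sum>j\<in>{..<r} - {i}. D $$ (i, j) * cf x j)"
      using i by (intro sum.remove) auto
    also have "D $$ (i, i) * cf x i + (\<Sum>j\<in>{..<r} - {i}. D $$ (i, j) * cf x j) - u ^ m i * (t i * cf x i)
      = (D $$ (i, i) - u ^ m i * t i) * cf x i + (\<Sum>j\<in>{..<r} - {i}. D $$ (i, j) * cf x j)" by (simp add: algebra_simps)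
    finally have e: "cf (lm r D x) i - u ^ m i * (t i * cf x i)
      = (D $$ (i, i) - u ^ m i * t i) * cf x i + (\<Sum>j\<in>{..<r} - {i}. D $$ (i, j) * cf x j)" .
    have "of_nat p dvd cf (lm r D x) i - u ^ m i * (t i * cf x i)"
      unfolding e using mt(2)[OF i] PQ(5)[folded D_def] i by (intro dvd_add dvd_mult2 dvd_sum) auto
    then obtain c where "cf (lm r D x) i - u ^ m i * (t i * cf x i) = of_nat p * c" by (rule dvdE)
    then show ?thesis by (intro exI[of _ c]) (simp add: algebra_simps)
  qed
  have W: "pV 1 r + lm r D ` VV r = Wm r m"
  proof
    have "pV 1 r <= Wm r m" by (auto simp: pV_iff Wm_def p_dvd_iff)
    moreover have "lm r D ` VV r <= Wm r m"
    proof
      fix y assume "y \<in> lm r D ` VV r"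
      then obtain x where x: "y = lm r D x" by blast
      have "\<rho> (fps_nth (cf y i) j) = 0" if ij: "i < r" "j < m i" for i j
      proof -
        obtain c where c: "cf y i = u ^ m i * (t i * cf x i) + of_nat p * c" using lmD[OF ij(1)] x by blast
        have "of_nat p dvd of_nat p * c" by simp
        then have "\<rho> (fps_nth (of_nat p * c) j) = 0" unfolding p_dvd_iff by blast
        then show ?thesis using ij(2) by (simp add: c rho_hom fps_X_power_mult_nth)
      qed
      then show "y \<in> Wm r m" using x by (simp add: Wm_def)
    qed
    ultimately show "pV 1 r + lm r D ` VV r <= Wm r m" by (rule plus_least[OF submod_Wm])
    show "Wm r m <= pV 1 r + lm r D ` VV r"
    proof
      fix x assume x: "x \<in> Wm r m"
      have "\<forall>i. \<exists>t'. i < r --> t i * t' = 1" using mt(1) fps_unit by metis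
      then obtain t' where t': "!!i. i < r ==> t i * t' i = 1" by metis
      define z where "z = fv (%i. if i < r then t' i * fps_shift (m i) (cf x i) else 0)"
      have z: "z \<in> VV r" by (simp add: z_def VV_def)
      have "x - lm r D z \<in> pV 1 r"
        unfolding pV_iff
      proof (intro conjI allI)
        have xV: "x \<in> VV r" using x by (simp add: Wm_def)
        show dV: "x - lm r D z \<in> VV r" by (rule submod_diff[OF submod_VV xV lm_VV])
        fix i
        show "of_nat p ^ 1 dvd cf (x - lm r D z) i"
        proof (cases "i < r")
          case True
          obtain c where c: "cf (lm r D z) i = u ^ m i * (t i * cf z i) + of_nat p * c" using lmD[OF True] by blast
          have "t i * cf z i = (t i * t' i) * fps_shift (m i) (cf x i)" using True by (simp add: z_def mult.assoc)
          then have ee: "cf (x - lm r D z) i = (cf x i - u ^ m i * fps_shift (m i) (cf x i)) - of_nat p * c" using c t' True by simp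
          have "of_nat p dvd cf x i - u ^ m i * fps_shift (m i) (cf x i)"
            using x True by (auto simp: p_dvd_iff fps_X_power_mult_nth Wm_def)
          then show ?thesis unfolding ee power_one_right by (rule dvd_diff) simp
        qed (use dV in \<open>simp add: VV_def\<close>)
      qed
      then have "(x - lm r D z) + lm r D z \<in> pV 1 r + lm r D ` VV r" using z by (intro set_plus_intro) auto
      then show "x \<in> pV 1 r + lm r D ` VV r" by simp
    qed
  qed
  note bP = lm_bij[OF PQ(1,3)] and bQ = lm_bij[OF PQ(2,4)]
  have sA: "submod (lm r A ` VV r)" by (simp add: submod_image lin_lm)
  have sub: "pV 1 r + lm r A ` VV r <= VV r" by (rule plus_least[OF submod_VV pV_subset]) auto
  have "lm r P ` (pV 1 r + lm r A ` VV r) = pV 1 r + lm r D ` VV r"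
  proof -
    have "lm r D ` VV r = lm r P ` lm r A ` lm r Q ` VV r"
      by (simp add: D_def image_image lm_mult[OF PA PQ(2)] lm_mult[OF PQ(1) A])
    then show ?thesis by (simp add: image_plus lin_lm bP(3) bQ(1))
  qed
  then have "len (Wm r m) (VV r) = len (lm r P ` (pV 1 r + lm r A ` VV r)) (lm r P ` VV r)" using W bP(1) by simp
  also have "\<dots> = len (pV 1 r + lm r A ` VV r) (VV r)"
    by (rule len_image_inj[OF lin_lm submod_plus[OF submod_pV sA] submod_VV sub bP(2)])
  finally show ?thesis using len_Wm ms by simp
qed

end

context witt_eisenstein
begin

lemma valuation_E: "valuation_mod {0} {s. \<not> E' dvd s} E'"
proof
  show "- 1 \<in> {s. \<not> E' dvd s}" using E_not_unit by simp
  show "1 \<in> {s. \<not> E' dvd s}" using E_not_unit by simp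
  show "s * t \<in> {s. \<not> E' dvd s}" if "s \<in> {s. \<not> E' dvd s}" "t \<in> {s. \<not> E' dvd s}" for s t using that E_prime by blast
  fix x assume "x \<notin> {0 :: 'w fps}"
  then show "\<exists>k s. s \<in> {s. \<not> E' dvd s} \<and> x - E' ^ k * s \<in> {0}" using E_power_decomp[of x] by auto
qed auto

lemma E_order_le: assumes "E' ^ x * s = E' ^ y * w" "\<not> E' dvd s" shows "y \<le> x"
proof (rule ccontr)
  assume "\<not> y \<le> x"
  then have "E' ^ x * s = E' ^ x * (E' ^ (y - x) * w)" using assms(1) by (simp add: mult.assoc[symmetric] power_add[symmetric])
  then have "s = E' ^ (y - x) * w" using fps_cancel[OF E_power_neq_0] by blast
  moreover have "E' dvd E' ^ (y - x)" using \<open>\<not> y \<le> x\<close> by (simp add: dvd_power)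
  ultimately show False using assms(2) by simp
qed

text \<open>\<open>E'\<close> is prime, so it can be split off from both factors until nothing but
  units is left. This will be applied to the determinant of the structure matrix.\<close>

lemma dvd_E_power: assumes "x * y = E' ^ N" shows "\<exists>v w. x = w * E' ^ v \<and> w dvd 1"
proof -
  have "x ~= 0" "y ~= 0" using assms E_power_neq_0[of N] by auto
  then obtain k s l t where x: "x = E' ^ k * s" "\<not> E' dvd s" and y: "y = E' ^ l * t" "\<not> E' dvd t" using E_power_decomp by metis
  have st: "\<not> E' dvd s * t" using x y E_prime by blast
  have e: "E' ^ (k + l) * (s * t) = E' ^ N * 1" using assms x y by (simp add: power_add mult_ac)
  have "N \<le> k + l" using E_order_le[OF e st] .
  moreover have "k + l \<le> N" using E_order_le[OF e[symmetric] E_not_unit] .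
  ultimately have "s * t = 1" using e fps_cancel[OF E_power_neq_0[of N], of "s * t" 1] by simp
  then have "s dvd 1" by (metis dvd_triv_left)
  then show ?thesis using x by (intro exI[of _ k] exI[of _ s]) (simp add: mult.commute)
qed

text \<open>Modulo p, \<open>E'\<close> is u^e, which is not a zero divisor; induction passes from p
  to p^n.\<close>

lemma p_dvd_E_mult: "of_nat p ^ n dvd E' ^ i * f ==> of_nat p ^ n dvd f"
proof (induction n arbitrary: f)
  case (Suc n)
  have one: "of_nat p dvd g" if "of_nat p dvd E' ^ i * g" for g
    using that
  proof (induction i)
    case (Suc i)
    obtain w where w: "E' = u ^ e + of_nat p * w" using E_mod_p by blast
    have "of_nat p dvd E' ^ Suc i * g - of_nat p * (w * (E' ^ i * g))" using Suc.prems by (rule dvd_diff) simp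
    also have "E' ^ Suc i * g - of_nat p * (w * (E' ^ i * g)) = (E' - of_nat p * w) * (E' ^ i * g)" by (simp add: algebra_simps)
    also have "E' - of_nat p * w = u ^ e" using w by simp
    finally show ?case using p_dvd_X_mult[of 1 e "E' ^ i * g"] Suc.IH by simp
  qed simp
  have "of_nat p dvd E' ^ i * f" using Suc.prems by (metis dvd_mult_left power_Suc)
  then obtain g where g: "f = of_nat p * g" using one[of f] by (auto simp: dvd_def)
  have "of_nat p ^ (1 + n) dvd of_nat p ^ 1 * (E' ^ i * g)" using Suc.prems g by (simp add: mult_ac)
  then have "of_nat p ^ n dvd E' ^ i * g" by (rule p_power_mult_dvd)
  then have "of_nat p ^ n dvd g" by (rule Suc.IH)
  then show ?case using g by (simp add: mult_dvd_mono)
qed simp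

end

section \<open>The structure map of a Kisin module\<close>

lemma presents_basis:
  fixes M :: "('a::comm_ring_1, 'b) module"
  assumes M: "Module.module RT M" and b: "module_basis RT M r b"
  shows "presents M {0} (VV r) (%x. finsum M (%i. cf x i \<odot>\<^bsub>M\<^esub> b i) {..<r})"
proof -
  interpret Module.module RT M by (rule M)
  let ?q = "%x. finsum M (%i. cf x i \<odot>\<^bsub>M\<^esub> b i) {..<r}"
  have bc: "b i \<in> carrier M" if "i < r" for i using b that by (auto simp: module_basis_def)
  have cl: "c \<odot>\<^bsub>M\<^esub> b i \<in> carrier M" if "i < r" for c i using bc[OF that] by simp
  have cl': "(%i. h i \<odot>\<^bsub>M\<^esub> b i) \<in> {..<r} \<rightarrow> carrier M" for h using cl by auto
  have cong: "finsum M (%i. h i \<odot>\<^bsub>M\<^esub> b i) {..<r} = finsum M (%i. g i \<odot>\<^bsub>M\<^esub> b i) {..<r}" if "!!i. i < r ==> h i = g i" for h g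
    by (rule finsum_cong'[OF refl cl']) (use that in auto)
  have add: "?q x \<oplus>\<^bsub>M\<^esub> ?q y = ?q (x + y)" for x y
  proof -
    have "?q x \<oplus>\<^bsub>M\<^esub> ?q y = finsum M (%i. cf x i \<odot>\<^bsub>M\<^esub> b i \<oplus>\<^bsub>M\<^esub> cf y i \<odot>\<^bsub>M\<^esub> b i) {..<r}"
      by (rule finsum_addf[symmetric]) (use cl in auto)
    also have "\<dots> = ?q (x + y)"
      by (rule finsum_cong'[OF refl cl']) (use smult_l_distr bc in auto)
    finally show ?thesis .
  qed
  have sm: "c \<odot>\<^bsub>M\<^esub> ?q x = ?q (c *: x)" for c x
  proof -
    have "c \<odot>\<^bsub>M\<^esub> finsum M (%i. cf x i \<odot>\<^bsub>M\<^esub> b i) {..<n} = finsum M (%i. (c * cf x i) \<odot>\<^bsub>M\<^esub> b i) {..<n}" if "n \<le> r" for n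
      using that
    proof (induction n)
      case 0
      then show ?case using smult_r_null[of c] by simp
    next
      case (Suc n)
      have f: "(%i. h i \<odot>\<^bsub>M\<^esub> b i) \<in> {..<n} \<rightarrow> carrier M" for h using cl Suc.prems by auto
      have n: "n < r" using Suc.prems by simp
      have "c \<odot>\<^bsub>M\<^esub> (cf x n \<odot>\<^bsub>M\<^esub> b n) = (c * cf x n) \<odot>\<^bsub>M\<^esub> b n" using smult_assoc1[of c "cf x n" "b n"] bc[OF n] by simp
      then show ?case
        using Suc f cl n smult_r_distr[of c] by (simp add: lessThan_Suc finsum_insert)
    qed
    then show ?thesis by simp
  qed
  have zero: "\<zero>\<^bsub>M\<^esub> = ?q 0"
  proof -
    have "?q 0 = finsum M (%i. \<zero>\<^bsub>M\<^esub>) {..<r}" by (rule finsum_cong') (use smult_l_null bc in auto)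
    then show ?thesis by simp
  qed
  have uniq: "?q x = ?q y \<longleftrightarrow> x - y \<in> {0}" if xy: "x \<in> VV r" "y \<in> VV r" for x y
  proof
    assume e: "?q x = ?q y"
    have "?q x \<in> carrier M" by (rule finsum_closed[OF cl'])
    then have "\<exists>!c. c \<in> {..<r} \<rightarrow>\<^sub>E UNIV \<and> ?q x = finsum M (%i. c i \<odot>\<^bsub>M\<^esub> b i) {..<r}"
      using b by (simp add: module_basis_def)
    moreover have "restrict (cf x) {..<r} \<in> {..<r} \<rightarrow>\<^sub>E UNIV" "?q x = finsum M (%i. restrict (cf x) {..<r} i \<odot>\<^bsub>M\<^esub> b i) {..<r}"
      by (auto intro!: cong)
    moreover have "restrict (cf y) {..<r} \<in> {..<r} \<rightarrow>\<^sub>E UNIV" "?q x = finsum M (%i. restrict (cf y) {..<r} i \<odot>\<^bsub>M\<^esub> b i) {..<r}"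
      using e by (auto intro!: cong)
    ultimately have "restrict (cf x) {..<r} = restrict (cf y) {..<r}" by metis
    then have "cf x i = cf y i" for i using xy by (cases "i < r") (auto simp: VV_def fun_eq_iff restrict_def split: if_splits)
    then have "x = y" by (rule fvec_eqI)
    then show "x - y \<in> {0}" by simp
  qed simp
  have carr: "carrier M = ?q ` VV r"
  proof
    show "?q ` VV r <= carrier M" using finsum_closed[OF cl'] by auto
    show "carrier M <= ?q ` VV r"
    proof
      fix m assume "m \<in> carrier M"
      then obtain c where c: "m = finsum M (%i. c i \<odot>\<^bsub>M\<^esub> b i) {..<r}" using b unfolding module_basis_def by blast
      have "m = ?q (fv (%i. if i < r then c i else 0))" unfolding c by (rule cong) simp
      then show "m \<in> ?q ` VV r" by (rule image_eqI) (simp add: VV_def)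
    qed
  qed
  have "submod {0 :: 'a fvec}" by (auto simp: submod_def smul_simps)
  then show ?thesis unfolding presents_def using carr add sm zero uniq by (simp add: submod_0)
qed

lemma common_denominator:
  fixes k :: nat
  assumes P: "presents M A B q" and T: "mulset T" and Y: "!!j. j < k ==> Y j \<in> carrier (loc_module RT T M)"
  shows "\<exists>c\<in>T. \<exists>x. \<forall>j<k. x j \<in> B \<and> Y j = fraction T M (q (x j)) c"
  using Y
proof (induction k)
  case 0
  then show ?case using mulsetD(1)[OF T] by blast
next
  case (Suc k)
  note d = presentsD[OF P]
  obtain c x where x: "c \<in> T" "!!j. j < k ==> x j \<in> B \<and> Y j = fraction T M (q (x j)) c" using Suc by (metis less_SucI)
  obtain y t where y: "y \<in> B" "t \<in> T" "Y k = fraction T M (q y) t" using Suc.prems[of k] unfolding carrier_loc[OF P] by auto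
  have ct: "c * t \<in> T" using x y T by (simp add: mulsetD)
  have e: "fraction T M (q z) s = fraction T M (q (s' *: z)) (s * s')" if "z \<in> B" "s \<in> T" "s' \<in> T" for z s s'
    using frac_eq[OF P T that(1,2), of "s' *: z" "s * s'"] that d(1,2) mulsetD[OF T]
    by (auto simp: submod_smul smul_simps submod_0 intro!: bexI[of _ 1])
  show ?case
    using x y e[of _ c t] e[OF y(1,2) x(1)] ct d(2)
    by (intro bexI[of _ "c * t"] exI[of _ "%j. if j < k then t *: x j else c *: y"])
      (auto simp: submod_smul less_Suc_eq mult.commute)
qed

context witt
begin

lemma Ph_0 [simp]: "Ph {0} = {0}"
proof
  show "Ph {0} <= {0}"
  proof
    fix z assume z: "z \<in> Ph {0}"
    have "z = (\<Sum>j<p. u ^ j *: Fr (co j z))" by (rule co_decomp[symmetric])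
    also have "\<dots> = 0" using z by (intro sum.neutral) (auto simp: Ph_def smul_simps)
    finally show "z \<in> {0}" by simp
  qed
qed (auto simp: Ph_def)

text \<open>The length of M/(p, u)M is \<open>r\<close> and does not depend on the basis. This gives
  a meaning to the definite description in \<open>kisin_rank\<close>.\<close>

lemma rank_unique:
  fixes M :: "('w fps, 'm) module"
  assumes M: "Module.module RT M" and b: "module_basis RT M r b" and b': "module_basis RT M r' b'"
  shows "r = r'"
proof -
  have len: "module_length RT (quot_module M {fps_X \<odot>\<^bsub>M\<^esub> x \<oplus>\<^bsub>M\<^esub> of_nat p \<odot>\<^bsub>M\<^esub> y | x y. x \<in> carrier M \<and> y \<in> carrier M}) = enat r"
    if b: "module_basis RT M r b" for r b
  proof -
    let ?q = "%x. finsum M (%i. cf x i \<odot>\<^bsub>M\<^esub> b i) {..<r}"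
    have P: "presents M {0} (VV r) ?q" by (rule presents_basis[OF M b])
    note d = presentsD[OF P]
    have q: "?q (u *: x + of_nat p *: y) = fps_X \<odot>\<^bsub>M\<^esub> ?q x \<oplus>\<^bsub>M\<^esub> of_nat p \<odot>\<^bsub>M\<^esub> ?q y" if "x \<in> VV r" "y \<in> VV r" for x y
      using d(6)[of "u *: x" "of_nat p *: y"] d(7)[of x] d(7)[of y] that by (simp add: submod_smul)
    have "{fps_X \<odot>\<^bsub>M\<^esub> x \<oplus>\<^bsub>M\<^esub> of_nat p \<odot>\<^bsub>M\<^esub> y | x y. x \<in> carrier M \<and> y \<in> carrier M} = ?q ` Wk r 0"
    proof
      show "{fps_X \<odot>\<^bsub>M\<^esub> x \<oplus>\<^bsub>M\<^esub> of_nat p \<odot>\<^bsub>M\<^esub> y | x y. x \<in> carrier M \<and> y \<in> carrier M} <= ?q ` Wk r 0"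
      proof
        fix m assume "m \<in> {fps_X \<odot>\<^bsub>M\<^esub> x \<oplus>\<^bsub>M\<^esub> of_nat p \<odot>\<^bsub>M\<^esub> y | x y. x \<in> carrier M \<and> y \<in> carrier M}"
        then obtain x y where xy: "x \<in> VV r" "y \<in> VV r" "m = fps_X \<odot>\<^bsub>M\<^esub> ?q x \<oplus>\<^bsub>M\<^esub> of_nat p \<odot>\<^bsub>M\<^esub> ?q y" unfolding d(4) by blast
        have "u *: x + of_nat p *: y \<in> Wk r 0" unfolding Wk_0 pV_def using xy by (intro set_plus_intro) auto
        then show "m \<in> ?q ` Wk r 0" unfolding xy(3) q[OF xy(1,2), symmetric] by (rule imageI)
      qed
      show "?q ` Wk r 0 <= {fps_X \<odot>\<^bsub>M\<^esub> x \<oplus>\<^bsub>M\<^esub> of_nat p \<odot>\<^bsub>M\<^esub> y | x y. x \<in> carrier M \<and> y \<in> carrier M}"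
      proof
        fix m assume "m \<in> ?q ` Wk r 0"
        then obtain w where w: "w \<in> Wk r 0" "m = ?q w" by blast
        then obtain x y where xy: "x \<in> VV r" "y \<in> VV r" "w = u *: x + of_nat p *: y"
          unfolding Wk_0 pV_def set_plus_def by auto
        then have "m = fps_X \<odot>\<^bsub>M\<^esub> ?q x \<oplus>\<^bsub>M\<^esub> of_nat p \<odot>\<^bsub>M\<^esub> ?q y" using w(2) q[OF xy(1,2)] by simp
        then show "m \<in> {fps_X \<odot>\<^bsub>M\<^esub> x \<oplus>\<^bsub>M\<^esub> of_nat p \<odot>\<^bsub>M\<^esub> y | x y. x \<in> carrier M \<and> y \<in> carrier M}"
          unfolding d(4) using xy by blast
      qed
    qed
    moreover have ml: "presents (quot_module M (?q ` Wk r 0)) (Wk r 0) (VV r) (%x. ?q ` Wk r 0 +>\<^bsub>M\<^esub> ?q x)"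
      by (rule presents_quot[OF P submod_Wk]) (auto simp: submod_0 submod_Wk Wk_def)
    ultimately show ?thesis using module_length_eq[OF ml] len_Wk[of r r] by (simp add: Wk_r)
  qed
  show ?thesis using len[OF b] len[OF b'] by simp
qed

text \<open>The images of the finitely many basis vectors have a common denominator c, and
  \<open>a\<close> is the linear map given by their numerators. Surjectivity survives in the form
  that every vector has a multiple by an element of \<open>T\<close> in the image of
  \<open>a\<close>.\<close>

lemma rep_of_iso:
  assumes iso: "phi_bijective \<phi> RT T Z" and T: "mulset T" and P: "presents (fst Z) {0} (VV r) q"
  obtains t\<^sub>0 a where "rep T t\<^sub>0 Z {0} (VV r) q a" "!!y. y \<in> VV r ==> \<exists>z\<in>VV r. \<exists>s\<in>T. a z = s *: y"
proof -
  let ?M = "fst Z" and ?\<Phi> = "snd Z"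
  let ?\<theta> = "%z t. fraction T (pb ?M) (theta ?M q z) t" and ?f = "%x t. fraction T ?M (q x) t"
  have PP: "presents (pb ?M) {0} (VV r) (theta ?M q)" using presents_pullback[OF P] by simp
  note one = mulsetD(1)[OF T] and cT = mulsetD(2)[OF T]
  have cl: "?\<theta> z t \<in> carrier (loc_module RT T (pb ?M))" if "z \<in> VV r" "t \<in> T" for z t
    unfolding carrier_loc[OF PP] using that by blast
  have sc: "sfrac T c t \<in> carrier (loc_ring RT T)" if "t \<in> T" for c t unfolding carrier_loc_ring using that by blast
  have bij: "bij_betw ?\<Phi> (carrier (loc_module RT T (pb ?M))) (carrier (loc_module RT T ?M))"
    and hom_add: "!!x y. x \<in> carrier (loc_module RT T (pb ?M)) ==> y \<in> carrier (loc_module RT T (pb ?M)) ==>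
      ?\<Phi> (x \<oplus>\<^bsub>loc_module RT T (pb ?M)\<^esub> y) = ?\<Phi> x \<oplus>\<^bsub>loc_module RT T ?M\<^esub> ?\<Phi> y"
    and hom_smul: "!!c x. c \<in> carrier (loc_ring RT T) ==> x \<in> carrier (loc_module RT T (pb ?M)) ==>
      ?\<Phi> (c \<odot>\<^bsub>loc_module RT T (pb ?M)\<^esub> x) = c \<odot>\<^bsub>loc_module RT T ?M\<^esub> ?\<Phi> x"
    using iso unfolding phi_bijective_def module_iso_def by blast+
  let ?e = "%j. fv (%i. if i = j then 1 else 0) :: 'w fps fvec"
  have e: "?e j \<in> VV r" if "j < r" for j using that by (auto simp: VV_def)
  have "?\<Phi> (?\<theta> (?e j) 1) \<in> carrier (loc_module RT T ?M)" if "j < r" for j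
    using bij_betw_apply[OF bij cl[OF e[OF that] one]] .
  then obtain c x where c: "c \<in> T" and x: "!!j. j < r ==> x j \<in> VV r" "!!j. j < r ==> ?\<Phi> (?\<theta> (?e j) 1) = ?f (x j) c"
    using common_denominator[OF P T, of r "%j. ?\<Phi> (?\<theta> (?e j) 1)"] by blast
  define a where "a z = (\<Sum>j<r. cf z j *: x j)" for z :: "'w fps fvec"
  have lin: "lin a" by (auto simp: lin_def a_def smul_simps(3) sum.distrib smul_sum smul_simps)
  have sV: "(\<Sum>j<k. cf z j *: x j) \<in> VV r" if "k \<le> r" for k z
    using that x(1) by (auto simp: VV_def)
  have aV: "a z \<in> VV r" for z unfolding a_def by (rule sV) simp
  have feq: "?f y t = ?f y' t'" if "y \<in> VV r" "y' \<in> VV r" "t \<in> T" "t' \<in> T" "t' *: y = t *: y'" for y y' t t'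
    using frac_eq[OF P T that(1,3,2,4)] one that(5) by (auto simp: smul_simps intro!: bexI[of _ 1])
  have 1: "?\<Phi> (?\<theta> (\<Sum>j<k. cf z j *: ?e j) 1) = ?f (\<Sum>j<k. cf z j *: x j) c" if "k \<le> r" for k z
    using that
  proof (induction k)
    case 0
    have "?\<Phi> (?\<theta> 0 1) \<in> carrier (loc_module RT T ?M)" using bij_betw_apply[OF bij cl[OF _ one]] by (simp add: submod_0)
    then obtain y t where y: "y \<in> VV r" "t \<in> T" "?\<Phi> (?\<theta> 0 1) = ?f y t" unfolding carrier_loc[OF P] by blast
    \<comment> \<open>The empty sum is the zero vector; linearity under the scalar 0 shows that its
      image is 0.\<close>
    have "sfrac T 0 1 \<odot>\<^bsub>loc_module RT T (pb ?M)\<^esub> ?\<theta> 0 1 = ?\<theta> 0 1"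
      using loc_smult[OF PP T _ one one, of 0 0] by (simp add: submod_0 smul_simps)
    then have "?\<Phi> (?\<theta> 0 1) = sfrac T 0 1 \<odot>\<^bsub>loc_module RT T ?M\<^esub> ?f y t"
      using hom_smul[OF sc[OF one] cl[OF _ one], of 0 0] y(3) by (simp add: submod_0)
    also have "\<dots> = ?f (0 *: y) (1 * t)" by (rule loc_smult[OF P T y(1,2) one])
    also have "\<dots> = ?f 0 c" by (rule feq) (use y c in \<open>simp_all add: smul_simps submod_0\<close>)
    finally show ?case by simp
  next
    case (Suc k)
    let ?w = "\<Sum>j<k. cf z j *: ?e j" and ?s = "\<Sum>j<k. cf z j *: x j"
    have k: "k < r" "k \<le> r" using Suc.prems by simp_all
    have w: "?w \<in> VV r" using k by (auto simp: VV_def)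
    have ke: "cf z k *: ?e k \<in> VV r" using e[OF k(1)] by (simp add: submod_smul)
    have st: "?\<theta> (cf z k *: ?e k) 1 = sfrac T (cf z k) 1 \<odot>\<^bsub>loc_module RT T (pb ?M)\<^esub> ?\<theta> (?e k) 1"
      using loc_smult[OF PP T e[OF k(1)] one one, of "cf z k"] by simp
    have "?\<Phi> (?\<theta> (cf z k *: ?e k) 1) = ?f (cf z k *: x k) c"
      unfolding st hom_smul[OF sc[OF one] cl[OF e[OF k(1)] one]] x(2)[OF k(1)]
      using loc_smult[OF P T x(1)[OF k(1)] c one, of "cf z k"] by simp
    moreover have "?\<theta> (\<Sum>j<Suc k. cf z j *: ?e j) 1 = ?\<theta> ?w 1 \<oplus>\<^bsub>loc_module RT T (pb ?M)\<^esub> ?\<theta> (cf z k *: ?e k) 1"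
      using loc_add[OF PP T w one ke one] by (simp add: smul_simps)
    ultimately have "?\<Phi> (?\<theta> (\<Sum>j<Suc k. cf z j *: ?e j) 1) = ?f ?s c \<oplus>\<^bsub>loc_module RT T ?M\<^esub> ?f (cf z k *: x k) c"
      using hom_add[OF cl[OF w one] cl[OF ke one]] Suc.IH k(2) by simp
    also have "\<dots> = ?f (c *: ?s + c *: cf z k *: x k) (c * c)"
      by (rule loc_add[OF P T sV[OF k(2)] c _ c]) (use x(1)[OF k(1)] in \<open>simp add: submod_smul\<close>)
    also have "\<dots> = ?f (\<Sum>j<Suc k. cf z j *: x j) c"
    proof (rule feq)
      show "c *: ?s + c *: cf z k *: x k \<in> VV r"
        by (intro submod_add submod_smul submod_VV sV[OF k(2)] x(1)[OF k(1)])
      show "(\<Sum>j<Suc k. cf z j *: x j) \<in> VV r" by (rule sV[OF Suc.prems])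
    qed (use c cT in \<open>simp_all add: smul_simps mult.assoc\<close>)
    finally show ?case .
  qed
  have exp: "(\<Sum>j<r. cf z j *: ?e j) = z" if "z \<in> VV r" for z
  proof (rule fvec_eqI)
    fix i
    have "(\<Sum>j<r. cf z j * (if i = j then 1 else 0)) = (\<Sum>j<r. if j = i then cf z i else 0)" by (intro sum.cong) auto
    then show "cf (\<Sum>j<r. cf z j *: ?e j) i = cf z i" using that by (auto simp: VV_def)
  qed
  have val: "?\<Phi> (?\<theta> z t) = ?f (a z) (c * t)" if z: "z \<in> VV r" and t: "t \<in> T" for z t
  proof -
    have "?\<theta> z t = sfrac T 1 t \<odot>\<^bsub>loc_module RT T (pb ?M)\<^esub> ?\<theta> z 1"
      using loc_smult[OF PP T z one t, of 1] by (simp add: smul_simps)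
    then have "?\<Phi> (?\<theta> z t) = sfrac T 1 t \<odot>\<^bsub>loc_module RT T ?M\<^esub> ?f (a z) c"
      using hom_smul[OF sc[OF t] cl[OF z one]] 1[OF order_refl, of z] exp[OF z] by (simp add: a_def)
    then show ?thesis using loc_smult[OF P T aV c t, of 1] by (simp add: smul_simps mult.commute)
  qed
  have "rep T c Z {0} (VV r) q a"
    unfolding rep_def using T c P lin aV val by (auto simp: lin_0)
  moreover have "\<exists>z\<in>VV r. \<exists>s\<in>T. a z = s *: y" if y: "y \<in> VV r" for y
  proof -
    have "?f y 1 \<in> carrier (loc_module RT T ?M)" unfolding carrier_loc[OF P] using y one by blast
    then have "?f y 1 \<in> ?\<Phi> ` carrier (loc_module RT T (pb ?M))" using bij by (simp add: bij_betw_def)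
    then obtain z t where z: "z \<in> VV r" "t \<in> T" "?f y 1 = ?f (a z) (c * t)" unfolding carrier_loc[OF PP] using val by auto
    then obtain v where v: "v \<in> T" "v *: ((c * t) *: y - 1 *: a z) \<in> {0}" using frac_eq[OF P T y one aV cT[OF c z(2)]] by blast
    have "a (v *: z) = (v * (c * t)) *: y" using v(2) by (simp add: linD(2)[OF lin] smul_simps)
    moreover have "v *: z \<in> VV r" using z by (simp add: submod_smul)
    moreover have "v * (c * t) \<in> T" using v z c cT by simp
    ultimately show ?thesis by blast
  qed
  ultimately show thesis by (rule that)
qed

end

section \<open>The polygon of a presented torsion module\<close>

context reduction
begin

lemma rep_piece:
  assumes R: "rep u_powers (u ^ N) Z A B q a" and A: "A \<in> L" and B: "B \<in> L" and AB: "A <= B"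
  shows "torsion_rank Z = rk B - rk A" and "torsion_degree p \<sigma> ee Z = real_of_int (dg B - dg A) / real ee"
    and "torsion_slope p \<sigma> ee Z = hn.slope A B / real ee" and "torsion_kisin_module p \<sigma> Z"
proof -
  note r = repD[OF R]
  note d = presentsD[OF r(3)]
  note ha = LD[OF A] and hb = LD[OF B]
  show rank: "torsion_rank Z = rk B - rk A"
    using torsion_rank_rep[OF r(3)] rkl_diff[OF A B AB] by simp
  have dl: "len (A + a ` Ph B) B = enat (dd B - dd A)" using dl_diff(2)[OF A B AB] by (simp add: dl_def)
  have "torsion_degree p \<sigma> ee Z = (real N * real (rk B - rk A) - real (dd B - dd A)) / real ee"
    by (rule torsion_degree_rep[OF R hb(3) ha(4) rkl_diff(2)[OF A B AB] dl])
  also have "real N * real (rk B - rk A) - real (dd B - dd A) = real_of_int (dg B - dg A)"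
    using rkl_diff(1)[OF A B AB] dl_diff(1)[OF A B AB] by (simp add: dg_def of_nat_diff algebra_simps)
  finally show degree: "torsion_degree p \<sigma> ee Z = real_of_int (dg B - dg A) / real ee" .
  show "torsion_slope p \<sigma> ee Z = hn.slope A B / real ee"
    unfolding torsion_slope_def rank degree hn.slope_def using rkl_diff(1)[OF A B AB] by (simp add: of_nat_diff)
  have fg: "finitely_generated RT (fst Z)"
  proof -
    obtain m g where g: "!!i. i < m ==> g i \<in> B" "B = lspan m g + pV n r" using generators_usat[OF hb(1-4)] by blast
    have "H = carrier (fst Z)" if H: "submodule H RT (fst Z)" "(%i. q (g i)) ` {..<m} <= H" for H
    proof -
      obtain X where X: "submod X" "A <= X" "X <= B" "H = q ` X" using H(1) submodule_iff[OF r(3)] by blast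
      have "g i \<in> X" if "i < m" for i
        using presents_image_mem[OF r(3) X(1-3) g(1)[OF that]] H(2) X(4) that by auto
      then have "lspan m g <= X" by (rule lspan_least[OF X(1)])
      moreover have "pV n r <= X" using ha(2) X(2) by blast
      ultimately have "B <= X" unfolding g(2) by (intro plus_least X(1))
      then show ?thesis using X d(4) by blast
    qed
    then show ?thesis unfolding finitely_generated_def
      using g(1) d(4) by (intro exI[of _ "(%i. q (g i)) ` {..<m}"]) auto
  qed
  have tors: "\<forall>x\<in>carrier (fst Z). of_nat p ^ n \<odot>\<^bsub>fst Z\<^esub> x = \<zero>\<^bsub>fst Z\<^esub>"
  proof
    fix x assume "x \<in> carrier (fst Z)"
    then obtain y where y: "y \<in> B" "x = q y" using d(4) by auto
    then have "of_nat p ^ n *: y \<in> A" using ha(2) hb(3) by (auto simp: pV_def)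
    then show "of_nat p ^ n \<odot>\<^bsub>fst Z\<^esub> x = \<zero>\<^bsub>fst Z\<^esub>"
      using y d presents_zero_iff[OF r(3), of "of_nat p ^ n *: y"] by (auto simp: submod_smul)
  qed
  have utf: "u_torsion_free (fst Z)"
    unfolding u_torsion_free_def d(4)
  proof safe
    fix x assume x: "x \<in> B" "u \<odot>\<^bsub>fst Z\<^esub> q x = \<zero>\<^bsub>fst Z\<^esub>"
    then have "u *: x \<in> A" using d(7) presents_zero_iff[OF r(3), of "u *: x"] d(2) by (simp add: submod_smul)
    then have "x \<in> A" using ha(4) hb(3) x(1) by (auto simp: usat_def)
    then show "q x = \<zero>\<^bsub>fst Z\<^esub>" using presents_zero_iff[OF r(3) x(1)] by simp
  qed
  have "bij_betw (snd Z) (carrier (loc_module RT u_powers (pb (fst Z)))) (carrier (loc_module RT u_powers (fst Z)))"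
    unfolding bij_betw_def
  proof
    have aB: "a z \<in> B" if "z \<in> Ph B" for z using that hb(5) by blast
    show "inj_on (snd Z) (carrier (loc_module RT u_powers (pb (fst Z))))"
    proof (rule inj_onI)
      fix X Y assume "X \<in> carrier (loc_module RT u_powers (pb (fst Z)))" "Y \<in> carrier (loc_module RT u_powers (pb (fst Z)))"
        and e: "snd Z X = snd Z Y"
      then obtain z t w s where z: "z \<in> Ph B" "t \<in> u_powers" "X = fraction u_powers (pb (fst Z)) (theta (fst Z) q z) t"
        and w: "w \<in> Ph B" "s \<in> u_powers" "Y = fraction u_powers (pb (fst Z)) (theta (fst Z) q w) s"
        unfolding carrier_loc[OF r(8)] by blast
      have "fraction u_powers (fst Z) (q (a z)) (u ^ N * t) = fraction u_powers (fst Z) (q (a w)) (u ^ N * s)"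
        using e unfolding z(3) w(3) r(7)[OF z(1,2)] r(7)[OF w(1,2)] .
      moreover have tt: "u ^ N * t \<in> u_powers" "u ^ N * s \<in> u_powers" using z w by (auto intro: mulsetD)
      ultimately obtain v where v: "v \<in> u_powers" "v *: ((u ^ N * s) *: a z - (u ^ N * t) *: a w) \<in> A"
        using frac_eq[OF r(3,1) aB[OF z(1)] tt(1) aB[OF w(1)] tt(2)] by blast
      have "v *: ((u ^ N * s) *: a z - (u ^ N * t) *: a w) = a ((v * u ^ N) *: (s *: z - t *: w))"
        by (simp add: linD(2)[OF lin_a] lin_diff[OF lin_a] smul_simps mult.assoc)
      then have "a ((v * u ^ N) *: (s *: z - t *: w)) \<in> A" using v(2) by simp
      moreover have "(v * u ^ N) *: (s *: z - t *: w) \<in> VV r"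
        using z(1) w(1) Ph_mono[OF hb(3)] by (intro submod_smul submod_diff submod_VV) auto
      ultimately have "(v * u ^ N) *: (s *: z - t *: w) \<in> Ph A" using preimage_in_Ph[OF A] by blast
      moreover have "v * u ^ N \<in> u_powers" using v(1) by (auto intro: mulsetD)
      ultimately show "X = Y" unfolding z(3) w(3) using frac_eq[OF r(8,1) z(1,2) w(1,2)] by blast
    qed
    show "snd Z ` carrier (loc_module RT u_powers (pb (fst Z))) = carrier (loc_module RT u_powers (fst Z))"
    proof
      show "snd Z ` carrier (loc_module RT u_powers (pb (fst Z))) <= carrier (loc_module RT u_powers (fst Z))"
      proof
        fix Y assume "Y \<in> snd Z ` carrier (loc_module RT u_powers (pb (fst Z)))"
        then obtain z t where z: "z \<in> Ph B" "t \<in> u_powers" "Y = snd Z (fraction u_powers (pb (fst Z)) (theta (fst Z) q z) t)"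
          unfolding carrier_loc[OF r(8)] by blast
        have "u ^ N * t \<in> u_powers" using z by (auto intro: mulsetD)
        then show "Y \<in> carrier (loc_module RT u_powers (fst Z))"
          unfolding z(3) r(7)[OF z(1,2)] carrier_loc[OF r(3)] using aB[OF z(1)] by blast
      qed
      show "carrier (loc_module RT u_powers (fst Z)) <= snd Z ` carrier (loc_module RT u_powers (pb (fst Z)))"
      proof
        fix Y assume "Y \<in> carrier (loc_module RT u_powers (fst Z))"
        then obtain y t where y: "y \<in> B" "t \<in> u_powers" "Y = fraction u_powers (fst Z) (q y) t"
          unfolding carrier_loc[OF r(3)] by blast
        obtain c z where z: "z \<in> VV r" "u ^ c *: y - a z \<in> pV n r" using a_surj y(1) hb(3) by blast
        have uA: "u ^ c *: y - a z \<in> A" using z(2) ha(2) by blast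
        have "u ^ c *: y \<in> B" using y hb(1) by (simp add: submod_smul)
        then have "a z \<in> B" using uA AB submod_diff_iff[OF hb(1), of "u ^ c *: y" "a z"] by blast
        then have zB: "z \<in> Ph B" using preimage_in_Ph[OF B z(1)] by blast
        \<comment> \<open>The structure map puts u^N into the denominator. Multiplying z by u^N
          cancels it, so u^N z over u^c t is a preimage of y/t.\<close>
        have wB: "u ^ N *: z \<in> Ph B" using zB hb(1) by (simp add: submod_smul)
        have ct: "u ^ c * t \<in> u_powers" "u ^ N * (u ^ c * t) \<in> u_powers" using y(2) by (auto intro!: mulsetD)
        have "- (u ^ N * t) *: (u ^ c *: y - a z) \<in> A" by (rule submod_smul[OF ha(1) uA])
        also have "- (u ^ N * t) *: (u ^ c *: y - a z) = 1 *: (t *: a (u ^ N *: z) - (u ^ N * (u ^ c * t)) *: y)"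
          by (rule fvec_eqI) (simp add: linD(2)[OF lin_a] algebra_simps)
        finally have "fraction u_powers (fst Z) (q (a (u ^ N *: z))) (u ^ N * (u ^ c * t)) = fraction u_powers (fst Z) (q y) t"
          using frac_eq[OF r(3,1) aB[OF wB] ct(2) y(1,2)] power_in_powers(2) by blast
        then have "Y = snd Z (fraction u_powers (pb (fst Z)) (theta (fst Z) q (u ^ N *: z)) (u ^ c * t))"
          unfolding y(3) r(7)[OF wB ct(1)] by simp
        then show "Y \<in> snd Z ` carrier (loc_module RT u_powers (pb (fst Z)))"
          unfolding carrier_loc[OF r(8)] using wB ct(1) by blast
      qed
    qed
  qed
  then have "phi_bijective \<phi> RT u_powers Z" by (rule rep_module_iso[OF R])
  then show "torsion_kisin_module p \<sigma> Z"
    unfolding torsion_kisin_module_def using fg tors utf presents_module[OF r(3)] by blast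
qed

lemma strict_iff_L:
  assumes R: "rep u_powers (u ^ N) Z A B q a" and A: "A \<in> L" and B: "B \<in> L"
  shows "strict_subobject p \<sigma> Z H \<longleftrightarrow> (\<exists>X\<in>L. A <= X \<and> X <= B \<and> H = q ` X)"
proof -
  have "submod X \<and> (\<forall>x\<in>B. u *: x \<in> X --> x \<in> X) \<and> a ` Ph X <= X \<longleftrightarrow> X \<in> L" if X: "A <= X" "X <= B" for X
  proof -
    have "usat r X \<longleftrightarrow> (\<forall>x\<in>B. u *: x \<in> X --> x \<in> X)"
      using LD(3,4)[OF B] X unfolding usat_def by blast
    then show ?thesis using LD(2)[OF A] LD(3)[OF B] X unfolding L_def by auto
  qed
  then show ?thesis unfolding strict_iff[OF R] by blast
qed

lemma rep_sub_L:
  assumes R: "rep u_powers (u ^ N) Z A B q a" and X: "X \<in> L" "A <= X" "X <= B"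
  shows "rep u_powers (u ^ N) (sub_object \<phi> RT u_powers Z (q ` X)) A X q a"
  using rep_sub[OF R _ X(2,3)] LD[OF X(1)] by simp

lemma semistable_iff:
  assumes R: "rep u_powers (u ^ N) Z A B q a" and A: "A \<in> L" and B: "B \<in> L" and AB: "A <= B" and ee: "0 < ee"
  shows "semistable p \<sigma> ee Z \<longleftrightarrow> A ~= B \<and> (\<forall>X\<in>L. A \<subset> X --> X <= B --> hn.slope A X \<le> hn.slope A B)"
proof -
  note r = repD[OF R]
  note d = presentsD[OF r(3)]
  have zero: "q ` X = {\<zero>\<^bsub>fst Z\<^esub>} \<longleftrightarrow> X = A" if X: "submod X" "A <= X" "X <= B" for X
  proof
    assume e: "q ` X = {\<zero>\<^bsub>fst Z\<^esub>}"
    have "x \<in> A" if "x \<in> X" for x using presents_zero_iff[OF r(3), of x] e that X(3) by blast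
    then show "X = A" using X(2) by blast
  next
    assume "X = A"
    then show "q ` X = {\<zero>\<^bsub>fst Z\<^esub>}" using presents_zero_iff[OF r(3)] d(3) submod_0[OF d(1)] d(5) by auto
  qed
  have "(\<forall>H. strict_subobject p \<sigma> Z H \<and> H ~= {\<zero>\<^bsub>fst Z\<^esub>} -->
        torsion_slope p \<sigma> ee (sub_object \<phi> RT u_powers Z H) \<le> torsion_slope p \<sigma> ee Z)
     \<longleftrightarrow> (\<forall>X\<in>L. A <= X --> X <= B --> q ` X ~= {\<zero>\<^bsub>fst Z\<^esub>} -->
        torsion_slope p \<sigma> ee (sub_object \<phi> RT u_powers Z (q ` X)) \<le> torsion_slope p \<sigma> ee Z)"
    unfolding strict_iff_L[OF R A B] by blast
  also have "\<dots> \<longleftrightarrow> (\<forall>X\<in>L. A \<subset> X --> X <= B --> hn.slope A X \<le> hn.slope A B)"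
  proof (rule ball_cong[OF refl])
    fix X assume X: "X \<in> L"
    show "(A <= X --> X <= B --> q ` X ~= {\<zero>\<^bsub>fst Z\<^esub>} -->
        torsion_slope p \<sigma> ee (sub_object \<phi> RT u_powers Z (q ` X)) \<le> torsion_slope p \<sigma> ee Z) \<longleftrightarrow>
      (A \<subset> X --> X <= B --> hn.slope A X \<le> hn.slope A B)"
    proof (cases "A <= X \<and> X <= B")
      case True
      have "torsion_slope p \<sigma> ee (sub_object \<phi> RT u_powers Z (q ` X)) = hn.slope A X / real ee"
        by (rule rep_piece(3)[OF rep_sub_L[OF R X] A X]) (use True in auto)
      moreover have "torsion_slope p \<sigma> ee Z = hn.slope A B / real ee" by (rule rep_piece(3)[OF R A B AB])
      moreover have "q ` X ~= {\<zero>\<^bsub>fst Z\<^esub>} \<longleftrightarrow> A \<subset> X" using zero[OF LD(1)[OF X]] True by blast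
      ultimately show ?thesis using True ee by (simp add: divide_le_cancel)
    qed auto
  qed
  finally show ?thesis
    unfolding semistable_def using rep_piece(4)[OF R A B AB] zero[OF d(2) AB subset_refl] d(4) by auto
qed

text \<open>Taking images under \<open>q\<close> is an order isomorphism from \<open>L\<close> to
  the strict subobjects. Under it ranks agree and slopes are divided by \<open>ee\<close>, so the
  filtrations correspond and the polygon is that of the lattice, scaled.\<close>

theorem hn_polygon_rep:
  assumes R: "rep u_powers (u ^ N) Z (pV n r) (VV r) q a" and ee: "0 < ee"
  shows "hn_polygon p \<sigma> ee Z = (%x. hn.hn x / real ee)"
proof -
  note r = repD[OF R]
  note d = presentsD[OF r(3)]
  have b: "pV n r \<in> L" by (simp add: pV_L)
  define Gp where "Gp F i = graded_piece p \<sigma> Z F i" for F i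
  have piece: "\<exists>q'. rep u_powers (u ^ N) (Gp F i) (G i) (G (Suc i)) q' a"
    if G: "G i \<in> L" "G (Suc i) \<in> L" "G i <= G (Suc i)" "F i = q ` G i" "F (Suc i) = q ` G (Suc i)" for F G i
  proof -
    note s = rep_sub_L[OF R G(2) LD(2,3)[OF G(2)]]
    show ?thesis unfolding Gp_def graded_piece_def G(4,5)
      using rep_quot[OF s LD(1,2)[OF G(1)] G(3) LD(5)[OF G(1)]] by blast
  qed
  have vim: "{x \<in> VV r. q x \<in> q ` X} = X" if "X \<in> L" for X
    using presents_image_mem[OF r(3) LD(1-3)[OF that]] LD(3)[OF that] by blast
  have sub: "q ` X <= q ` Y \<longleftrightarrow> X <= Y" if "X \<in> L" "Y \<in> L" for X Y
  proof
    assume s: "q ` X <= q ` Y"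
    have "{x \<in> VV r. q x \<in> q ` X} <= {x \<in> VV r. q x \<in> q ` Y}" using s by blast
    then show "X <= Y" unfolding vim[OF that(1)] vim[OF that(2)] .
  qed (rule image_mono)
  have im: "q ` X = q ` Y \<longleftrightarrow> X = Y" "q ` X \<subset> q ` Y \<longleftrightarrow> X \<subset> Y" if "X \<in> L" "Y \<in> L" for X Y
  proof -
    show "q ` X = q ` Y \<longleftrightarrow> X = Y"
      unfolding set_eq_subset[of "q ` X"] sub[OF that] sub[OF that(2,1)] by (rule set_eq_subset[symmetric])
    show "q ` X \<subset> q ` Y \<longleftrightarrow> X \<subset> Y" unfolding less_le_not_le sub[OF that] sub[OF that(2,1)] ..
  qed
  have filt: "hn_filtration p \<sigma> ee Z k F \<longleftrightarrow> hn.filt k G \<and> G 0 = pV n r"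
    if G: "!!i. i \<le> k ==> G i \<in> L \<and> F i = q ` G i" for k F G
  proof -
    have z: "{\<zero>\<^bsub>fst Z\<^esub>} = q ` pV n r" using presents_zero_iff[OF r(3)] d(3) submod_0[OF d(1)] d(5) by auto
    have s: "strict_subobject p \<sigma> Z (F i)" if "i \<le> k" for i
      unfolding strict_iff_L[OF R b top_L] using G[OF that] LD(2,3) by blast
    have lt: "F i \<subset> F (Suc i) \<longleftrightarrow> G i \<subset> G (Suc i)" if "i < k" for i using im(2) G[of i] G[of "Suc i"] that by simp
    have ss: "semistable p \<sigma> ee (graded_piece p \<sigma> Z F i) \<longleftrightarrow> (\<forall>X\<in>L. G i \<subset> X --> X <= G (Suc i) --> hn.slope (G i) X \<le> hn.slope (G i) (G (Suc i)))"
      if i: "i < k" "G i \<subset> G (Suc i)" for i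
    proof -
      obtain q' where "rep u_powers (u ^ N) (Gp F i) (G i) (G (Suc i)) q' a" using piece[of G i F] G[of i] G[of "Suc i"] i by auto
      from semistable_iff[OF this _ _ _ ee] show ?thesis unfolding Gp_def using G[of i] G[of "Suc i"] i by auto
    qed
    have sl: "torsion_slope p \<sigma> ee (graded_piece p \<sigma> Z F i) = hn.slope (G i) (G (Suc i)) / real ee" if i: "i < k" "G i \<subset> G (Suc i)" for i
    proof -
      obtain q' where "rep u_powers (u ^ N) (Gp F i) (G i) (G (Suc i)) q' a" using piece[of G i F] G[of i] G[of "Suc i"] i by auto
      from rep_piece(3)[OF this] show ?thesis unfolding Gp_def using G[of i] G[of "Suc i"] i by auto
    qed
    have "hn_filtration p \<sigma> ee Z k F \<longleftrightarrow> G 0 = pV n r \<and> G k = VV r \<and> (\<forall>i<k. G i \<subset> G (Suc i) \<and> semistable p \<sigma> ee (graded_piece p \<sigma> Z F i)) \<and>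
       (\<forall>i. Suc i < k --> torsion_slope p \<sigma> ee (graded_piece p \<sigma> Z F i) > torsion_slope p \<sigma> ee (graded_piece p \<sigma> Z F (Suc i)))"
      unfolding hn_filtration_def z d(4) using s lt im(1) G[of 0] G[of k] b top_L by auto
    also have "\<dots> \<longleftrightarrow> hn.filt k G \<and> G 0 = pV n r"
    proof -
      have 1: "(\<forall>i<k. G i \<subset> G (Suc i) \<and> semistable p \<sigma> ee (graded_piece p \<sigma> Z F i)) \<longleftrightarrow>
          (\<forall>i<k. G i \<subset> G (Suc i) \<and> (\<forall>H\<in>L. G i \<subset> H --> H <= G (Suc i) --> hn.slope (G i) H \<le> hn.slope (G i) (G (Suc i))))"
        using ss by (intro all_cong1 imp_cong refl conj_cong)
      have 2: "(\<forall>i. Suc i < k --> torsion_slope p \<sigma> ee (graded_piece p \<sigma> Z F i) > torsion_slope p \<sigma> ee (graded_piece p \<sigma> Z F (Suc i))) \<longleftrightarrow>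
          (\<forall>i. Suc i < k --> hn.slope (G (Suc i)) (G (Suc (Suc i))) < hn.slope (G i) (G (Suc i)))"
        if inc: "\<forall>i<k. G i \<subset> G (Suc i)"
        using sl inc ee by (intro all_cong1 imp_cong refl) (simp add: divide_less_cancel)
      have 3: "\<forall>i\<le>k. G i \<in> L" using G by simp
      show ?thesis unfolding hn.filt_def 1 using 2 3 by (smt (verit))
    qed
    finally show ?thesis .
  qed
  have poly: "polygon_of_filtration p \<sigma> ee Z k F = (%x. hn.polygon k G x / real ee)"
    if G: "!!i. i \<le> k ==> G i \<in> L \<and> F i = q ` G i" and f: "hn.filt k G" "G 0 = pV n r" for k F G
  proof
    fix x
    have inc: "G i \<subset> G (Suc i)" if "i < k" for i using f(1) that by (simp add: hn.filt_def)
    have pc: "torsion_slope p \<sigma> ee (graded_piece p \<sigma> Z F i) = hn.slope (G i) (G (Suc i)) / real ee \<and>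
      real (torsion_rank (graded_piece p \<sigma> Z F i)) = real (rk (G (Suc i))) - real (rk (G i))" if i: "i < k" for i
    proof -
      have gg: "G i \<in> L" "G (Suc i) \<in> L" "G i <= G (Suc i)" using G[of i] G[of "Suc i"] inc[OF i] i by auto
      obtain q' where q': "rep u_powers (u ^ N) (Gp F i) (G i) (G (Suc i)) q' a" using piece[of G i F] G[of i] G[of "Suc i"] gg i by auto
      show ?thesis using rep_piece(1)[OF q' gg] rep_piece(3)[OF q' gg, of ee] rkl_diff(1)[OF gg] unfolding Gp_def by (simp add: of_nat_diff)
    qed
    have sm: "(\<Sum>j<i. real (torsion_rank (graded_piece p \<sigma> Z F j))) = real (rk (G i))" if "i < k" for i
    proof -
      have "(\<Sum>j<i. real (torsion_rank (graded_piece p \<sigma> Z F j))) = (\<Sum>j<i. real (rk (G (Suc j))) - real (rk (G j)))"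
        by (rule sum.cong) (use pc that in auto)
      also have "\<dots> = real (rk (G i)) - real (rk (G 0))" by (rule sum_lessThan_telescope)
      finally show ?thesis using f(2) hn.rk_bt by simp
    qed
    show "polygon_of_filtration p \<sigma> ee Z k F x = hn.polygon k G x / real ee"
      unfolding polygon_of_filtration_def hn.polygon_def pl_def sum_divide_distrib
      by (rule sum.cong) (use pc sm in auto)
  qed
  show ?thesis unfolding hn_polygon_def
  proof (rule the_equality)
    obtain k G where G: "hn.filt k G" "G 0 = pV n r" "hn.hn = hn.polygon k G" by (rule hn.hn_filt)
    have GL: "i \<le> k ==> G i \<in> L \<and> q ` G i = q ` G i" for i using G(1) by (simp add: hn.filt_def)
    show "\<exists>k F. hn_filtration p \<sigma> ee Z k F \<and> (%x. hn.hn x / real ee) = polygon_of_filtration p \<sigma> ee Z k F"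
      using filt[of k G "%i. q ` G i"] poly[of k G "%i. q ` G i"] GL G by (intro exI[of _ k] exI[of _ "%i. q ` G i"]) simp
  next
    fix t assume "\<exists>k F. hn_filtration p \<sigma> ee Z k F \<and> t = polygon_of_filtration p \<sigma> ee Z k F"
    then obtain k F where F: "hn_filtration p \<sigma> ee Z k F" "t = polygon_of_filtration p \<sigma> ee Z k F" by blast
    have st: "\<forall>i\<le>k. strict_subobject p \<sigma> Z (F i)" using F(1) unfolding hn_filtration_def by (elim conjE)
    have "\<exists>X. X \<in> L \<and> F i = q ` X" if "i \<le> k" for i
    proof -
      have "strict_subobject p \<sigma> Z (F i)" using st that by simp
      then show ?thesis using strict_iff_L[OF R b top_L, of "F i"] by blast
    qed
    then have "\<forall>i. \<exists>X. i \<le> k --> X \<in> L \<and> F i = q ` X" by (intro allI) metis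
    then obtain G where G: "!!i. i \<le> k ==> G i \<in> L \<and> F i = q ` G i" by metis
    have f: "hn.filt k G" "G 0 = pV n r" using filt[of k G F] G F(1) by blast+
    show "t = (%x. hn.hn x / real ee)" using F(2) poly[OF G f] hn.hn_eq[OF f] by simp
  qed
qed

end

section \<open>The degree of a Kisin module\<close>

lemma det_diag_mat:
  "det (mat n n (%(i, j). if i = j then d i else 0)) = (\<Prod>i<n. d i :: 'a::comm_ring_1)"
proof -
  let ?D = "mat n n (%(i, j). if i = j then d i else 0)"
  have "det ?D = prod_list (diag_mat ?D)" by (rule det_upper_triangular[of _ n]) auto
  then show ?thesis by (simp add: prod_list_diag_prod lessThan_atLeast0)
qed

lemma mult_diag_mat:
  assumes "A \<in> carrier_mat n n" "i < n" "j < n"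
  shows "(A * mat n n (%(i, j). if i = j then d i else 0)) $$ (i, j) = A $$ (i, j) * (d j :: 'a::comm_ring_1)"
proof -
  have "(A * mat n n (%(i, j). if i = j then d i else 0)) $$ (i, j)
      = (\<Sum>k<n. A $$ (i, k) * mat n n (%(i, j). if i = j then d i else 0) $$ (k, j))"
    by (rule index_mult_sum[of _ n n _ n]) (use assms in auto)
  also have "\<dots> = (\<Sum>k<n. if k = j then A $$ (i, j) * d j else 0)" by (rule sum.cong) (use assms in auto)
  finally show ?thesis using assms by simp
qed

text \<open>In a basis of \<open>M\<close> the structure map is \<open>A\<close> divided by E^c,
  with determinant a unit times E^(v - cr). This is why the degree comes out as cr - v.\<close>

locale kisin = witt_eisenstein p \<rho> \<sigma> E
  for p :: nat and \<rho> :: "'w::comm_ring_1 => 'f::field" and \<sigma> and E :: "'w poly" +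
  fixes Z :: "('w fps, 'm) phi_module" and r c v :: nat and q :: "'w fps fvec => 'm" and A :: "'w fps mat" and w :: "'w fps"
  assumes R: "rep (powers E') (E' ^ c) Z {0} (VV r) q (lm r A)"
    and A: "A \<in> carrier_mat r r" and det_A: "det A = w * E' ^ v" and w_unit: "w dvd 1"
begin

abbreviation M where "M \<equiv> fst Z"
abbreviation T :: "'w fps set" where "T \<equiv> {s. s ~= 0}"
abbreviation K where "K \<equiv> loc_ring RT T"
abbreviation V where "V \<equiv> loc_module RT T M"
abbreviation OE where "OE \<equiv> {sfrac T s t | s t. \<not> E' dvd t}"
abbreviation ME where "ME \<equiv> {fraction T M m t | m t. m \<in> carrier M \<and> \<not> E' dvd t}"
abbreviation PE where "PE \<equiv> {sfrac T 1 t \<odot>\<^bsub>V\<^esub> loc_map T M id (snd Z (fraction (powers E') (pb M) y 1)) | y t.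
  y \<in> carrier (pb M) \<and> \<not> E' dvd t}"
abbreviation fr where "fr x t \<equiv> fraction T M (q x) t"

lemma w_E: "\<not> E' dvd w" using w_unit E_not_unit dvd_trans by blast

lemma mulset_T: "mulset T" using fps_domain by (auto simp: mulset_def)

lemma E_nonzero: "\<not> E' dvd t ==> t ~= 0" by auto

lemma E_prod: "\<not> E' dvd s ==> \<not> E' dvd t ==> \<not> E' dvd s * t" using E_prime by blast

lemma E_pow: "\<not> E' dvd s ==> \<not> E' dvd s ^ n" by (induction n) (use E_not_unit E_prod in auto)

lemma nonzero_mult: "(s :: 'w fps) ~= 0 ==> t ~= 0 ==> s * t ~= 0" using fps_domain by blast

lemma smul_cancel: fixes s :: "'w fps" assumes "s ~= 0" shows "s *: x = s *: y \<longleftrightarrow> x = y"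
proof
  assume h: "s *: x = s *: y"
  have "s * cf x i = s * cf y i" for i using arg_cong[OF h, of "%z. cf z i"] by simp
  then show "x = y" using fps_cancel[OF assms] by (auto intro!: fvec_eqI)
qed simp

lemma P: "presents M {0} (VV r) q" using repD(3)[OF R] .

section \<open>Fractions and finite sums in \<open>V\<close> and \<open>K\<close>\<close>

lemma fr_eq: assumes "x \<in> VV r" "y \<in> VV r" "t ~= 0" "s ~= 0" shows "fr x t = fr y s \<longleftrightarrow> s *: x = t *: y"
proof -
  have "fr x t = fr y s \<longleftrightarrow> (\<exists>v\<in>T. v *: (s *: x - t *: y) \<in> {0})"
    by (rule frac_eq[OF P mulset_T]) (use assms in auto)
  also have "\<dots> \<longleftrightarrow> s *: x = t *: y"
  proof
    assume "\<exists>v\<in>T. v *: (s *: x - t *: y) \<in> {0}"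
    then obtain v where "v ~= 0" "v *: (s *: x - t *: y) = v *: 0" by (auto simp: smul_simps)
    then have "s *: x - t *: y = 0" using smul_cancel by blast
    then show "s *: x = t *: y" by simp
  next
    assume "s *: x = t *: y"
    then show "\<exists>v\<in>T. v *: (s *: x - t *: y) \<in> {0}" by (intro bexI[of _ 1]) (use mulsetD(1)[OF mulset_T] in \<open>auto simp: smul_simps\<close>)
  qed
  finally show ?thesis .
qed

lemma fr_add: "x \<in> VV r ==> y \<in> VV r ==> t ~= 0 ==> s ~= 0 ==> fr x t \<oplus>\<^bsub>V\<^esub> fr y s = fr (s *: x + t *: y) (t * s)"
  by (rule loc_add[OF P mulset_T]) auto

lemma fr_add_same: assumes "x \<in> VV r" "y \<in> VV r" "t ~= 0" shows "fr x t \<oplus>\<^bsub>V\<^esub> fr y t = fr (x + y) t"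
proof -
  have "fr (t *: x + t *: y) (t * t) = fr (x + y) t"
    using assms by (subst fr_eq) (simp_all add: submod_add submod_smul nonzero_mult smul_simps)
  then show ?thesis using fr_add assms by simp
qed

lemma fr_smul: "x \<in> VV r ==> t ~= 0 ==> s ~= 0 ==> sfrac T b s \<odot>\<^bsub>V\<^esub> fr x t = fr (b *: x) (s * t)"
  by (rule loc_smult[OF P mulset_T]) auto

lemma V_zero: "\<zero>\<^bsub>V\<^esub> = fr 0 1" by (simp add: loc_module_def presentsD(5)[OF P])

text \<open>\<open>finsum\<close> depends on the carrier, and \<open>kisin_degree\<close> takes sums
  both in \<open>V\<close> and in \<open>V\<close> with carrier \<open>ME\<close>; a variable
  carrier \<open>C\<close> serves both.\<close>

lemma V_sum:
  fixes n :: nat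
  assumes C: "C <= {fr x t | x t. x \<in> VV r \<and> t ~= 0}" "fr 0 1 \<in> C" "!!X Y. X \<in> C ==> Y \<in> C ==> X \<oplus>\<^bsub>V\<^esub> Y \<in> C"
    and f: "!!i. i < n ==> x i \<in> VV r \<and> f i = fr (x i) t \<and> f i \<in> C" and t: "t ~= 0"
  shows "finsum (V\<lparr>carrier := C\<rparr>) f {..<n} = fr (\<Sum>i<n. x i) t"
proof -
  have Cd: "\<exists>x t. x \<in> VV r \<and> t ~= 0 \<and> X = fr x t" if "X \<in> carrier (V\<lparr>carrier := C\<rparr>)" for X
  proof -
    have "X \<in> C" using that by simp
    then show ?thesis using C(1) by blast
  qed
  have "abelian_monoid (V\<lparr>carrier := C\<rparr>)"
  proof (rule abelian_monoidI)
    fix X Y W assume XYW: "X \<in> carrier (V\<lparr>carrier := C\<rparr>)" "Y \<in> carrier (V\<lparr>carrier := C\<rparr>)" "W \<in> carrier (V\<lparr>carrier := C\<rparr>)"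
    then obtain x s y t z l where xyz: "x \<in> VV r" "s ~= 0" "X = fr x s" "y \<in> VV r" "t ~= 0" "Y = fr y t" "z \<in> VV r" "l ~= 0" "W = fr z l"
      using Cd[OF XYW(1)] Cd[OF XYW(2)] Cd[OF XYW(3)] by blast
    have 1: "t *: x + s *: y \<in> VV r" "l *: y + t *: z \<in> VV r" "s * t ~= 0" "t * l ~= 0"
      using xyz by (auto simp: submod_add submod_smul nonzero_mult)
    have "l *: (t *: x + s *: y) + (s * t) *: z = (t * l) *: x + s *: (l *: y + t *: z)"
      by (rule fvec_eqI) (simp add: algebra_simps)
    then show "X \<oplus>\<^bsub>V\<lparr>carrier := C\<rparr>\<^esub> Y \<oplus>\<^bsub>V\<lparr>carrier := C\<rparr>\<^esub> W = X \<oplus>\<^bsub>V\<lparr>carrier := C\<rparr>\<^esub> (Y \<oplus>\<^bsub>V\<lparr>carrier := C\<rparr>\<^esub> W)"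
      using xyz 1 by (simp add: fr_add mult.assoc)
  next
    fix X Y assume XY: "X \<in> carrier (V\<lparr>carrier := C\<rparr>)" "Y \<in> carrier (V\<lparr>carrier := C\<rparr>)"
    then obtain x s y t where xyz: "x \<in> VV r" "s ~= 0" "X = fr x s" "y \<in> VV r" "t ~= 0" "Y = fr y t"
      using Cd[OF XY(1)] Cd[OF XY(2)] by blast
    then show "X \<oplus>\<^bsub>V\<lparr>carrier := C\<rparr>\<^esub> Y = Y \<oplus>\<^bsub>V\<lparr>carrier := C\<rparr>\<^esub> X" by (simp add: fr_add add.commute mult.commute)
    show "X \<oplus>\<^bsub>V\<lparr>carrier := C\<rparr>\<^esub> Y \<in> carrier (V\<lparr>carrier := C\<rparr>)" using C(3) XY by simp
  next
    fix X assume X: "X \<in> carrier (V\<lparr>carrier := C\<rparr>)"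
    obtain x s where x: "x \<in> VV r" "s ~= 0" "X = fr x s" using Cd[OF X] by blast
    then show "\<zero>\<^bsub>V\<lparr>carrier := C\<rparr>\<^esub> \<oplus>\<^bsub>V\<lparr>carrier := C\<rparr>\<^esub> X = X"
      using fr_add[of 0 x 1 s] by (simp add: V_zero submod_0 smul_simps)
  qed (use C(2) V_zero in simp)
  then interpret V': abelian_monoid "V\<lparr>carrier := C\<rparr>" .
  have "finsum (V\<lparr>carrier := C\<rparr>) f {..<k} = fr (\<Sum>i<k. x i) t" if "k \<le> n" for k
    using that
  proof (induction k)
    case 0
    have "fr 0 1 = fr 0 t" using t by (subst fr_eq) (simp_all add: submod_0 smul_simps)
    then show ?case by (simp add: V_zero)
  next
    case (Suc k)
    have s: "(\<Sum>i<k. x i) \<in> VV r" using f Suc.prems by (auto simp: VV_def)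
    have "finsum (V\<lparr>carrier := C\<rparr>) f {..<Suc k} = f k \<oplus>\<^bsub>V\<^esub> finsum (V\<lparr>carrier := C\<rparr>) f {..<k}"
    proof -
      have "f i \<in> C" if "i < n" for i using f that by blast
      then have fc: "f \<in> {..<k} \<rightarrow> carrier (V\<lparr>carrier := C\<rparr>)" "f k \<in> carrier (V\<lparr>carrier := C\<rparr>)" using Suc.prems by simp_all
      show ?thesis using V'.finsum_insert[of "{..<k}" k f, OF _ _ fc] by (simp add: lessThan_Suc)
    qed
    also have "\<dots> = fr (x k) t \<oplus>\<^bsub>V\<^esub> fr (\<Sum>i<k. x i) t" using Suc f by simp
    also have "\<dots> = fr (\<Sum>i<Suc k. x i) t" using f[of k] Suc.prems s t by (simp add: fr_add_same add.commute)
    finally show ?case .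
  qed
  then show ?thesis by simp
qed

lemma V_sum_top:
  fixes n :: nat
  assumes "!!i. i < n ==> x i \<in> VV r \<and> f i = fr (x i) t" "t ~= 0"
  shows "finsum V f {..<n} = fr (\<Sum>i<n. x i) t"
proof -
  let ?C = "{fr x t | x t. x \<in> VV r \<and> t ~= 0}"
  have C: "carrier V = ?C" unfolding carrier_loc[OF P] by simp
  then have "V\<lparr>carrier := ?C\<rparr> = V" by simp
  moreover have "finsum (V\<lparr>carrier := ?C\<rparr>) f {..<n} = fr (\<Sum>i<n. x i) t"
  proof (rule V_sum)
    show "fr 0 1 \<in> ?C" using submod_0[OF submod_VV] by force
    fix X Y assume "X \<in> ?C" "Y \<in> ?C"
    then obtain x s y t where xyz: "x \<in> VV r" "s ~= 0" "X = fr x s" "y \<in> VV r" "t ~= 0" "Y = fr y t" by blast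
    then have "X \<oplus>\<^bsub>V\<^esub> Y = fr (t *: x + s *: y) (s * t)" by (simp add: fr_add)
    then show "X \<oplus>\<^bsub>V\<^esub> Y \<in> ?C" using xyz nonzero_mult submod_add[OF submod_VV] submod_smul[OF submod_VV] by blast
  next
    fix i assume "i < n"
    then show "x i \<in> VV r \<and> f i = fr (x i) t \<and> f i \<in> ?C" using assms by blast
  qed (use assms in auto)
  ultimately show ?thesis by simp
qed

lemma ME_eq: "ME = {fr x t | x t. x \<in> VV r \<and> \<not> E' dvd t}"
  unfolding presentsD(4)[OF P] by blast

lemma V_sum_ME:
  fixes n :: nat
  assumes "!!i. i < n ==> x i \<in> VV r \<and> f i = fr (x i) t" "\<not> E' dvd t"
  shows "finsum (V\<lparr>carrier := ME\<rparr>) f {..<n} = fr (\<Sum>i<n. x i) t"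
  unfolding ME_eq
proof (rule V_sum)
  show "fr 0 1 \<in> {fr x t | x t. x \<in> VV r \<and> \<not> E' dvd t}" using submod_0[OF submod_VV] E_not_unit by blast
  show "{fr x t | x t. x \<in> VV r \<and> \<not> E' dvd t} <= {fr x t | x t. x \<in> VV r \<and> t ~= 0}" using E_nonzero by blast
  fix X Y assume "X \<in> {fr x t | x t. x \<in> VV r \<and> \<not> E' dvd t}" "Y \<in> {fr x t | x t. x \<in> VV r \<and> \<not> E' dvd t}"
  then obtain x s y t where xyz: "x \<in> VV r" "\<not> E' dvd s" "X = fr x s" "y \<in> VV r" "\<not> E' dvd t" "Y = fr y t" by blast
  then have "X \<oplus>\<^bsub>V\<^esub> Y = fr (t *: x + s *: y) (s * t)" using E_nonzero[of s] E_nonzero[of t] by (simp add: fr_add)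
  then show "X \<oplus>\<^bsub>V\<^esub> Y \<in> {fr x t | x t. x \<in> VV r \<and> \<not> E' dvd t}"
    using xyz E_prod[of s t] submod_add[OF submod_VV] submod_smul[OF submod_VV] by blast
next
  fix i assume "i < n"
  then show "x i \<in> VV r \<and> f i = fr (x i) t \<and> f i \<in> {fr x t | x t. x \<in> VV r \<and> \<not> E' dvd t}" using assms by blast
qed (use assms E_nonzero in auto)

lemma sfrac_T: "t ~= 0 ==> s ~= 0 ==> sfrac T a t = sfrac T b s \<longleftrightarrow> s * a = t * b"
  using sfrac_eq[OF mulset_T, of t s a b] fps_cancel by (auto intro: exI[of _ 1])

lemma K_mult: assumes "s ~= 0" "t ~= 0" shows "sfrac T a s \<otimes>\<^bsub>K\<^esub> sfrac T b t = sfrac T (a * b) (s * t)"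
proof -
  let ?x = "fv (%i. if i = 0 then b else 0) :: 'w fps fvec"
  have "?x \<in> VV 1" by (auto simp: VV_def)
  then have "sfrac T a s \<odot>\<^bsub>loc_module RT T (self_module RT)\<^esub> sfrac T (cf ?x 0) t = sfrac T (cf (a *: ?x) 0) (s * t)"
    by (intro loc_smult[OF presents_self mulset_T]) (use assms in auto)
  then show ?thesis by (simp add: loc_ring_def Let_def)
qed

lemma K_one: "\<one>\<^bsub>K\<^esub> = sfrac T 1 1" by (simp add: loc_ring_def Let_def)

lemma K_carrier: "t ~= 0 ==> sfrac T b t \<in> carrier K" unfolding carrier_loc_ring by blast

lemma monoid_K: "monoid K"
proof (rule monoidI)
  fix x y z assume "x \<in> carrier K" "y \<in> carrier K" "z \<in> carrier K"
  then obtain a s b t d l where "x = sfrac T a s" "s ~= 0" "y = sfrac T b t" "t ~= 0" "z = sfrac T d l" "l ~= 0"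
    unfolding carrier_loc_ring by blast
  then show "x \<otimes>\<^bsub>K\<^esub> y \<otimes>\<^bsub>K\<^esub> z = x \<otimes>\<^bsub>K\<^esub> (y \<otimes>\<^bsub>K\<^esub> z)" by (simp add: K_mult nonzero_mult mult.assoc)
next
  fix x y assume "x \<in> carrier K" "y \<in> carrier K"
  then obtain a s b t where "x = sfrac T a s" "s ~= 0" "y = sfrac T b t" "t ~= 0" unfolding carrier_loc_ring by blast
  then show "x \<otimes>\<^bsub>K\<^esub> y \<in> carrier K" using nonzero_mult[of s t] by (auto simp: K_mult carrier_loc_ring)
next
  show "\<one>\<^bsub>K\<^esub> \<in> carrier K" unfolding K_one carrier_loc_ring using mulsetD(1)[OF mulset_T] by blast
next
  fix x assume "x \<in> carrier K"
  then obtain a s where "x = sfrac T a s" "s ~= 0" unfolding carrier_loc_ring by blast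
  then show "\<one>\<^bsub>K\<^esub> \<otimes>\<^bsub>K\<^esub> x = x" "x \<otimes>\<^bsub>K\<^esub> \<one>\<^bsub>K\<^esub> = x" by (simp_all add: K_one K_mult)
qed

text \<open>The exponents in \<open>kisin_degree\<close> may be negative; written as a difference of
  natural numbers they become numerator and denominator of one fraction.\<close>

lemma K_power: "sfrac T E' 1 [^]\<^bsub>K\<^esub> (int i - int j) = sfrac T (E' ^ i) (E' ^ j)"
proof -
  have n: "sfrac T E' 1 [^]\<^bsub>K\<^esub> k = sfrac T (E' ^ k) 1" for k :: nat
    by (induction k) (simp_all add: K_one K_mult mult.commute)
  have i: "inv\<^bsub>K\<^esub> sfrac T (E' ^ k) 1 = sfrac T 1 (E' ^ k)" for k
  proof -
    have e: "sfrac T (E' ^ k) (E' ^ k) = \<one>\<^bsub>K\<^esub>" unfolding K_one by (subst sfrac_T) (simp_all add: E_power_neq_0)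
    have m: "sfrac T (E' ^ k) 1 \<otimes>\<^bsub>K\<^esub> sfrac T 1 (E' ^ k) = \<one>\<^bsub>K\<^esub>" "sfrac T 1 (E' ^ k) \<otimes>\<^bsub>K\<^esub> sfrac T (E' ^ k) 1 = \<one>\<^bsub>K\<^esub>"
      using e E_not_unit by (subst K_mult[OF _ E_power_neq_0] K_mult[OF E_power_neq_0]; simp)+
    have "sfrac T 1 (E' ^ k) = inv\<^bsub>K\<^esub> sfrac T (E' ^ k) 1"
      by (rule monoid.inv_unique'[OF monoid_K K_carrier K_carrier[OF E_power_neq_0] m]) (use E_not_unit in auto)
    then show ?thesis ..
  qed
  show ?thesis
  proof (cases "j \<le> i")
    case True
    have "int i - int j = int (i - j)" using True by simp
    then have "sfrac T E' 1 [^]\<^bsub>K\<^esub> (int i - int j) = sfrac T (E' ^ (i - j)) 1" by (simp only: int_pow_int n)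
    also have "\<dots> = sfrac T (E' ^ i) (E' ^ j)"
      using True by (subst sfrac_T) (simp_all add: E_power_neq_0 power_add[symmetric])
    finally show ?thesis .
  next
    case False
    have "nat (- (int i - int j)) = j - i" using False by simp
    then have "sfrac T E' 1 [^]\<^bsub>K\<^esub> (int i - int j) = sfrac T 1 (E' ^ (j - i))" using False by (simp add: int_pow_def2 n i)
    also have "\<dots> = sfrac T (E' ^ i) (E' ^ j)"
      using False by (subst sfrac_T) (simp_all add: E_power_neq_0 power_add[symmetric])
    finally show ?thesis .
  qed
qed

text \<open>\<open>E'\<close> is prime, so the product of the individual denominators is again prime
  to \<open>E'\<close>.\<close>

lemma common_den:
  fixes k :: nat
  assumes "!!i. i < k ==> \<exists>t. \<not> E' dvd t \<and> Q i t" "!!i s t. i < k ==> Q i t ==> \<not> E' dvd s ==> Q i (t * s)"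
  shows "\<exists>t. \<not> E' dvd t \<and> (\<forall>i<k. Q i t)"
  using assms
proof (induction k)
  case 0
  then show ?case using E_not_unit by blast
next
  case (Suc k)
  obtain t where t: "\<not> E' dvd t" "\<forall>i<k. Q i t" using Suc.IH Suc.prems by (metis less_SucI)
  obtain s where s: "\<not> E' dvd s" "Q k s" using Suc.prems(1) by blast
  have "Q k (s * t)" using Suc.prems(2) s t by blast
  moreover have "Q i (t * s)" if "i < k" for i using Suc.prems(2)[of i t s] s t that by simp
  ultimately show ?case using E_prod[OF t(1) s(1)] by (metis less_Suc_eq mult.commute)
qed

lemma OE_common:
  fixes k :: nat
  assumes "!!i. i < k ==> C i \<in> OE"
  obtains n t where "\<not> E' dvd t" "!!i. i < k ==> C i = sfrac T (n i) t"
proof -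
  have "\<exists>t. \<not> E' dvd t \<and> (\<forall>i<k. t ~= 0 \<and> (\<exists>n. C i = sfrac T n t))"
  proof (rule common_den)
    fix i assume "i < k"
    then obtain s t where st: "C i = sfrac T s t" "\<not> E' dvd t" using assms by blast
    then have "t ~= 0" by auto
    then show "\<exists>t. \<not> E' dvd t \<and> t ~= 0 \<and> (\<exists>n. C i = sfrac T n t)" using st by blast
  next
    fix i s t assume h: "t ~= 0 \<and> (\<exists>n. C i = sfrac T n t)" "\<not> E' dvd s"
    then obtain n where n: "t ~= 0" "C i = sfrac T n t" by blast
    have "s ~= 0" using h(2) by auto
    then have "sfrac T n t = sfrac T (n * s) (t * s)" using n by (subst sfrac_T) (simp_all add: nonzero_mult mult_ac)
    then show "t * s ~= 0 \<and> (\<exists>n. C i = sfrac T n (t * s))" using n nonzero_mult[OF n(1) \<open>s ~= 0\<close>] by metis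
  qed
  then show thesis using that by metis
qed

lemma PE_eq: "PE = {fr (lm r A z) (t * E' ^ c) | z t. z \<in> VV r \<and> \<not> E' dvd t}"
proof -
  note rd = repD[OF R]
  have sub: "powers E' <= T" using E_power_neq_0 by (auto simp: powers_def)
  have "sfrac T 1 t \<odot>\<^bsub>V\<^esub> loc_map T M id (snd Z (fraction (powers E') (pb M) (theta M q z) 1)) = fr (lm r A z) (t * E' ^ c)"
    if z: "z \<in> VV r" and t: "\<not> E' dvd t" for z t
  proof -
    have "snd Z (fraction (powers E') (pb M) (theta M q z) 1) = fraction (powers E') M (q (lm r A z)) (E' ^ c)"
      using rd(7)[of z 1] z by simp
    moreover have "loc_map T M id (fraction (powers E') M (q (lm r A z)) (E' ^ c)) = fr (lm r A z) (E' ^ c)"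
      by (rule loc_map_frac[OF P P subset_refl subset_refl rd(1) mulset_T sub _ lm_VV]) simp_all
    ultimately show ?thesis using fr_smul[where x = "lm r A z" and t = "E' ^ c" and s = t and b = 1, OF lm_VV E_power_neq_0 E_nonzero[OF t]] by (simp add: smul_simps)
  qed
  then show ?thesis unfolding presentsD(4)[OF rd(8)] by auto blast+
qed

lemma lm_combination:
  fixes x :: "nat => 'w fps"
  shows "(\<Sum>i<r. x i *: lm r B (fv (%k. if k = i then 1 else 0))) = lm r B (fv (%i. if i < r then x i else 0))"
proof -
  have "(\<Sum>i<r. x i *: fv (%k. if k = i then 1 else 0)) = fv (%i. if i < r then x i else 0)"
  proof (rule fvec_eqI)
    fix k
    have "(\<Sum>i<r. x i * (if k = i then 1 else 0)) = (\<Sum>i<r. if i = k then x k else 0)" by (intro sum.cong) auto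
    then show "cf (\<Sum>i<r. x i *: fv (%k. if k = i then 1 else 0)) k = cf (fv (%i. if i < r then x i else 0)) k" by auto
  qed
  then show ?thesis using lin_sum[OF lin_lm, of r B "%i. x i *: fv (%k. if k = i then 1 else 0)" "{..<r}"]
    by (simp add: linD(2)[OF lin_lm])
qed

lemma degree_exists:
  "\<exists>r' b a. module_basis (K\<lparr>carrier := OE\<rparr>) (V\<lparr>carrier := ME\<rparr>) r' b \<and>
    PE = {finsum V (%i. (C i \<otimes>\<^bsub>K\<^esub> (sfrac T E' 1 [^]\<^bsub>K\<^esub> (- a i))) \<odot>\<^bsub>V\<^esub> b i) {..<r'} | C. C \<in> {..<r'} \<rightarrow> OE} \<and>
    int (c * r) - int v = (\<Sum>i<r'. a i)"
proof -
  interpret v: valuation_mod "{0}" "{s. \<not> E' dvd s}" E' by (rule valuation_E)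
  obtain P' Q where PQ: "P' \<in> carrier_mat r r" "Q \<in> carrier_mat r r" "\<not> E' dvd det P'" "\<not> E' dvd det Q"
    "!!i j. i < r ==> j < r ==> i ~= j ==> (P' * A * Q) $$ (i, j) = 0"
    using v.diagonalizable_all[OF A] unfolding v.diagonalizable_def by auto
  define D where "D = P' * A * Q"
  have PA: "P' * A \<in> carrier_mat r r" using PQ A by simp
  have D: "D \<in> carrier_mat r r" using PA PQ by (simp add: D_def)
  have dP: "det P' ~= 0" "det Q ~= 0" using PQ E_nonzero by blast+
  have w0: "w ~= 0" using w_E by auto
  have dD: "det D = (\<Prod>i<r. D $$ (i, i))" using v.det_mod[OF D] PQ(5) by (simp add: D_def)
  have dD': "det D = E' ^ v * (det P' * w * det Q)" using PQ A PA by (simp add: D_def det_mult[of _ r] det_A mult_ac)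
  then have "det D ~= 0" using E_power_neq_0 dP w0 by (simp add: nonzero_mult)
  then have nz: "D $$ (i, i) ~= 0" if "i < r" for i using that unfolding dD by (metis finite_lessThan lessThan_iff prod_zero)
  have "\<exists>k s. D $$ (i, i) = E' ^ k * s \<and> \<not> E' dvd s" if "i < r" for i by (rule E_power_decomp[OF nz[OF that]])
  then have "\<forall>i. \<exists>k s. i < r --> D $$ (i, i) = E' ^ k * s \<and> \<not> E' dvd s" by blast
  then obtain m s where ms: "!!i. i < r ==> D $$ (i, i) = E' ^ m i * s i" "!!i. i < r ==> \<not> E' dvd s i" by metis
  have sP: "\<not> E' dvd (\<Prod>i\<in>I. s i)" if "I <= {..<r}" for I
  proof -
    have "finite I" using that by (rule finite_subset) simp
    then show ?thesis using that by (induction I) (use E_not_unit E_prod ms(2) in auto)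
  qed
  have "(\<Prod>i<r. D $$ (i, i)) = E' ^ (\<Sum>i<r. m i) * (\<Prod>i<r. s i)" using ms(1) by (simp add: prod.distrib power_sum)
  then have e: "E' ^ v * (det P' * w * det Q) = E' ^ (\<Sum>i<r. m i) * (\<Prod>i<r. s i)" using dD dD' by simp
  have wE: "\<not> E' dvd det P' * w * det Q" by (intro E_prod PQ(3,4) w_E)
  have mv: "(\<Sum>i<r. m i) = v"
    using E_order_le[OF e wE] E_order_le[OF e[symmetric] sP[OF subset_refl]] by (rule antisym)
  let ?f = "%y. lm r (adj_mat P') y" and ?e = "%i. fv (%k. if k = i then 1 else 0) :: 'w fps fvec"
  let ?v = "%n. fv (%i. if i < r then n i else 0) :: 'w fps fvec"
  have vV: "?v n \<in> VV r" for n by (auto simp: VV_def)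
  \<comment> \<open>Over the localization at (E) the matrix P' is invertible, its inverse being the
    adjugate up to the unit \<open>det P'\<close>; the columns of the adjugate form the adapted
    basis. A diagonal entry of order m i over E^c gives the exponent m i - c = -a i.\<close>
  define b where "b i = fr (?f (?e i)) 1" for i
  define a where "a i = int c - int (m i)" for i
  have Di: "cf (lm r D x) i = D $$ (i, i) * cf x i" if i: "i < r" for x i
  proof -
    have "(\<Sum>j<r. D $$ (i, j) * cf x j) = (\<Sum>j<r. if j = i then D $$ (i, i) * cf x i else 0)"
      by (rule sum.cong) (use PQ(5)[folded D_def] i in auto)
    then show ?thesis using i by (simp add: lm_def)
  qed
  have PDQ: "?f (lm r D z) = det P' *: lm r A (lm r Q z)" for z
    using lm_adj(2)[OF PQ(1), of "lm r A (lm r Q z)"] by (simp add: D_def lm_mult[OF PA PQ(2)] lm_mult[OF PQ(1) A])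
  have cb: "sfrac T n \<tau> \<odot>\<^bsub>V\<^esub> b i = fr (n *: ?f (?e i)) \<tau>" if "\<tau> ~= 0" for n \<tau> i
    unfolding b_def using fr_smul[OF lm_VV _ that, of 1 n] by simp
  have fsum: "finsum (V\<lparr>carrier := ME\<rparr>) (%i. C i \<odot>\<^bsub>V\<^esub> b i) {..<r} = fr (?f (?v n)) \<tau>"
    if C: "!!i. i < r ==> C i = sfrac T (n i) \<tau>" and \<tau>: "\<not> E' dvd \<tau>" for C n \<tau>
  proof -
    have "finsum (V\<lparr>carrier := ME\<rparr>) (%i. C i \<odot>\<^bsub>V\<^esub> b i) {..<r} = fr (\<Sum>i<r. n i *: ?f (?e i)) \<tau>"
      by (rule V_sum_ME) (use C \<tau> E_nonzero[OF \<tau>] cb in \<open>simp_all add: submod_smul\<close>)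
    then show ?thesis by (simp add: lm_combination)
  qed
  have basis: "module_basis (K\<lparr>carrier := OE\<rparr>) (V\<lparr>carrier := ME\<rparr>) r b"
    unfolding module_basis_def
  proof (intro conjI ballI)
    have "b i \<in> ME" for i unfolding ME_eq b_def using E_not_unit lm_VV by blast
    then show "b \<in> {..<r} \<rightarrow> carrier (V\<lparr>carrier := ME\<rparr>)" by auto
    fix X assume "X \<in> carrier (V\<lparr>carrier := ME\<rparr>)"
    then have "X \<in> ME" by simp
    then obtain x t where x: "X = fr x t" "x \<in> VV r" "\<not> E' dvd t" unfolding ME_eq by blast
    define n where "n i = cf (lm r P' x) i" for i
    define \<tau> where "\<tau> = t * det P'"
    have \<tau>: "\<not> E' dvd \<tau>" unfolding \<tau>_def by (rule E_prod[OF x(3) PQ(3)])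
    have vn: "?v n = lm r P' x" by (rule fvec_eqI) (simp add: n_def lm_def)
    have x1: "X = fr (?f (?v n)) \<tau>"
      unfolding x(1) vn lm_adj(2)[OF PQ(1) x(2)]
      using x(2) E_nonzero[OF x(3)] E_nonzero[OF \<tau>] by (subst fr_eq) (simp_all add: submod_smul \<tau>_def smul_simps mult_ac)
    have x2: "finsum (V\<lparr>carrier := ME\<rparr>) (%i. restrict (%i. sfrac T (n i) \<tau>) {..<r} i \<odot>\<^bsub>V\<^esub> b i) {..<r} = fr (?f (?v n)) \<tau>"
      by (rule fsum) (use \<tau> in auto)
    have x3: "restrict (%i. sfrac T (n i) \<tau>) {..<r} \<in> {..<r} \<rightarrow>\<^sub>E OE" using \<tau> by auto
    have ex: "\<exists>C. C \<in> {..<r} \<rightarrow>\<^sub>E OE \<and> X = finsum (V\<lparr>carrier := ME\<rparr>) (%i. C i \<odot>\<^bsub>V\<^esub> b i) {..<r}"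
      by (rule exI, rule conjI, rule x3, rule trans[OF x1 x2[symmetric]])
    have uni: "C = C'" if C: "C \<in> {..<r} \<rightarrow>\<^sub>E OE" "X = finsum (V\<lparr>carrier := ME\<rparr>) (%i. C i \<odot>\<^bsub>V\<^esub> b i) {..<r}"
      and C': "C' \<in> {..<r} \<rightarrow>\<^sub>E OE" "X = finsum (V\<lparr>carrier := ME\<rparr>) (%i. C' i \<odot>\<^bsub>V\<^esub> b i) {..<r}" for C C'
    proof (rule PiE_ext[OF C(1) C'(1)])
      obtain n t where n: "\<not> E' dvd t" "!!i. i < r ==> C i = sfrac T (n i) t" by (rule OE_common[of r C, OF PiE_mem[OF C(1)]]) auto
      obtain n' t' where n': "\<not> E' dvd t'" "!!i. i < r ==> C' i = sfrac T (n' i) t'" by (rule OE_common[of r C', OF PiE_mem[OF C'(1)]]) auto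
      note tt = E_nonzero[OF n(1)] E_nonzero[OF n'(1)]
      have "fr (?f (?v n)) t = fr (?f (?v n')) t'" using fsum[OF n(2,1)] fsum[OF n'(2,1)] C(2) C'(2) by simp
      then have "t' *: ?f (?v n) = t *: ?f (?v n')" using fr_eq[OF lm_VV lm_VV tt] by blast
      then have "lm r P' (t' *: ?f (?v n)) = lm r P' (t *: ?f (?v n'))" by simp
      then have "t' *: det P' *: ?v n = t *: det P' *: ?v n'" by (simp only: linD(2)[OF lin_lm] lm_adj(1)[OF PQ(1) vV])
      then have "det P' *: (t' *: ?v n) = det P' *: (t *: ?v n')" by (simp add: smul_simps mult.commute)
      then have "t' *: ?v n = t *: ?v n'" using smul_cancel[OF dP(1)] by blast
      then have tv: "cf (t' *: ?v n) i = cf (t *: ?v n') i" for i by (rule arg_cong)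
      have "t' * n i = t * n' i" if "i < r" for i using tv[of i] that by simp
      then show "C i = C' i" if "i \<in> {..<r}" for i using that n(2) n'(2) sfrac_T[OF tt] by simp
    qed
    have "\<exists>!C. C \<in> {..<r} \<rightarrow>\<^sub>E OE \<and> X = finsum (V\<lparr>carrier := ME\<rparr>) (%i. C i \<odot>\<^bsub>V\<^esub> b i) {..<r}"
      by (rule ex_ex1I[OF ex], elim conjE, rule uni, assumption+)
    then show "\<exists>!C. C \<in> {..<r} \<rightarrow>\<^sub>E carrier (K\<lparr>carrier := OE\<rparr>) \<and>
        X = finsum (V\<lparr>carrier := ME\<rparr>) (%i. C i \<odot>\<^bsub>V\<lparr>carrier := ME\<rparr>\<^esub> b i) {..<r}" by simp
  qed
  have tsum: "finsum V (%i. (C i \<otimes>\<^bsub>K\<^esub> (sfrac T E' 1 [^]\<^bsub>K\<^esub> (- a i))) \<odot>\<^bsub>V\<^esub> b i) {..<r}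
      = fr (?f (?v (%i. n i * E' ^ m i))) (\<tau> * E' ^ c)"
    if C: "!!i. i < r ==> C i = sfrac T (n i) \<tau>" and \<tau>: "\<tau> ~= 0" for C n \<tau>
  proof -
    have nz: "\<tau> * E' ^ c ~= 0" using \<tau> E_power_neq_0 by (rule nonzero_mult)
    have "- a i = int (m i) - int c" for i by (simp add: a_def)
    then have "(C i \<otimes>\<^bsub>K\<^esub> (sfrac T E' 1 [^]\<^bsub>K\<^esub> (- a i))) \<odot>\<^bsub>V\<^esub> b i = fr ((n i * E' ^ m i) *: ?f (?e i)) (\<tau> * E' ^ c)" if "i < r" for i
      using that C by (simp only: K_power K_mult[OF \<tau> E_power_neq_0] cb[OF nz])
    then have "finsum V (%i. (C i \<otimes>\<^bsub>K\<^esub> (sfrac T E' 1 [^]\<^bsub>K\<^esub> (- a i))) \<odot>\<^bsub>V\<^esub> b i) {..<r}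
      = fr (\<Sum>i<r. (n i * E' ^ m i) *: ?f (?e i)) (\<tau> * E' ^ c)"
      using nz by (intro V_sum_top) (simp_all add: submod_smul)
    then show ?thesis by (simp only: lm_combination)
  qed
  let ?R = "{finsum V (%i. (C i \<otimes>\<^bsub>K\<^esub> (sfrac T E' 1 [^]\<^bsub>K\<^esub> (- a i))) \<odot>\<^bsub>V\<^esub> b i) {..<r} | C. C \<in> {..<r} \<rightarrow> OE}"
  have "PE = ?R"
    unfolding PE_eq
  proof (intro antisym subsetI)
    fix X assume "X \<in> {fr (lm r A z) (t * E' ^ c) | z t. z \<in> VV r \<and> \<not> E' dvd t}"
    then obtain z t where z: "X = fr (lm r A z) (t * E' ^ c)" "z \<in> VV r" "\<not> E' dvd t" by blast
    define z' where "z' = lm r (adj_mat Q) z"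
    define \<tau> where "\<tau> = det P' * det Q * t"
    have \<tau>: "\<not> E' dvd \<tau>" unfolding \<tau>_def by (intro E_prod PQ(3,4) z(3))
    have "lm r D z' = ?v (%i. (s i * cf z' i) * E' ^ m i)"
      by (rule fvec_eqI) (auto simp: Di ms(1) mult_ac, simp add: lm_def)
    then have "?f (?v (%i. (s i * cf z' i) * E' ^ m i)) = (det P' * det Q) *: lm r A z"
      using PDQ[of z'] lm_adj(1)[OF PQ(2) z(2)] by (simp add: z'_def linD(2)[OF lin_lm] smul_simps)
    moreover have "X = fr ((det P' * det Q) *: lm r A z) (\<tau> * E' ^ c)"
      unfolding z(1)
      by (rule fr_eq[THEN iffD2, OF lm_VV _ nonzero_mult[OF E_nonzero[OF z(3)] E_power_neq_0] nonzero_mult[OF E_nonzero[OF \<tau>] E_power_neq_0]])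
        (simp_all add: submod_smul \<tau>_def smul_simps mult_ac)
    ultimately have "X = finsum V (%i. (sfrac T (s i * cf z' i) \<tau> \<otimes>\<^bsub>K\<^esub> (sfrac T E' 1 [^]\<^bsub>K\<^esub> (- a i))) \<odot>\<^bsub>V\<^esub> b i) {..<r}"
      using tsum[of "%i. sfrac T (s i * cf z' i) \<tau>" "%i. s i * cf z' i" \<tau>] E_nonzero[OF \<tau>] by simp
    moreover have "(%i. sfrac T (s i * cf z' i) \<tau>) \<in> {..<r} \<rightarrow> OE" using \<tau> by blast
    ultimately show "X \<in> ?R" by (intro CollectI exI conjI)
  next
    fix X assume "X \<in> ?R"
    then obtain C where C: "X = finsum V (%i. (C i \<otimes>\<^bsub>K\<^esub> (sfrac T E' 1 [^]\<^bsub>K\<^esub> (- a i))) \<odot>\<^bsub>V\<^esub> b i) {..<r}" "C \<in> {..<r} \<rightarrow> OE" by blast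
    obtain n \<tau> where n: "\<not> E' dvd \<tau>" "!!i. i < r ==> C i = sfrac T (n i) \<tau>" by (rule OE_common[of r C, OF Pi_mem[OF C(2)]]) auto
    have X1: "X = fr (?f (?v (%i. n i * E' ^ m i))) (\<tau> * E' ^ c)"
      by ((rule trans[OF C(1)], rule tsum, erule n(2), rule E_nonzero[OF n(1)])
        | (use C(1) tsum[of C n \<tau>] n(2) E_nonzero[OF n(1)] in simp))
    \<comment> \<open>The coordinates would have to be divided by the units \<open>s i\<close>.
      Instead the whole vector is multiplied by their product, with the factor s i omitted in
      coordinate i.\<close>
    define S where "S = (\<Prod>i<r. s i)"
    define z' where "z' = ?v (%i. n i * (\<Prod>j\<in>{..<r} - {i}. s j))"
    have "lm r D z' = S *: ?v (%i. n i * E' ^ m i)"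
    proof (rule fvec_eqI)
      fix i
      show "cf (lm r D z') i = cf (S *: ?v (%i. n i * E' ^ m i)) i"
      proof (cases "i < r")
        case True
        then have "S = s i * (\<Prod>j\<in>{..<r} - {i}. s j)" unfolding S_def by (intro prod.remove) auto
        then show ?thesis using True by (simp add: Di ms(1) z'_def mult_ac)
      qed (simp add: lm_def)
    qed
    then have "S *: ?f (?v (%i. n i * E' ^ m i)) = lm r A (det P' *: lm r Q z')"
      using PDQ[of z'] by (simp add: linD(2)[OF lin_lm])
    moreover have S: "\<not> E' dvd S" unfolding S_def by (rule sP) simp
    moreover have "X = fr (S *: ?f (?v (%i. n i * E' ^ m i))) ((S * \<tau>) * E' ^ c)"
      unfolding X1
      by (rule fr_eq[THEN iffD2, OF lm_VV _ nonzero_mult[OF E_nonzero[OF n(1)] E_power_neq_0]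
            nonzero_mult[OF E_nonzero[OF E_prod[OF S n(1)]] E_power_neq_0]])
        (simp_all add: submod_smul smul_simps mult_ac)
    ultimately have "X = fr (lm r A (det P' *: lm r Q z')) ((S * \<tau>) * E' ^ c)" by simp
    moreover have "\<not> E' dvd S * \<tau>" "det P' *: lm r Q z' \<in> VV r" using E_prod[OF S n(1)] by (simp_all add: submod_smul)
    ultimately show "X \<in> {fr (lm r A z) (t * E' ^ c) | z t. z \<in> VV r \<and> \<not> E' dvd t}" by blast
  qed
  moreover have "int (c * r) - int v = (\<Sum>i<r. a i)" using mv by (simp add: a_def sum_subtractf flip: of_nat_sum)
  ultimately show ?thesis using basis by blast
qed

end

context kisin
begin

text \<open>Each of the two inclusions between \<open>PE\<close> and the lattice spanned by the
  E^(-a i) b i becomes a matrix identity over \<SS>. The orders of \<open>E'\<close> in the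
  determinants give two opposite inequalities.\<close>

lemma degree_unique:
  assumes basis: "module_basis (K\<lparr>carrier := OE\<rparr>) (V\<lparr>carrier := ME\<rparr>) r' b"
    and PE: "PE = {finsum V (%i. (C i \<otimes>\<^bsub>K\<^esub> (sfrac T E' 1 [^]\<^bsub>K\<^esub> (- a i))) \<odot>\<^bsub>V\<^esub> b i) {..<r'} | C. C \<in> {..<r'} \<rightarrow> OE}"
  shows "(\<Sum>i<r'. a i) = int (c * r) - int v"
proof -
  have bM: "b i \<in> ME" if "i < r'" for i using basis that by (auto simp: module_basis_def)
  have "\<exists>t. \<not> E' dvd t \<and> (\<forall>i<r'. \<exists>x\<in>VV r. b i = fr x t)"
  proof (rule common_den)
    show "\<exists>t. \<not> E' dvd t \<and> (\<exists>x\<in>VV r. b i = fr x t)" if "i < r'" for i using bM[OF that] unfolding ME_eq by blast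
    fix i s t assume h: "\<exists>x\<in>VV r. b i = fr x t" "\<not> E' dvd s"
    then obtain x where x: "x \<in> VV r" "b i = fr x t" by blast
    show "\<exists>x\<in>VV r. b i = fr x (t * s)"
    proof (cases "t = 0")
      case False
      have "s ~= 0" using h(2) by auto
      then have "fr x t = fr (s *: x) (t * s)" using x(1) False by (subst fr_eq) (simp_all add: submod_smul nonzero_mult smul_simps)
      then show ?thesis using x by (metis submod_VV submod_smul)
    qed (use h in auto)
  qed
  then obtain \<tau>0 where t0: "\<not> E' dvd \<tau>0" "\<forall>i<r'. \<exists>x\<in>VV r. b i = fr x \<tau>0" by blast
  then have "\<forall>i. \<exists>x. i < r' --> x \<in> VV r \<and> b i = fr x \<tau>0" by blast
  then obtain \<beta> where \<beta>: "!!i. i < r' ==> \<beta> i \<in> VV r" "!!i. i < r' ==> b i = fr (\<beta> i) \<tau>0" by metis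
  have t0nz: "\<tau>0 ~= 0" using t0 by auto
  have cb: "sfrac T n \<tau> \<odot>\<^bsub>V\<^esub> b i = fr (n *: \<beta> i) (\<tau> * \<tau>0)" if "i < r'" "\<tau> ~= 0" for n \<tau> i
    unfolding \<beta>(2)[OF that(1)] by (rule fr_smul[OF \<beta>(1)[OF that(1)] t0nz that(2)])
  have sV: "(\<Sum>i<r'. n i *: \<beta> i) \<in> VV r" for n using \<beta>(1) by (auto simp: VV_def)
  have fsum: "finsum (V\<lparr>carrier := ME\<rparr>) (%i. C i \<odot>\<^bsub>V\<^esub> b i) {..<r'} = fr (\<Sum>i<r'. n i *: \<beta> i) (\<tau> * \<tau>0)"
    if C: "!!i. i < r' ==> C i = sfrac T (n i) \<tau>" and \<tau>: "\<not> E' dvd \<tau>" for C n \<tau>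
    by (rule V_sum_ME) (use C \<tau> E_nonzero[OF \<tau>] cb \<beta>(1) E_prod[OF \<tau> t0(1)] in \<open>simp_all add: submod_smul\<close>)
  have rep: "\<exists>C. C \<in> {..<r'} \<rightarrow>\<^sub>E OE \<and> X = finsum (V\<lparr>carrier := ME\<rparr>) (%i. C i \<odot>\<^bsub>V\<^esub> b i) {..<r'}" if "X \<in> ME" for X
  proof -
    have "\<exists>!C. C \<in> {..<r'} \<rightarrow>\<^sub>E OE \<and> X = finsum (V\<lparr>carrier := ME\<rparr>) (%i. C i \<odot>\<^bsub>V\<^esub> b i) {..<r'}"
      using basis that unfolding module_basis_def by simp
    then show ?thesis by (rule ex1_implies_ex)
  qed
  have uni: "C = C'" if "C \<in> {..<r'} \<rightarrow>\<^sub>E OE" "C' \<in> {..<r'} \<rightarrow>\<^sub>E OE" "X \<in> ME"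
    "X = finsum (V\<lparr>carrier := ME\<rparr>) (%i. C i \<odot>\<^bsub>V\<^esub> b i) {..<r'}" "X = finsum (V\<lparr>carrier := ME\<rparr>) (%i. C' i \<odot>\<^bsub>V\<^esub> b i) {..<r'}" for C C' X
  proof -
    have "\<exists>!C. C \<in> {..<r'} \<rightarrow>\<^sub>E OE \<and> X = finsum (V\<lparr>carrier := ME\<rparr>) (%i. C i \<odot>\<^bsub>V\<^esub> b i) {..<r'}"
      using basis that(3) unfolding module_basis_def by simp
    then show ?thesis using that(1,2,4,5) by blast
  qed
  have indep: "x l = y l" if eq: "(\<Sum>i<r'. x i *: \<beta> i) = (\<Sum>i<r'. y i *: \<beta> i)" and l: "l < r'" for x y l
  proof -
    let ?X = "fr (\<Sum>i<r'. x i *: \<beta> i) (1 * \<tau>0)" and ?C = "%x. restrict (%i. sfrac T (x i) 1) {..<r'}"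
    have "?X \<in> ME" unfolding ME_eq using sV t0(1) by auto
    moreover have "?X = finsum (V\<lparr>carrier := ME\<rparr>) (%i. ?C x i \<odot>\<^bsub>V\<^esub> b i) {..<r'}"
      by (rule fsum[symmetric]) (use E_not_unit in auto)
    moreover have "?X = finsum (V\<lparr>carrier := ME\<rparr>) (%i. ?C y i \<odot>\<^bsub>V\<^esub> b i) {..<r'}"
      unfolding eq by (rule fsum[symmetric]) (use E_not_unit in auto)
    moreover have "?C x \<in> {..<r'} \<rightarrow>\<^sub>E OE" "?C y \<in> {..<r'} \<rightarrow>\<^sub>E OE" using E_not_unit by auto
    ultimately have "?C x = ?C y" by (intro uni)
    then have "?C x l = ?C y l" by (rule fun_cong)
    then have "sfrac T (x l) 1 = sfrac T (y l) 1" using l by simp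
    then show ?thesis by (subst (asm) sfrac_T) auto
  qed
  let ?e = "%j. fv (%k. if k = j then 1 else 0) :: 'w fps fvec"
  have eV: "?e j \<in> VV r" if "j < r" for j using that by (auto simp: VV_def)
  have "\<exists>\<sigma>'. \<not> E' dvd \<sigma>' \<and> (\<forall>j<r. \<exists>n. \<sigma>' *: ?e j = (\<Sum>i<r'. n i *: \<beta> i))"
  proof (rule common_den)
    fix j assume j: "j < r"
    have "fr (?e j) 1 \<in> ME" unfolding ME_eq using eV[OF j] E_not_unit by blast
    then obtain C where C: "C \<in> {..<r'} \<rightarrow>\<^sub>E OE" "fr (?e j) 1 = finsum (V\<lparr>carrier := ME\<rparr>) (%i. C i \<odot>\<^bsub>V\<^esub> b i) {..<r'}" using rep by blast
    obtain n t where n: "\<not> E' dvd t" "!!i. i < r' ==> C i = sfrac T (n i) t" by (rule OE_common[of r' C, OF PiE_mem[OF C(1)]]) auto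
    have "t * \<tau>0 ~= 0" using E_nonzero[OF n(1)] t0nz by (rule nonzero_mult)
    then have "(t * \<tau>0) *: ?e j = 1 *: (\<Sum>i<r'. n i *: \<beta> i)"
      using C(2) fsum[OF n(2,1)] fr_eq[OF eV[OF j] sV, of 1 "t * \<tau>0"] by simp
    then show "\<exists>\<sigma>'. \<not> E' dvd \<sigma>' \<and> (\<exists>n. \<sigma>' *: ?e j = (\<Sum>i<r'. n i *: \<beta> i))"
      using E_prod[OF n(1) t0(1)] by (intro exI[of _ "t * \<tau>0"]) (auto simp: smul_simps)
  next
    fix j s t assume "\<exists>n. t *: ?e j = (\<Sum>i<r'. n i *: \<beta> i)"
    then obtain n where n: "t *: ?e j = (\<Sum>i<r'. n i *: \<beta> i)" by blast
    have "(t * s) *: ?e j = s *: (t *: ?e j)" by (simp add: smul_simps mult.commute)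
    also have "\<dots> = (\<Sum>i<r'. (s * n i) *: \<beta> i)" unfolding n lin_sum[OF lin_smul] by (simp add: smul_simps)
    finally show "\<exists>n. (t * s) *: ?e j = (\<Sum>i<r'. n i *: \<beta> i)" by (intro exI[of _ "%i. s * n i"])
  qed
  then obtain \<sigma>' where sg: "\<not> E' dvd \<sigma>'" "\<forall>j. \<exists>n. j < r --> \<sigma>' *: ?e j = (\<Sum>i<r'. n i *: \<beta> i)" by blast
  then obtain N where N: "!!j. j < r ==> \<sigma>' *: ?e j = (\<Sum>i<r'. N j i *: \<beta> i)" by metis
  have Nk: "(\<Sum>i<r'. cf (\<beta> i) k * N j i) = (if k = j then \<sigma>' else 0)" if "j < r" for k j
    using arg_cong[OF N[OF that], of "%x. cf x k"] by (simp add: mult.commute split: if_splits)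
  \<comment> \<open>The coordinate matrices of the two bases are inverse to each other up to the
    factor \<sigma>', in either order, which forces r' = r.\<close>
  have "r \<le> r'"
    by (rule mat_right_inverse_le[where n = r and m = r' and B = "%k i. cf (\<beta> i) k" and C = "%i j. N j i" and s = \<sigma>']) (use Nk E_nonzero[OF E_pow[OF sg(1)]] in auto)
  moreover have "r' \<le> r"
  proof (rule mat_right_inverse_le[where n = r' and m = r and B = "%l j. N j l" and C = "%j i. cf (\<beta> i) j" and s = \<sigma>'])
    fix l i assume li: "l < r'" "i < r'"
    have be: "\<beta> i = (\<Sum>j<r. cf (\<beta> i) j *: ?e j)"
    proof (rule fvec_eqI)
      fix k
      have "(\<Sum>j<r. cf (\<beta> i) j * (if k = j then 1 else 0)) = (\<Sum>j<r. if j = k then cf (\<beta> i) k else 0)" by (intro sum.cong) auto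
      then show "cf (\<beta> i) k = cf (\<Sum>j<r. cf (\<beta> i) j *: ?e j) k" using \<beta>(1)[OF li(2)] by (auto simp: VV_def)
    qed
    have "\<sigma>' *: \<beta> i = (\<Sum>j<r. cf (\<beta> i) j *: (\<sigma>' *: ?e j))"
      by (subst be) (simp add: lin_sum[OF lin_smul] smul_simps mult.commute)
    also have "\<dots> = (\<Sum>j<r. \<Sum>l<r'. (N j l * cf (\<beta> i) j) *: \<beta> l)"
      by (rule sum.cong) (simp_all add: N lin_sum[OF lin_smul] smul_simps mult.commute)
    also have "\<dots> = (\<Sum>l<r'. \<Sum>j<r. (N j l * cf (\<beta> i) j) *: \<beta> l)" by (rule sum.swap)
    also have "\<dots> = (\<Sum>l<r'. (\<Sum>j<r. N j l * cf (\<beta> i) j) *: \<beta> l)"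
      by (rule sum.cong[OF refl], rule fvec_eqI) (simp add: sum_distrib_right)
    finally have "\<sigma>' *: \<beta> i = (\<Sum>l<r'. (\<Sum>j<r. N j l * cf (\<beta> i) j) *: \<beta> l)" .
    moreover have "\<sigma>' *: \<beta> i = (\<Sum>l<r'. (if l = i then \<sigma>' else 0) *: \<beta> l)"
    proof -
      have "(\<Sum>l<r'. (if l = i then \<sigma>' else 0) *: \<beta> l) = (\<Sum>l<r'. if l = i then \<sigma>' *: \<beta> i else 0)"
        by (rule sum.cong) (auto simp: smul_simps)
      then show ?thesis using li(2) by simp
    qed
    ultimately have e2: "(\<Sum>l<r'. (\<Sum>j<r. N j l * cf (\<beta> i) j) *: \<beta> l) = (\<Sum>l<r'. (if l = i then \<sigma>' else 0) *: \<beta> l)" by simp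
    show "(\<Sum>j<r. N j l * cf (\<beta> i) j) = (if l = i then \<sigma>' else 0)" using indep[OF e2 li(1)] .
  qed (use E_nonzero[OF E_pow[OF sg(1)]] in auto)
  ultimately have rr: "r' = r" by simp
  define B where "B = mat r r (%(k, i). cf (\<beta> i) k)"
  have B: "B \<in> carrier_mat r r" by (simp add: B_def)
  have detB: "\<not> E' dvd det B"
  proof
    let ?N = "mat r r (%(i, j). N j i)"
    assume d: "E' dvd det B"
    have "B * ?N = \<sigma>' \<cdot>\<^sub>m 1\<^sub>m r"
    proof (rule eq_matI)
      fix k j assume "k < dim_row (\<sigma>' \<cdot>\<^sub>m 1\<^sub>m r :: 'w fps mat)" "j < dim_col (\<sigma>' \<cdot>\<^sub>m 1\<^sub>m r :: 'w fps mat)"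
      then have kj: "k < r" "j < r" by auto
      have "(B * ?N) $$ (k, j) = (\<Sum>i<r. B $$ (k, i) * ?N $$ (i, j))" by (rule index_mult_sum[of _ r r _ r]) (use B kj in auto)
      also have "\<dots> = (\<Sum>i<r'. cf (\<beta> i) k * N j i)" using kj rr by (intro sum.cong) (auto simp: B_def)
      finally show "(B * ?N) $$ (k, j) = (\<sigma>' \<cdot>\<^sub>m 1\<^sub>m r) $$ (k, j)" using Nk[OF kj(2)] kj by simp
    qed (use B in auto)
    moreover have "det (B * ?N) = det B * det ?N" by (rule det_mult[OF B]) simp
    ultimately have "\<sigma>' ^ r = det B * det ?N" by simp
    then show False using d E_pow[OF sg(1), of r] by simp
  qed
  \<comment> \<open>A common shift that makes all exponents N0 - a i natural numbers.\<close>
  define N0 where "N0 = (\<Sum>i<r. nat (a i))"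
  define nn where "nn i = nat (int N0 - a i)" for i
  have nn: "- a i = int (nn i) - int N0" if "i < r" for i
  proof -
    have "nat (a i) \<le> N0" unfolding N0_def using that by (intro member_le_sum) auto
    then show ?thesis by (simp add: nn_def)
  qed
  have sumnn: "int (\<Sum>i<r. nn i) = int (r * N0) - (\<Sum>i<r. a i)"
  proof -
    have "int (\<Sum>i<r. nn i) = (\<Sum>i<r. int N0 - a i)" unfolding of_nat_sum by (rule sum.cong) (use nn in fastforce)+
    then show ?thesis by (simp add: sum_subtractf)
  qed
  have tsum: "finsum V (%i. (C i \<otimes>\<^bsub>K\<^esub> (sfrac T E' 1 [^]\<^bsub>K\<^esub> (- a i))) \<odot>\<^bsub>V\<^esub> b i) {..<r}
      = fr (\<Sum>i<r. (x i * E' ^ nn i) *: \<beta> i) (\<tau> * E' ^ N0 * \<tau>0)"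
    if C: "!!i. i < r ==> C i = sfrac T (x i) \<tau>" and \<tau>: "\<tau> ~= 0" for C x \<tau>
  proof -
    have nz: "\<tau> * E' ^ N0 ~= 0" using \<tau> E_power_neq_0 by (rule nonzero_mult)
    have "(C i \<otimes>\<^bsub>K\<^esub> (sfrac T E' 1 [^]\<^bsub>K\<^esub> (- a i))) \<odot>\<^bsub>V\<^esub> b i = fr ((x i * E' ^ nn i) *: \<beta> i) (\<tau> * E' ^ N0 * \<tau>0)" if "i < r" for i
      using that C cb[of i] rr by (simp only: nn K_power K_mult[OF \<tau> E_power_neq_0] nz simp_thms)
    then show ?thesis using nonzero_mult[OF nz t0nz] \<beta>(1) rr by (intro V_sum_top) (simp_all add: submod_smul)
  qed
  have sV': "(\<Sum>i<r. n i *: \<beta> i) \<in> VV r" for n using sV rr by simp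
  have "\<exists>t. \<not> E' dvd t \<and> (\<forall>i<r. \<exists>z. (t * E' ^ c * E' ^ nn i) *: \<beta> i = (E' ^ N0 * \<tau>0) *: lm r A z)"
  proof (rule common_den)
    fix i assume i: "i < r"
    let ?C = "%j. sfrac T (if j = i then 1 else 0) 1"
    have "?C \<in> {..<r} \<rightarrow> OE" using E_not_unit by blast
    then have "finsum V (%i. (?C i \<otimes>\<^bsub>K\<^esub> (sfrac T E' 1 [^]\<^bsub>K\<^esub> (- a i))) \<odot>\<^bsub>V\<^esub> b i) {..<r} \<in> PE"
      unfolding PE rr by (intro CollectI exI[of _ ?C] conjI refl)
    moreover have "finsum V (%i. (?C i \<otimes>\<^bsub>K\<^esub> (sfrac T E' 1 [^]\<^bsub>K\<^esub> (- a i))) \<odot>\<^bsub>V\<^esub> b i) {..<r}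
        = fr (\<Sum>j<r. ((if j = i then 1 else 0) * E' ^ nn j) *: \<beta> j) (1 * E' ^ N0 * \<tau>0)" by (rule tsum) simp_all
    moreover have "(\<Sum>j<r. ((if j = i then 1 else 0) * E' ^ nn j) *: \<beta> j) = (\<Sum>j<r. if j = i then E' ^ nn i *: \<beta> i else 0)"
      by (rule sum.cong) (auto simp: smul_simps)
    ultimately have "fr (E' ^ nn i *: \<beta> i) (E' ^ N0 * \<tau>0) \<in> PE" using i by simp
    then obtain z t where z: "fr (E' ^ nn i *: \<beta> i) (E' ^ N0 * \<tau>0) = fr (lm r A z) (t * E' ^ c)" "\<not> E' dvd t" unfolding PE_eq by blast
    have "(t * E' ^ c) *: (E' ^ nn i *: \<beta> i) = (E' ^ N0 * \<tau>0) *: lm r A z"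
      using z E_nonzero[OF z(2)] \<beta>(1)[of i] i rr t0nz
      by (subst (asm) fr_eq) (simp_all add: nonzero_mult E_power_neq_0 submod_smul)
    then show "\<exists>t. \<not> E' dvd t \<and> (\<exists>z. (t * E' ^ c * E' ^ nn i) *: \<beta> i = (E' ^ N0 * \<tau>0) *: lm r A z)"
      using z(2) by (auto simp: smul_simps)
  next
    fix i s t assume "\<exists>z. (t * E' ^ c * E' ^ nn i) *: \<beta> i = (E' ^ N0 * \<tau>0) *: lm r A z"
    then obtain z where z: "(t * E' ^ c * E' ^ nn i) *: \<beta> i = (E' ^ N0 * \<tau>0) *: lm r A z" by blast
    have "(t * s * E' ^ c * E' ^ nn i) *: \<beta> i = s *: ((t * E' ^ c * E' ^ nn i) *: \<beta> i)" by (simp add: smul_simps mult_ac)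
    also have "\<dots> = (E' ^ N0 * \<tau>0) *: lm r A (s *: z)" unfolding z by (simp add: linD(2)[OF lin_lm] smul_simps mult_ac)
    finally show "\<exists>z. (t * s * E' ^ c * E' ^ nn i) *: \<beta> i = (E' ^ N0 * \<tau>0) *: lm r A z" by blast
  qed
  then obtain t where t: "\<not> E' dvd t" "\<forall>i. \<exists>z. i < r --> (t * E' ^ c * E' ^ nn i) *: \<beta> i = (E' ^ N0 * \<tau>0) *: lm r A z" by blast
  then obtain z where z: "!!i. i < r ==> (t * E' ^ c * E' ^ nn i) *: \<beta> i = (E' ^ N0 * \<tau>0) *: lm r A (z i)" by metis
  \<comment> \<open>The vectors E^(-a i) b i lie in \<open>PE\<close>, hence are combinations of the
    columns of A/E^c with denominators prime to E.\<close>
  have le1: "N0 * r + v \<le> c * r + (\<Sum>i<r. nn i)"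
  proof (rule E_order_le)
    let ?D = "mat r r (%(i, j). if i = j then t * E' ^ c * E' ^ nn i else 0)" and ?Z = "mat r r (%(l, i). cf (z i) l)"
    have eq: "B * ?D = (E' ^ N0 * \<tau>0) \<cdot>\<^sub>m (A * ?Z)"
    proof (rule eq_matI)
      fix k i assume "k < dim_row ((E' ^ N0 * \<tau>0) \<cdot>\<^sub>m (A * ?Z))" "i < dim_col ((E' ^ N0 * \<tau>0) \<cdot>\<^sub>m (A * ?Z))"
      then have ki: "k < r" "i < r" using A by auto
      have "(B * ?D) $$ (k, i) = cf (\<beta> i) k * (t * E' ^ c * E' ^ nn i)" using mult_diag_mat[OF B ki] ki by (simp add: B_def)
      also have "\<dots> = (E' ^ N0 * \<tau>0) * cf (lm r A (z i)) k"
        using arg_cong[OF z[OF ki(2)], of "%x. cf x k"] by (simp add: mult.commute)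
      also have "cf (lm r A (z i)) k = (A * ?Z) $$ (k, i)"
        using ki by (subst index_mult_sum[of A r r ?Z r]) (use A in \<open>auto simp: lm_def intro!: sum.cong\<close>)
      finally show "(B * ?D) $$ (k, i) = ((E' ^ N0 * \<tau>0) \<cdot>\<^sub>m (A * ?Z)) $$ (k, i)" using ki A by simp
    qed (use A B in auto)
    have 1: "det (B * ?D) = det B * det ?D" by (rule det_mult[OF B]) simp
    have 2: "det (A * ?Z) = det A * det ?Z" by (rule det_mult[OF A]) simp
    have 3: "det ((E' ^ N0 * \<tau>0) \<cdot>\<^sub>m (A * ?Z)) = (E' ^ N0 * \<tau>0) ^ r * det (A * ?Z)" unfolding det_smult by simp
    have "det B * det ?D = (E' ^ N0 * \<tau>0) ^ r * (det A * det ?Z)"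
      unfolding 1[symmetric] 2[symmetric] 3[symmetric] by (rule arg_cong[OF eq])
    then show "E' ^ (c * r + (\<Sum>i<r. nn i)) * (det B * t ^ r) = E' ^ (N0 * r + v) * (\<tau>0 ^ r * w * det ?Z)"
      by (simp add: det_diag_mat det_A prod.distrib power_sum power_add power_mult power_mult_distrib mult_ac)
    show "\<not> E' dvd det B * t ^ r" by (rule E_prod[OF detB E_pow[OF t(1)]])
  qed
  have "\<exists>\<tau>. \<not> E' dvd \<tau> \<and> (\<forall>j<r. \<exists>x. (\<tau> * E' ^ N0 * \<tau>0) *: lm r A (?e j) = E' ^ c *: (\<Sum>i<r. (x i * E' ^ nn i) *: \<beta> i))"
  proof (rule common_den)
    fix j assume j: "j < r"
    have "fr (lm r A (?e j)) (1 * E' ^ c) \<in> PE" unfolding PE_eq using eV[OF j] E_not_unit by blast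
    then obtain C where C: "fr (lm r A (?e j)) (1 * E' ^ c) = finsum V (%i. (C i \<otimes>\<^bsub>K\<^esub> (sfrac T E' 1 [^]\<^bsub>K\<^esub> (- a i))) \<odot>\<^bsub>V\<^esub> b i) {..<r}"
      "C \<in> {..<r} \<rightarrow> OE" unfolding PE rr by blast
    obtain x \<tau> where x: "\<not> E' dvd \<tau>" "!!i. i < r ==> C i = sfrac T (x i) \<tau>" by (rule OE_common[of r C, OF Pi_mem[OF C(2)]]) auto
    have "fr (lm r A (?e j)) (E' ^ c) = fr (\<Sum>i<r. (x i * E' ^ nn i) *: \<beta> i) (\<tau> * E' ^ N0 * \<tau>0)"
      using C(1) tsum[OF x(2) E_nonzero[OF x(1)]] by simp
    then have "(\<tau> * E' ^ N0 * \<tau>0) *: lm r A (?e j) = E' ^ c *: (\<Sum>i<r. (x i * E' ^ nn i) *: \<beta> i)"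
      using E_nonzero[OF x(1)] t0nz sV' by (subst (asm) fr_eq) (simp_all add: nonzero_mult E_power_neq_0)
    then show "\<exists>\<tau>. \<not> E' dvd \<tau> \<and> (\<exists>x. (\<tau> * E' ^ N0 * \<tau>0) *: lm r A (?e j) = E' ^ c *: (\<Sum>i<r. (x i * E' ^ nn i) *: \<beta> i))"
      using x(1) by blast
  next
    fix j s \<tau> assume "\<exists>x. (\<tau> * E' ^ N0 * \<tau>0) *: lm r A (?e j) = E' ^ c *: (\<Sum>i<r. (x i * E' ^ nn i) *: \<beta> i)"
    then obtain x where x: "(\<tau> * E' ^ N0 * \<tau>0) *: lm r A (?e j) = E' ^ c *: (\<Sum>i<r. (x i * E' ^ nn i) *: \<beta> i)" by blast
    have "(\<tau> * s * E' ^ N0 * \<tau>0) *: lm r A (?e j) = s *: ((\<tau> * E' ^ N0 * \<tau>0) *: lm r A (?e j))" by (simp add: smul_simps mult_ac)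
    also have "\<dots> = E' ^ c *: (s *: (\<Sum>i<r. (x i * E' ^ nn i) *: \<beta> i))" unfolding x by (simp add: smul_simps mult_ac)
    also have "s *: (\<Sum>i<r. (x i * E' ^ nn i) *: \<beta> i) = (\<Sum>i<r. (s * x i * E' ^ nn i) *: \<beta> i)"
      unfolding lin_sum[OF lin_smul] by (simp add: smul_simps mult_ac)
    finally show "\<exists>x. (\<tau> * s * E' ^ N0 * \<tau>0) *: lm r A (?e j) = E' ^ c *: (\<Sum>i<r. (x i * E' ^ nn i) *: \<beta> i)" by (intro exI[of _ "%i. s * x i"])
  qed
  then obtain \<tau> where \<tau>: "\<not> E' dvd \<tau>" "\<forall>j. \<exists>x. j < r --> (\<tau> * E' ^ N0 * \<tau>0) *: lm r A (?e j) = E' ^ c *: (\<Sum>i<r. (x i * E' ^ nn i) *: \<beta> i)" by blast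
  then obtain x where "\<forall>j. j < r --> (\<tau> * E' ^ N0 * \<tau>0) *: lm r A (?e j) = E' ^ c *: (\<Sum>i<r. (x j i * E' ^ nn i) *: \<beta> i)"
    using choice[OF \<tau>(2)] by (elim exE)
  note x = this[rule_format]
  \<comment> \<open>Conversely, the columns of A/E^c are combinations of the E^(-a i) b i with
    denominators prime to E.\<close>
  have le2: "c * r + (\<Sum>i<r. nn i) \<le> N0 * r + v"
  proof (rule E_order_le)
    let ?D = "mat r r (%(i, j). if i = j then E' ^ nn i else 0)" and ?X = "mat r r (%(i, j). x j i)"
    have BD: "B * ?D \<in> carrier_mat r r" using B by simp
    have eq: "(\<tau> * E' ^ N0 * \<tau>0) \<cdot>\<^sub>m A = E' ^ c \<cdot>\<^sub>m (B * ?D * ?X)"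
    proof (rule eq_matI)
      fix k j assume "k < dim_row (E' ^ c \<cdot>\<^sub>m (B * ?D * ?X))" "j < dim_col (E' ^ c \<cdot>\<^sub>m (B * ?D * ?X))"
      then have kj: "k < r" "j < r" using B by auto
      have "(\<Sum>l<r. A $$ (k, l) * (if l = j then 1 else 0)) = (\<Sum>l<r. if l = j then A $$ (k, j) else 0)" by (rule sum.cong) auto
      then have "cf (lm r A (?e j)) k = A $$ (k, j)" using kj by (simp add: lm_def)
      then have "(\<tau> * E' ^ N0 * \<tau>0) * A $$ (k, j) = E' ^ c * (\<Sum>i<r. (x j i * E' ^ nn i) * cf (\<beta> i) k)"
        using arg_cong[OF x[OF kj(2)], of "%y. cf y k"] by simp
      also have "(\<Sum>i<r. (x j i * E' ^ nn i) * cf (\<beta> i) k) = (B * ?D * ?X) $$ (k, j)"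
      proof (subst index_mult_sum[OF BD _ kj])
        show "(\<Sum>i<r. (x j i * E' ^ nn i) * cf (\<beta> i) k) = (\<Sum>i<r. (B * ?D) $$ (k, i) * ?X $$ (i, j))"
          by (rule sum.cong) (use kj mult_diag_mat[OF B kj(1)] in \<open>simp_all add: B_def mult_ac del: index_mult_mat\<close>)
      qed simp
      finally show "((\<tau> * E' ^ N0 * \<tau>0) \<cdot>\<^sub>m A) $$ (k, j) = (E' ^ c \<cdot>\<^sub>m (B * ?D * ?X)) $$ (k, j)" using kj A B by simp
    qed (use A B in auto)
    have 1: "det (B * ?D * ?X) = det (B * ?D) * det ?X" by (rule det_mult[OF BD]) simp
    have 2: "det (B * ?D) = det B * det ?D" by (rule det_mult[OF B]) simp
    have 3: "det ((\<tau> * E' ^ N0 * \<tau>0) \<cdot>\<^sub>m A) = (\<tau> * E' ^ N0 * \<tau>0) ^ r * det A" unfolding det_smult using A by simp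
    have 4: "det (E' ^ c \<cdot>\<^sub>m (B * ?D * ?X)) = (E' ^ c) ^ r * det (B * ?D * ?X)" unfolding det_smult by simp
    have main: "(\<tau> * E' ^ N0 * \<tau>0) ^ r * det A = (E' ^ c) ^ r * (det B * det ?D * det ?X)"
      unfolding 2[symmetric] 1[symmetric] 3[symmetric] 4[symmetric] by (rule arg_cong[OF eq])
    have d: "det ?D = E' ^ (\<Sum>i<r. nn i)" unfolding det_diag_mat by (rule power_sum[symmetric])
    have "E' ^ (N0 * r + v) * ((\<tau> * \<tau>0) ^ r * w) = (\<tau> * E' ^ N0 * \<tau>0) ^ r * (w * E' ^ v)"
      by (simp only: power_add power_mult power_mult_distrib mult_ac)
    also have "\<dots> = (E' ^ c) ^ r * (det B * E' ^ (\<Sum>i<r. nn i) * det ?X)" using main by (simp only: det_A d)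
    also have "\<dots> = E' ^ (c * r + (\<Sum>i<r. nn i)) * (det B * det ?X)" by (simp only: power_add power_mult mult_ac)
    finally show "E' ^ (N0 * r + v) * ((\<tau> * \<tau>0) ^ r * w) = E' ^ (c * r + (\<Sum>i<r. nn i)) * (det B * det ?X)" .
    show "\<not> E' dvd (\<tau> * \<tau>0) ^ r * w" by (rule E_prod[OF E_pow[OF E_prod[OF \<tau>(1) t0(1)]] w_E])
  qed
  have "N0 * r + v = c * r + (\<Sum>i<r. nn i)" using le1 le2 by simp
  then have "int (N0 * r) + int v = int (c * r) + int (\<Sum>i<r. nn i)" by (metis of_nat_add)
  then show ?thesis using sumnn rr by (simp add: mult.commute)
qed

theorem kisin_degree_eq: "kisin_degree p \<sigma> E Z = int (c * r) - int v"
  unfolding kisin_degree_def Let_def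
proof (rule the_equality)
  show "\<exists>r' b a. module_basis (K\<lparr>carrier := OE\<rparr>) (V\<lparr>carrier := ME\<rparr>) r' b \<and>
    PE = {finsum V (%i. (C i \<otimes>\<^bsub>K\<^esub> (sfrac T E' 1 [^]\<^bsub>K\<^esub> (- a i))) \<odot>\<^bsub>V\<^esub> b i) {..<r'} | C. C \<in> {..<r'} \<rightarrow> OE} \<and>
    int (c * r) - int v = (\<Sum>i<r'. a i)" by (rule degree_exists)
  fix d :: int assume "\<exists>r' b (a :: nat => int). module_basis (K\<lparr>carrier := OE\<rparr>) (V\<lparr>carrier := ME\<rparr>) r' b \<and>
    PE = {finsum V (%i. (C i \<otimes>\<^bsub>K\<^esub> (sfrac T E' 1 [^]\<^bsub>K\<^esub> (- a i))) \<odot>\<^bsub>V\<^esub> b i) {..<r'} | C. C \<in> {..<r'} \<rightarrow> OE} \<and>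
    d = (\<Sum>i<r'. a i)"
  then obtain r' b and a :: "nat => int" where h: "module_basis (K\<lparr>carrier := OE\<rparr>) (V\<lparr>carrier := ME\<rparr>) r' b"
    "PE = {finsum V (%i. (C i \<otimes>\<^bsub>K\<^esub> (sfrac T E' 1 [^]\<^bsub>K\<^esub> (- a i))) \<odot>\<^bsub>V\<^esub> b i) {..<r'} | C. C \<in> {..<r'} \<rightarrow> OE}"
    "d = (\<Sum>i<r'. a i)" by (elim exE conjE)
  show "d = int (c * r) - int v" unfolding h(3) by (rule degree_unique[OF h(1,2)])
qed

end

section \<open>Reductions of Kisin modules\<close>

lemma dvd_diff_mult: "(m :: 'a::comm_ring_1) dvd x - y ==> m dvd x' - y' ==> m dvd x * x' - y * y'"
proof -
  assume "m dvd x - y" "m dvd x' - y'"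
  then have "m dvd x * (x' - y') + (x - y) * y'" by (intro dvd_add dvd_mult dvd_mult2)
  then show ?thesis by (simp add: algebra_simps)
qed

lemma dvd_diff_swap: "(m :: 'a::comm_ring_1) dvd x - y ==> m dvd y - x"
  using dvd_minus_iff[of m "x - y"] by simp

lemma dvd_diff_pow: "(m :: 'a::comm_ring_1) dvd x - y ==> m dvd x ^ j - y ^ j"
  by (induction j) (auto intro: dvd_diff_mult)

lemma (in witt) pV_smulI: "of_nat p ^ n dvd b ==> z \<in> VV r ==> b *: z \<in> pV n r"
  by (simp add: pV_iff submod_smul)

lemma (in witt) lm_pV: "lm r B ` pV n r <= pV n r"
proof -
  have "lm r B ` pV n r = smul (of_nat p ^ n) ` (lm r B ` VV r)" unfolding pV_def by (rule lin_image_smul[OF lin_lm])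
  then show ?thesis unfolding pV_def by (auto intro!: image_mono)
qed

context witt_eisenstein
begin

abbreviation TT :: "'w fps set" where "TT \<equiv> {E' ^ i * u ^ j | i j. True}"

lemma mulset_TT: "mulset TT"
  unfolding mulset_def
proof (intro conjI ballI)
  show "1 \<in> TT" by (rule CollectI, rule exI[of _ 0], rule exI[of _ 0]) simp
  fix s t assume "s \<in> TT" "t \<in> TT"
  then obtain i j k l where st: "s = E' ^ i * u ^ j" "t = E' ^ k * u ^ l" by blast
  then have "s * t = E' ^ (i + k) * u ^ (j + l)" by (simp add: power_add mult_ac)
  then show "s * t \<in> TT" by blast
qed

lemma powers_TT: "powers E' <= TT" "u_powers <= TT"
proof -
  show "powers E' <= TT"
  proof
    fix x assume "x \<in> powers E'"
    then obtain i where "x = E' ^ i * u ^ 0" by (auto simp: powers_def)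
    then show "x \<in> TT" by blast
  qed
  show "u_powers <= TT"
  proof
    fix x :: "'w fps" assume "x \<in> u_powers"
    then obtain i where "x = E' ^ 0 * u ^ i" by (auto simp: powers_def)
    then show "x \<in> TT" by blast
  qed
qed

lemma TT_cancel: assumes "s \<in> TT" "x \<in> VV r" "s *: x \<in> pV n r" shows "x \<in> pV n r"
proof -
  obtain i j where s: "s = E' ^ i * u ^ j" using assms(1) by blast
  have "of_nat p ^ n dvd cf x l" for l
  proof -
    have "of_nat p ^ n dvd E' ^ i * (u ^ j * cf x l)" using assms(3) by (simp add: pV_iff s mult.assoc)
    then show ?thesis by (rule p_dvd_X_mult[OF p_dvd_E_mult])
  qed
  then show ?thesis using assms(2) by (simp add: pV_iff)
qed

text \<open>\<open>E'\<close> and u are regular modulo p^n by \<open>TT_cancel\<close>, so the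
  localization at \<open>T2\<close> embeds in the one that inverts both, and \<open>inv_into\<close>
  finds the right fraction.\<close>

lemma change_loc_frac:
  assumes P: "presents M (pV n r) (VV r) q" and T1: "mulset T1" "T1 <= TT" and T2: "mulset T2" "T2 <= TT"
    and x: "x \<in> VV r" "t \<in> T1" and y: "y \<in> VV r" "s \<in> T2" and e: "s *: x - t *: y \<in> pV n r"
  shows "change_loc RT TT T2 M (fraction T1 M (q x) t) = fraction T2 M (q y) s"
proof -
  have l: "loc_map TT M id (fraction T' M (q z) b) = fraction TT M (q z) b" if "mulset T'" "T' <= TT" "z \<in> VV r" "b \<in> T'" for T' z b
    by (rule loc_map_frac[OF P P subset_refl subset_refl that(1) mulset_TT that(2) _ that(3,4)]) simp
  have inj: "inj_on (loc_map TT M id) (carrier (loc_module RT T2 M))"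
  proof (rule inj_onI)
    fix X Y assume "X \<in> carrier (loc_module RT T2 M)" "Y \<in> carrier (loc_module RT T2 M)" and h: "loc_map TT M id X = loc_map TT M id Y"
    then obtain x1 t1 x2 t2 where xt: "x1 \<in> VV r" "t1 \<in> T2" "X = fraction T2 M (q x1) t1" "x2 \<in> VV r" "t2 \<in> T2" "Y = fraction T2 M (q x2) t2"
      unfolding carrier_loc[OF P] by blast
    have "t1 \<in> TT" "t2 \<in> TT" using xt T2 by blast+
    moreover have "fraction TT M (q x1) t1 = fraction TT M (q x2) t2" using h xt l[OF T2] by simp
    ultimately obtain b where b: "b \<in> TT" "b *: (t2 *: x1 - t1 *: x2) \<in> pV n r"
      using frac_eq[OF P mulset_TT xt(1) _ xt(4)] by blast
    have "t2 *: x1 - t1 *: x2 \<in> VV r" by (intro submod_diff submod_smul submod_VV xt)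
    then have "t2 *: x1 - t1 *: x2 \<in> pV n r" using TT_cancel[OF b(1) _ b(2)] by blast
    then have "\<exists>v\<in>T2. v *: (t2 *: x1 - t1 *: x2) \<in> pV n r" using mulsetD(1)[OF T2(1)] by (metis smul_simps(6))
    then show "X = Y" unfolding xt(3,6) using frac_eq[OF P T2(1) xt(1,2,4,5)] by blast
  qed
  have "t \<in> TT" "s \<in> TT" using x y T1 T2 by blast+
  moreover have "\<exists>v\<in>TT. v *: (s *: x - t *: y) \<in> pV n r" using e
    by (intro bexI[of _ 1] mulsetD(1)[OF mulset_TT]) (simp add: smul_simps(6))
  ultimately have "fraction TT M (q x) t = fraction TT M (q y) s" using frac_eq[OF P mulset_TT x(1) _ y(1)] by blast
  then have "change_loc RT TT T2 M (fraction T1 M (q x) t)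
      = inv_into (carrier (loc_module RT T2 M)) (loc_map TT M id) (loc_map TT M id (fraction T2 M (q y) s))"
    unfolding change_loc_def l[OF T1 x] l[OF T2 y] by simp
  also have "\<dots> = fraction T2 M (q y) s" using inj y unfolding carrier_loc[OF P] by (intro inv_into_f_f) (auto simp: carrier_loc[OF P])
  finally show ?thesis .
qed

text \<open>With y = u^e - E' divisible by p, the power y^k vanishes modulo p^k. Since u^(ek) - y^k
  is divisible by E', and E'^k - (-y)^k by u^e, each of E' and u divides a power of the other modulo
  p^k. The congruence for \<open>g\<close> modulo p will give the order of a determinant.\<close>

lemma E_u_comparison:
  assumes "1 \<le> k"
  obtains g g' where "of_nat p ^ k dvd E' * g - u ^ (e * k)" "of_nat p ^ k dvd E' ^ k - u ^ e * g'" "of_nat p dvd g - u ^ (e * (k - 1))"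
proof -
  obtain w where w: "E' = u ^ e + of_nat p * w" using E_mod_p by blast
  define y where "y = - (of_nat p * w)"
  define g where "g = (\<Sum>i<k. y ^ (k - Suc i) * (u ^ e) ^ i)"
  have "(u ^ e) ^ k - y ^ k = (u ^ e - y) * g" unfolding g_def by (rule power_diff_sumr2)
  also have "u ^ e - y = E'" by (simp add: w y_def)
  finally have "E' * g - u ^ (e * k) = - (y ^ k)" unfolding power_mult[of u e k] by (simp add: algebra_simps)
  moreover have "y ^ k = of_nat p ^ k * (- w) ^ k" by (simp add: y_def flip: power_mult_distrib)
  ultimately have g: "of_nat p ^ k dvd E' * g - u ^ (e * k)" by simp
  define g' where "g' = (\<Sum>i<k. (- y) ^ (k - Suc i) * E' ^ i)"
  have "E' ^ k - (- y) ^ k = (E' - (- y)) * g'" unfolding g'_def by (rule power_diff_sumr2)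
  also have "E' - (- y) = u ^ e" by (simp add: w y_def)
  finally have "E' ^ k - u ^ e * g' = (- y) ^ k" by (simp add: algebra_simps)
  then have g': "of_nat p ^ k dvd E' ^ k - u ^ e * g'" by (simp add: y_def power_mult_distrib)
  have "of_nat p dvd (of_nat p ^ k :: 'w fps)" using assms by (simp add: dvd_power)
  then have "of_nat p dvd E' * g - u ^ (e * k)" using g by (rule dvd_trans)
  then have "of_nat p dvd (E' * g - u ^ (e * k)) - of_nat p * (w * g)" by (rule dvd_diff) simp
  also have "(E' * g - u ^ (e * k)) - of_nat p * (w * g) = u ^ e * g - u ^ (e * k)" by (simp add: w algebra_simps)
  also have "\<dots> = u ^ e * (g - u ^ (e * (k - 1)))"
  proof -
    have "e + e * (k - 1) = e * k" using assms by (cases k) auto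
    then have "u ^ e * u ^ (e * (k - 1)) = (u ^ (e * k) :: 'w fps)" by (simp only: power_add[symmetric])
    then show ?thesis by (simp only: right_diff_distrib)
  qed
  finally have "of_nat p ^ 1 dvd u ^ e * (g - u ^ (e * (k - 1)))" by (simp only: power_one_right)
  then have "of_nat p ^ 1 dvd g - u ^ (e * (k - 1))" by (rule p_dvd_X_mult)
  then have "of_nat p dvd g - u ^ (e * (k - 1))" by (simp only: power_one_right)
  then show thesis using that g g' by blast
qed

lemma rep_change_loc:
  assumes R: "rep (powers E') (E' ^ c) Z (pV n r) (VV r) q a"
    and g: "of_nat p ^ n dvd E' * g - u ^ (e * k)" and g': "of_nat p ^ n dvd E' ^ k - u ^ e * g'"
  shows "rep u_powers (u ^ (e * k * c)) (change_loc_object \<phi> RT (powers E') TT u_powers Z) (pV n r) (VV r) q (%z. g ^ c *: a z)"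
proof -
  note rd = repD[OF R]
  let ?M = "fst Z"
  have PP: "presents (pb ?M) (pV n r) (VV r) (theta ?M q)" using rd(8) by simp
  have aV: "a z \<in> VV r" if "z \<in> VV r" for z using rd(5) that by auto
  have main: "change_loc RT TT u_powers ?M (snd Z (change_loc RT TT (powers E') (pb ?M) (fraction u_powers (pb ?M) (theta ?M q z) t)))
      = fraction u_powers ?M (q (g ^ c *: a z)) (u ^ (e * k * c) * t)"
    if z: "z \<in> VV r" and t: "t \<in> u_powers" for z t
  proof -
    obtain j where j: "t = u ^ j" using t by (auto simp: powers_def)
    \<comment> \<open>A denominator u^j must first become a power of \<open>E'\<close>: u^j h = (u^e
      g')^j, which is E'^(kj) modulo p^n. As e is positive, e j - j is a true difference.\<close>
    define h where "h = u ^ (e * j - j) * g' ^ j"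
    have "j \<le> e * j" using e_pos by simp
    then have uh: "u ^ j * h = (u ^ e * g') ^ j"
      by (simp add: h_def power_mult_distrib power_mult[symmetric] power_add[symmetric] mult.assoc[symmetric])
    have c1: "of_nat p ^ n dvd E' ^ (k * j) - u ^ j * h" unfolding uh power_mult by (rule dvd_diff_pow[OF g'])
    have c2: "of_nat p ^ n dvd (E' * g) ^ c - u ^ (e * k * c)" unfolding power_mult[of u "e * k" c] by (rule dvd_diff_pow[OF g])
    have hz: "h *: z \<in> VV r" using z by (simp add: submod_smul)
    have 1: "change_loc RT TT (powers E') (pb ?M) (fraction u_powers (pb ?M) (theta ?M q z) t)
        = fraction (powers E') (pb ?M) (theta ?M q (h *: z)) (E' ^ (k * j))"
    proof (rule change_loc_frac[OF PP mulset_powers powers_TT(2) mulset_powers powers_TT(1) z t hz power_in_powers(1)])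
      have "(E' ^ (k * j) - u ^ j * h) *: z \<in> pV n r" using c1 z by (rule pV_smulI)
      moreover have "(E' ^ (k * j) - u ^ j * h) *: z = E' ^ (k * j) *: z - t *: h *: z" by (rule fvec_eqI) (simp add: j algebra_simps)
      ultimately show "E' ^ (k * j) *: z - t *: h *: z \<in> pV n r" by simp
    qed
    have 2: "snd Z (fraction (powers E') (pb ?M) (theta ?M q (h *: z)) (E' ^ (k * j)))
        = fraction (powers E') ?M (q (a (h *: z))) (E' ^ c * E' ^ (k * j))"
      by (rule rd(7)) (use hz in simp_all)
    have 3: "change_loc RT TT u_powers ?M (fraction (powers E') ?M (q (a (h *: z))) (E' ^ c * E' ^ (k * j)))
        = fraction u_powers ?M (q (g ^ c *: a z)) (u ^ (e * k * c) * t)"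
    proof (rule change_loc_frac[OF rd(3) mulset_powers powers_TT(1) mulset_powers powers_TT(2) aV[OF hz]])
      show "E' ^ c * E' ^ (k * j) \<in> powers E'" "u ^ (e * k * c) * t \<in> u_powers" using t by (simp_all add: mulsetD(2)[OF mulset_powers])
      show "g ^ c *: a z \<in> VV r" using aV[OF z] by (simp add: submod_smul)
      have "of_nat p ^ n dvd (E' * g) ^ c * E' ^ (k * j) - u ^ (e * k * c) * (u ^ j * h)" using c2 c1 by (rule dvd_diff_mult)
      then have "of_nat p ^ n dvd u ^ (e * k * c) * (u ^ j * h) - (E' * g) ^ c * E' ^ (k * j)" by (rule dvd_diff_swap)
      then have "(u ^ (e * k * c) * (u ^ j * h) - (E' * g) ^ c * E' ^ (k * j)) *: a z \<in> pV n r"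
        by (rule pV_smulI[OF _ aV[OF z]])
      moreover have "(u ^ (e * k * c) * (u ^ j * h) - (E' * g) ^ c * E' ^ (k * j)) *: a z
          = (u ^ (e * k * c) * t) *: a (h *: z) - (E' ^ c * E' ^ (k * j)) *: g ^ c *: a z"
        by (rule fvec_eqI) (simp add: j linD(2)[OF rd(4)] power_mult_distrib algebra_simps)
      ultimately show "(u ^ (e * k * c) * t) *: a (h *: z) - (E' ^ c * E' ^ (k * j)) *: g ^ c *: a z \<in> pV n r" by simp
    qed
    show ?thesis unfolding 1 2 3 ..
  qed
  have "lin (%z. g ^ c *: a z)" by (rule lin_comp[OF lin_smul rd(4)])
  moreover have "(%z. g ^ c *: a z) ` VV r <= VV r" using aV by (auto simp: submod_smul)
  moreover have "(%z. g ^ c *: a z) ` pV n r <= pV n r"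
  proof
    fix x assume "x \<in> (%z. g ^ c *: a z) ` pV n r"
    then obtain z where z: "z \<in> pV n r" "x = g ^ c *: a z" by blast
    have "a z \<in> pV n r" using rd(6) z(1) by auto
    then show "x \<in> pV n r" unfolding z(2) by (rule submod_smul[OF submod_pV])
  qed
  ultimately show ?thesis
    unfolding rep_def change_loc_object_def using rd(3) main by simp
qed

end

section \<open>Limits along divisibility\<close>

lemma pl_lipschitz: "\<bar>pl k \<mu> s x - pl k \<mu> s y\<bar> \<le> (\<Sum>i<k. \<bar>\<mu> i\<bar>) * \<bar>x - y\<bar>"
proof -
  let ?c = "%i z. max 0 (min (z - s i) (s (Suc i) - s i))"
  have c: "\<bar>?c i x - ?c i y\<bar> \<le> \<bar>x - y\<bar>" for i by (auto simp: max_def min_def)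
  have "\<bar>pl k \<mu> s x - pl k \<mu> s y\<bar> = \<bar>\<Sum>i<k. \<mu> i * (?c i x - ?c i y)\<bar>"
    by (simp add: pl_def sum_subtractf right_diff_distrib)
  also have "\<dots> \<le> (\<Sum>i<k. \<bar>\<mu> i * (?c i x - ?c i y)\<bar>)" by (rule sum_abs)
  also have "\<dots> \<le> (\<Sum>i<k. \<bar>\<mu> i\<bar> * \<bar>x - y\<bar>)" by (intro sum_mono) (simp add: abs_mult mult_left_mono c)
  finally show ?thesis by (simp add: sum_distrib_right)
qed

lemma (in hn_lattice) hn_lipschitz: "\<exists>C. \<forall>x y. \<bar>hn x - hn y\<bar> \<le> C * \<bar>x - y\<bar>"
proof -
  obtain k F where "hn = polygon k F" by (rule hn_filt)
  then show ?thesis unfolding polygon_def using pl_lipschitz by metis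
qed

text \<open>Chord slopes of a concave function decrease, so each slope lies between that of a chord
  from 0 and that of a chord to r. There g agrees with h at one end and is below h at the other, so
  the Lipschitz bound of h limits both slopes.\<close>

lemma concave_lipschitz:
  fixes g h :: "real => real"
  assumes g: "concave_on {0..r} g" "g 0 = h 0" "g r = h r" "!!x. x \<in> {0..r} ==> g x \<le> h x"
    and h: "!!x y. \<bar>h x - h y\<bar> \<le> C * \<bar>x - y\<bar>" and x: "x \<in> {0..r}" and y: "y \<in> {0..r}"
  shows "\<bar>g x - g y\<bar> \<le> C * \<bar>x - y\<bar>"
proof -
  have main: "\<bar>g x - g y\<bar> \<le> C * (y - x)" if xy: "0 \<le> x" "x < y" "y \<le> r" for x y
  proof -
    have gy: "g y - g 0 \<le> C * y" using g(2) g(4)[of y] h[of y 0] xy by auto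
    have gx: "g x - g r \<le> C * (r - x)" using g(3) g(4)[of x] h[of x r] xy by auto
    have "(1 - x / y) * g 0 + x / y * g y \<le> g ((1 - x / y) *\<^sub>R 0 + (x / y) *\<^sub>R y)"
      by (rule concave_onD[OF g(1)]) (use xy in auto)
    then have a: "(1 - x / y) * g 0 + x / y * g y \<le> g x" using xy by simp
    have "y * ((1 - x / y) * g 0 + x / y * g y) \<le> y * g x" using a xy by (intro mult_left_mono) auto
    then have "(y - x) * g 0 + x * g y \<le> y * g x" using xy by (simp add: field_simps)
    then have "y * (g y - g x) \<le> (y - x) * (g y - g 0)" by (simp add: algebra_simps)
    also have "\<dots> \<le> (y - x) * (C * y)" using gy xy by (intro mult_left_mono) auto
    finally have "y * (g y - g x) \<le> y * (C * (y - x))" by (simp add: algebra_simps)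
    then have up: "g y - g x \<le> C * (y - x)" using xy by (simp add: mult_le_cancel_left_pos)
    have "(1 - (y - x) / (r - x)) * g x + (y - x) / (r - x) * g r \<le> g ((1 - (y - x) / (r - x)) *\<^sub>R x + ((y - x) / (r - x)) *\<^sub>R r)"
      by (rule concave_onD[OF g(1)]) (use xy in \<open>auto simp: field_simps\<close>)
    moreover have "(1 - (y - x) / (r - x)) *\<^sub>R x + ((y - x) / (r - x)) *\<^sub>R r = y"
    proof -
      define c where "c = (y - x) / (r - x)"
      have "(1 - c) * x + c * r = x + c * (r - x)" by (simp add: algebra_simps)
      moreover have "c * (r - x) = y - x" using xy by (simp add: c_def)
      ultimately have "(1 - (y - x) / (r - x)) * x + (y - x) / (r - x) * r = y" unfolding c_def by simp
      then show ?thesis using xy by simp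
    qed
    ultimately have "(1 - (y - x) / (r - x)) * g x + (y - x) / (r - x) * g r \<le> g y" by simp
    then have "(r - x) * ((1 - (y - x) / (r - x)) * g x + (y - x) / (r - x) * g r) \<le> (r - x) * g y" using xy by (intro mult_left_mono) auto
    moreover have "(r - x) * ((1 - (y - x) / (r - x)) * g x + (y - x) / (r - x) * g r) = (r - y) * g x + (y - x) * g r"
    proof -
      define c where "c = (y - x) / (r - x)"
      have c: "c * (r - x) = y - x" using xy by (simp add: c_def)
      have "(r - x) * ((1 - c) * g x + c * g r) = (r - x) * g x + (c * (r - x)) * (g r - g x)" by (simp add: algebra_simps)
      then show ?thesis unfolding c by (simp add: c_def algebra_simps)
    qed
    ultimately have "(r - x) * (g x - g y) \<le> (y - x) * (g x - g r)" by (simp add: algebra_simps)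
    also have "\<dots> \<le> (y - x) * (C * (r - x))" using gx xy by (intro mult_left_mono) auto
    finally have "(r - x) * (g x - g y) \<le> (r - x) * (C * (y - x))" by (simp add: algebra_simps)
    then have "g x - g y \<le> C * (y - x)" using xy by (simp add: mult_le_cancel_left_pos)
    then show ?thesis using up by linarith
  qed
  consider "x < y" | "x = y" | "y < x" by linarith
  then show ?thesis
  proof cases
    case 1 then show ?thesis using main[of x y] x y by auto
  next
    case 3 then show ?thesis using main[of y x] x y by (auto simp: abs_minus_commute)
  qed simp
qed

theorem divisibility_limit:
  fixes f :: "nat => real => real"
  assumes r: "0 \<le> r" and conc: "!!n. 1 \<le> n ==> concave_on {0..r} (f n)"
    and f0: "!!n. 1 \<le> n ==> f n 0 = 0" and fr: "!!n. 1 \<le> n ==> f n r = d"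
    and mult: "!!n m x. 1 \<le> n ==> 1 \<le> m ==> x \<in> {0..r} ==> f (n * m) x \<le> f n x"
    and lip: "!!x y. \<bar>f 1 x - f 1 y\<bar> \<le> C * \<bar>x - y\<bar>"
  shows "\<exists>t. uniform_limit {0..r} f t divisibility_filter \<and> continuous_on {0..r} t \<and> concave_on {0..r} t \<and>
    (\<forall>x\<in>{0..r}. bdd_below ((%n. f n x) ` {1..}) \<and> t x = (INF n\<in>{1..}. f n x)) \<and> t 0 = 0 \<and> t r = d"
proof -
  have C: "0 \<le> C" using lip[of 0 1] by simp
  have le1: "f n x \<le> f 1 x" if "1 \<le> n" "x \<in> {0..r}" for n x using mult[of 1 n x] that by simp
  have fl: "\<bar>f n x - f n y\<bar> \<le> C * \<bar>x - y\<bar>" if "1 \<le> n" "x \<in> {0..r}" "y \<in> {0..r}" for n x y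
    by (rule concave_lipschitz[where h = "f 1", OF conc[OF that(1)] _ _ _ lip that(2,3)]) (use that f0 fr le1 in auto)
  have low: "- (C * r) \<le> f n x" if "1 \<le> n" "x \<in> {0..r}" for n x
  proof -
    have "\<bar>f n x - f n 0\<bar> \<le> C * \<bar>x - 0\<bar>" using fl[of n x 0] that r by auto
    moreover have "C * \<bar>x - 0\<bar> \<le> C * r" using that C by (intro mult_left_mono) auto
    ultimately show ?thesis using f0[OF that(1)] by linarith
  qed
  have bdd: "bdd_below ((%n. f n x) ` {1..})" if "x \<in> {0..r}" for x
    by (rule bdd_belowI2[of _ "- (C * r)"]) (use low that in auto)
  define t where "t x = (INF n\<in>{1..}. f n x)" for x
  have tle: "t x \<le> f n x" if "1 \<le> n" "x \<in> {0..r}" for n x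
    unfolding t_def by (rule cINF_lower[OF bdd[OF that(2)]]) (use that in auto)
  have tI: "c \<le> t x" if "!!n. 1 \<le> n ==> c \<le> f n x" for c x
    unfolding t_def by (rule cINF_greatest) (use that in auto)
  have t0: "t 0 = 0" "t r = d"
    by (rule antisym; use tle[of 1] tI f0 fr r in force)+
  have tc: "concave_on {0..r} t"
    unfolding concave_on_iff
  proof (intro conjI ballI allI impI)
    fix x y a b :: real assume xy: "x \<in> {0..r}" "y \<in> {0..r}" "0 \<le> a" "0 \<le> b" "a + b = 1"
    show "a * t x + b * t y \<le> t (a *\<^sub>R x + b *\<^sub>R y)"
    proof (rule tI)
      fix n :: nat assume n: "1 \<le> n"
      have "a * t x + b * t y \<le> a * f n x + b * f n y" using tle[OF n] xy by (intro add_mono mult_left_mono) auto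
      also have "\<dots> \<le> f n (a *\<^sub>R x + b *\<^sub>R y)" using conc[OF n] xy unfolding concave_on_iff by blast
      finally show "a * t x + b * t y \<le> f n (a *\<^sub>R x + b *\<^sub>R y)" .
    qed
  qed simp
  have tl: "\<bar>t x - t y\<bar> \<le> C * \<bar>x - y\<bar>" if "x \<in> {0..r}" "y \<in> {0..r}" for x y
    by (rule concave_lipschitz[where h = "f 1", OF tc _ _ _ lip that]) (use t0 f0 fr tle in auto)
  have cont: "continuous_on {0..r} t"
    by (rule lipschitz_on_continuous_on[of C]) (use tl C in \<open>auto intro!: lipschitz_onI simp: dist_real_def\<close>)
  have "uniform_limit {0..r} f t divisibility_filter"
    unfolding uniform_limit_iff
  proof (intro allI impI)
    fix \<epsilon> :: real assume \<epsilon>: "0 < \<epsilon>"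
    \<comment> \<open>Three errors of at most \<epsilon>/4 will add up; C + 1 keeps the quotient
      defined when C is 0.\<close>
    define \<delta> where "\<delta> = \<epsilon> / (4 * (C + 1))"
    have \<delta>: "0 < \<delta>" "C * \<delta> \<le> \<epsilon> / 4" using \<epsilon> C by (auto simp: \<delta>_def field_simps)
    define G where "G = {y \<in> {0..r}. \<exists>i\<le>nat \<lfloor>r / \<delta>\<rfloor>. y = real i * \<delta>}"
    have finG: "finite G" by (rule finite_subset[of _ "(%i. real i * \<delta>) ` {..nat \<lfloor>r / \<delta>\<rfloor>}"]) (auto simp: G_def)
    have net: "\<exists>y\<in>G. \<bar>x - y\<bar> \<le> \<delta>" if x: "x \<in> {0..r}" for x
    proof -
      define i where "i = nat \<lfloor>x / \<delta>\<rfloor>"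
      have x0: "0 \<le> x / \<delta>" using x \<delta> by simp
      then have "real i \<le> x / \<delta>" "x / \<delta> < real i + 1" unfolding i_def by linarith+
      then have ix: "real i * \<delta> \<le> x" "x < real i * \<delta> + \<delta>" using \<delta> by (simp_all add: field_simps)
      have "x / \<delta> \<le> r / \<delta>" using x \<delta> by (simp add: divide_right_mono)
      then have "i \<le> nat \<lfloor>r / \<delta>\<rfloor>" unfolding i_def by (intro nat_mono floor_mono)
      moreover have "real i * \<delta> \<in> {0..r}" using ix x \<delta> by auto
      ultimately have "real i * \<delta> \<in> G" unfolding G_def by blast
      then show ?thesis using ix by (intro bexI[of _ "real i * \<delta>"]) auto
    qed
    have "\<exists>n\<ge>1. f n y < t y + \<epsilon> / 4" if y: "y \<in> {0..r}" for y
    proof (rule ccontr)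
      assume "\<not> ?thesis"
      then have "t y + \<epsilon> / 4 \<le> t y" by (intro tI) (auto simp: not_less)
      then show False using \<epsilon> by simp
    qed
    then obtain nn where nn: "!!y. y \<in> {0..r} ==> 1 \<le> nn y \<and> f (nn y) y < t y + \<epsilon> / 4" by metis
    \<comment> \<open>A multiple of the product is a multiple of every \<open>nn y\<close>, so one
      index serves the whole finite net.\<close>
    define m where "m = (\<Prod>y\<in>G. nn y)"
    have m: "1 \<le> m" unfolding m_def using nn by (intro prod_ge_1) (auto simp: G_def)
    show "\<forall>\<^sub>F n in divisibility_filter. \<forall>x\<in>{0..r}. dist (f n x) (t x) < \<epsilon>"
      unfolding divisibility_filter_def
    proof (rule eventually_INF1[of m])
      show "\<forall>\<^sub>F n in principal {n. 1 \<le> n \<and> m dvd n}. \<forall>x\<in>{0..r}. dist (f n x) (t x) < \<epsilon>"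
        unfolding eventually_principal
      proof (intro ballI)
        fix n x assume n: "n \<in> {n. 1 \<le> n \<and> m dvd n}" and x: "x \<in> {0..r}"
        obtain y where y: "y \<in> G" "\<bar>x - y\<bar> \<le> \<delta>" using net[OF x] by blast
        have yr: "y \<in> {0..r}" using y by (simp add: G_def)
        have "nn y dvd m" unfolding m_def using finG y(1) by (rule dvd_prodI)
        then obtain k where k: "n = nn y * k" using n by (metis dvd_def dvd_trans mem_Collect_eq)
        have "1 \<le> k" using k n by (cases k) auto
        then have "f n y \<le> f (nn y) y" using mult[of "nn y" k y] nn[OF yr] yr k by simp
        then have a: "f n y < t y + \<epsilon> / 4" using nn[OF yr] by linarith
        have n1: "1 \<le> n" using n by simp
        have "C * \<bar>x - y\<bar> \<le> C * \<delta>" using y(2) C by (rule mult_left_mono)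
        then have "\<bar>f n x - f n y\<bar> \<le> \<epsilon> / 4" "\<bar>t x - t y\<bar> \<le> \<epsilon> / 4" using fl[OF n1 x yr] tl[OF x yr] \<delta>(2) by linarith+
        then have "f n x < t x + \<epsilon>" using a \<epsilon> by linarith
        then show "dist (f n x) (t x) < \<epsilon>" using tle[OF n1 x] by (simp add: dist_real_def)
      qed
    qed (use m in simp)
  qed
  then show ?thesis using cont tc bdd t0 by (intro exI[of _ t]) (simp add: t_def)
qed

section \<open>The polygons of a Kisin module\<close>

lemma lm_smult: "A \<in> carrier_mat r r ==> lm r (b \<cdot>\<^sub>m A) x = b *: lm r A x"
  by (rule fvec_eqI) (auto simp: lm_def sum_distrib_left mult.assoc intro!: sum.cong)

context kisin
begin

text \<open>The adjugate turns \<open>A\<close> into multiplication by its determinant, a unit times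
  a power of \<open>E'\<close>, and this is regular modulo p^n.\<close>

lemma A_cancel: assumes x: "x \<in> VV r" "lm r A x \<in> pV n r" shows "x \<in> pV n r"
proof -
  have "lm r (adj_mat A) (lm r A x) \<in> pV n r" using lm_pV x(2) by blast
  then have 1: "(w * E' ^ v) *: x \<in> pV n r" using lm_adj(2)[OF A x(1)] by (simp add: det_A)
  obtain w' where w': "1 = w * w'" using w_unit by (rule dvdE)
  have "w' *: ((w * E' ^ v) *: x) \<in> pV n r" using 1 by (rule submod_smul[OF submod_pV])
  also have "w' *: ((w * E' ^ v) *: x) = (w * w') *: (E' ^ v *: x)" by (rule fvec_eqI) (simp add: mult_ac)
  also have "\<dots> = E' ^ v *: x" by (simp add: w'[symmetric] smul_simps)
  finally have "E' ^ v *: x \<in> pV n r" .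
  moreover have "E' ^ v \<in> TT" by (rule subsetD[OF powers_TT(1) power_in_powers(1)])
  ultimately show ?thesis using TT_cancel x(1) by blast
qed

lemma reduction_axioms_g:
  assumes g: "of_nat p ^ n dvd E' * g - u ^ (e * k)"
  shows "reduction p \<rho> \<sigma> n r (%z. g ^ c *: lm r A z)"
proof (rule reduction.intro[OF witt_axioms reduction_axioms.intro])
  show "lin (%z. g ^ c *: lm r A z)" by (rule lin_comp[OF lin_smul lin_lm])
  show "(%z. g ^ c *: lm r A z) ` VV r <= VV r" by (auto simp: submod_smul)
  have eg: "of_nat p ^ n dvd (E' * g) ^ l - u ^ (e * k * l)" for l
    unfolding power_mult[of u "e * k" l] by (rule dvd_diff_pow[OF g])
  fix x assume x: "x \<in> VV r" "g ^ c *: lm r A x \<in> pV n r"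
  have "E' ^ c *: (g ^ c *: lm r A x) - ((E' * g) ^ c - u ^ (e * k * c)) *: lm r A x \<in> pV n r"
    by (intro submod_diff submod_pV submod_smul x(2) pV_smulI eg lm_VV)
  also have "E' ^ c *: (g ^ c *: lm r A x) - ((E' * g) ^ c - u ^ (e * k * c)) *: lm r A x = u ^ (e * k * c) *: lm r A x"
    by (rule fvec_eqI) (simp add: power_mult_distrib algebra_simps)
  finally have "lm r A x \<in> pV n r" by (rule usat_pow[OF usat_pV lm_VV])
  then show "x \<in> pV n r" using A_cancel x(1) by blast
next
  have eg: "of_nat p ^ n dvd (E' * g) ^ l - u ^ (e * k * l)" for l
    unfolding power_mult[of u "e * k" l] by (rule dvd_diff_pow[OF g])
  obtain w' where w': "1 = w * w'" using w_unit by (rule dvdE)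
  show "\<exists>l. \<forall>x\<in>VV r. \<exists>z\<in>VV r. u ^ l *: x - g ^ c *: lm r A z \<in> pV n r"
  proof (intro exI[of _ "e * k * (c + v)"] ballI)
    fix x :: "'w fps fvec" assume x: "x \<in> VV r"
    \<comment> \<open>Applied to this vector, A adj(A) = w E^v gives g^c A adj(A) ?y = (E g)^(c+v)
      x, which is u^(ek(c+v)) x modulo p^n.\<close>
    let ?y = "(w' * E' ^ c * g ^ v) *: x"
    have "?y \<in> VV r" using x by (simp add: submod_smul)
    then have "g ^ c *: lm r A (lm r (adj_mat A) ?y) = g ^ c *: (w * E' ^ v) *: ?y"
      using lm_adj(1)[OF A, of ?y] by (simp add: det_A)
    also have "\<dots> = (w * w') *: (E' * g) ^ (c + v) *: x"
      by (rule fvec_eqI) (simp add: power_mult_distrib power_add mult_ac)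
    finally have "u ^ (e * k * (c + v)) *: x - g ^ c *: lm r A (lm r (adj_mat A) ?y) = (u ^ (e * k * (c + v)) - (E' * g) ^ (c + v)) *: x"
      using w'[symmetric] by (simp add: smul_simps)
    moreover have "of_nat p ^ n dvd u ^ (e * k * (c + v)) - (E' * g) ^ (c + v)" by (rule dvd_diff_swap[OF eg])
    ultimately have "u ^ (e * k * (c + v)) *: x - g ^ c *: lm r A (lm r (adj_mat A) ?y) \<in> pV n r" using x by (simp add: pV_smulI)
    then show "\<exists>z\<in>VV r. u ^ (e * k * (c + v)) *: x - g ^ c *: lm r A z \<in> pV n r"
      by (intro bexI[of _ "lm r (adj_mat A) ?y"] lm_VV)
  qed
qed

lemma rep_reduction:
  assumes g: "of_nat p ^ n dvd E' * g - u ^ (e * k)" and g': "of_nat p ^ n dvd E' ^ k - u ^ e * g'"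
  shows "rep u_powers (u ^ (e * k * c)) (kisin_reduction p \<sigma> E Z n) (pV n r) (VV r) (%x. q ` pV n r +>\<^bsub>M\<^esub> q x) (%z. g ^ c *: lm r A z)"
proof -
  have im: "(%x. of_nat p ^ n \<odot>\<^bsub>M\<^esub> x) ` carrier M = q ` pV n r"
    unfolding presentsD(4)[OF P] pV_def image_image by (rule image_cong) (simp_all add: presentsD(7)[OF P])
  have "rep (powers E') (E' ^ c) (quot_object \<phi> RT (powers E') Z (q ` pV n r)) (pV n r) (VV r) (%x. q ` pV n r +>\<^bsub>M\<^esub> q x) (lm r A)"
    by (rule rep_quot[OF R submod_pV _ pV_subset]) (simp_all add: submod_0 lm_pV)
  then show ?thesis unfolding kisin_reduction_def Let_def im by (rule rep_change_loc[OF _ g g'])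
qed

lemma kisin_polygon_properties:
  assumes n: "1 \<le> n"
  shows "concave_on {0..real r} (kisin_polygon p \<sigma> E Z n)" "kisin_polygon p \<sigma> E Z n 0 = 0"
    "kisin_polygon p \<sigma> E Z n (real r) = real_of_int (int (c * r) - int v)"
    "\<exists>C. \<forall>x y. \<bar>kisin_polygon p \<sigma> E Z n x - kisin_polygon p \<sigma> E Z n y\<bar> \<le> C * \<bar>x - y\<bar>"
proof -
  obtain g g' where g: "of_nat p ^ n dvd E' * g - u ^ (e * n)" "of_nat p ^ n dvd E' ^ n - u ^ e * g'" and gm: "of_nat p dvd g - u ^ (e * (n - 1))"
    by (rule E_u_comparison[OF n])
  let ?a = "%z. g ^ c *: lm r A z"
  interpret red: reduction p \<rho> \<sigma> n r "e * n * c" ?a by (rule reduction_axioms_g[OF g(1)])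
  have eq: "kisin_polygon p \<sigma> E Z n x = red.hn.hn (real n * x) / real e / real n" for x
    unfolding kisin_polygon_def red.hn_polygon_rep[OF rep_reduction[OF g] e_pos] ..
  have conc: "concave_on {0..real n * real r} red.hn.hn" using red.hn.hn_concave red.rk_top by simp
  show "concave_on {0..real r} (kisin_polygon p \<sigma> E Z n)"
    unfolding concave_on_iff
  proof (intro conjI ballI allI impI)
    fix x y a b :: real assume h: "x \<in> {0..real r}" "y \<in> {0..real r}" "0 \<le> a" "0 \<le> b" "a + b = 1"
    have "real n * x \<in> {0..real n * real r}" "real n * y \<in> {0..real n * real r}" using h by (auto intro: mult_left_mono)
    then have "a * red.hn.hn (real n * x) + b * red.hn.hn (real n * y) \<le> red.hn.hn (a *\<^sub>R (real n * x) + b *\<^sub>R (real n * y))"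
      using conc h(3-5) unfolding concave_on_iff by blast
    also have "a *\<^sub>R (real n * x) + b *\<^sub>R (real n * y) = real n * (a *\<^sub>R x + b *\<^sub>R y)" by (simp add: algebra_simps)
    finally have "(a * red.hn.hn (real n * x) + b * red.hn.hn (real n * y)) / real e / real n
        \<le> red.hn.hn (real n * (a *\<^sub>R x + b *\<^sub>R y)) / real e / real n" by (intro divide_right_mono) auto
    then show "a * kisin_polygon p \<sigma> E Z n x + b * kisin_polygon p \<sigma> E Z n y \<le> kisin_polygon p \<sigma> E Z n (a *\<^sub>R x + b *\<^sub>R y)"
      unfolding eq by (simp add: add_divide_distrib)
  qed simp
  show "kisin_polygon p \<sigma> E Z n 0 = 0" using red.hn.hn_ends(1) by (simp add: eq)
  have dg: "red.dg (VV r) = int n * int e * (int (c * r) - int v)"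
  proof -
    \<comment> \<open>The order in u of det(g^c A) modulo p: there g is u^(e(n-1)) and E is u^e,
      while det A = w E^v. In the degree the terms with n^2 cancel and n e (cr - v) remains.\<close>
    define s where "s = e * (n - 1) * (c * r) + e * v"
    obtain w1 where w1: "E' = u ^ e + of_nat p * w1" using E_mod_p by blast
    have "of_nat p dvd E' ^ v - (u ^ e) ^ v" by (rule dvd_diff_pow) (simp add: w1)
    then have "of_nat p dvd g ^ (c * r) * E' ^ v - (u ^ (e * (n - 1))) ^ (c * r) * (u ^ e) ^ v"
      by (rule dvd_diff_mult[OF dvd_diff_pow[OF gm]])
    then have f1: "of_nat p dvd (g ^ (c * r) * E' ^ v - (u ^ (e * (n - 1))) ^ (c * r) * (u ^ e) ^ v) * w" by (rule dvd_mult2)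
    have f2: "(u ^ (e * (n - 1))) ^ (c * r) * (u ^ e) ^ v = (u ^ s :: 'w fps)" by (simp only: s_def power_add power_mult)
    have f3: "det (g ^ c \<cdot>\<^sub>m A) = g ^ (c * r) * E' ^ v * w" using A by (simp add: det_A power_mult mult_ac)
    have d: "of_nat p dvd det (g ^ c \<cdot>\<^sub>m A) - u ^ s * w"
      unfolding f3 using f1 unfolding f2 by (simp only: left_diff_distrib)
    obtain w' where "1 = w * w'" using w_unit by (rule dvdE)
    then have "\<rho> (fps_nth w 0) * \<rho> (fps_nth w' 0) = 1" by (metis fps_mult_nth_0 fps_one_nth rho_hom(2,3))
    then have w0: "\<rho> (fps_nth w 0) ~= 0" by auto
    have "?a ` VV r = lm r (g ^ c \<cdot>\<^sub>m A) ` VV r" by (rule image_cong) (simp_all add: lm_smult[OF A])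
    then have "len (pV 1 r + ?a ` VV r) (VV r) = enat s" using len_lm[OF _ d w0] A by simp
    then have "red.dd (VV r) = n * s" using red.dd_top by simp
    then have "red.dg (VV r) = int (e * n * c * (n * r)) - int (n * s)" unfolding red.dg_def red.rk_top by simp
    also have "\<dots> = int n * int e * (int (c * r) - int v)"
    proof -
      obtain n' where n': "n = Suc n'" using n by (cases n) auto
      show ?thesis unfolding s_def n' by (simp add: algebra_simps)
    qed
    finally show ?thesis .
  qed
  have "red.hn.hn (real n * real r) = real n * real e * real_of_int (int (c * r) - int v)"
    using red.hn.hn_ends(2) unfolding red.rk_top dg by simp
  then show "kisin_polygon p \<sigma> E Z n (real r) = real_of_int (int (c * r) - int v)"
    unfolding eq using n e_pos by simp
  obtain C where C: "\<bar>red.hn.hn x - red.hn.hn y\<bar> \<le> C * \<bar>x - y\<bar>" for x y using red.hn.hn_lipschitz by blast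
  have "\<bar>kisin_polygon p \<sigma> E Z n x - kisin_polygon p \<sigma> E Z n y\<bar> \<le> C * real n / real e / real n * \<bar>x - y\<bar>" for x y
  proof -
    have "\<bar>red.hn.hn (real n * x) - red.hn.hn (real n * y)\<bar> \<le> C * (real n * \<bar>x - y\<bar>)"
      using C[of "real n * x" "real n * y"] by (simp add: right_diff_distrib[symmetric] abs_mult)
    then have "\<bar>red.hn.hn (real n * x) - red.hn.hn (real n * y)\<bar> / real e / real n \<le> C * (real n * \<bar>x - y\<bar>) / real e / real n"
      by (intro divide_right_mono) auto
    moreover have "\<bar>red.hn.hn (real n * x) / real e / real n - red.hn.hn (real n * y) / real e / real n\<bar>
        = \<bar>red.hn.hn (real n * x) - red.hn.hn (real n * y)\<bar> / real e / real n"
      unfolding diff_divide_distrib[symmetric] by (simp add: abs_divide)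
    ultimately show ?thesis unfolding eq by (simp only: times_divide_eq_left mult.assoc)
  qed
  then show "\<exists>C. \<forall>x y. \<bar>kisin_polygon p \<sigma> E Z n x - kisin_polygon p \<sigma> E Z n y\<bar> \<le> C * \<bar>x - y\<bar>" by blast
qed

lemma kisin_polygon_mult_le:
  assumes n: "1 \<le> n" and m: "1 \<le> m" and x: "x \<in> {0..real r}"
  shows "kisin_polygon p \<sigma> E Z (n * m) x \<le> kisin_polygon p \<sigma> E Z n x"
proof -
  have nm: "1 \<le> n * m" using n m by simp
  \<comment> \<open>One \<open>g\<close> is chosen modulo p^(nm) and also used modulo p^n, so that
    both levels have the same map and the same shift.\<close>
  obtain g g' where g: "of_nat p ^ (n * m) dvd E' * g - u ^ (e * (n * m))" "of_nat p ^ (n * m) dvd E' ^ (n * m) - u ^ e * g'"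
    using E_u_comparison[OF nm] by blast
  have "(of_nat p ^ n :: 'w fps) dvd of_nat p ^ (n * m)" using m by (intro le_imp_power_dvd) simp
  then have gn: "of_nat p ^ n dvd E' * g - u ^ (e * (n * m))" "of_nat p ^ n dvd E' ^ (n * m) - u ^ e * g'"
    using g dvd_trans by blast+
  interpret pr: reduction_pair p \<rho> \<sigma> n m r "e * (n * m) * c" "%z. g ^ c *: lm r A z"
    by (rule reduction_pair.intro[OF reduction_axioms_g[OF gn(1)] reduction_axioms_g[OF g(1)] reduction_pair_axioms.intro]) (use m in simp)
  have A: "kisin_polygon p \<sigma> E Z n x = pr.A.hn.hn (real n * x) / real e / real n"
    unfolding kisin_polygon_def pr.A.hn_polygon_rep[OF rep_reduction[OF gn] e_pos] ..
  have B: "kisin_polygon p \<sigma> E Z (n * m) x = pr.B.hn.hn (real (n * m) * x) / real e / real (n * m)"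
    unfolding kisin_polygon_def pr.B.hn_polygon_rep[OF rep_reduction[OF g] e_pos] ..
  have "real (n * m) * x \<in> {0..real (n * m * r)}" using x by (auto intro: mult_left_mono)
  then have "pr.B.hn.hn (real (n * m) * x) \<le> real m * pr.A.hn.hn (real (n * m) * x / real m)" by (rule pr.hn_le)
  also have "real (n * m) * x / real m = real n * x" using m by simp
  finally have "pr.B.hn.hn (real (n * m) * x) / real e / real (n * m) \<le> real m * pr.A.hn.hn (real n * x) / real e / real (n * m)"
    by (intro divide_right_mono) auto
  also have "real m * pr.A.hn.hn (real n * x) / real e / real (n * m) = pr.A.hn.hn (real n * x) / real e / real n" using m by simp
  finally show ?thesis unfolding A B .
qed

end

theorem theorem3p19:
  fixes p :: nat
    and \<rho> :: "'w::comm_ring_1 \<Rightarrow> 'f::field"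
    and \<sigma> :: "'w \<Rightarrow> 'w"
    and E :: "'w poly"
    and M :: "('w fps, 'm) phi_module"
    and r :: nat and d :: int
  assumes "witt_ring p \<rho> \<sigma>"
    and "eisenstein p E"
    and "kisin_module p \<sigma> E M"
    and "r = kisin_rank M"
    and "d = kisin_degree p \<sigma> E M"
  shows "\<exists>t :: real \<Rightarrow> real.
    uniform_limit {0..real r} (kisin_polygon p \<sigma> E M) t divisibility_filter \<and>
    continuous_on {0..real r} t \<and>
    concave_on {0..real r} t \<and>
    (\<forall>x\<in>{0..real r}.
       bdd_below ((\<lambda>n. kisin_polygon p \<sigma> E M n x) ` {1..}) \<and>
       t x = (INF n\<in>{1..}. kisin_polygon p \<sigma> E M n x)) \<and>
    t 0 = 0 \<and> t (real r) = real_of_int d"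
proof -
  interpret witt_eisenstein p \<rho> \<sigma> E by unfold_locales (rule assms(1), rule assms(2))
  have mod: "Module.module RT (fst M)" and iso: "phi_bijective \<phi> RT (powers E') M" and "\<exists>r b. module_basis RT (fst M) r b"
    using assms(3) unfolding kisin_module_def by blast+
  then obtain r' b where b: "module_basis RT (fst M) r' b" by blast
  have "kisin_rank M = r'" unfolding kisin_rank_def
    by (rule the_equality) (use b rank_unique[OF mod _ b] in blast)+
  then have b: "module_basis RT (fst M) r b" using b assms(4) by simp
  define q where "q x = finsum (fst M) (\<lambda>i. cf x i \<odot>\<^bsub>fst M\<^esub> b i) {..<r}" for x
  have P: "presents (fst M) {0} (VV r) q" unfolding q_def by (rule presents_basis[OF mod b])
  obtain t\<^sub>0 a where R: "rep (powers E') t\<^sub>0 M {0} (VV r) q a" and surj: "\<And>y. y \<in> VV r \<Longrightarrow> \<exists>z\<in>VV r. \<exists>s\<in>powers E'. a z = s *: y"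
    using rep_of_iso[OF iso mulset_powers P] by blast
  obtain c where c: "t\<^sub>0 = E' ^ c" using repD(2)[OF R] by (auto simp: powers_def)
  let ?e = "\<lambda>j. fv (\<lambda>k. if k = j then 1 else 0) :: 'w fps fvec"
  define A where "A = mat r r (\<lambda>(i, j). cf (a (?e j)) i)"
  have A: "A \<in> carrier_mat r r" by (simp add: A_def)
  have aV: "a x \<in> VV r" if "x \<in> VV r" for x using repD(5)[OF R] that by auto
  have aA: "a x = lm r A x" if "x \<in> VV r" for x unfolding A_def by (rule lin_eq_lm[OF repD(4)[OF R] aV that])
  have "lm r A ` Ph (VV r) \<subseteq> VV r" "lm r A ` Ph {0} \<subseteq> {0}" by (auto simp: lin_0[OF lin_lm])
  then have R': "rep (powers E') (E' ^ c) M {0} (VV r) q (lm r A)"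
    unfolding rep_def
  proof (intro conjI ballI)
    fix z t assume z: "z \<in> Ph (VV r)" "t \<in> powers E'"
    show "snd M (fraction (powers E') (pb (fst M)) (theta (fst M) q z) t) = fraction (powers E') (fst M) (q (lm r A z)) (E' ^ c * t)"
      using repD(7)[OF R z] aA[of z] z(1) unfolding c by simp
  qed (simp_all add: P lin_lm)
  have "\<exists>z k. a z = E' ^ k *: ?e j \<and> z \<in> VV r" if "j < r" for j
  proof -
    have "?e j \<in> VV r" using that by (auto simp: VV_def)
    then obtain z s where "z \<in> VV r" "s \<in> powers E'" "a z = s *: ?e j" using surj by blast
    then show ?thesis by (auto simp: powers_def)
  qed
  then have "\<forall>j. \<exists>z k. j < r \<longrightarrow> a z = E' ^ k *: ?e j \<and> z \<in> VV r" by blast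
  then obtain z k where zk: "\<And>j. j < r \<Longrightarrow> a (z j) = E' ^ k j *: ?e j" "\<And>j. j < r \<Longrightarrow> z j \<in> VV r" by metis
  \<comment> \<open>\<open>A\<close> sends the columns of \<open>B\<close> to powers of E times the
    basis vectors, so A B is diagonal and det A divides a power of \<open>E'\<close>.\<close>
  define B where "B = mat r r (\<lambda>(l, j). cf (z j) l)"
  have B: "B \<in> carrier_mat r r" by (simp add: B_def)
  have "A * B = mat r r (\<lambda>(i, j). if i = j then E' ^ k i else 0)"
  proof (rule eq_matI)
    fix i j assume "i < dim_row (mat r r (\<lambda>(i, j). if i = j then E' ^ k i else 0))" "j < dim_col (mat r r (\<lambda>(i, j). if i = j then E' ^ k i else 0))"
    then have ij: "i < r" "j < r" by auto
    have "(A * B) $$ (i, j) = (\<Sum>l<r. A $$ (i, l) * B $$ (l, j))" by (rule index_mult_sum[OF A B ij])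
    also have "\<dots> = cf (lm r A (z j)) i" using ij by (simp add: lm_def B_def)
    also have "\<dots> = cf (E' ^ k j *: ?e j) i" using aA[OF zk(2)[OF ij(2)]] zk(1)[OF ij(2)] by simp
    finally show "(A * B) $$ (i, j) = mat r r (\<lambda>(i, j). if i = j then E' ^ k i else 0) $$ (i, j)" using ij by simp
  qed (use A B in auto)
  then have "det A * det B = E' ^ (\<Sum>i<r. k i)" using det_mult[OF A B] det_diag_mat[of r "\<lambda>i. E' ^ k i"] by (simp add: power_sum)
  then obtain v w where vw: "det A = w * E' ^ v" "w dvd 1" using dvd_E_power by blast
  interpret kisin p \<rho> \<sigma> E M r c v q A w by unfold_locales (rule R' A vw)+
  have d: "d = int (c * r) - int v" using assms(5) kisin_degree_eq by simp
  obtain C where C: "\<bar>kisin_polygon p \<sigma> E M 1 x - kisin_polygon p \<sigma> E M 1 y\<bar> \<le> C * \<bar>x - y\<bar>" for x y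
    using kisin_polygon_properties(4)[of 1] by auto
  show ?thesis unfolding d
    by (rule divisibility_limit[OF _ kisin_polygon_properties(1-3) kisin_polygon_mult_le C]) simp_all
qed

end
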